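(* Let $(V,T,\Theta)$ be a representation of a difference Lie group $(G,\mathcal{D})$. Abelian extensions of $(G,\mathcal{D})$ by $(V,T)$ relative to the representation $(V,T,\Theta)$ are classified by the second cohomology group $\mathcal{H}^2(G,\mathcal{D},V,T)$; that is, assigning to such an extension $(\Pi,\mathcal{D}_\Pi)$ the class $[(\alpha,\beta)]$ of the $2$-cocycle defined by any section $s$ of it gives a well-defined bijection from the set of isomorphism classes of abelian extensions of $(G,\mathcal{D})$ by $(V,T)$ relative to $(V,T,\Theta)$ onto $\mathcal{H}^2(G,\mathcal{D},V,T)$.
   Context: A difference operator on a Lie group $G$ is a smooth map $\mathcal{D}:G\to G$ with $\mathcal{D}(gh)=\mathcal{D}(g)\,g\,\mathcal{D}(h)\,g^{-1}$ for all $g,h\in G$; the pair $(G,\mathcal{D})$ is called a difference Lie group. A homomorphism $(G,\mathcal{D})\to(G',\mathcal{D}')$ is a Lie group homomorphism $\Psi:G\to G'$ with $\mathcal{D}'\circ\Psi=\Psi\circ\mathcal{D}$. A representation $(V,T,\Theta)$ of $(G,\mathcal{D})$ consists of a finite-dimensional real vector space $V$, a linear map $T:V\to V$ and a Lie group homomorphism $\Theta:G\to GL(V)$ such that $T(\Theta(g)u)+\Theta(g)u=\Theta(\mathcal{D}(g)g)T(u)+\Theta(\mathcal{D}(g)g)u$ for all $g\in G$, $u\in V$. Then $\Theta_{\mathcal{D}}(g)=\Theta(\mathcal{D}(g)g)$ is also a representation of $G$ on $V$. Abelian extensions. Let $V$ be a vector space (an abelian Lie group under addition) and $T:V\to V$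 linear. An abelian extension of $(G,\mathcal{D})$ by $(V,T)$ is a difference Lie group $(\Pi,\mathcal{D}_\Pi)$ with a short exact sequence of Lie groups $\{1\}\to V\stackrel{i}{\to}\Pi\stackrel{p}{\to}G\to\{1\}$ in which $i$ and $p$ are homomorphisms of difference Lie groups: $\mathcal{D}_\Pi\circ i=i\circ T$ and $p\circ\mathcal{D}_\Pi=\mathcal{D}\circ p$. $V$ is identified with $i(V)\subset\Pi$. A section is a smooth map $s:G\to\Pi$ with $p\circ s=\mathrm{Id}$ and $s(e_G)=e_\Pi$. Given a section $s$, $\Theta(g)u=s(g)\,u\,s(g)^{-1}$ (product in $\Pi$) defines a representation $(V,T,\Theta)$ of $(G,\mathcal{D})$ independent of the choice of $s$; the extension is said to be relative to this representation. Two abelian extensions $(\Pi,\mathcal{D}_\Pi)$ (with $i,p$) and $(\hat\Pi,\hat{\mathcal{D}}_{\hat\Pi})$ (with $\hat i,\hat p$) are isomorphic if there is an isomorphism of difference Lie groups $\sigma:\Pi\to\hat\Pi$ with $\sigma\circ i=\hat i$ and $\hat p\circ\sigma=p$. The cocycle defined by a section $s$ is the pair $(\alpha,\beta)$, $$\alpha(g,h)=s(g)\,s(h)\,s(gh)^{-1}\in V,\qquad \beta(g)=\mathcal{D}_\Pi(s(g))\,s(\mathcal{D}(g))^{-1}\in V.$$ Cohomology. For $n\ge1$, $C^n(G,V)$ is the space of smooth maps $\alpha_n:G^n\to V$ vanishing whenever some argument is $e_G$, and $$\mathrm{d}^{\Theta}(\alpha_n)(g_1,\dots,g_{n+1})=\Theta(g_1)\alpha_n(g_2,\dots,g_{n+1})+\sum_{i=1}^n(-1)^i\alpha_n(g_1,\dots,g_{i-1},g_ig_{i+1},g_{i+2},\dots,g_{n+1})+(-1)^{n+1}\alpha_n(g_1,\dots,g_n);$$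 $\mathrm{d}^{\Theta_{\mathcal{D}}}$ is defined likewise with $\Theta_{\mathcal{D}}$. Put $C^1(G,\mathcal{D},V,T)=C^1(G,V)$ and $C^n(G,\mathcal{D},V,T)=C^n(G,V)\oplus C^{n-1}(G,V)$ for $n\ge2$, with coboundary operator $$\delta(\alpha_n,\beta_{n-1})=\big(\mathrm{d}^{\Theta}\alpha_n,\ \mathrm{d}^{\Theta_{\mathcal{D}}}\beta_{n-1}+\mathfrak{K}(\alpha_n)\big)$$ (with no $\beta$-component when $n=1$), where $\mathfrak{K}=\mathfrak{K}'+\widehat{\mathfrak{K}}:C^n(G,V)\to C^n(G,V)$, $$\mathfrak{K}'(\alpha_1)(g_1)=-\Theta(\mathcal{D}(g_1))\alpha_1(g_1)+\alpha_1(\mathcal{D}(g_1)g_1)-\alpha_1(\mathcal{D}(g_1)),$$ $$\mathfrak{K}'(\alpha_2)(g_1,g_2)=\alpha_2(\mathcal{D}(g_1),g_1)-\alpha_2(\mathcal{D}(g_1g_2),g_1g_2)+\Theta(\mathcal{D}(g_1)g_1)\alpha_2(\mathcal{D}(g_2),g_2),$$ $\mathfrak{K}'(\alpha_n)=0$ for $n\ge3$, and $$\widehat{\mathfrak{K}}(\alpha_n)(g_1,\dots,g_n)=(-1)^n\Big(\alpha_n(\mathcal{D}(g_1)g_1,\dots,\mathcal{D}(g_n)g_n)-T(\alpha_n(g_1,\dots,g_n))-\alpha_n(g_1,\dots,g_n)\Big).$$ One has $\delta\circ\delta=0$, and $\mathcal{H}^n(G,\mathcal{D},V,T)$ is the $n$-th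 cohomology group of this complex (starting in degree $1$). *)

theory Defs
  imports "HOL-Analysis.Analysis" "HOL-Algebra.Coset" "HOL-Library.Function_Algebras"
begin

text \<open>Functions as a real vector space; together with the product topology this provides the
  model spaces of powers of manifolds and of general linear groups.\<close>

instantiation "fun" :: (type, real_vector) real_vector
begin

definition scaleR_fun :: "real \<Rightarrow> ('a \<Rightarrow> 'b) \<Rightarrow> 'a \<Rightarrow> 'b"
  where "scaleR_fun r f = (\<lambda>x. r *\<^sub>R f x)"

instance
  by standard (simp_all add: scaleR_fun_def fun_eq_iff scaleR_add_right scaleR_add_left)

end


section \<open>Smooth manifolds\<close>

text \<open>Here \<open>E\<close> is a finite-dimensional linear subspace and \<open>U\<close> is relatively open in \<open>E\<close>.
  A map is of class \<open>C\<^sup>k\<close> on \<open>U\<close> if all its iterated directional derivatives of order at most \<open>k\<close>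
  along vectors of \<open>E\<close> exist and are continuous on \<open>U\<close>. Only the values of \<open>f\<close> on \<open>U\<close> matter.\<close>

primrec Ck_on :: "nat \<Rightarrow> 'a::{real_vector,topological_space} set \<Rightarrow> 'a set
    \<Rightarrow> ('a \<Rightarrow> 'b::{real_vector,topological_space}) \<Rightarrow> bool"
  where
    "Ck_on 0 E U f \<longleftrightarrow> continuous_on U f"
  | "Ck_on (Suc k) E U f \<longleftrightarrow> continuous_on U f \<and>
       (\<forall>v\<in>E. \<exists>f'. (\<forall>x\<in>U. ((\<lambda>t::real. (f (x + t *\<^sub>R v) - f x) /\<^sub>R t) \<longlongrightarrow> f' x) (at 0)) \<and>
                  Ck_on k E U f')"

definition smooth_on :: "'a::{real_vector,topological_space} set \<Rightarrow> 'a set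
    \<Rightarrow> ('a \<Rightarrow> 'b::{real_vector,topological_space}) \<Rightarrow> bool"
  where "smooth_on E U f \<longleftrightarrow> (\<forall>k. Ck_on k E U f)"

text \<open>The model space of a manifold is a finite-dimensional linear subspace of the type of the
  coordinates. In this way the dimension is not tied to a type, and dimension \<open>0\<close> is allowed.
  A chart is a pair of its domain and the coordinate map. Atlases need not be maximal: all notions
  below depend only on the smooth structure that the atlas generates.\<close>

record ('a, 'e) manifold =
  mtop :: "'a topology"
  model :: "'e set"
  atlas :: "('a set \<times> ('a \<Rightarrow> 'e)) set"

definition second_countable_space :: "'a topology \<Rightarrow> bool"
  where "second_countable_space X \<longleftrightarrow>
    (\<exists>\<B>. countable \<B> \<and> (\<forall>B\<in>\<B>. openin X B) \<and>
         (\<forall>U x. openin X U \<and> x \<in> U \<longrightarrow> (\<exists>B\<in>\<B>. x \<in> B \<and> B \<subseteq> U)))"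

definition smooth_manifold :: "('a, 'e::{real_vector,topological_space}) manifold \<Rightarrow> bool"
  where "smooth_manifold M \<longleftrightarrow>
    Hausdorff_space (mtop M) \<and> second_countable_space (mtop M) \<and>
    (\<exists>B. finite B \<and> model M = span B) \<and>
    (\<Union>(U,\<phi>)\<in>atlas M. U) = topspace (mtop M) \<and>
    (\<forall>(U,\<phi>)\<in>atlas M.
        openin (mtop M) U \<and> openin (top_of_set (model M)) (\<phi> ` U) \<and>
        homeomorphic_map (subtopology (mtop M) U) (top_of_set (\<phi> ` U)) \<phi>) \<and>
    (\<forall>(U,\<phi>)\<in>atlas M. \<forall>(U',\<psi>)\<in>atlas M.
        smooth_on (model M) (\<phi> ` (U \<inter> U')) (\<psi> \<circ> inv_into U \<phi>))"

definition smooth_map :: "('a, 'e::{real_vector,topological_space}) manifold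
    \<Rightarrow> ('b, 'f::{real_vector,topological_space}) manifold \<Rightarrow> ('a \<Rightarrow> 'b) \<Rightarrow> bool"
  where "smooth_map M N f \<longleftrightarrow>
    continuous_map (mtop M) (mtop N) f \<and>
    (\<forall>(U,\<phi>)\<in>atlas M. \<forall>(U',\<psi>)\<in>atlas N.
        smooth_on (model M) (\<phi> ` (U \<inter> f -` U')) (\<psi> \<circ> f \<circ> inv_into U \<phi>))"

definition prod_manifold :: "('a, 'e) manifold \<Rightarrow> ('b, 'f) manifold \<Rightarrow> ('a \<times> 'b, 'e \<times> 'f) manifold"
  where "prod_manifold M N =
    \<lparr>mtop = prod_topology (mtop M) (mtop N),
     model = model M \<times> model N,
     atlas = {(U \<times> U', map_prod \<phi> \<psi>) | U \<phi> U' \<psi>. (U,\<phi>) \<in> atlas M \<and> (U',\<psi>) \<in> atlas N}\<rparr>"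

text \<open>The \<open>n\<close>-fold power, with lists of length \<open>n\<close> as points.\<close>

definition power_manifold :: "nat \<Rightarrow> ('a, 'e::zero) manifold \<Rightarrow> ('a list, nat \<Rightarrow> 'e) manifold"
  where "power_manifold n M =
    \<lparr>mtop = pullback_topology {xs. length xs = n} (\<lambda>xs. \<lambda>i\<in>{..<n}. xs ! i)
              (product_topology (\<lambda>i. mtop M) {..<n}),
     model = {x. (\<forall>i<n. x i \<in> model M) \<and> (\<forall>i\<ge>n. x i = 0)},
     atlas = {({xs. length xs = n \<and> (\<forall>i<n. xs ! i \<in> fst (c i))},
               \<lambda>xs i. if i < n then snd (c i) (xs ! i) else 0) | c. \<forall>i<n. c i \<in> atlas M}\<rparr>"


section \<open>Lie groups\<close>

record ('a, 'e) smooth_group = "'a monoid" +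
  mfd :: "('a, 'e) manifold"

definition lie_group :: "('a, 'e::{real_vector,topological_space}) smooth_group \<Rightarrow> bool"
  where "lie_group G \<longleftrightarrow>
    group G \<and> smooth_manifold (mfd G) \<and> topspace (mtop (mfd G)) = carrier G \<and>
    smooth_map (prod_manifold (mfd G) (mfd G)) (mfd G) (\<lambda>(g, h). g \<otimes>\<^bsub>G\<^esub> h) \<and>
    smooth_map (mfd G) (mfd G) (\<lambda>g. inv\<^bsub>G\<^esub> g)"

definition lie_hom :: "('a, 'e::{real_vector,topological_space}) smooth_group
    \<Rightarrow> ('b, 'f::{real_vector,topological_space}) smooth_group \<Rightarrow> ('a \<Rightarrow> 'b) \<Rightarrow> bool"
  where "lie_hom G H f \<longleftrightarrow> f \<in> hom G H \<and> smooth_map (mfd G) (mfd H) f"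

text \<open>Finite-dimensional vector spaces are represented by linear subspaces of Euclidean spaces,
  so that the zero space is included.\<close>

definition vec_group :: "'v::euclidean_space set \<Rightarrow> ('v, 'v) smooth_group"
  where "vec_group V =
    \<lparr>carrier = V, mult = (+), one = 0,
     mfd = \<lparr>mtop = top_of_set V, model = V, atlas = {(V, \<lambda>u. u)}\<rparr>\<rparr>"

definition linear_endo :: "'v::real_vector set \<Rightarrow> ('v \<Rightarrow> 'v) \<Rightarrow> bool"
  where "linear_endo V A \<longleftrightarrow>
    (\<forall>u\<in>V. A u \<in> V) \<and> (\<forall>u\<in>V. \<forall>w\<in>V. A (u + w) = A u + A w) \<and>
    (\<forall>r. \<forall>u\<in>V. A (r *\<^sub>R u) = r *\<^sub>R A u)"

text \<open>An element of \<open>End V\<close> is represented by the function that is \<open>0\<close> outside \<open>V\<close>. On \<open>End V\<close> the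
  topology of pointwise convergence is the usual topology of a finite-dimensional space, and
  \<open>GL V\<close> is an open subset of it, with a single chart.\<close>

definition End_space :: "'v::real_vector set \<Rightarrow> ('v \<Rightarrow> 'v) set"
  where "End_space V = {A. linear_endo V A \<and> (\<forall>u. u \<notin> V \<longrightarrow> A u = 0)}"

definition GL_group :: "'v::euclidean_space set \<Rightarrow> ('v \<Rightarrow> 'v, 'v \<Rightarrow> 'v) smooth_group"
  where "GL_group V =
    (let C = {A \<in> End_space V. bij_betw A V V} in
      \<lparr>carrier = C, mult = (\<circ>), one = (\<lambda>u. if u \<in> V then u else 0),
       mfd = \<lparr>mtop = top_of_set C, model = End_space V, atlas = {(C, \<lambda>A. A)}\<rparr>\<rparr>)"


section \<open>Difference Lie groups and their representations\<close>

definition difference_lie_group ::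
    "('a, 'e::{real_vector,topological_space}) smooth_group \<Rightarrow> ('a \<Rightarrow> 'a) \<Rightarrow> bool"
  where "difference_lie_group G D \<longleftrightarrow>
    lie_group G \<and> smooth_map (mfd G) (mfd G) D \<and>
    (\<forall>g\<in>carrier G. \<forall>h\<in>carrier G.
        D (g \<otimes>\<^bsub>G\<^esub> h) = D g \<otimes>\<^bsub>G\<^esub> g \<otimes>\<^bsub>G\<^esub> D h \<otimes>\<^bsub>G\<^esub> inv\<^bsub>G\<^esub> g)"

definition difference_hom :: "('a, 'e::{real_vector,topological_space}) smooth_group \<Rightarrow> ('a \<Rightarrow> 'a)
    \<Rightarrow> ('b, 'f::{real_vector,topological_space}) smooth_group \<Rightarrow> ('b \<Rightarrow> 'b) \<Rightarrow> ('a \<Rightarrow> 'b) \<Rightarrow> bool"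
  where "difference_hom G D G' D' \<Psi> \<longleftrightarrow>
    lie_hom G G' \<Psi> \<and> (\<forall>g\<in>carrier G. D' (\<Psi> g) = \<Psi> (D g))"

definition difference_rep :: "('g, 'e::{real_vector,topological_space}) smooth_group \<Rightarrow> ('g \<Rightarrow> 'g)
    \<Rightarrow> 'v::euclidean_space set \<Rightarrow> ('v \<Rightarrow> 'v) \<Rightarrow> ('g \<Rightarrow> 'v \<Rightarrow> 'v) \<Rightarrow> bool"
  where "difference_rep G D V T \<Theta> \<longleftrightarrow>
    subspace V \<and> linear_endo V T \<and> lie_hom G (GL_group V) \<Theta> \<and>
    (\<forall>g\<in>carrier G. \<forall>u\<in>V.
        T (\<Theta> g u) + \<Theta> g u = \<Theta> (D g \<otimes>\<^bsub>G\<^esub> g) (T u) + \<Theta> (D g \<otimes>\<^bsub>G\<^esub> g) u)"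


section \<open>Abelian extensions\<close>

record ('p, 'f, 'v, 'g) extension =
  total :: "('p, 'f) smooth_group"
  dop :: "'p \<Rightarrow> 'p"
  incl :: "'v \<Rightarrow> 'p"
  proj :: "'p \<Rightarrow> 'g"

definition abelian_extension :: "('g, 'e::{real_vector,topological_space}) smooth_group \<Rightarrow> ('g \<Rightarrow> 'g)
    \<Rightarrow> 'v::euclidean_space set \<Rightarrow> ('v \<Rightarrow> 'v)
    \<Rightarrow> ('p, 'f::{real_vector,topological_space}, 'v, 'g) extension \<Rightarrow> bool"
  where "abelian_extension G D V T X \<longleftrightarrow>
    difference_lie_group (total X) (dop X) \<and>
    difference_hom (vec_group V) T (total X) (dop X) (incl X) \<and>
    difference_hom (total X) (dop X) G D (proj X) \<and>
    inj_on (incl X) V \<and>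
    incl X ` V = kernel (total X) G (proj X) \<and>
    proj X ` carrier (total X) = carrier G"

definition is_section :: "('g, 'e::{real_vector,topological_space}) smooth_group
    \<Rightarrow> ('p, 'f::{real_vector,topological_space}, 'v, 'g) extension \<Rightarrow> ('g \<Rightarrow> 'p) \<Rightarrow> bool"
  where "is_section G X s \<longleftrightarrow>
    smooth_map (mfd G) (mfd (total X)) s \<and>
    (\<forall>g\<in>carrier G. proj X (s g) = g) \<and> s \<one>\<^bsub>G\<^esub> = \<one>\<^bsub>total X\<^esub>"

definition abelian_extensions_rel :: "('g, 'e::{real_vector,topological_space}) smooth_group
    \<Rightarrow> ('g \<Rightarrow> 'g) \<Rightarrow> 'v::euclidean_space set \<Rightarrow> ('v \<Rightarrow> 'v) \<Rightarrow> ('g \<Rightarrow> 'v \<Rightarrow> 'v)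
    \<Rightarrow> ('p, 'f::{real_vector,topological_space}, 'v, 'g) extension set"
  where "abelian_extensions_rel G D V T \<Theta> =
    {X. abelian_extension G D V T X \<and>
        (\<forall>s. is_section G X s \<longrightarrow>
          (\<forall>g\<in>carrier G. \<forall>u\<in>V.
             incl X (\<Theta> g u) = s g \<otimes>\<^bsub>total X\<^esub> incl X u \<otimes>\<^bsub>total X\<^esub> inv\<^bsub>total X\<^esub> s g))}"

definition isomorphic_extensions :: "'v set
    \<Rightarrow> ('p, 'f::{real_vector,topological_space}, 'v, 'g) extension
    \<Rightarrow> ('p, 'f, 'v, 'g) extension \<Rightarrow> bool"
  where "isomorphic_extensions V X Y \<longleftrightarrow>
    (\<exists>\<sigma>. difference_hom (total X) (dop X) (total Y) (dop Y) \<sigma> \<and>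
         bij_betw \<sigma> (carrier (total X)) (carrier (total Y)) \<and>
         smooth_map (mfd (total Y)) (mfd (total X)) (inv_into (carrier (total X)) \<sigma>) \<and>
         (\<forall>u\<in>V. \<sigma> (incl X u) = incl Y u) \<and>
         (\<forall>x\<in>carrier (total X). proj Y (\<sigma> x) = proj X x))"

definition extension_iso_rel :: "('g, 'e::{real_vector,topological_space}) smooth_group
    \<Rightarrow> ('g \<Rightarrow> 'g) \<Rightarrow> 'v::euclidean_space set \<Rightarrow> ('v \<Rightarrow> 'v) \<Rightarrow> ('g \<Rightarrow> 'v \<Rightarrow> 'v)
    \<Rightarrow> ('p, 'f::{real_vector,topological_space}, 'v, 'g) extension rel"
  where "extension_iso_rel G D V T \<Theta> =
    {(X, Y). X \<in> abelian_extensions_rel G D V T \<Theta> \<and> Y \<in> abelian_extensions_rel G D V T \<Theta> \<and>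
             isomorphic_extensions V X Y}"


section \<open>Cohomology\<close>

text \<open>An \<open>n\<close>-cochain is a function on lists of length \<open>n\<close> over \<open>carrier G\<close>; it is extended by \<open>0\<close>
  to all other lists, so that equality of cochains is equality of functions.\<close>

definition tuples :: "('g, 'm) monoid_scheme \<Rightarrow> nat \<Rightarrow> 'g list set"
  where "tuples G n = {gs. set gs \<subseteq> carrier G \<and> length gs = n}"

definition group_cochains :: "('g, 'e::{real_vector,topological_space}) smooth_group
    \<Rightarrow> 'v::euclidean_space set \<Rightarrow> nat \<Rightarrow> ('g list \<Rightarrow> 'v) set"
  where "group_cochains G V n =
    {\<alpha>. smooth_map (power_manifold n (mfd G)) (mfd (vec_group V)) \<alpha> \<and>
        (\<forall>gs\<in>tuples G n. \<one>\<^bsub>G\<^esub> \<in> set gs \<longrightarrow> \<alpha> gs = 0) \<and>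
        (\<forall>gs. gs \<notin> tuples G n \<longrightarrow> \<alpha> gs = 0)}"

text \<open>List positions start at \<open>0\<close>: the entry \<open>g\<^sub>i\<close> is \<open>gs ! (i - 1)\<close>.\<close>

definition group_coboundary :: "('g, 'm) monoid_scheme \<Rightarrow> ('g \<Rightarrow> 'v::real_vector \<Rightarrow> 'v) \<Rightarrow> nat
    \<Rightarrow> ('g list \<Rightarrow> 'v) \<Rightarrow> 'g list \<Rightarrow> 'v"
  where "group_coboundary G \<Theta> n \<alpha> = (\<lambda>gs. if gs \<in> tuples G (n + 1) then
      \<Theta> (gs ! 0) (\<alpha> (drop 1 gs)) +
      (\<Sum>i=1..n. (- 1) ^ i *\<^sub>R
         \<alpha> (take (i - 1) gs @ [gs ! (i - 1) \<otimes>\<^bsub>G\<^esub> gs ! i] @ drop (i + 1) gs)) +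
      (- 1) ^ (n + 1) *\<^sub>R \<alpha> (take n gs)
    else 0)"

definition rep_D :: "('g, 'm) monoid_scheme \<Rightarrow> ('g \<Rightarrow> 'g) \<Rightarrow> ('g \<Rightarrow> 'v \<Rightarrow> 'v) \<Rightarrow> 'g \<Rightarrow> 'v \<Rightarrow> 'v"
  where "rep_D G D \<Theta> = (\<lambda>g. \<Theta> (D g \<otimes>\<^bsub>G\<^esub> g))"

definition K_prime :: "('g, 'm) monoid_scheme \<Rightarrow> ('g \<Rightarrow> 'g) \<Rightarrow> ('g \<Rightarrow> 'v::real_vector \<Rightarrow> 'v) \<Rightarrow> nat
    \<Rightarrow> ('g list \<Rightarrow> 'v) \<Rightarrow> 'g list \<Rightarrow> 'v"
  where "K_prime G D \<Theta> n \<alpha> = (\<lambda>gs.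
    if n = 1 then
      (let g = gs ! 0 in
        - \<Theta> (D g) (\<alpha> [g]) + \<alpha> [D g \<otimes>\<^bsub>G\<^esub> g] - \<alpha> [D g])
    else if n = 2 then
      (let g = gs ! 0; h = gs ! 1 in
        \<alpha> [D g, g] - \<alpha> [D (g \<otimes>\<^bsub>G\<^esub> h), g \<otimes>\<^bsub>G\<^esub> h] + \<Theta> (D g \<otimes>\<^bsub>G\<^esub> g) (\<alpha> [D h, h]))
    else 0)"

definition K_hat :: "('g, 'm) monoid_scheme \<Rightarrow> ('g \<Rightarrow> 'g) \<Rightarrow> ('v::real_vector \<Rightarrow> 'v) \<Rightarrow> nat
    \<Rightarrow> ('g list \<Rightarrow> 'v) \<Rightarrow> 'g list \<Rightarrow> 'v"
  where "K_hat G D T n \<alpha> = (\<lambda>gs.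
    (- 1) ^ n *\<^sub>R (\<alpha> (map (\<lambda>g. D g \<otimes>\<^bsub>G\<^esub> g) gs) - T (\<alpha> gs) - \<alpha> gs))"

definition K_map :: "('g, 'm) monoid_scheme \<Rightarrow> ('g \<Rightarrow> 'g) \<Rightarrow> ('v::real_vector \<Rightarrow> 'v)
    \<Rightarrow> ('g \<Rightarrow> 'v \<Rightarrow> 'v) \<Rightarrow> nat \<Rightarrow> ('g list \<Rightarrow> 'v) \<Rightarrow> 'g list \<Rightarrow> 'v"
  where "K_map G D T \<Theta> n \<alpha> = (\<lambda>gs.
    if gs \<in> tuples G n then K_prime G D \<Theta> n \<alpha> gs + K_hat G D T n \<alpha> gs else 0)"

text \<open>In degree \<open>1\<close> there is no second component; it is represented by \<open>0\<close>.\<close>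

definition cochains :: "('g, 'e::{real_vector,topological_space}) smooth_group
    \<Rightarrow> 'v::euclidean_space set \<Rightarrow> nat \<Rightarrow> (('g list \<Rightarrow> 'v) \<times> ('g list \<Rightarrow> 'v)) set"
  where "cochains G V n =
    group_cochains G V n \<times> (if n = 1 then {0} else group_cochains G V (n - 1))"

definition coboundary :: "('g, 'm) monoid_scheme \<Rightarrow> ('g \<Rightarrow> 'g) \<Rightarrow> ('v::real_vector \<Rightarrow> 'v)
    \<Rightarrow> ('g \<Rightarrow> 'v \<Rightarrow> 'v) \<Rightarrow> nat
    \<Rightarrow> ('g list \<Rightarrow> 'v) \<times> ('g list \<Rightarrow> 'v) \<Rightarrow> ('g list \<Rightarrow> 'v) \<times> ('g list \<Rightarrow> 'v)"
  where "coboundary G D T \<Theta> n = (\<lambda>(\<alpha>, \<beta>).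
    (group_coboundary G \<Theta> n \<alpha>,
     (if n = 1 then 0 else group_coboundary G (rep_D G D \<Theta>) (n - 1) \<beta>) + K_map G D T \<Theta> n \<alpha>))"

definition cocycle_group :: "('g, 'e::{real_vector,topological_space}) smooth_group \<Rightarrow> ('g \<Rightarrow> 'g)
    \<Rightarrow> 'v::euclidean_space set \<Rightarrow> ('v \<Rightarrow> 'v) \<Rightarrow> ('g \<Rightarrow> 'v \<Rightarrow> 'v) \<Rightarrow> nat
    \<Rightarrow> (('g list \<Rightarrow> 'v) \<times> ('g list \<Rightarrow> 'v)) monoid"
  where "cocycle_group G D V T \<Theta> n =
    \<lparr>carrier = {c \<in> cochains G V n. coboundary G D T \<Theta> n c = 0}, mult = (+), one = 0\<rparr>"

text \<open>The complex starts in degree \<open>1\<close>.\<close>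

definition coboundaries :: "('g, 'e::{real_vector,topological_space}) smooth_group \<Rightarrow> ('g \<Rightarrow> 'g)
    \<Rightarrow> 'v::euclidean_space set \<Rightarrow> ('v \<Rightarrow> 'v) \<Rightarrow> ('g \<Rightarrow> 'v \<Rightarrow> 'v) \<Rightarrow> nat
    \<Rightarrow> (('g list \<Rightarrow> 'v) \<times> ('g list \<Rightarrow> 'v)) set"
  where "coboundaries G D V T \<Theta> n =
    (if n \<le> 1 then {0} else coboundary G D T \<Theta> (n - 1) ` cochains G V (n - 1))"

definition cohomology_group :: "('g, 'e::{real_vector,topological_space}) smooth_group \<Rightarrow> ('g \<Rightarrow> 'g)
    \<Rightarrow> 'v::euclidean_space set \<Rightarrow> ('v \<Rightarrow> 'v) \<Rightarrow> ('g \<Rightarrow> 'v \<Rightarrow> 'v) \<Rightarrow> nat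
    \<Rightarrow> (('g list \<Rightarrow> 'v) \<times> ('g list \<Rightarrow> 'v)) set monoid"
  where "cohomology_group G D V T \<Theta> n = cocycle_group G D V T \<Theta> n Mod coboundaries G D V T \<Theta> n"

definition cohomology_class :: "('g, 'e::{real_vector,topological_space}) smooth_group \<Rightarrow> ('g \<Rightarrow> 'g)
    \<Rightarrow> 'v::euclidean_space set \<Rightarrow> ('v \<Rightarrow> 'v) \<Rightarrow> ('g \<Rightarrow> 'v \<Rightarrow> 'v) \<Rightarrow> nat
    \<Rightarrow> ('g list \<Rightarrow> 'v) \<times> ('g list \<Rightarrow> 'v) \<Rightarrow> (('g list \<Rightarrow> 'v) \<times> ('g list \<Rightarrow> 'v)) set"
  where "cohomology_class G D V T \<Theta> n c =
    coboundaries G D V T \<Theta> n #>\<^bsub>cocycle_group G D V T \<Theta> n\<^esub> c"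

text \<open>The identification of \<open>V\<close> with its image in the total group is undone by \<open>inv_into V (incl X)\<close>.\<close>

definition section_cocycle :: "('g, 'e) smooth_group \<Rightarrow> ('g \<Rightarrow> 'g) \<Rightarrow> 'v::zero set
    \<Rightarrow> ('p, 'f, 'v, 'g) extension \<Rightarrow> ('g \<Rightarrow> 'p) \<Rightarrow> ('g list \<Rightarrow> 'v) \<times> ('g list \<Rightarrow> 'v)"
  where "section_cocycle G D V X s =
    ((\<lambda>gs. if gs \<in> tuples G 2 then
        (let g = gs ! 0; h = gs ! 1 in
          inv_into V (incl X)
            (s g \<otimes>\<^bsub>total X\<^esub> s h \<otimes>\<^bsub>total X\<^esub> inv\<^bsub>total X\<^esub> s (g \<otimes>\<^bsub>G\<^esub> h)))
      else 0),
     (\<lambda>gs. if gs \<in> tuples G 1 then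
        (let g = gs ! 0 in
          inv_into V (incl X) (dop X (s g) \<otimes>\<^bsub>total X\<^esub> inv\<^bsub>total X\<^esub> s (D g)))
      else 0))"

end

theory Submission
  imports Defs
begin

text \<open>On an extension \<open>\<Pi>\<close> of \<open>G\<close> by \<open>V\<close> the map \<open>x \<mapsto> \<D>(x) x\<close> is a group homomorphism, so an extension with a
  section \<open>s\<close> is described in the coordinates \<open>x = i(u) s(g)\<close> by the cocycle \<open>\<alpha>\<close> of the multiplication and by
  the function \<open>\<gamma>(g) = \<beta>(g) + \<alpha>(\<D> g, g)\<close> through which this homomorphism acts on \<open>s(g)\<close>. The two cocycle
  conditions are associativity and multiplicativity; another section changes \<open>(\<alpha>, \<beta>)\<close> by a coboundary; equal
  cocycles give the isomorphism \<open>i(u) s(g) \<mapsto> i'(u) s'(g)\<close>; and every cocycle arises on \<open>V \<times> G\<close>.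

  The analytic part is the existence of a smooth section and the smoothness of the coordinates \<open>u\<close>, \<open>g\<close>. A map
  between manifolds with enough symmetries has constant rank; if its image contains an open set, the rank is
  the dimension of the target, because otherwise the image would be negligible, and then the map has local
  smooth sections. This is applied to \<open>p\<close> and to \<open>(u, g) \<mapsto> i(u) s(g)\<close>. The local sections of \<open>p\<close> are
  averaged with bump functions, which makes sense because they differ by \<open>V\<close>-valued maps.\<close>


section \<open>Calculus of smooth maps\<close>

text \<open>In the exact sequence \<open>p\<close> is only a smooth surjective homomorphism and
  \<open>i\<close> only a smooth injective one; that \<open>p\<close> is a submersion and that
  \<open>i\<close> has a smooth inverse on its image has to be proved. Both fail without a countable
  base (the line with the discrete topology maps bijectively onto the line), so countability must
  enter: countably many negligible pieces cannot fill an open set. The kernel of \<open>p\<close>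
  need not be open and carries no manifold structure of its own, so \<open>i\<close> cannot be
  treated like \<open>p\<close>; it is completed by a local section of \<open>p\<close> to a map
  onto an open set. Model spaces are linear subspaces of a Euclidean type and may themselves be
  negligible there. Maps and sets are therefore pulled back along the orthogonal projection before
  total derivatives or measure are used. The coordinates of GL(V) and of powers of G are functions
  and not Euclidean vectors; smoothness of \<open>\<Theta>\<close> and of cochains is reduced at the
  start to maps between manifolds with Euclidean coordinates. As \<open>Ck_on\<close> is recursive,
  each operation needs a formula for its directional derivative that is built from operations of the
  same kind.\<close>

lemma Ck_on_subset: "Ck_on k E U f \<Longrightarrow> U' \<subseteq> U \<Longrightarrow> Ck_on k E U' f"
proof (induction k arbitrary: f)
  case 0
  then show ?case by (auto intro: continuous_on_subset)
next
  case (Suc k)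
  show ?case
    unfolding Ck_on.simps
  proof (intro conjI ballI)
    show "continuous_on U' f"
      using Suc.prems by (auto intro: continuous_on_subset)
    fix v assume "v \<in> E"
    then obtain f' where "\<forall>x\<in>U. ((\<lambda>t::real. (f (x + t *\<^sub>R v) - f x) /\<^sub>R t) \<longlongrightarrow> f' x) (at 0)"
      "Ck_on k E U f'"
      using Suc.prems by auto
    then show "\<exists>f'. (\<forall>x\<in>U'. ((\<lambda>t::real. (f (x + t *\<^sub>R v) - f x) /\<^sub>R t) \<longlongrightarrow> f' x) (at 0)) \<and> Ck_on k E U' f'"
      using Suc.IH Suc.prems(2) by blast
  qed
qed

lemma Ck_on_continuous: "Ck_on k E U f \<Longrightarrow> continuous_on U f"
  by (cases k) auto

lemma Ck_on_SucD: "Ck_on (Suc k) E U f \<Longrightarrow> Ck_on k E U f"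
proof (induction k arbitrary: f)
  case (Suc k)
  have "continuous_on U f" using Suc.prems by simp
  moreover have "\<exists>f'. (\<forall>x\<in>U. ((\<lambda>t::real. (f (x + t *\<^sub>R v) - f x) /\<^sub>R t) \<longlongrightarrow> f' x) (at 0)) \<and> Ck_on k E U f'"
    if "v \<in> E" for v
    using Suc.prems Suc.IH that Ck_on.simps(2)[of "Suc k" E U f] by blast
  ultimately show ?case by simp
qed simp

lemma Ck_on_Suc_intro:
  assumes "continuous_on U f"
    and "\<And>v x. v \<in> E \<Longrightarrow> x \<in> U \<Longrightarrow> ((\<lambda>t::real. (f (x + t *\<^sub>R v) - f x) /\<^sub>R t) \<longlongrightarrow> F v x) (at 0)"
    and "\<And>v. v \<in> E \<Longrightarrow> Ck_on k E U (F v)"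
  shows "Ck_on (Suc k) E U f"
  unfolding Ck_on.simps
proof (intro conjI ballI)
  fix v assume "v \<in> E"
  then show "\<exists>f'. (\<forall>x\<in>U. ((\<lambda>t::real. (f (x + t *\<^sub>R v) - f x) /\<^sub>R t) \<longlongrightarrow> f' x) (at 0)) \<and> Ck_on k E U f'"
    by (intro exI[of _ "F v"]) (simp add: assms)
qed (rule assms)

lemma Ck_on_Suc_elim:
  assumes "Ck_on (Suc k) E U f"
  obtains F where "\<forall>v\<in>E. \<forall>x\<in>U. ((\<lambda>t::real. (f (x + t *\<^sub>R v) - f x) /\<^sub>R t) \<longlongrightarrow> F v x) (at 0)"
    and "\<forall>v\<in>E. Ck_on k E U (F v)" and "continuous_on U f"
proof -
  have "\<forall>v\<in>E. \<exists>f'. (\<forall>x\<in>U. ((\<lambda>t::real. (f (x + t *\<^sub>R v) - f x) /\<^sub>R t) \<longlongrightarrow> f' x) (at 0)) \<and> Ck_on k E U f'"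
    using assms unfolding Ck_on.simps by (rule conjunct2)
  from bchoice[OF this] obtain F where
    F: "\<forall>v\<in>E. (\<forall>x\<in>U. ((\<lambda>t::real. (f (x + t *\<^sub>R v) - f x) /\<^sub>R t) \<longlongrightarrow> F v x) (at 0)) \<and> Ck_on k E U (F v)" ..
  show ?thesis
  proof (rule that[of F])
    show "continuous_on U f" using assms by simp
  qed (use F in simp_all)
qed

text \<open>The derivative of the composition along \<open>v\<close> is the derivative of
  \<open>f\<close> along \<open>L v\<close>, because the two difference quotients coincide. No total
  derivative enters, so the substitution rule is available for coordinate types that are not
  normed.\<close>

lemma Ck_on_compose_linear:
  assumes "Ck_on k E U f" and L: "continuous_on U' L" "L ` U' \<subseteq> U"
    and lin: "\<And>x v t. x \<in> U' \<Longrightarrow> v \<in> E' \<Longrightarrow> L (x + t *\<^sub>R v) = L x + t *\<^sub>R L v"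
    and E: "\<And>v. v \<in> E' \<Longrightarrow> L v \<in> E"
  shows "Ck_on k E' U' (\<lambda>x. f (L x))"
  using assms(1)
proof (induction k arbitrary: f)
  case 0
  then show ?case using continuous_on_compose2[OF _ L, of f] by simp
next
  case (Suc k)
  from Suc.prems obtain F where
    F[rule_format]: "\<forall>v\<in>E. \<forall>x\<in>U. ((\<lambda>t::real. (f (x + t *\<^sub>R v) - f x) /\<^sub>R t) \<longlongrightarrow> F v x) (at 0)"
    and kF[rule_format]: "\<forall>v\<in>E. Ck_on k E U (F v)" and "continuous_on U f"
    by (rule Ck_on_Suc_elim)
  show ?case
  proof (rule Ck_on_Suc_intro)
    show "continuous_on U' (\<lambda>x. f (L x))"
      using continuous_on_compose2[OF _ L, of f] Suc.prems by simp
    fix v assume v: "v \<in> E'"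
    show "Ck_on k E' U' (\<lambda>x. F (L v) (L x))"
      by (rule Suc.IH[OF kF[OF E[OF v]]])
    fix x assume "x \<in> U'"
    then show "((\<lambda>t::real. (f (L (x + t *\<^sub>R v)) - f (L x)) /\<^sub>R t) \<longlongrightarrow> F (L v) (L x)) (at 0)"
      using F[OF E[OF v], of "L x"] L(2) v by (auto simp: lin)
  qed
qed

lemma Ck_on_linear_compose:
  assumes "Ck_on k E U f" "linear L" "continuous_on UNIV L"
  shows "Ck_on k E U (\<lambda>x. L (f x))"
  using assms(1)
proof (induction k arbitrary: f)
  case 0
  then show ?case using continuous_on_compose2[OF assms(3)] by simp
next
  case (Suc k)
  interpret linear L by fact
  from Suc.prems obtain F where
    F[rule_format]: "\<forall>v\<in>E. \<forall>x\<in>U. ((\<lambda>t::real. (f (x + t *\<^sub>R v) - f x) /\<^sub>R t) \<longlongrightarrow> F v x) (at 0)"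
    and kF[rule_format]: "\<forall>v\<in>E. Ck_on k E U (F v)" and "continuous_on U f"
    by (rule Ck_on_Suc_elim)
  show ?case
  proof (rule Ck_on_Suc_intro)
    show "continuous_on U (\<lambda>x. L (f x))"
      using continuous_on_compose2[OF assms(3) Ck_on_continuous[OF Suc.prems]] by simp
    fix v assume v: "v \<in> E"
    show "Ck_on k E U (\<lambda>x. L (F v x))"
      by (rule Suc.IH[OF kF[OF v]])
    fix x assume x: "x \<in> U"
    have "((\<lambda>t::real. L ((f (x + t *\<^sub>R v) - f x) /\<^sub>R t)) \<longlongrightarrow> L (F v x)) (at 0)"
      by (rule continuous_on_tendsto_compose[OF assms(3) F[OF v x]]) auto
    then show "((\<lambda>t::real. (L (f (x + t *\<^sub>R v)) - L (f x)) /\<^sub>R t) \<longlongrightarrow> L (F v x)) (at 0)"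
      by (simp add: scale diff)
  qed
qed

text \<open>The difference quotients in \<open>Ck_on\<close> see a function off \<open>U\<close>
  unless short segments in the directions of \<open>E\<close> stay in \<open>U\<close>. The
  condition mentions no topology, so it can also be checked for subsets of function spaces, such as
  the coordinates of powers.\<close>

definition dir_open :: "'a::real_vector set \<Rightarrow> 'a set \<Rightarrow> bool"
  where "dir_open E U \<longleftrightarrow> (\<forall>x\<in>U. \<forall>v\<in>E. \<forall>\<^sub>F t::real in at 0. x + t *\<^sub>R v \<in> U)"

lemma dir_open_openin:
  fixes E :: "'a::real_normed_vector set"
  assumes "subspace E" "openin (top_of_set E) U"
  shows "dir_open E U"
  unfolding dir_open_def
proof (intro ballI)
  fix x v assume x: "x \<in> U" and v: "v \<in> E"
  obtain S where S: "open S" "U = E \<inter> S" using assms(2) by (auto simp: openin_open)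
  have "((\<lambda>t::real. x + t *\<^sub>R v) \<longlongrightarrow> x + 0 *\<^sub>R v) (at 0)"
    by (intro tendsto_intros)
  then have "\<forall>\<^sub>F t in at 0. x + t *\<^sub>R v \<in> S"
    using S x by (intro topological_tendstoD) auto
  moreover have "x + t *\<^sub>R v \<in> E" for t
    using assms(1) x v S by (auto intro: subspace_add subspace_scale)
  ultimately show "\<forall>\<^sub>F t in at 0. x + t *\<^sub>R v \<in> U"
    by (auto simp: S elim: eventually_mono)
qed

lemma dir_open_open: "open (U::'a::real_normed_vector set) \<Longrightarrow> dir_open UNIV U"
  by (rule dir_open_openin) auto

lemma Ck_on_cong:
  assumes "Ck_on k E U f" "dir_open E U" "\<And>x. x \<in> U \<Longrightarrow> f x = g x"
  shows "Ck_on k E U g"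
proof (cases k)
  case 0
  then show ?thesis using assms by (auto cong: continuous_on_cong)
next
  case (Suc m)
  from assms(1)[unfolded Suc] obtain F where
    F[rule_format]: "\<forall>v\<in>E. \<forall>x\<in>U. ((\<lambda>t::real. (f (x + t *\<^sub>R v) - f x) /\<^sub>R t) \<longlongrightarrow> F v x) (at 0)"
    and kF[rule_format]: "\<forall>v\<in>E. Ck_on m E U (F v)" and c: "continuous_on U f"
    by (rule Ck_on_Suc_elim)
  show ?thesis
    unfolding Suc
  proof (rule Ck_on_Suc_intro[OF _ _ kF])
    show "continuous_on U g"
      using continuous_on_cong[of U U f g] assms(3) c by simp
    fix v x assume v: "v \<in> E" and x: "x \<in> U"
    show "((\<lambda>t::real. (g (x + t *\<^sub>R v) - g x) /\<^sub>R t) \<longlongrightarrow> F v x) (at 0)"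
    proof (rule Lim_transform_eventually[OF F[OF v x]])
      have "\<forall>\<^sub>F t::real in at 0. x + t *\<^sub>R v \<in> U"
        using assms(2) x v by (simp add: dir_open_def)
      then show "\<forall>\<^sub>F t::real in at 0. (f (x + t *\<^sub>R v) - f x) /\<^sub>R t = (g (x + t *\<^sub>R v) - g x) /\<^sub>R t"
        by eventually_elim (simp add: assms(3) x)
    qed
  qed
qed

lemma continuous_on_local:
  assumes "\<And>x. x \<in> U \<Longrightarrow> \<exists>W. x \<in> W \<and> openin (top_of_set U) W \<and> continuous_on W f"
  shows "continuous_on U f"
  unfolding continuous_on_topological
proof (intro ballI allI impI)
  fix x B assume x: "x \<in> U" and B: "open B" "f x \<in> B"
  obtain W S where W: "x \<in> W" "W = U \<inter> S" "open S" "continuous_on W f"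
    using assms[OF x] by (auto simp: openin_open)
  then obtain A where "open A" "x \<in> A" "\<forall>y\<in>W. y \<in> A \<longrightarrow> f y \<in> B"
    using B unfolding continuous_on_topological by metis
  then show "\<exists>A. open A \<and> x \<in> A \<and> (\<forall>y\<in>U. y \<in> A \<longrightarrow> f y \<in> B)"
    using W by (intro exI[of _ "A \<inter> S"]) auto
qed

text \<open>The derivatives found on different neighbourhoods must fit together. Limits in a
  Hausdorff space are unique, so \<open>Lim\<close> names one derivative that agrees with all the
  local ones.\<close>

lemma Ck_on_local:
  fixes f :: "'a::{real_vector,topological_space} \<Rightarrow> 'b::{real_vector,t2_space}"
  assumes "\<And>x. x \<in> U \<Longrightarrow> \<exists>W. x \<in> W \<and> openin (top_of_set U) W \<and> dir_open E W \<and> Ck_on k E W f"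
  shows "Ck_on k E U f"
  using assms
proof (induction k arbitrary: f)
  case 0
  show ?case
    unfolding Ck_on.simps by (rule continuous_on_local) (use 0 in auto)
next
  case (Suc k)
  define q where "q v x t = (f (x + t *\<^sub>R v) - f x) /\<^sub>R t" for v x and t :: real
  define F where "F v x = Lim (at 0) (q v x)" for v x
  have loc: "\<exists>W. x \<in> W \<and> openin (top_of_set U) W \<and> dir_open E W \<and> (\<forall>y\<in>W. (q v y \<longlongrightarrow> F v y) (at 0)) \<and> Ck_on k E W (F v)"
    if x: "x \<in> U" and v: "v \<in> E" for x v
  proof -
    obtain W where W: "x \<in> W" "openin (top_of_set U) W" "dir_open E W" "Ck_on (Suc k) E W f"
      using Suc.prems[OF x] by metis
    from W(4) obtain h where
      h[rule_format]: "\<forall>v\<in>E. \<forall>y\<in>W. (q v y \<longlongrightarrow> h v y) (at 0)" "\<forall>v\<in>E. Ck_on k E W (h v)"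
      and "continuous_on W f"
      unfolding q_def[abs_def] by (rule Ck_on_Suc_elim)
    have eq: "h v y = F v y" if "y \<in> W" for y
      using h(1)[OF v that] unfolding F_def by (simp add: tendsto_Lim)
    have "\<forall>y\<in>W. (q v y \<longlongrightarrow> F v y) (at 0)"
      using h(1)[OF v] eq by simp
    moreover have "Ck_on k E W (F v)"
      by (rule Ck_on_cong[OF h(2)[OF v] W(3) eq])
    ultimately show ?thesis
      using W by blast
  qed
  show ?case
  proof (rule Ck_on_Suc_intro)
    show "continuous_on U f"
    proof (rule continuous_on_local)
      fix x assume "x \<in> U"
      from Suc.prems[OF this] show "\<exists>W. x \<in> W \<and> openin (top_of_set U) W \<and> continuous_on W f"
        by (metis Ck_on_continuous)
    qed
    fix v assume v: "v \<in> E"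
    show "Ck_on k E U (F v)"
      using loc[OF _ v] by (intro Suc.IH) metis
    fix x assume x: "x \<in> U"
    show "((\<lambda>t::real. (f (x + t *\<^sub>R v) - f x) /\<^sub>R t) \<longlongrightarrow> F v x) (at 0)"
    proof -
      obtain W where "x \<in> W" "\<forall>y\<in>W. (q v y \<longlongrightarrow> F v y) (at 0)"
        using loc[OF x v] by (elim exE conjE)
      then have "(q v x \<longlongrightarrow> F v x) (at 0)" by simp
      then show ?thesis unfolding q_def[abs_def] .
    qed
  qed
qed

lemma dir_quotient_continuous:
  fixes f :: "'a::real_vector \<Rightarrow> 'b::real_normed_vector"
  assumes "((\<lambda>t::real. (f (x + t *\<^sub>R v) - f x) /\<^sub>R t) \<longlongrightarrow> D) (at 0)"
  shows "((\<lambda>t::real. f (x + t *\<^sub>R v)) \<longlongrightarrow> f x) (at 0)"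
proof -
  have "((\<lambda>t::real. f x + t *\<^sub>R ((f (x + t *\<^sub>R v) - f x) /\<^sub>R t)) \<longlongrightarrow> f x + 0 *\<^sub>R D) (at 0)"
    by (intro tendsto_intros assms)
  then have "((\<lambda>t::real. f x + t *\<^sub>R ((f (x + t *\<^sub>R v) - f x) /\<^sub>R t)) \<longlongrightarrow> f x) (at 0)"
    by simp
  then show ?thesis
    by (rule Lim_transform_eventually) (simp add: eventually_at_filter)
qed

lemma Ck_on_add:
  fixes f g :: "'a::{real_vector,topological_space} \<Rightarrow> 'b::real_normed_vector"
  assumes "Ck_on k E U f" "Ck_on k E U g"
  shows "Ck_on k E U (\<lambda>x. f x + g x)"
  using assms
proof (induction k arbitrary: f g)
  case 0
  then show ?case by (auto intro: continuous_intros)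
next
  case (Suc k)
  from Suc.prems(1) obtain F where
    F[rule_format]: "\<forall>v\<in>E. \<forall>x\<in>U. ((\<lambda>t::real. (f (x + t *\<^sub>R v) - f x) /\<^sub>R t) \<longlongrightarrow> F v x) (at 0)"
    and kF[rule_format]: "\<forall>v\<in>E. Ck_on k E U (F v)" and cf: "continuous_on U f"
    by (rule Ck_on_Suc_elim)
  from Suc.prems(2) obtain H where
    H[rule_format]: "\<forall>v\<in>E. \<forall>x\<in>U. ((\<lambda>t::real. (g (x + t *\<^sub>R v) - g x) /\<^sub>R t) \<longlongrightarrow> H v x) (at 0)"
    and kH[rule_format]: "\<forall>v\<in>E. Ck_on k E U (H v)" and cg: "continuous_on U g"
    by (rule Ck_on_Suc_elim)
  show ?case
  proof (rule Ck_on_Suc_intro)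
    show "continuous_on U (\<lambda>x. f x + g x)"
      by (intro continuous_intros cf cg)
    fix v assume v: "v \<in> E"
    show "Ck_on k E U (\<lambda>x. F v x + H v x)"
      by (rule Suc.IH[OF kF[OF v] kH[OF v]])
    fix x assume "x \<in> U"
    from tendsto_add[OF F[OF v this] H[OF v this]]
    show "((\<lambda>t::real. (f (x + t *\<^sub>R v) + g (x + t *\<^sub>R v) - (f x + g x)) /\<^sub>R t) \<longlongrightarrow> F v x + H v x) (at 0)"
      by (simp add: algebra_simps)
  qed
qed

lemma Ck_on_const: "Ck_on k E U (\<lambda>x. c :: 'b::real_normed_vector)"
proof (induction k arbitrary: c)
  case (Suc k)
  show ?case
    by (rule Ck_on_Suc_intro[OF _ _ Suc[of 0]]) simp_all
qed simp

lemma Ck_on_sum: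
  fixes f :: "'i \<Rightarrow> 'a::{real_vector,topological_space} \<Rightarrow> 'b::real_normed_vector"
  assumes "\<And>i. i \<in> I \<Longrightarrow> Ck_on k E U (f i)"
  shows "Ck_on k E U (\<lambda>x. \<Sum>i\<in>I. f i x)"
  using assms
proof (induction I rule: infinite_finite_induct)
  case (insert i I)
  then show ?case by (simp add: Ck_on_add)
qed (auto simp: Ck_on_const)

lemma (in bounded_bilinear) Ck_on:
  assumes "Ck_on k E U f" "Ck_on k E U g"
  shows "Ck_on k E U (\<lambda>x. prod (f x) (g x))"
  using assms
proof (induction k arbitrary: f g)
  case 0
  then show ?case by (auto intro: continuous_on)
next
  case (Suc k)
  from Suc.prems(1) obtain F where
    F[rule_format]: "\<forall>v\<in>E. \<forall>x\<in>U. ((\<lambda>t::real. (f (x + t *\<^sub>R v) - f x) /\<^sub>R t) \<longlongrightarrow> F v x) (at 0)"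
    and kF[rule_format]: "\<forall>v\<in>E. Ck_on k E U (F v)" and cf: "continuous_on U f"
    by (rule Ck_on_Suc_elim)
  from Suc.prems(2) obtain H where
    H[rule_format]: "\<forall>v\<in>E. \<forall>x\<in>U. ((\<lambda>t::real. (g (x + t *\<^sub>R v) - g x) /\<^sub>R t) \<longlongrightarrow> H v x) (at 0)"
    and kH[rule_format]: "\<forall>v\<in>E. Ck_on k E U (H v)" and cg: "continuous_on U g"
    by (rule Ck_on_Suc_elim)
  show ?case
  proof (rule Ck_on_Suc_intro)
    show "continuous_on U (\<lambda>x. prod (f x) (g x))"
      by (rule continuous_on[OF cf cg])
    fix v assume v: "v \<in> E"
    show "Ck_on k E U (\<lambda>x. prod (f x) (H v x) + prod (F v x) (g x))"
      by (rule Ck_on_add[OF Suc.IH[OF Ck_on_SucD[OF Suc.prems(1)] kH[OF v]]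
            Suc.IH[OF kF[OF v] Ck_on_SucD[OF Suc.prems(2)]]])
    fix x assume x: "x \<in> U"
    \<comment> \<open>The point \<open>x + t *\<^sub>R v\<close> may lie off \<open>U\<close>, so
      the convergence of the first factor comes from the existence of the directional derivative and
      not from continuity on \<open>U\<close>.\<close>
    have "((\<lambda>t::real. prod (f (x + t *\<^sub>R v)) ((g (x + t *\<^sub>R v) - g x) /\<^sub>R t)
           + prod ((f (x + t *\<^sub>R v) - f x) /\<^sub>R t) (g x)) \<longlongrightarrow> prod (f x) (H v x) + prod (F v x) (g x)) (at 0)"
      by (rule tendsto_add[OF tendsto[OF dir_quotient_continuous[OF F[OF v x]] H[OF v x]]
            tendsto[OF F[OF v x] tendsto_const]])
    then show "((\<lambda>t::real. (prod (f (x + t *\<^sub>R v)) (g (x + t *\<^sub>R v)) - prod (f x) (g x)) /\<^sub>R t)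
        \<longlongrightarrow> prod (f x) (H v x) + prod (F v x) (g x)) (at 0)"
      by (simp add: scaleR_right scaleR_left diff_right diff_left flip: scaleR_add_right)
  qed
qed

lemma Ck_on_bounded_linear:
  assumes "bounded_linear L"
  shows "Ck_on k E U L"
proof (cases k)
  case 0
  then show ?thesis using assms by (simp add: linear_continuous_on)
next
  case (Suc m)
  interpret bounded_linear L by fact
  show ?thesis
    unfolding Suc
  proof (rule Ck_on_Suc_intro[OF linear_continuous_on[OF assms] _ Ck_on_const])
    show "((\<lambda>t::real. (L (x + t *\<^sub>R v) - L x) /\<^sub>R t) \<longlongrightarrow> L v) (at 0)" for x v
      by (rule tendsto_eventually) (auto simp: add scaleR eventually_at_filter)
  qed
qed


section \<open>From directional derivatives to the total derivative and the chain rule\<close>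

lemma dir_quotient_vector_derivative:
  fixes f :: "'a::real_vector \<Rightarrow> 'b::real_normed_vector"
  assumes "((\<lambda>s::real. (f (y + t *\<^sub>R v + s *\<^sub>R v) - f (y + t *\<^sub>R v)) /\<^sub>R s) \<longlongrightarrow> D) (at 0)"
  shows "((\<lambda>s. f (y + s *\<^sub>R v)) has_derivative (\<lambda>s. s *\<^sub>R D)) (at t)"
  unfolding has_derivative_at
proof
  have "((\<lambda>s. norm ((f (y + t *\<^sub>R v + s *\<^sub>R v) - f (y + t *\<^sub>R v)) /\<^sub>R s - D)) \<longlongrightarrow> 0) (at 0)"
    using assms by (rule tendsto_norm_zero[OF LIM_zero])
  then show "((\<lambda>h. norm (f (y + (t + h) *\<^sub>R v) - f (y + t *\<^sub>R v) - h *\<^sub>R D) / norm h) \<longlongrightarrow> 0) (at 0)"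
  proof (rule Lim_transform_eventually)
    have "norm ((f (y + t *\<^sub>R v + s *\<^sub>R v) - f (y + t *\<^sub>R v)) /\<^sub>R s - D)
       = norm (f (y + (t + s) *\<^sub>R v) - f (y + t *\<^sub>R v) - s *\<^sub>R D) / norm s" if "s \<noteq> 0" for s
    proof -
      have "(f (y + t *\<^sub>R v + s *\<^sub>R v) - f (y + t *\<^sub>R v)) /\<^sub>R s - D
        = (f (y + (t + s) *\<^sub>R v) - f (y + t *\<^sub>R v) - s *\<^sub>R D) /\<^sub>R s"
        using that by (simp add: scaleR_diff_right scaleR_add_left add.assoc)
      then show ?thesis by (simp add: divide_inverse_commute)
    qed
    then show "\<forall>\<^sub>F s in at 0. norm ((f (y + t *\<^sub>R v + s *\<^sub>R v) - f (y + t *\<^sub>R v)) /\<^sub>R s - D)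
       = norm (f (y + (t + s) *\<^sub>R v) - f (y + t *\<^sub>R v) - s *\<^sub>R D) / norm s"
      by (simp add: eventually_at_filter)
  qed
qed (rule bounded_linear_scaleR_left)

text \<open>The mean value inequality applies to
  \<open>f (y + t *\<^sub>R v) - t *\<^sub>R D0\<close>, whose derivative in \<open>t\<close> is
  \<open>D t - D0\<close>. A closed segment is used instead of an interval because \<open>r\<close>
  may be negative.\<close>

lemma dir_quotient_mean_value:
  fixes f :: "'a::real_vector \<Rightarrow> 'b::real_normed_vector"
  assumes "\<And>t. t \<in> closed_segment 0 r \<Longrightarrow>
      ((\<lambda>s::real. (f (y + t *\<^sub>R v + s *\<^sub>R v) - f (y + t *\<^sub>R v)) /\<^sub>R s) \<longlongrightarrow> D t) (at 0)"
    and "\<And>t. t \<in> closed_segment 0 r \<Longrightarrow> norm (D t - D0) \<le> e"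
  shows "norm (f (y + r *\<^sub>R v) - f y - r *\<^sub>R D0) \<le> e * \<bar>r\<bar>"
proof -
  define g where "g t = f (y + t *\<^sub>R v) - t *\<^sub>R D0" for t
  have "norm (g r - g 0) \<le> e * norm (r - 0)"
  proof (rule differentiable_bound[of "closed_segment 0 r" g "\<lambda>t s. s *\<^sub>R (D t - D0)"])
    fix t assume t: "t \<in> closed_segment 0 r"
    have "(g has_derivative (\<lambda>s. s *\<^sub>R D t - s *\<^sub>R D0)) (at t)"
      unfolding g_def
      by (intro has_derivative_diff dir_quotient_vector_derivative assms t
          has_derivative_scaleR_left has_derivative_ident)
    then show "(g has_derivative (\<lambda>s. s *\<^sub>R (D t - D0))) (at t within closed_segment 0 r)"
      by (simp add: scaleR_diff_right has_derivative_at_withinI)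
    show "onorm (\<lambda>s. s *\<^sub>R (D t - D0)) \<le> e"
      using onorm_scaleR_left[OF bounded_linear_ident, of "D t - D0"] assms(2)[OF t]
      by (simp add: onorm_id)
  qed auto
  then show ?thesis by (simp add: g_def algebra_simps)
qed

text \<open>The increment is decomposed along the basis, one direction at a time. On each leg the
  mean value inequality compares the partial derivative at nearby points with its value at
  \<open>x\<close>, which is where continuity of the partial derivatives is used.\<close>

lemma has_derivative_dir_quotients:
  fixes f :: "'a::euclidean_space \<Rightarrow> 'b::real_normed_vector"
  assumes S: "open S" "x \<in> S"
    and D: "\<And>b y. b \<in> Basis \<Longrightarrow> y \<in> S \<Longrightarrow> ((\<lambda>t::real. (f (y + t *\<^sub>R b) - f y) /\<^sub>R t) \<longlongrightarrow> D b y) (at 0)"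
    and cont: "\<And>b. b \<in> Basis \<Longrightarrow> continuous_on S (D b)"
  shows "(f has_derivative (\<lambda>h. \<Sum>b\<in>Basis. (h \<bullet> b) *\<^sub>R D b x)) (at x)"
proof -
  have main: "\<exists>d>0. \<forall>h. norm h < d \<longrightarrow>
      norm (f (x + (\<Sum>b\<in>B. (h \<bullet> b) *\<^sub>R b)) - f x - (\<Sum>b\<in>B. (h \<bullet> b) *\<^sub>R D b x)) \<le> e * norm h"
    if "finite B" "B \<subseteq> Basis" "e > 0" for B e
    using that
  proof (induction B arbitrary: e rule: finite_induct)
    case empty
    then show ?case by (intro exI[of _ 1]) auto
  next
    case (insert b B)
    obtain d1 where d1: "d1 > 0" "\<And>h. norm h < d1 \<Longrightarrow>
      norm (f (x + (\<Sum>b\<in>B. (h \<bullet> b) *\<^sub>R b)) - f x - (\<Sum>b\<in>B. (h \<bullet> b) *\<^sub>R D b x)) \<le> e/2 * norm h"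
      using insert.IH[of "e/2"] insert.prems by auto
    have b: "b \<in> Basis" using insert by auto
    have "isCont (D b) x"
      using cont[OF b] S by (simp add: continuous_on_eq_continuous_at)
    then obtain d2 where d2: "d2 > 0" "\<And>y. dist y x < d2 \<Longrightarrow> dist (D b y) (D b x) < e/2"
      using insert.prems unfolding continuous_at_eps_delta by (metis half_gt_zero)
    obtain d3 where d3: "d3 > 0" "ball x d3 \<subseteq> S"
      using S open_contains_ball by blast
    \<comment> \<open>Each of the legs moves by at most \<open>norm h\<close>, so all points met
      stay within \<open>N * norm h\<close> of \<open>x\<close>. This is why the radius
      \<open>min d2 d3\<close> is divided by \<open>N\<close>.\<close>
    define N where "N = real (card (insert b B))"
    have N: "N \<ge> 1" using insert.hyps(1) by (simp add: N_def card_insert_disjoint insert.hyps)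
    define d where "d = min d1 (min d2 d3 / N)"
    have d: "d > 0" using d1 d2 d3 N by (simp add: d_def)
    show ?case
    proof (intro exI[of _ d] conjI allI impI d)
      fix h :: 'a assume h: "norm h < d"
      define y where "y = x + (\<Sum>b\<in>B. (h \<bullet> b) *\<^sub>R b)"
      have near: "dist (y + t *\<^sub>R b) x < min d2 d3" if t: "t \<in> closed_segment 0 (h \<bullet> b)" for t
      proof -
        have "\<bar>t\<bar> \<le> \<bar>h \<bullet> b\<bar>"
          using t by (auto simp: closed_segment_eq_real_ivl split: if_splits)
        also have "\<dots> \<le> norm h"
          using Basis_le_norm[OF b] by simp
        finally have t': "\<bar>t\<bar> \<le> norm h" .
        have "norm (\<Sum>b\<in>B. (h \<bullet> b) *\<^sub>R b) \<le> (\<Sum>b\<in>B. norm h)"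
          using insert.prems by (intro sum_norm_le) (auto simp: subset_iff Basis_le_norm)
        then have "norm (y + t *\<^sub>R b - x) \<le> real (card B) * norm h + norm h"
          using t' b norm_triangle_ineq[of "\<Sum>b\<in>B. (h \<bullet> b) *\<^sub>R b" "t *\<^sub>R b"] by (simp add: y_def)
        also have "\<dots> = N * norm h"
          using insert.hyps by (simp add: N_def algebra_simps)
        also have "\<dots> < min d2 d3"
          using h N by (simp add: d_def field_simps)
        finally show ?thesis by (simp add: dist_norm)
      qed
      have "norm (f (y + (h \<bullet> b) *\<^sub>R b) - f y - (h \<bullet> b) *\<^sub>R D b x) \<le> e/2 * \<bar>h \<bullet> b\<bar>"
      proof (rule dir_quotient_mean_value[where D = "\<lambda>t. D b (y + t *\<^sub>R b)"])
        fix t assume t: "t \<in> closed_segment 0 (h \<bullet> b)"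
        have "y + t *\<^sub>R b \<in> S"
          using near[OF t] d3 by (auto simp: dist_commute)
        then show "((\<lambda>s::real. (f (y + t *\<^sub>R b + s *\<^sub>R b) - f (y + t *\<^sub>R b)) /\<^sub>R s) \<longlongrightarrow> D b (y + t *\<^sub>R b)) (at 0)"
          by (rule D[OF b])
        show "norm (D b (y + t *\<^sub>R b) - D b x) \<le> e/2"
          using d2(2)[of "y + t *\<^sub>R b"] near[OF t] by (simp add: dist_norm)
      qed
      also have "\<dots> \<le> e/2 * norm h"
        using Basis_le_norm[OF b] insert.prems by simp
      finally have 1: "norm (f (y + (h \<bullet> b) *\<^sub>R b) - f y - (h \<bullet> b) *\<^sub>R D b x) \<le> e/2 * norm h" .
      have 2: "norm (f y - f x - (\<Sum>b\<in>B. (h \<bullet> b) *\<^sub>R D b x)) \<le> e/2 * norm h"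
        unfolding y_def using h by (intro d1(2)) (simp add: d_def)
      have "f (x + (\<Sum>b\<in>insert b B. (h \<bullet> b) *\<^sub>R b)) - f x - (\<Sum>b\<in>insert b B. (h \<bullet> b) *\<^sub>R D b x)
        = (f (y + (h \<bullet> b) *\<^sub>R b) - f y - (h \<bullet> b) *\<^sub>R D b x) + (f y - f x - (\<Sum>b\<in>B. (h \<bullet> b) *\<^sub>R D b x))"
        using insert.hyps by (simp add: y_def algebra_simps)
      then have "norm (f (x + (\<Sum>b\<in>insert b B. (h \<bullet> b) *\<^sub>R b)) - f x - (\<Sum>b\<in>insert b B. (h \<bullet> b) *\<^sub>R D b x))
          \<le> e/2 * norm h + e/2 * norm h"
        using norm_triangle_mono[OF 1 2] by (simp only:)
      then show "norm (f (x + (\<Sum>b\<in>insert b B. (h \<bullet> b) *\<^sub>R b)) - f x - (\<Sum>b\<in>insert b B. (h \<bullet> b) *\<^sub>R D b x)) \<le> e * norm h"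
        by simp
    qed
  qed
  show ?thesis
    unfolding has_derivative_at_alt
  proof (intro conjI allI impI)
    show "bounded_linear (\<lambda>h. \<Sum>b\<in>Basis. (h \<bullet> b) *\<^sub>R D b x)"
      by (intro bounded_linear_sum bounded_linear_scaleR_const bounded_linear_inner_left)
    fix e :: real assume "e > 0"
    from main[OF finite_Basis order_refl this] obtain d where d: "d > 0" "\<And>h. norm h < d \<Longrightarrow>
      norm (f (x + (\<Sum>b\<in>Basis. (h \<bullet> b) *\<^sub>R b)) - f x - (\<Sum>b\<in>Basis. (h \<bullet> b) *\<^sub>R D b x)) \<le> e * norm h"
      by auto
    show "\<exists>d>0. \<forall>y. norm (y - x) < d \<longrightarrow> norm (f y - f x - (\<Sum>b\<in>Basis. ((y - x) \<bullet> b) *\<^sub>R D b x)) \<le> e * norm (y - x)"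
      using d(1) d(2)[of "y - x" for y] by (intro exI[of _ d]) (simp add: euclidean_representation)
  qed
qed


lemma has_derivative_real_quotient:
  fixes f :: "real \<Rightarrow> 'b::real_normed_vector"
  assumes "(f has_derivative f') (at 0)"
  shows "((\<lambda>t. (f t - f 0) /\<^sub>R t) \<longlongrightarrow> f' 1) (at 0)"
proof -
  interpret f': bounded_linear f' using assms by (rule has_derivative_bounded_linear)
  have "((\<lambda>h. norm (f (0 + h) - f 0 - f' h) / norm h) \<longlongrightarrow> 0) (at 0)"
    using assms unfolding has_derivative_at by blast
  then have "((\<lambda>h. norm ((f h - f 0) /\<^sub>R h - f' 1)) \<longlongrightarrow> 0) (at 0)"
  proof (rule Lim_transform_eventually)
    have "norm (f (0 + h) - f 0 - f' h) / norm h = norm ((f h - f 0) /\<^sub>R h - f' 1)" if "h \<noteq> 0" for h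
    proof -
      have "(f h - f 0) /\<^sub>R h - f' 1 = (f (0 + h) - f 0 - f' h) /\<^sub>R h"
        using that f'.scaleR[of h 1] by (simp add: scaleR_diff_right)
      then show ?thesis by (simp add: divide_inverse_commute)
    qed
    then show "\<forall>\<^sub>F h in at 0. norm (f (0 + h) - f 0 - f' h) / norm h = norm ((f h - f 0) /\<^sub>R h - f' 1)"
      by (simp add: eventually_at_filter)
  qed
  then show ?thesis
    by (rule LIM_zero_cancel[OF tendsto_norm_zero_cancel])
qed

lemma Ck_on_has_derivative:
  fixes f :: "'a::euclidean_space \<Rightarrow> 'b::real_normed_vector"
  assumes "Ck_on (Suc k) UNIV S f" "open S"
  obtains D where "\<And>x. x \<in> S \<Longrightarrow> (f has_derivative (\<lambda>h. \<Sum>b\<in>Basis. (h \<bullet> b) *\<^sub>R D b x)) (at x)"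
    and "\<And>b. Ck_on k UNIV S (D b)"
proof -
  from assms(1) obtain D where
    D[rule_format]: "\<forall>v\<in>UNIV. \<forall>x\<in>S. ((\<lambda>t::real. (f (x + t *\<^sub>R v) - f x) /\<^sub>R t) \<longlongrightarrow> D v x) (at 0)"
    and kD[rule_format]: "\<forall>v\<in>UNIV. Ck_on k UNIV S (D v)" and "continuous_on S f"
    by (rule Ck_on_Suc_elim)
  show thesis
  proof (rule that[of D])
    show "(f has_derivative (\<lambda>h. \<Sum>b\<in>Basis. (h \<bullet> b) *\<^sub>R D b x)) (at x)" if "x \<in> S" for x
      using has_derivative_dir_quotients[OF assms(2) that, of f D] D Ck_on_continuous[OF kD] by simp
    show "Ck_on k UNIV S (D b)" for b
      using kD by simp
  qed
qed

text \<open>By the total derivative of \<open>g\<close>, the derivative of the composition is a sum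
  of products of derivatives of \<open>f\<close> with partial derivatives of \<open>g\<close> taken
  at \<open>f x\<close>. The latter are compositions again, but of lower order, so the induction on
  \<open>k\<close> covers them.\<close>

lemma Ck_on_compose:
  fixes f :: "'a::{real_vector,topological_space} \<Rightarrow> 'b::euclidean_space"
    and g :: "'b \<Rightarrow> 'c::real_normed_vector"
  assumes "Ck_on k E U f" "Ck_on k UNIV S g" "open S" "f ` U \<subseteq> S"
  shows "Ck_on k E U (\<lambda>x. g (f x))"
  using assms(1,2)
proof (induction k arbitrary: g)
  case 0
  then show ?case using continuous_on_compose2[of S g U f] assms(4) by simp
next
  case (Suc k)
  from Suc.prems(1) obtain F where
    F[rule_format]: "\<forall>v\<in>E. \<forall>x\<in>U. ((\<lambda>t::real. (f (x + t *\<^sub>R v) - f x) /\<^sub>R t) \<longlongrightarrow> F v x) (at 0)"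
    and kF[rule_format]: "\<forall>v\<in>E. Ck_on k E U (F v)" and cf: "continuous_on U f"
    by (rule Ck_on_Suc_elim)
  obtain D where
    D: "\<And>x. x \<in> S \<Longrightarrow> (g has_derivative (\<lambda>h. \<Sum>b\<in>Basis. (h \<bullet> b) *\<^sub>R D b x)) (at x)"
    and kD: "\<And>b. Ck_on k UNIV S (D b)"
    using Ck_on_has_derivative[OF Suc.prems(2) assms(3)] by blast
  show ?case
  proof (rule Ck_on_Suc_intro)
    show "continuous_on U (\<lambda>x. g (f x))"
      using continuous_on_compose2[OF Ck_on_continuous[OF Suc.prems(2)] cf assms(4)] .
    fix v assume v: "v \<in> E"
    show "Ck_on k E U (\<lambda>x. \<Sum>b\<in>Basis. (F v x \<bullet> b) *\<^sub>R D b (f x))"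
      by (intro Ck_on_sum bounded_bilinear.Ck_on[OF bounded_bilinear_scaleR]
          bounded_bilinear.Ck_on[OF bounded_bilinear_inner] Ck_on_const kF v
          Suc.IH Ck_on_SucD[OF Suc.prems(1)] kD)
    fix x assume x: "x \<in> U"
    have "((\<lambda>t. f (x + t *\<^sub>R v)) has_derivative (\<lambda>t. t *\<^sub>R F v x)) (at 0)"
      using dir_quotient_vector_derivative[of f x 0 v "F v x"] F[OF v x] by simp
    moreover have "(g has_derivative (\<lambda>h. \<Sum>b\<in>Basis. (h \<bullet> b) *\<^sub>R D b (f x))) (at (f (x + 0 *\<^sub>R v)))"
      using D[of "f x"] x assms(4) by auto
    ultimately have "((\<lambda>t. g (f (x + t *\<^sub>R v))) has_derivative
        (\<lambda>t. \<Sum>b\<in>Basis. ((t *\<^sub>R F v x) \<bullet> b) *\<^sub>R D b (f x))) (at 0)"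
      using diff_chain_at[of "\<lambda>t. f (x + t *\<^sub>R v)" "\<lambda>t. t *\<^sub>R F v x" 0 g] unfolding o_def by blast
    from has_derivative_real_quotient[OF this]
    show "((\<lambda>t::real. (g (f (x + t *\<^sub>R v)) - g (f x)) /\<^sub>R t) \<longlongrightarrow> (\<Sum>b\<in>Basis. (F v x \<bullet> b) *\<^sub>R D b (f x))) (at 0)"
      by simp
  qed
qed

text \<open>Injectivity of the limit gives a lower bound \<open>c * norm h\<close> for
  \<open>norm (A0 h)\<close>, and it survives small perturbations. Solutions therefore depend
  continuously on the data, without any formula for inverse matrices.\<close>

lemma tendsto_solve_linear:
  fixes A :: "'i \<Rightarrow> 'a::euclidean_space \<Rightarrow> 'a"
  assumes lin: "\<forall>\<^sub>F t in F. linear (A t)" and A0: "linear A0" "inj A0"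
    and lim: "\<And>b. b \<in> Basis \<Longrightarrow> ((\<lambda>t. A t b) \<longlongrightarrow> A0 b) F"
    and eq: "\<forall>\<^sub>F t in F. A t (x t) = z t" and z: "(z \<longlongrightarrow> A0 x0) F"
  shows "(x \<longlongrightarrow> x0) F"
proof -
  obtain c where c: "c > 0" "\<And>h. c * norm h \<le> norm (A0 h)"
    using linear_inj_bounded_below_pos[OF A0] by metis
  define \<epsilon> where "\<epsilon> t = (\<Sum>b\<in>Basis. norm (A t b - A0 b))" for t
  have \<epsilon>: "(\<epsilon> \<longlongrightarrow> 0) F"
    unfolding \<epsilon>_def using lim by (intro tendsto_null_sum tendsto_norm_zero LIM_zero)
  \<comment> \<open>With the error of \<open>A t\<close> below \<open>c / 2\<close>, the term
    \<open>\<epsilon> t * norm (x t - x0)\<close> is absorbed by the lower bound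
    \<open>c * norm (x t - x0)\<close>, and half of the latter remains.\<close>
  have small: "\<forall>\<^sub>F t in F. \<epsilon> t < c / 2"
    using order_tendstoD(2)[OF \<epsilon>, of "c/2"] c by simp
  have bound: "norm (A t h - A0 h) \<le> \<epsilon> t * norm h" if "linear (A t)" for t h
  proof -
    interpret d: linear "\<lambda>h. A t h - A0 h"
      using that A0 by (intro linear_compose_sub)
    have "A t h - A0 h = (\<Sum>b\<in>Basis. (h \<bullet> b) *\<^sub>R (A t b - A0 b))"
      using d.sum[of "\<lambda>b. (h \<bullet> b) *\<^sub>R b" Basis] by (simp add: d.scale euclidean_representation)
    also have "norm \<dots> \<le> (\<Sum>b\<in>Basis. norm h * norm (A t b - A0 b))"
      by (intro sum_norm_le) (simp add: Basis_le_norm mult_right_mono)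
    finally show ?thesis by (simp add: \<epsilon>_def sum_distrib_left mult.commute)
  qed
  have ev: "\<forall>\<^sub>F t in F. norm (x t - x0) \<le> 2 / c * (norm (z t - A0 x0) + \<epsilon> t * norm x0)"
    using lin eq small
  proof eventually_elim
    case (elim t)
    have "norm (A0 (x t - x0)) = norm ((z t - A0 x0) - (A t (x t) - A0 (x t)))"
      using elim by (simp add: linear_diff[OF A0(1)])
    then have "c * norm (x t - x0) \<le> norm (z t - A0 x0) + \<epsilon> t * norm (x t)"
      using c(2)[of "x t - x0"] bound[OF elim(1), of "x t"] norm_triangle_ineq4[of "z t - A0 x0" "A t (x t) - A0 (x t)"]
      by linarith
    also have "\<epsilon> t * norm (x t) \<le> \<epsilon> t * (norm (x t - x0) + norm x0)"
      using norm_triangle_ineq[of "x t - x0" x0] by (intro mult_left_mono) (auto simp: \<epsilon>_def sum_nonneg)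
    also have "\<dots> \<le> c / 2 * norm (x t - x0) + \<epsilon> t * norm x0"
      using mult_right_mono[of "\<epsilon> t" "c / 2" "norm (x t - x0)"] elim by (simp add: distrib_left)
    finally show ?case using c by (simp add: field_simps)
  qed
  have "((\<lambda>t. 2 / c * (norm (z t - A0 x0) + \<epsilon> t * norm x0)) \<longlongrightarrow> 2 / c * (0 + 0 * norm x0)) F"
    by (intro tendsto_intros \<epsilon> tendsto_norm_zero LIM_zero z)
  then have "((\<lambda>t. 2 / c * (norm (z t - A0 x0) + \<epsilon> t * norm x0)) \<longlongrightarrow> 0) F"
    by simp
  with ev have "((\<lambda>t. x t - x0) \<longlongrightarrow> 0) F"
    by (rule Lim_null_comparison)
  then show ?thesis by (rule LIM_zero_cancel)
qed

text \<open>Implicit differentiation: the derivative of \<open>x\<close> solves a system with the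
  same matrix \<open>A y\<close> and a right-hand side built from \<open>x\<close> and the
  derivatives of \<open>z\<close> and \<open>A\<close>, so the order of differentiability climbs by
  induction. This one fact replaces the smoothness of matrix inversion for the inverse function
  theorem and the quotient rule for the cutoff function.\<close>

lemma Ck_on_solve_linear:
  fixes A :: "'p::real_normed_vector \<Rightarrow> 'a::euclidean_space \<Rightarrow> 'a"
  assumes A: "\<And>y. y \<in> U \<Longrightarrow> linear (A y)" "\<And>y. y \<in> U \<Longrightarrow> inj (A y)" and U: "dir_open E U"
    and "\<And>b. b \<in> Basis \<Longrightarrow> Ck_on k E U (\<lambda>y. A y b)"
    and "Ck_on k E U z" and "\<And>y. y \<in> U \<Longrightarrow> A y (x y) = z y"
  shows "Ck_on k E U x"
  using assms(4-)
proof (induction k arbitrary: x z)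
  case 0
  show ?case
    unfolding Ck_on.simps continuous_on_def
  proof
    fix y assume y: "y \<in> U"
    show "(x \<longlongrightarrow> x y) (at y within U)"
    proof (rule tendsto_solve_linear[where A = A and z = z and ?A0.0 = "A y"])
      show "(z \<longlongrightarrow> A y (x y)) (at y within U)"
        using 0 y by (simp add: continuous_on_def)
    qed (use 0 y A in \<open>auto simp: continuous_on_def eventually_at_filter\<close>)
  qed
next
  case (Suc k)
  from Suc.prems(2) obtain Z where
    Z[rule_format]: "\<forall>v\<in>E. \<forall>x\<in>U. ((\<lambda>t::real. (z (x + t *\<^sub>R v) - z x) /\<^sub>R t) \<longlongrightarrow> Z v x) (at 0)"
    and kZ[rule_format]: "\<forall>v\<in>E. Ck_on k E U (Z v)" and cz: "continuous_on U z"
    by (rule Ck_on_Suc_elim)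
  define P where "P F b \<longleftrightarrow> (\<forall>v\<in>E. \<forall>y\<in>U. ((\<lambda>t::real. (A (y + t *\<^sub>R v) b - A y b) /\<^sub>R t) \<longlongrightarrow> F v y) (at 0)) \<and>
      (\<forall>v\<in>E. Ck_on k E U (F v))" for F b
  have "\<forall>b\<in>Basis. \<exists>F. P F b"
  proof
    fix b :: 'a assume "b \<in> Basis"
    from Suc.prems(1)[OF this] obtain F where
      "\<forall>v\<in>E. \<forall>y\<in>U. ((\<lambda>t::real. (A (y + t *\<^sub>R v) b - A y b) /\<^sub>R t) \<longlongrightarrow> F v y) (at 0)"
      "\<forall>v\<in>E. Ck_on k E U (F v)" "continuous_on U (\<lambda>y. A y b)"
      by (rule Ck_on_Suc_elim)
    then show "\<exists>F. P F b" unfolding P_def by (intro exI[of _ F] conjI)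
  qed
  from bchoice[OF this] obtain B where PB: "\<forall>b\<in>Basis. P (B b) b" ..
  have B: "((\<lambda>t::real. (A (y + t *\<^sub>R v) b - A y b) /\<^sub>R t) \<longlongrightarrow> B b v y) (at 0)"
    if "b \<in> Basis" "v \<in> E" "y \<in> U" for b v y
    using PB that unfolding P_def by simp
  have kB: "Ck_on k E U (B b v)" if "b \<in> Basis" "v \<in> E" for b v
    using PB that unfolding P_def by simp
  have kx: "Ck_on k E U x"
    by (rule Suc.IH[OF Ck_on_SucD[OF Suc.prems(1)] Ck_on_SucD[OF Suc.prems(2)] Suc.prems(3)])
  define w where "w v y = Z v y - (\<Sum>b\<in>Basis. (x y \<bullet> b) *\<^sub>R B b v y)" for v y
  have kw: "Ck_on k E U (w v)" if v: "v \<in> E" for v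
  proof -
    have "Ck_on k E U (\<lambda>y. (x y \<bullet> b) *\<^sub>R B b v y)" if "b \<in> Basis" for b
      by (rule bounded_bilinear.Ck_on[OF bounded_bilinear_scaleR
            bounded_bilinear.Ck_on[OF bounded_bilinear_inner kx Ck_on_const] kB[OF that v]])
    then have "Ck_on k E U (\<lambda>y. \<Sum>b\<in>Basis. (x y \<bullet> b) *\<^sub>R B b v y)"
      by (rule Ck_on_sum)
    from Ck_on_linear_compose[OF this, of "\<lambda>u. - u"]
    have "Ck_on k E U (\<lambda>y. - (\<Sum>b\<in>Basis. (x y \<bullet> b) *\<^sub>R B b v y))"
      by (simp add: bounded_linear.linear[OF bounded_linear_minus[OF bounded_linear_ident]] continuous_on_minus)
    from Ck_on_add[OF kZ[OF v] this] show ?thesis by (simp add: w_def[abs_def])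
  qed
  define X where "X v y = inv_into UNIV (A y) (w v y)" for v y
  have AX: "A y (X v y) = w v y" if "y \<in> U" for y v
    unfolding X_def by (rule surj_f_inv_f) (use A that linear_injective_imp_surjective in blast)
  show ?case
  proof (rule Ck_on_Suc_intro)
    show "continuous_on U x" using kx by (rule Ck_on_continuous)
    fix v assume v: "v \<in> E"
    show "Ck_on k E U (X v)"
      by (rule Suc.IH[OF Ck_on_SucD[OF Suc.prems(1)] kw[OF v] AX])
    fix y assume y: "y \<in> U"
    have inU: "\<forall>\<^sub>F t::real in at 0. y + t *\<^sub>R v \<in> U"
      using U v y by (simp add: dir_open_def)
    \<comment> \<open>Subtracting the equations at \<open>y + t *\<^sub>R v\<close> and
      \<open>y\<close> and dividing by \<open>t\<close> shows that the difference quotient of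
      \<open>x\<close> is itself a solution, for the matrix at the moved point and this right-hand
      side.\<close>
    define q where "q t = (z (y + t *\<^sub>R v) - z y) /\<^sub>R t - (\<Sum>b\<in>Basis. (x y \<bullet> b) *\<^sub>R ((A (y + t *\<^sub>R v) b - A y b) /\<^sub>R t))" for t
    show "((\<lambda>t::real. (x (y + t *\<^sub>R v) - x y) /\<^sub>R t) \<longlongrightarrow> X v y) (at 0)"
    proof (rule tendsto_solve_linear[where A = "\<lambda>t. A (y + t *\<^sub>R v)" and z = q and ?A0.0 = "A y"])
      show "\<forall>\<^sub>F t in at 0. linear (A (y + t *\<^sub>R v))"
        using inU by eventually_elim (rule A)
      show "((\<lambda>t. A (y + t *\<^sub>R v) b) \<longlongrightarrow> A y b) (at 0)" if "b \<in> Basis" for b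
        using B[OF that v y] by (rule dir_quotient_continuous)
      show "(q \<longlongrightarrow> A y (X v y)) (at 0)"
        unfolding AX[OF y] w_def q_def
        by (intro tendsto_diff Z v y tendsto_sum tendsto_scaleR tendsto_const B)
      show "\<forall>\<^sub>F t in at 0. A (y + t *\<^sub>R v) ((x (y + t *\<^sub>R v) - x y) /\<^sub>R t) = q t"
        using inU
      proof eventually_elim
        case (elim t)
        interpret At: linear "A (y + t *\<^sub>R v)" using A elim by blast
        interpret Ay: linear "A y" using A y by blast
        have rep: "L (x y) = (\<Sum>b\<in>Basis. (x y \<bullet> b) *\<^sub>R L b)" if "linear L" for L :: "'a \<Rightarrow> 'a"
          using linear_sum[OF that, of "\<lambda>b. (x y \<bullet> b) *\<^sub>R b" Basis]
          by (simp add: linear_scale[OF that] euclidean_representation)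
        have "A (y + t *\<^sub>R v) ((x (y + t *\<^sub>R v) - x y) /\<^sub>R t) = (z (y + t *\<^sub>R v) - A (y + t *\<^sub>R v) (x y)) /\<^sub>R t"
          using Suc.prems(3)[OF elim] by (simp add: At.scale At.diff)
        also have "\<dots> = (z (y + t *\<^sub>R v) - z y) /\<^sub>R t - (A (y + t *\<^sub>R v) (x y) - A y (x y)) /\<^sub>R t"
          using Suc.prems(3)[OF y] by (simp flip: scaleR_diff_right)
        also have "(A (y + t *\<^sub>R v) (x y) - A y (x y)) /\<^sub>R t
            = (\<Sum>b\<in>Basis. (x y \<bullet> b) *\<^sub>R ((A (y + t *\<^sub>R v) b - A y b) /\<^sub>R t))"
          unfolding rep[OF At.linear_axioms] rep[OF Ay.linear_axioms]
          by (simp add: scaleR_sum_right sum_subtractf[symmetric] scaleR_diff_right mult.commute)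
        finally show ?case by (simp add: q_def)
      qed
    qed (use A y in auto)
  qed
qed


section \<open>Smooth maps on relatively open subsets of linear subspaces\<close>

lemma smooth_on_D: "smooth_on E U f \<Longrightarrow> Ck_on k E U f"
  by (simp add: smooth_on_def)

lemma smooth_on_continuous: "smooth_on E U f \<Longrightarrow> continuous_on U f"
  by (rule Ck_on_continuous[OF smooth_on_D])

lemma smooth_on_subset: "smooth_on E U f \<Longrightarrow> U' \<subseteq> U \<Longrightarrow> smooth_on E U' f"
  unfolding smooth_on_def using Ck_on_subset by blast

lemma smooth_on_cong:
  assumes "smooth_on E U f" "dir_open E U" "\<And>x. x \<in> U \<Longrightarrow> f x = g x"
  shows "smooth_on E U g"
  unfolding smooth_on_def
proof
  show "Ck_on k E U g" for k by (rule Ck_on_cong[OF smooth_on_D[OF assms(1)] assms(2,3)])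
qed

lemma smooth_on_local:
  fixes f :: "'a::{real_vector,topological_space} \<Rightarrow> 'b::{real_vector,t2_space}"
  assumes "\<And>x. x \<in> U \<Longrightarrow> \<exists>W. x \<in> W \<and> openin (top_of_set U) W \<and> dir_open E W \<and> smooth_on E W f"
  shows "smooth_on E U f"
  unfolding smooth_on_def
proof
  fix k show "Ck_on k E U f"
    by (rule Ck_on_local) (meson assms smooth_on_D)
qed

lemma smooth_on_compose_linear:
  assumes "smooth_on E U f" and L: "continuous_on U' L" "L ` U' \<subseteq> U"
    and lin: "\<And>x v t. x \<in> U' \<Longrightarrow> v \<in> E' \<Longrightarrow> L (x + t *\<^sub>R v) = L x + t *\<^sub>R L v"
    and E: "\<And>v. v \<in> E' \<Longrightarrow> L v \<in> E"
  shows "smooth_on E' U' (\<lambda>x. f (L x))"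
  unfolding smooth_on_def using Ck_on_compose_linear[OF smooth_on_D[OF assms(1)] L lin E] by simp

lemma smooth_on_linear_compose:
  assumes "smooth_on E U f" "linear L" "continuous_on UNIV L"
  shows "smooth_on E U (\<lambda>x. L (f x))"
  using Ck_on_linear_compose[OF smooth_on_D[OF assms(1)] assms(2,3)] by (simp add: smooth_on_def)

lemma smooth_on_add:
  fixes f g :: "'a::{real_vector,topological_space} \<Rightarrow> 'b::real_normed_vector"
  shows "smooth_on E U f \<Longrightarrow> smooth_on E U g \<Longrightarrow> smooth_on E U (\<lambda>x. f x + g x)"
  by (simp add: smooth_on_def Ck_on_add)

lemma smooth_on_const: "smooth_on E U (\<lambda>x. c :: 'b::real_normed_vector)"
  by (simp add: smooth_on_def Ck_on_const)

lemma (in bounded_bilinear) smooth_on: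
  assumes "smooth_on E U f" "smooth_on E U g"
  shows "smooth_on E U (\<lambda>x. prod (f x) (g x))"
  unfolding smooth_on_def by (intro allI Ck_on smooth_on_D assms)

lemma smooth_on_bounded_linear: "bounded_linear L \<Longrightarrow> smooth_on E U L"
  by (simp add: smooth_on_def Ck_on_bounded_linear)

lemma smooth_on_Pair:
  fixes f :: "'a::{real_vector,topological_space} \<Rightarrow> 'b::real_normed_vector"
    and g :: "'a \<Rightarrow> 'c::real_normed_vector"
  assumes "smooth_on E U f" "smooth_on E U g"
  shows "smooth_on E U (\<lambda>x. (f x, g x))"
proof -
  have 1: "bounded_linear (\<lambda>y::'b. (y, 0::'c))" and 2: "bounded_linear (\<lambda>y::'c. (0::'b, y))"
    by (intro bounded_linear_Pair bounded_linear_ident bounded_linear_zero)+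
  have "smooth_on E U (\<lambda>x. (f x, 0::'c) + (0::'b, g x))"
    using 1 2 by (intro smooth_on_add smooth_on_linear_compose[OF assms(1), of "\<lambda>y. (y, 0)"]
        smooth_on_linear_compose[OF assms(2), of "\<lambda>y. (0, y)"])
      (auto intro: bounded_linear.linear linear_continuous_on)
  then show ?thesis by simp
qed

text \<open>The orthogonal projection onto a subspace. Composed with it, a map on a relatively open
  subset of \<open>E\<close> becomes a map on an open subset of the whole type, and a subset of
  \<open>E\<close> becomes a cylinder whose measure is meaningful.\<close>

definition proj_on :: "'a::euclidean_space set \<Rightarrow> 'a \<Rightarrow> 'a"
  where "proj_on E = (SOME P. linear P \<and> (\<forall>x. P x \<in> E) \<and> (\<forall>x\<in>E. P x = x) \<and> (\<forall>x. \<forall>y\<in>E. (x - P x) \<bullet> y = 0))"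

lemma proj_on:
  fixes E :: "'a::euclidean_space set"
  assumes "subspace E"
  shows "linear (proj_on E)" "proj_on E x \<in> E" "x \<in> E \<Longrightarrow> proj_on E x = x"
    "y \<in> E \<Longrightarrow> (x - proj_on E x) \<bullet> y = 0"
proof -
  obtain B where B: "B \<subseteq> E" "pairwise orthogonal B" "\<And>x. x \<in> B \<Longrightarrow> norm x = 1"
    "independent B" "card B = dim E" "span B = E"
    using orthonormal_basis_subspace[OF assms] by metis
  have fin: "finite B" using B(4) by (rule independent_imp_finite)
  define P where "P x = (\<Sum>b\<in>B. (x \<bullet> b) *\<^sub>R b)" for x
  have lin: "linear P"
    unfolding P_def by (intro linear_compose_sum ballI linearI) (auto simp: inner_add_left scaleR_add_left)
  have mem: "P x \<in> E" for x
    unfolding P_def using B(1) assms by (auto intro!: subspace_sum subspace_scale)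
  have b: "P x \<bullet> c = x \<bullet> c" if "c \<in> B" for x c
  proof -
    have "P x \<bullet> c = (\<Sum>b\<in>B. (x \<bullet> b) * (b \<bullet> c))"
      by (simp add: P_def inner_sum_left)
    also have "\<dots> = (\<Sum>b\<in>{c}. (x \<bullet> b) * (b \<bullet> c))"
      using B(2) that fin by (intro sum.mono_neutral_right) (auto simp: pairwise_def orthogonal_def)
    also have "\<dots> = x \<bullet> c"
      using B(3)[OF that] by (simp add: norm_eq_1)
    finally show ?thesis .
  qed
  have orth: "(x - P x) \<bullet> y = 0" if "y \<in> E" for x y
  proof -
    have "B \<subseteq> {y. (x - P x) \<bullet> y = 0}" using b by (auto simp: inner_diff_left)
    moreover have "subspace {y. (x - P x) \<bullet> y = 0}" by (rule subspace_hyperplane)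
    ultimately have "span B \<subseteq> {y. (x - P x) \<bullet> y = 0}" by (rule span_minimal)
    then show ?thesis using B(6) that by auto
  qed
  have id: "P x = x" if "x \<in> E" for x
    using orth[of "x - P x" x] mem that assms by (simp add: subspace_diff)
  have "\<exists>P. linear P \<and> (\<forall>x. P x \<in> E) \<and> (\<forall>x\<in>E. P x = x) \<and> (\<forall>x. \<forall>y\<in>E. (x - P x) \<bullet> y = 0)"
    using lin mem id orth by blast
  from someI_ex[OF this] show "linear (proj_on E)" "proj_on E x \<in> E" "x \<in> E \<Longrightarrow> proj_on E x = x"
    "y \<in> E \<Longrightarrow> (x - proj_on E x) \<bullet> y = 0"
    unfolding proj_on_def by blast+
qed

lemma open_proj_on_vimage:
  assumes "subspace E" "openin (top_of_set E) U"
  shows "open (proj_on E -` U)"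
proof -
  obtain S where S: "open S" "U = E \<inter> S" using assms(2) by (auto simp: openin_open)
  have "proj_on E -` U = proj_on E -` S"
    using proj_on(2)[OF assms(1)] by (auto simp: S)
  then show ?thesis
    using S proj_on(1)[OF assms(1)] by (simp add: continuous_open_vimage linear_continuous_at linear_conv_bounded_linear)
qed

lemma smooth_on_proj_on:
  fixes f :: "'a::euclidean_space \<Rightarrow> 'b::{real_vector,topological_space}"
  assumes "subspace E" "smooth_on E U f"
  shows "smooth_on UNIV (proj_on E -` U) (\<lambda>x. f (proj_on E x))"
proof (rule smooth_on_compose_linear[OF assms(2)])
  note P = proj_on[OF assms(1)]
  show "continuous_on (proj_on E -` U) (proj_on E)"
    using P(1) by (rule linear_continuous_on[OF linear_conv_bounded_linear[THEN iffD1]])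
  show "proj_on E (x + t *\<^sub>R v) = proj_on E x + t *\<^sub>R proj_on E v" for x t v
    by (simp add: linear_add[OF P(1)] linear_scale[OF P(1)])
  show "proj_on E v \<in> E" for v by (rule P)
qed auto

lemma smooth_on_from_UNIV:
  assumes "smooth_on UNIV U f"
  shows "smooth_on E U f"
  using smooth_on_compose_linear[OF assms, of U "\<lambda>x. x" E] by (simp add: continuous_on_id)

text \<open>The outer map lives on a subspace only, while the chain rule wants an open set of the
  whole type. Replacing \<open>g\<close> by \<open>g\<close> after \<open>proj_on E'\<close> changes
  nothing on the values of \<open>f\<close>.\<close>

lemma smooth_on_compose:
  fixes f :: "'a::{real_vector,topological_space} \<Rightarrow> 'b::euclidean_space"
    and g :: "'b \<Rightarrow> 'c::real_normed_vector"
  assumes g: "smooth_on E' S g" and S: "subspace E'" "openin (top_of_set E') S"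
    and f: "smooth_on E U f" "dir_open E U" "f ` U \<subseteq> S"
  shows "smooth_on E U (\<lambda>x. g (f x))"
proof -
  have SE: "S \<subseteq> E'" using S(2) by (rule openin_imp_subset)
  have *: "proj_on E' (f x) = f x" if "x \<in> U" for x
    using f(3) SE that proj_on(3)[OF S(1)] by blast
  have "smooth_on E U (\<lambda>x. g (proj_on E' (f x)))"
    unfolding smooth_on_def
    by (intro allI Ck_on_compose[OF smooth_on_D[OF f(1)] smooth_on_D[OF smooth_on_proj_on[OF S(1) g]]
          open_proj_on_vimage[OF S]]) (use f(3) * in auto)
  then show ?thesis
    by (rule smooth_on_cong[OF _ f(2)]) (simp add: *)
qed

lemma smooth_on_differentiable:
  fixes f :: "'a::euclidean_space \<Rightarrow> 'b::real_normed_vector"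
  assumes "smooth_on UNIV S f" "open S" "x \<in> S"
  shows "f differentiable (at x)"
proof (rule Ck_on_has_derivative[OF smooth_on_D[OF assms(1), of "Suc 0"] assms(2)])
  fix D assume "\<And>x. x \<in> S \<Longrightarrow> (f has_derivative (\<lambda>h. \<Sum>b\<in>Basis. (h \<bullet> b) *\<^sub>R D b x)) (at x)"
  from this[OF assms(3)] show ?thesis by (rule differentiableI)
qed

text \<open>The classical theorem provides a differentiable local inverse. Its derivative in
  direction \<open>v\<close> solves a linear system with matrix \<open>f' (g y)\<close>, and this
  matrix is as regular as \<open>g\<close>; hence \<open>g\<close> gains one order of
  differentiability at a time. The derivative at \<open>x0\<close> is normalised to the identity,
  which is all that the straightening of a map requires.\<close>

lemma smooth_inverse_function:
  fixes f :: "'a::euclidean_space \<Rightarrow> 'a"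
  assumes f: "smooth_on UNIV U f" and U: "open U" "x0 \<in> U" and id: "(f has_derivative (\<lambda>h. h)) (at x0)"
  obtains U' V g where "open U'" "U' \<subseteq> U" "x0 \<in> U'" "open V" "f x0 \<in> V" "homeomorphism U' V f g"
    "smooth_on UNIV V g"
proof -
  obtain D where D: "\<And>x. x \<in> U \<Longrightarrow> (f has_derivative (\<lambda>h. \<Sum>b\<in>Basis. (h \<bullet> b) *\<^sub>R D b x)) (at x)"
    and kD: "\<And>b. Ck_on 0 UNIV U (D b)"
    using Ck_on_has_derivative[OF smooth_on_D[OF f, of "Suc 0"] U(1)] by blast
  \<comment> \<open>The derivative is assembled as a bounded operator, because the classical theorem
    asks for continuity in the operator norm.\<close>
  define f' where "f' x = (\<Sum>b\<in>Basis. blinfun_scaleR_left (D b x) o\<^sub>L blinfun_inner_right b)" for x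
  have f'_apply: "blinfun_apply (f' x) h = (\<Sum>b\<in>Basis. (h \<bullet> b) *\<^sub>R D b x)" for x h
    by (simp add: f'_def blinfun.sum_left inner_commute)
  have der: "(f has_derivative blinfun_apply (f' x)) (at x)" if "x \<in> U" for x
    using D[OF that] by (simp add: f'_apply[abs_def])
  have cont: "continuous_on U f'"
    unfolding f'_def
    by (intro continuous_on_sum bounded_bilinear.continuous_on[OF bounded_bilinear_blinfun_compose]
        bounded_linear.continuous_on[OF bounded_linear_blinfun_scaleR_left] continuous_on_const)
      (use kD in simp)
  have id': "id_blinfun o\<^sub>L f' x0 = id_blinfun"
    using has_derivative_unique[OF der[OF U(2)] id] by (intro blinfun_eqI) simp
  obtain U' V g g' where inv: "open U'" "U' \<subseteq> U" "x0 \<in> U'" "open V" "f x0 \<in> V" "homeomorphism U' V f g"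
    and g': "\<And>y. y \<in> V \<Longrightarrow> (g has_derivative g' y) (at y)"
    "\<And>y. y \<in> V \<Longrightarrow> g' y = inv_into UNIV (blinfun_apply (f' (g y)))"
    "\<And>y. y \<in> V \<Longrightarrow> bij (blinfun_apply (f' (g y)))"
    using inverse_function_theorem[OF U(1) der cont U(2) id'] by blast
  have gU: "g y \<in> U" if "y \<in> V" for y
    using inv that by (auto simp: homeomorphism_def)
  have "Ck_on k UNIV V g" for k
  proof (induction k)
    case 0
    then show ?case using inv by (simp add: homeomorphism_def)
  next
    case (Suc k)
    show ?case
    proof (rule Ck_on_Suc_intro)
      show "continuous_on V g" using inv by (simp add: homeomorphism_def)
      fix v :: 'a
      show "Ck_on k UNIV V (\<lambda>y. g' y v)"
      proof (rule Ck_on_solve_linear[where A = "\<lambda>y. blinfun_apply (f' (g y))" and z = "\<lambda>y. v"])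
        fix y assume y: "y \<in> V"
        show "linear (blinfun_apply (f' (g y)))"
          by (simp add: blinfun.bounded_linear_right bounded_linear.linear)
        show "inj (blinfun_apply (f' (g y)))" using g'(3)[OF y] by (rule bij_is_inj)
        show "blinfun_apply (f' (g y)) (g' y v) = v"
          using g'(2,3)[OF y] by (simp add: bij_is_surj surj_f_inv_f)
      next
        fix b :: 'a assume b: "b \<in> Basis"
        have "Ck_on (Suc k) UNIV U f" by (rule smooth_on_D[OF f])
        then obtain B where
          B[rule_format]: "\<forall>v\<in>UNIV. \<forall>x\<in>U. ((\<lambda>t::real. (f (x + t *\<^sub>R v) - f x) /\<^sub>R t) \<longlongrightarrow> B v x) (at 0)"
          and kB[rule_format]: "\<forall>v\<in>UNIV. Ck_on k UNIV U (B v)" and "continuous_on U f"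
          by (rule Ck_on_Suc_elim)
        have eq: "B b x = blinfun_apply (f' x) b" if x: "x \<in> U" for x
        proof -
          have "((\<lambda>t. x + t *\<^sub>R b) has_derivative (\<lambda>t. t *\<^sub>R b)) (at 0)"
            by (auto intro!: derivative_eq_intros)
          moreover have "(f has_derivative blinfun_apply (f' x)) (at (x + 0 *\<^sub>R b))"
            using der[OF x] by simp
          ultimately have "((\<lambda>t::real. f (x + t *\<^sub>R b)) has_derivative (\<lambda>t. blinfun_apply (f' x) (t *\<^sub>R b))) (at 0)"
            using diff_chain_at[of "\<lambda>t. x + t *\<^sub>R b" "\<lambda>t. t *\<^sub>R b" 0 f] unfolding o_def by blast
          from has_derivative_real_quotient[OF this] B[of b x] x show ?thesis
            by (auto intro: tendsto_unique[OF trivial_limit_at])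
        qed
        have "Ck_on k UNIV U (\<lambda>x. blinfun_apply (f' x) b)"
          by (rule Ck_on_cong[OF kB[OF UNIV_I] dir_open_open[OF U(1)] eq])
        then show "Ck_on k UNIV V (\<lambda>y. blinfun_apply (f' (g y)) b)"
          by (rule Ck_on_compose[OF Suc.IH _ U(1)]) (use gU in auto)
      qed (auto intro: Ck_on_const dir_open_open inv)
      fix y assume y: "y \<in> V"
      have "((\<lambda>t. y + t *\<^sub>R v) has_derivative (\<lambda>t. t *\<^sub>R v)) (at 0)"
        by (auto intro!: derivative_eq_intros)
      moreover have "(g has_derivative g' y) (at (y + 0 *\<^sub>R v))"
        using g'(1)[OF y] by simp
      ultimately have "((\<lambda>t::real. g (y + t *\<^sub>R v)) has_derivative (\<lambda>t. g' y (t *\<^sub>R v))) (at 0)"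
        using diff_chain_at[of "\<lambda>t. y + t *\<^sub>R v" "\<lambda>t. t *\<^sub>R v" 0 g] unfolding o_def by blast
      from has_derivative_real_quotient[OF this]
      show "((\<lambda>t::real. (g (y + t *\<^sub>R v) - g y) /\<^sub>R t) \<longlongrightarrow> g' y v) (at 0)" by simp
    qed
  qed
  then show thesis using inv by (intro that[of U' V g]) (auto simp: smooth_on_def)
qed

text \<open>The functions \<open>x\<^sup>-\<^sup>n exp (-1/x)\<close> are treated simultaneously: the derivative of each is a
  combination of two others.\<close>

definition exp_recip :: "nat \<Rightarrow> real \<Rightarrow> real"
  where "exp_recip n x = (if x \<le> 0 then 0 else (1 / x) ^ n * exp (- (1 / x)))"

lemma exp_recip_tendsto_0: "(exp_recip n \<longlongrightarrow> 0) (at 0)"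
proof (rule filterlim_split_at)
  show "(exp_recip n \<longlongrightarrow> 0) (at_left 0)"
    by (rule tendsto_eventually) (auto simp: exp_recip_def eventually_at_filter)
  have "((\<lambda>x::real. x ^ n / exp x) \<longlongrightarrow> 0) at_top"
    by (rule tendsto_power_div_exp_0)
  then have "((\<lambda>x::real. inverse x ^ n / exp (inverse x)) \<longlongrightarrow> 0) (at_right 0)"
    using filterlim_inverse_at_top_right by (rule filterlim_compose)
  then show "(exp_recip n \<longlongrightarrow> 0) (at_right 0)"
    by (rule Lim_transform_eventually)
      (auto simp: exp_recip_def eventually_at_filter exp_minus divide_simps)
qed

lemma exp_recip_has_derivative:
  "(exp_recip n has_real_derivative exp_recip (n + 2) x - real n * exp_recip (n + 1) x) (at x)"
proof -
  consider "x > 0" | "x < 0" | "x = 0" by linarith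
  then show ?thesis
  proof cases
    case 1
    have "((\<lambda>x. (1 / x) ^ n * exp (- (1 / x))) has_real_derivative
        exp_recip (n + 2) x - real n * exp_recip (n + 1) x) (at x)"
    proof -
      have 2: "((\<lambda>x. 1 / x) has_real_derivative - (1 / x ^ 2)) (at x)"
        using 1 by (auto intro!: derivative_eq_intros simp: power2_eq_square)
      have "((\<lambda>x. (1 / x) ^ n * exp (- (1 / x))) has_real_derivative
          real n * (- (1 / x ^ 2) * (1 / x) ^ (n - Suc 0)) * exp (- (1 / x)) +
          (exp (- (1 / x)) * - (- (1 / x ^ 2))) * (1 / x) ^ n) (at x)"
        by (intro DERIV_mult DERIV_power 2 DERIV_fun_exp DERIV_minus)
      then show ?thesis
        using 1 by (cases n) (simp_all add: exp_recip_def power2_eq_square field_simps)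
    qed
    moreover have ev: "\<forall>\<^sub>F y in nhds x. (1 / y) ^ n * exp (- (1 / y)) = exp_recip n y"
      using eventually_nhds_in_open[of "{0<..}" x] 1 by (auto simp: exp_recip_def elim: eventually_mono)
    ultimately show ?thesis
      unfolding DERIV_cong_ev[OF refl ev refl] by blast
  next
    case 2
    have ev: "\<forall>\<^sub>F y in nhds x. 0 = exp_recip n y"
      using eventually_nhds_in_open[of "{..<0}" x] 2 by (auto simp: exp_recip_def elim: eventually_mono)
    have "((\<lambda>y. 0) has_real_derivative 0) (at x)" by simp
    then have "(exp_recip n has_real_derivative 0) (at x)"
      unfolding DERIV_cong_ev[OF refl ev refl] .
    then show ?thesis using 2 by (simp add: exp_recip_def)
  next
    case 3
    \<comment> \<open>For nonzero arguments the difference quotient of \<open>exp_recip n\<close> at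
      0 is exactly \<open>exp_recip (n + 1)\<close>, which tends to 0.\<close>
    have "((\<lambda>h. (exp_recip n (0 + h) - exp_recip n 0) / h) \<longlongrightarrow> 0) (at 0)"
      by (rule Lim_transform_eventually[OF exp_recip_tendsto_0[of "n + 1"]])
        (auto simp: exp_recip_def eventually_at_filter)
    then show ?thesis using 3 by (simp add: DERIV_def exp_recip_def)
  qed
qed

lemma Ck_on_exp_recip: "Ck_on k UNIV UNIV (exp_recip n)"
proof (induction k arbitrary: n)
  case 0
  show ?case
    using exp_recip_has_derivative DERIV_isCont by (fastforce simp: continuous_on_eq_continuous_at)
next
  case (Suc k)
  show ?case
  proof (rule Ck_on_Suc_intro)
    show "continuous_on UNIV (exp_recip n)"
      using exp_recip_has_derivative DERIV_isCont by (fastforce simp: continuous_on_eq_continuous_at)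
    fix v x :: real
    define D where "D x = exp_recip (n + 2) x - real n * exp_recip (n + 1) x" for x
    have D: "(exp_recip n has_derivative (\<lambda>h. D x * h)) (at (x + 0 *\<^sub>R v))"
      using exp_recip_has_derivative[of n x] by (simp add: D_def has_field_derivative_def)
    have "((\<lambda>t. x + t *\<^sub>R v) has_derivative (\<lambda>t. t *\<^sub>R v)) (at 0)"
      by (auto intro!: derivative_eq_intros)
    from diff_chain_at[OF this D]
    have "((\<lambda>t. exp_recip n (x + t *\<^sub>R v)) has_derivative (\<lambda>t. D x * (t *\<^sub>R v))) (at 0)"
      unfolding o_def .
    from has_derivative_real_quotient[OF this]
    show "((\<lambda>t::real. (exp_recip n (x + t *\<^sub>R v) - exp_recip n x) /\<^sub>R t) \<longlongrightarrow> D x * v) (at 0)"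
      by simp
    have "Ck_on k UNIV UNIV (\<lambda>x. v * (exp_recip (n + 2) x + (- real n) * exp_recip (n + 1) x))"
      by (intro bounded_bilinear.Ck_on[OF bounded_bilinear_mult] Ck_on_add Ck_on_const Suc.IH)
    then show "Ck_on k UNIV UNIV (\<lambda>x. D x * v)"
      by (simp add: D_def algebra_simps)
  qed
qed

definition smooth_step :: "real \<Rightarrow> real"
  where "smooth_step t = exp_recip 0 (2 - t) / (exp_recip 0 (2 - t) + exp_recip 0 (t - 1))"

text \<open>The denominator is positive because \<open>2 - t\<close> and \<open>t - 1\<close> are
  never both nonpositive. Smoothness is that of the solution of the one-dimensional linear equation
  with the denominator as coefficient.\<close>

lemma smooth_step:
  "t \<le> 1 \<Longrightarrow> smooth_step t = 1" "t \<ge> 2 \<Longrightarrow> smooth_step t = 0" "smooth_on UNIV UNIV smooth_step"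
proof -
  define d where "d t = exp_recip 0 (2 - t) + exp_recip 0 (t - 1)" for t
  show "t \<le> 1 \<Longrightarrow> smooth_step t = 1" "t \<ge> 2 \<Longrightarrow> smooth_step t = 0"
    by (auto simp: smooth_step_def exp_recip_def)
  have pos: "d t > 0" for t
    by (auto simp: d_def exp_recip_def add_pos_pos)
  have 1: "Ck_on k UNIV UNIV (\<lambda>t. exp_recip 0 (2 - t))" "Ck_on k UNIV UNIV (\<lambda>t. exp_recip 0 (t - 1))" for k
  proof -
    have "Ck_on k UNIV UNIV (\<lambda>t::real. 2 + (-1) * t)"
      by (intro Ck_on_add Ck_on_const Ck_on_bounded_linear bounded_linear_mult_right)
    from Ck_on_compose[OF this Ck_on_exp_recip] show "Ck_on k UNIV UNIV (\<lambda>t. exp_recip 0 (2 - t))" by simp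
    have "Ck_on k UNIV UNIV (\<lambda>t::real. t + (-1))"
      by (intro Ck_on_add Ck_on_const Ck_on_bounded_linear bounded_linear_ident)
    from Ck_on_compose[OF this Ck_on_exp_recip] show "Ck_on k UNIV UNIV (\<lambda>t. exp_recip 0 (t - 1))" by simp
  qed
  show "smooth_on UNIV UNIV smooth_step"
    unfolding smooth_on_def
  proof
    fix k
    show "Ck_on k UNIV UNIV smooth_step"
    proof (rule Ck_on_solve_linear[where A = "\<lambda>t h. d t * h" and z = "\<lambda>t. exp_recip 0 (2 - t)"])
      show "linear ((*) (d t))" for t
        by (intro bounded_linear.linear bounded_linear_mult_right)
      show "inj ((*) (d t))" for t
        using pos[of t] by (auto intro!: injI)
      show "dir_open UNIV (UNIV :: real set)" by (rule dir_open_open) simp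
      show "Ck_on k UNIV UNIV (\<lambda>t. d t * b)" for b
        unfolding d_def
        by (intro bounded_bilinear.Ck_on[OF bounded_bilinear_mult] Ck_on_add Ck_on_const 1)
      show "d t * smooth_step t = exp_recip 0 (2 - t)" for t
        using pos[of t] by (simp add: smooth_step_def d_def)
    qed (rule 1)
  qed
qed


section \<open>Smoothness at a point of a manifold\<close>

text \<open>One pair of charts and one neighbourhood suffice here, whereas \<open>smooth_map\<close>
  speaks of all charts. This makes local constructions easy to feed in. Continuity is not a separate
  clause: it is contained in the neighbourhood being mapped into a single chart and in the
  smoothness of the coordinate expression.\<close>

definition smooth_at :: "('a, 'e::{real_vector,topological_space}) manifold
    \<Rightarrow> ('b, 'f::{real_vector,topological_space}) manifold \<Rightarrow> ('a \<Rightarrow> 'b) \<Rightarrow> 'a \<Rightarrow> bool"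
  where "smooth_at M N f x \<longleftrightarrow> (\<exists>U \<phi> U' \<psi> W. (U, \<phi>) \<in> atlas M \<and> (U', \<psi>) \<in> atlas N \<and>
    openin (mtop M) W \<and> x \<in> W \<and> W \<subseteq> U \<and> f ` W \<subseteq> U' \<and>
    smooth_on (model M) (\<phi> ` W) (\<psi> \<circ> f \<circ> inv_into U \<phi>))"

lemma smooth_atI:
  assumes "(U, \<phi>) \<in> atlas M" "(U', \<psi>) \<in> atlas N" "openin (mtop M) W" "x \<in> W" "W \<subseteq> U" "f ` W \<subseteq> U'"
    "smooth_on (model M) (\<phi> ` W) (\<psi> \<circ> f \<circ> inv_into U \<phi>)"
  shows "smooth_at M N f x"
  using assms unfolding smooth_at_def by blast

lemma smooth_atE:
  assumes "smooth_at M N f x"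
  obtains U \<phi> U' \<psi> W where "(U, \<phi>) \<in> atlas M" "(U', \<psi>) \<in> atlas N" "openin (mtop M) W" "x \<in> W" "W \<subseteq> U"
    "f ` W \<subseteq> U'" "smooth_on (model M) (\<phi> ` W) (\<psi> \<circ> f \<circ> inv_into U \<phi>)"
  using assms unfolding smooth_at_def by (elim exE conjE)

lemma smooth_manifold_model:
  fixes M :: "('a, 'e::euclidean_space) manifold"
  assumes "smooth_manifold M"
  shows "subspace (model M)"
  using assms unfolding smooth_manifold_def by (auto simp: subspace_span)

lemma smooth_manifold_cover:
  assumes "smooth_manifold M" "x \<in> topspace (mtop M)"
  obtains U \<phi> where "(U, \<phi>) \<in> atlas M" "x \<in> U"
proof -
  have "x \<in> (\<Union>(U,\<phi>)\<in>atlas M. U)"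
    using assms unfolding smooth_manifold_def by simp
  then show thesis using that by auto
qed

lemma smooth_manifold_transition:
  assumes "smooth_manifold M" "(U, \<phi>) \<in> atlas M" "(U', \<psi>) \<in> atlas M"
  shows "smooth_on (model M) (\<phi> ` (U \<inter> U')) (\<psi> \<circ> inv_into U \<phi>)"
  using assms unfolding smooth_manifold_def by fast

context
  fixes M :: "('a, 'e::euclidean_space) manifold" and U \<phi>
  assumes M: "smooth_manifold M" and U: "(U, \<phi>) \<in> atlas M"
begin

lemma chart_openin: "openin (mtop M) U"
  and chart_image: "openin (top_of_set (model M)) (\<phi> ` U)"
  and chart_homeo: "homeomorphic_map (subtopology (mtop M) U) (top_of_set (\<phi> ` U)) \<phi>"
  using M U unfolding smooth_manifold_def by fast+

lemma chart_topspace: "U \<subseteq> topspace (mtop M)"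
  using chart_openin by (rule openin_subset)

lemma chart_inj: "inj_on \<phi> U"
  using homeomorphic_imp_injective_map[OF chart_homeo] chart_topspace by (simp add: Int_absorb1)

lemma chart_image_openin:
  assumes "openin (mtop M) W" "W \<subseteq> U"
  shows "openin (top_of_set (model M)) (\<phi> ` W)"
proof -
  have "openin (subtopology (mtop M) U) W"
    using assms by (auto simp: openin_subtopology)
  then have "openin (top_of_set (\<phi> ` U)) (\<phi> ` W)"
    using homeomorphic_imp_open_map[OF chart_homeo] by (simp add: open_map_def)
  then show ?thesis using chart_image by (rule openin_trans)
qed

lemma chart_vimage_openin:
  assumes "openin (top_of_set (model M)) Y"
  shows "openin (mtop M) {x \<in> U. \<phi> x \<in> Y}"
proof -
  have "openin (top_of_set (\<phi> ` U)) (\<phi> ` U \<inter> Y)"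
    using assms openin_imp_subset[OF chart_image] openin_subtopology_Int2[of _ Y]
    by (metis inf.absorb_iff1 inf_commute openin_subtopology_Int subtopology_subtopology)
  from openin_continuous_map_preimage[OF homeomorphic_imp_continuous_map[OF chart_homeo] this]
  have "openin (subtopology (mtop M) U) {x \<in> U. \<phi> x \<in> Y}"
    using chart_topspace by (simp add: Int_absorb1) (smt (verit) Collect_cong imageI)
  then show ?thesis
    using chart_openin by (rule openin_trans_full)
qed

lemma chart_mem_model: "x \<in> U \<Longrightarrow> \<phi> x \<in> model M"
  using openin_imp_subset[OF chart_image] by blast

lemma chart_dir_open:
  assumes "openin (mtop M) W" "W \<subseteq> U"
  shows "dir_open (model M) (\<phi> ` W)"
  by (rule dir_open_openin[OF smooth_manifold_model[OF M] chart_image_openin[OF assms]])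

lemma chart_inv_into: "x \<in> U \<Longrightarrow> inv_into U \<phi> (\<phi> x) = x"
  by (rule inv_into_f_f[OF chart_inj])

end

text \<open>The coordinate expression in arbitrary charts is the given one between two transition
  maps. The open set \<open>B\<close> is included so that the same statement also yields continuity
  at the point.\<close>

lemma smooth_at_chart:
  fixes M :: "('a, 'e::euclidean_space) manifold" and N :: "('b, 'f::euclidean_space) manifold"
  assumes M: "smooth_manifold M" and N: "smooth_manifold N" and f: "smooth_at M N f x"
    and c: "(U, \<phi>) \<in> atlas M" "x \<in> U" "(U', \<psi>) \<in> atlas N" "f x \<in> U'"
    and B: "openin (mtop N) B" "f x \<in> B"
  obtains W where "openin (mtop M) W" "x \<in> W" "W \<subseteq> U" "f ` W \<subseteq> U' \<inter> B"
    "smooth_on (model M) (\<phi> ` W) (\<psi> \<circ> f \<circ> inv_into U \<phi>)"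
proof -
  from f obtain V \<kappa> V' \<xi> W where W: "(V, \<kappa>) \<in> atlas M" "(V', \<xi>) \<in> atlas N" "openin (mtop M) W" "x \<in> W" "W \<subseteq> V"
    "f ` W \<subseteq> V'" "smooth_on (model M) (\<kappa> ` W) (\<xi> \<circ> f \<circ> inv_into V \<kappa>)"
    by (rule smooth_atE)
  define F where "F = \<xi> \<circ> f \<circ> inv_into V \<kappa>"
  have F: "F (\<kappa> z) = \<xi> (f z)" if "z \<in> W" for z
    using that W(5) chart_inv_into[OF M W(1)] by (auto simp: F_def)
  define Y where "Y = \<xi> ` (V' \<inter> U' \<inter> B)"
  have "openin (mtop N) (V' \<inter> U' \<inter> B)"
    using chart_openin[OF N W(2)] chart_openin[OF N c(3)] B(1) by (intro openin_Int)
  then have Y: "openin (top_of_set (model N)) Y"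
    unfolding Y_def by (intro chart_image_openin[OF N W(2)]) auto
  \<comment> \<open>That the points of \<open>W\<close> mapped into the new chart and into
    \<open>B\<close> form an open set follows from continuity of the coordinate expression
    \<open>F\<close>; nothing else is known about the continuity of \<open>f\<close>.\<close>
  have "openin (top_of_set (\<kappa> ` W)) {y \<in> \<kappa> ` W. F y \<in> Y}"
  proof -
    have "continuous_map (top_of_set (\<kappa> ` W)) (top_of_set (model N)) F"
    proof -
      have "F ` \<kappa> ` W \<subseteq> model N"
        using F W(6) chart_mem_model[OF N W(2)] by (auto simp: image_subset_iff)
      then show ?thesis
        using smooth_on_continuous[OF W(7)] unfolding F_def[symmetric]
        by (simp add: continuous_map_in_subtopology image_subset_iff_funcset)
    qed
    from openin_continuous_map_preimage[OF this Y] show ?thesis by simp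
  qed
  then have "openin (top_of_set (model M)) {y \<in> \<kappa> ` W. F y \<in> Y}"
    using chart_image_openin[OF M W(1,3,5)] by (rule openin_trans)
  from chart_vimage_openin[OF M W(1) this]
  have "openin (mtop M) ({z \<in> V. \<kappa> z \<in> {y \<in> \<kappa> ` W. F y \<in> Y}} \<inter> U)"
    by (intro openin_Int chart_openin[OF M c(1)])
  moreover have "{z \<in> V. \<kappa> z \<in> {y \<in> \<kappa> ` W. F y \<in> Y}} \<inter> U = {z \<in> W. f z \<in> U' \<inter> B} \<inter> U"
  proof -
    have 1: "(\<kappa> z \<in> \<kappa> ` W) = (z \<in> W)" if "z \<in> V" for z
      using chart_inj[OF M W(1)] W(5) that by (auto simp: inj_on_def)
    have 2: "(F (\<kappa> z) \<in> Y) = (f z \<in> U' \<inter> B)" if "z \<in> W" for z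
    proof -
      have "f z \<in> V'" using that W(6) by auto
      then show ?thesis
        using chart_inj[OF N W(2)] unfolding F[OF that] Y_def by (auto simp: inj_on_def)
    qed
    show ?thesis using 1 2 W(5) by auto
  qed
  ultimately have open1: "openin (mtop M) ({z \<in> W. f z \<in> U' \<inter> B} \<inter> U)" by simp
  define W1 where "W1 = {z \<in> W. f z \<in> U' \<inter> B} \<inter> U"
  have W1: "openin (mtop M) W1" "W1 \<subseteq> U" "W1 \<subseteq> V" "W1 \<subseteq> W" "f ` W1 \<subseteq> U' \<inter> B" "f ` W1 \<subseteq> V'"
    using open1 W(5,6) by (auto simp: W1_def)
  have t1: "smooth_on (model M) (\<phi> ` W1) (\<kappa> \<circ> inv_into U \<phi>)"
    by (rule smooth_on_subset[OF smooth_manifold_transition[OF M c(1) W(1)]]) (use W1 in blast)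
  have t2: "smooth_on (model N) (\<xi> ` (V' \<inter> U')) (\<psi> \<circ> inv_into V' \<xi>)"
    by (rule smooth_manifold_transition[OF N W(2) c(3)])
  have d: "dir_open (model M) (\<phi> ` W1)"
    by (rule chart_dir_open[OF M c(1) W1(1,2)])
  have i1: "inv_into U \<phi> (\<phi> z) = z" if "z \<in> W1" for z
    using that W1 chart_inv_into[OF M c(1)] by blast
  have s1: "smooth_on (model M) (\<phi> ` W1) (\<lambda>y. F ((\<kappa> \<circ> inv_into U \<phi>) y))"
  proof (rule smooth_on_compose[OF _ smooth_manifold_model[OF M] chart_image_openin[OF M W(1,3,5)] t1 d])
    show "smooth_on (model M) (\<kappa> ` W) F" using W(7) by (simp add: F_def)
    show "(\<kappa> \<circ> inv_into U \<phi>) ` \<phi> ` W1 \<subseteq> \<kappa> ` W"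
      using i1 W1 by (auto simp: image_subset_iff)
  qed
  have "smooth_on (model M) (\<phi> ` W1) (\<lambda>y. (\<psi> \<circ> inv_into V' \<xi>) (F ((\<kappa> \<circ> inv_into U \<phi>) y)))"
  proof (rule smooth_on_compose[OF t2 smooth_manifold_model[OF N] _ s1 d])
    show "openin (top_of_set (model N)) (\<xi> ` (V' \<inter> U'))"
      using chart_openin[OF N W(2)] chart_openin[OF N c(3)] by (intro chart_image_openin[OF N W(2)] openin_Int) auto
    show "(\<lambda>y. F ((\<kappa> \<circ> inv_into U \<phi>) y)) ` \<phi> ` W1 \<subseteq> \<xi> ` (V' \<inter> U')"
      using i1 W1 F by (auto simp: image_subset_iff subset_iff)
  qed
  then have "smooth_on (model M) (\<phi> ` W1) (\<psi> \<circ> f \<circ> inv_into U \<phi>)"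
  proof (rule smooth_on_cong[OF _ d])
    fix y assume "y \<in> \<phi> ` W1"
    then obtain z where z: "z \<in> W1" "y = \<phi> z" by auto
    then have "f z \<in> V'" "z \<in> W" using W1 by auto
    then show "(\<psi> \<circ> inv_into V' \<xi>) (F ((\<kappa> \<circ> inv_into U \<phi>) y)) = (\<psi> \<circ> f \<circ> inv_into U \<phi>) y"
      using i1[OF z(1)] z F chart_inv_into[OF N W(2)] by simp
  qed
  moreover have "x \<in> W1" using W(4) c B by (simp add: W1_def)
  ultimately show thesis using that W1 by blast
qed


section \<open>Locality, composition, and the passage between pointwise and global
  smoothness\<close>

lemma smooth_at_topspace: "smooth_at M N f x \<Longrightarrow> x \<in> topspace (mtop M)"
  unfolding smooth_at_def using openin_subset by blast

lemma smooth_at_near: "smooth_at M N f x \<Longrightarrow> \<forall>\<^sub>F y in nhdsin (mtop M) x. smooth_at M N f y"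
  unfolding smooth_at_def eventually_nhdsin by meson

lemma eventually_nhdsinI:
  "openin X S \<Longrightarrow> a \<in> S \<Longrightarrow> (\<And>x. x \<in> S \<Longrightarrow> P x) \<Longrightarrow> eventually P (nhdsin X a)"
  unfolding eventually_nhdsin by blast

lemma eventually_nhdsin_openin: "openin X S \<Longrightarrow> a \<in> S \<Longrightarrow> \<forall>\<^sub>F x in nhdsin X a. x \<in> S"
  by (rule eventually_nhdsinI)

lemma eventually_nhdsin_topspace: "a \<in> topspace X \<Longrightarrow> \<forall>\<^sub>F x in nhdsin X a. x \<in> topspace X"
  by (rule eventually_nhdsin_openin) auto

lemma eventually_nhdsinE:
  assumes "eventually P (nhdsin X a)" "a \<in> topspace X"
  obtains S where "openin X S" "a \<in> S" "\<And>x. x \<in> S \<Longrightarrow> P x"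
  using assms unfolding eventually_nhdsin by blast

lemma eventually_nhdsin_self: "eventually P (nhdsin X a) \<Longrightarrow> a \<in> topspace X \<Longrightarrow> P a"
  unfolding eventually_nhdsin by blast

lemma smooth_at_codomain:
  fixes N :: "('b, 'f::euclidean_space) manifold"
  assumes "smooth_manifold N" "smooth_at M N f x"
  shows "f x \<in> topspace (mtop N)"
  using assms(2)
proof (rule smooth_atE)
  fix U \<phi> U' \<psi> W
  assume "(U', \<psi>) \<in> atlas N" "x \<in> W" "f ` W \<subseteq> U'"
  then show ?thesis using chart_topspace[OF assms(1)] by blast
qed

text \<open>Continuity at a point in the language of filters: the open set \<open>B\<close> of
  \<open>smooth_at_chart\<close> is chosen inside the neighbourhood on which \<open>P\<close>
  holds.\<close>

lemma smooth_at_eventually: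
  fixes M :: "('a, 'e::euclidean_space) manifold" and N :: "('b, 'f::euclidean_space) manifold"
  assumes M: "smooth_manifold M" and N: "smooth_manifold N" and f: "smooth_at M N f x"
    and P: "eventually P (nhdsin (mtop N) (f x))"
  shows "\<forall>\<^sub>F y in nhdsin (mtop M) x. P (f y)"
proof -
  obtain B where B: "openin (mtop N) B" "f x \<in> B" "\<And>y. y \<in> B \<Longrightarrow> P y"
    using eventually_nhdsinE[OF P smooth_at_codomain[OF N f]] by metis
  obtain U \<phi> where U: "(U, \<phi>) \<in> atlas M" "x \<in> U"
    using smooth_manifold_cover[OF M smooth_at_topspace[OF f]] .
  obtain U' \<psi> where U': "(U', \<psi>) \<in> atlas N" "f x \<in> U'"
    using smooth_manifold_cover[OF N smooth_at_codomain[OF N f]] .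
  obtain W where W: "openin (mtop M) W" "x \<in> W" "W \<subseteq> U" "f ` W \<subseteq> U' \<inter> B"
    "smooth_on (model M) (\<phi> ` W) (\<psi> \<circ> f \<circ> inv_into U \<phi>)"
    by (rule smooth_at_chart[OF M N f U U' B(1,2)])
  show ?thesis
    by (rule eventually_nhdsinI[OF W(1,2)]) (use W(4) B(3) in blast)
qed

lemma smooth_at_cong:
  fixes M :: "('a, 'e::euclidean_space) manifold"
  assumes M: "smooth_manifold M" and f: "smooth_at M N f x"
    and eq: "\<forall>\<^sub>F y in nhdsin (mtop M) x. f y = g y"
  shows "smooth_at M N g x"
proof -
  from f obtain U \<phi> U' \<psi> W where W: "(U, \<phi>) \<in> atlas M" "(U', \<psi>) \<in> atlas N" "openin (mtop M) W" "x \<in> W" "W \<subseteq> U"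
    "f ` W \<subseteq> U'" "smooth_on (model M) (\<phi> ` W) (\<psi> \<circ> f \<circ> inv_into U \<phi>)"
    by (rule smooth_atE)
  obtain S where S: "openin (mtop M) S" "x \<in> S" "\<And>y. y \<in> S \<Longrightarrow> f y = g y"
    using eventually_nhdsinE[OF eq smooth_at_topspace[OF f]] by metis
  have WS: "openin (mtop M) (W \<inter> S)" "W \<inter> S \<subseteq> U"
    using W S by (auto intro: openin_Int)
  have "smooth_on (model M) (\<phi> ` (W \<inter> S)) (\<psi> \<circ> f \<circ> inv_into U \<phi>)"
    by (rule smooth_on_subset[OF W(7)]) auto
  then have "smooth_on (model M) (\<phi> ` (W \<inter> S)) (\<psi> \<circ> g \<circ> inv_into U \<phi>)"
  proof (rule smooth_on_cong[OF _ chart_dir_open[OF M W(1) WS]])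
    fix y assume "y \<in> \<phi> ` (W \<inter> S)"
    then show "(\<psi> \<circ> f \<circ> inv_into U \<phi>) y = (\<psi> \<circ> g \<circ> inv_into U \<phi>) y"
      using chart_inv_into[OF M W(1)] WS(2) S(3) by auto
  qed
  moreover have "g ` (W \<inter> S) \<subseteq> U'" using W(6) S(3) by (auto simp flip: S(3))
  ultimately show ?thesis
    using W(4) S(2) by (intro smooth_atI[OF W(1,2) WS(1) _ WS(2)]) auto
qed

lemma smooth_at_compose:
  fixes M :: "('a, 'e::euclidean_space) manifold" and N :: "('b, 'f::euclidean_space) manifold"
    and P :: "('c, 'h::euclidean_space) manifold"
  assumes M: "smooth_manifold M" and N: "smooth_manifold N"
    and g: "smooth_at N P g (f x)" and f: "smooth_at M N f x"
  shows "smooth_at M P (\<lambda>x. g (f x)) x"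
proof -
  from g obtain V \<psi> V' \<kappa> S where S: "(V, \<psi>) \<in> atlas N" "(V', \<kappa>) \<in> atlas P" "openin (mtop N) S" "f x \<in> S" "S \<subseteq> V"
    "g ` S \<subseteq> V'" "smooth_on (model N) (\<psi> ` S) (\<kappa> \<circ> g \<circ> inv_into V \<psi>)"
    by (rule smooth_atE)
  obtain U \<phi> where U: "(U, \<phi>) \<in> atlas M" "x \<in> U"
    using smooth_manifold_cover[OF M smooth_at_topspace[OF f]] .
  obtain W where W: "openin (mtop M) W" "x \<in> W" "W \<subseteq> U" "f ` W \<subseteq> V \<inter> S"
    "smooth_on (model M) (\<phi> ` W) (\<psi> \<circ> f \<circ> inv_into U \<phi>)"
    by (rule smooth_at_chart[OF M N f U S(1) subsetD[OF S(5,4)] S(3,4)])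
  have i: "inv_into U \<phi> (\<phi> z) = z" if "z \<in> W" for z
    using that W chart_inv_into[OF M U(1)] by blast
  note d = chart_dir_open[OF M U(1) W(1,3)]
  have "smooth_on (model M) (\<phi> ` W) (\<lambda>y. (\<kappa> \<circ> g \<circ> inv_into V \<psi>) ((\<psi> \<circ> f \<circ> inv_into U \<phi>) y))"
  proof (rule smooth_on_compose[OF S(7) smooth_manifold_model[OF N] chart_image_openin[OF N S(1,3,5)] W(5) d])
    show "(\<psi> \<circ> f \<circ> inv_into U \<phi>) ` \<phi> ` W \<subseteq> \<psi> ` S"
      using i W(4) by (auto simp: image_subset_iff)
  qed
  then have "smooth_on (model M) (\<phi> ` W) (\<kappa> \<circ> (\<lambda>x. g (f x)) \<circ> inv_into U \<phi>)"
  proof (rule smooth_on_cong[OF _ d])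
    fix y assume "y \<in> \<phi> ` W"
    then obtain z where z: "z \<in> W" "y = \<phi> z" by auto
    then have "f z \<in> V" using W(4) by auto
    then show "(\<kappa> \<circ> g \<circ> inv_into V \<psi>) ((\<psi> \<circ> f \<circ> inv_into U \<phi>) y) = (\<kappa> \<circ> (\<lambda>x. g (f x)) \<circ> inv_into U \<phi>) y"
      using i[OF z(1)] z(2) chart_inv_into[OF N S(1)] by simp
  qed
  then show ?thesis
    using W S(6) by (intro smooth_atI[OF U(1) S(2) W(1,2,3)]) (auto simp: image_subset_iff subset_iff)
qed

lemma smooth_map_smooth_at:
  fixes M :: "('a, 'e::euclidean_space) manifold" and N :: "('b, 'f::euclidean_space) manifold"
  assumes M: "smooth_manifold M" and N: "smooth_manifold N" and f: "smooth_map M N f" and x: "x \<in> topspace (mtop M)"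
  shows "smooth_at M N f x"
proof -
  have cont: "continuous_map (mtop M) (mtop N) f" using f by (simp add: smooth_map_def)
  then have fx: "f x \<in> topspace (mtop N)" using x by (auto simp: continuous_map_def)
  obtain U \<phi> where U: "(U, \<phi>) \<in> atlas M" "x \<in> U" using smooth_manifold_cover[OF M x] .
  obtain U' \<psi> where U': "(U', \<psi>) \<in> atlas N" "f x \<in> U'" using smooth_manifold_cover[OF N fx] .
  have "openin (mtop M) (U \<inter> {z \<in> topspace (mtop M). f z \<in> U'})"
    by (intro openin_Int chart_openin[OF M U(1)] openin_continuous_map_preimage[OF cont] chart_openin[OF N U'(1)])
  also have "U \<inter> {z \<in> topspace (mtop M). f z \<in> U'} = U \<inter> f -` U'"
    using chart_topspace[OF M U(1)] by auto
  finally have op: "openin (mtop M) (U \<inter> f -` U')" .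
  have "smooth_on (model M) (\<phi> ` (U \<inter> f -` U')) (\<psi> \<circ> f \<circ> inv_into U \<phi>)"
    using f U U' unfolding smooth_map_def by fast
  then show ?thesis
    using U U' by (intro smooth_atI[OF U(1) U'(1) op]) auto
qed

lemma smooth_mapI:
  fixes M :: "('a, 'e::euclidean_space) manifold" and N :: "('b, 'f::euclidean_space) manifold"
  assumes M: "smooth_manifold M" and N: "smooth_manifold N"
    and f: "\<And>x. x \<in> topspace (mtop M) \<Longrightarrow> smooth_at M N f x"
  shows "smooth_map M N f"
  unfolding smooth_map_def
proof (intro conjI ballI case_prodI2)
  have ev: "\<forall>\<^sub>F y in nhdsin (mtop M) x. f y \<in> B" if "x \<in> topspace (mtop M)" "openin (mtop N) B" "f x \<in> B" for x B
    using smooth_at_eventually[OF M N f[OF that(1)] eventually_nhdsin_openin[OF that(2,3)]] .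
  show cont: "continuous_map (mtop M) (mtop N) f"
    unfolding continuous_map_def
  proof (intro conjI allI impI)
    show "f \<in> topspace (mtop M) \<rightarrow> topspace (mtop N)"
      using smooth_at_codomain[OF N f] by blast
    fix B assume B: "openin (mtop N) B"
    show "openin (mtop M) {x \<in> topspace (mtop M). f x \<in> B}"
    proof (subst openin_subopen, intro ballI)
      fix x assume "x \<in> {x \<in> topspace (mtop M). f x \<in> B}"
      then obtain S where "openin (mtop M) S" "x \<in> S" "\<And>y. y \<in> S \<Longrightarrow> f y \<in> B"
        using eventually_nhdsinE[OF ev] B by blast
      then show "\<exists>T. openin (mtop M) T \<and> x \<in> T \<and> T \<subseteq> {x \<in> topspace (mtop M). f x \<in> B}"
        using openin_subset by blast
    qed
  qed
  fix c c' U \<phi> U' \<psi> assume c: "c \<in> atlas M" "c = (U, \<phi>)" "c' \<in> atlas N" "c' = (U', \<psi>)"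
  show "smooth_on (model M) (\<phi> ` (U \<inter> f -` U')) (\<psi> \<circ> f \<circ> inv_into U \<phi>)"
  proof (rule smooth_on_local)
    fix y assume "y \<in> \<phi> ` (U \<inter> f -` U')"
    then obtain x where x: "x \<in> U" "f x \<in> U'" "y = \<phi> x" by auto
    then have sm: "smooth_at M N f x" using chart_topspace[OF M] c by (intro f) blast
    obtain W where W: "openin (mtop M) W" "x \<in> W" "W \<subseteq> U" "f ` W \<subseteq> U' \<inter> U'"
      "smooth_on (model M) (\<phi> ` W) (\<psi> \<circ> f \<circ> inv_into U \<phi>)"
      by (rule smooth_at_chart[OF M N sm c(1)[unfolded c(2)] x(1) c(3)[unfolded c(4)] x(2)
            chart_openin[OF N c(3)[unfolded c(4)]] x(2)])
    moreover have "openin (top_of_set (\<phi> ` (U \<inter> f -` U'))) (\<phi> ` W)"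
    proof (rule openin_subset_trans)
      show "openin (top_of_set (model M)) (\<phi> ` W)"
        by (rule chart_image_openin[OF M c(1)[unfolded c(2)] W(1,3)])
      show "\<phi> ` (U \<inter> f -` U') \<subseteq> model M" using chart_mem_model[OF M] c by auto
      show "\<phi> ` W \<subseteq> \<phi> ` (U \<inter> f -` U')" by (rule image_mono) (use W in auto)
    qed
    moreover have "dir_open (model M) (\<phi> ` W)"
      by (rule chart_dir_open[OF M c(1)[unfolded c(2)] W(1,3)])
    ultimately show "\<exists>W. y \<in> W \<and> openin (top_of_set (\<phi> ` (U \<inter> f -` U'))) W \<and> dir_open (model M) W \<and>
        smooth_on (model M) W (\<psi> \<circ> f \<circ> inv_into U \<phi>)"
      using x(3) W(2,5) by blast
  qed
qed

lemma smooth_at_id: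
  fixes M :: "('a, 'e::euclidean_space) manifold"
  assumes M: "smooth_manifold M" and x: "x \<in> topspace (mtop M)"
  shows "smooth_at M M (\<lambda>x. x) x"
proof -
  obtain U \<phi> where U: "(U, \<phi>) \<in> atlas M" "x \<in> U" using smooth_manifold_cover[OF M x] .
  show ?thesis
    using smooth_manifold_transition[OF M U(1) U(1)] U
    by (intro smooth_atI[OF U(1) U(1) chart_openin[OF M U(1)]]) (auto simp: o_def)
qed

lemma smooth_at_const:
  fixes M :: "('a, 'e::euclidean_space) manifold" and N :: "('b, 'f::euclidean_space) manifold"
  assumes M: "smooth_manifold M" and x: "x \<in> topspace (mtop M)" and N: "smooth_manifold N" and c: "c \<in> topspace (mtop N)"
  shows "smooth_at M N (\<lambda>x. c) x"
proof -
  obtain U \<phi> where U: "(U, \<phi>) \<in> atlas M" "x \<in> U" using smooth_manifold_cover[OF M x] .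
  obtain U' \<psi> where U': "(U', \<psi>) \<in> atlas N" "c \<in> U'" using smooth_manifold_cover[OF N c] .
  show ?thesis
    using U U' by (intro smooth_atI[OF U(1) U'(1) chart_openin[OF M U(1)]]) (auto simp: o_def smooth_on_const)
qed


section \<open>Products of manifolds, their projections and pairings\<close>

lemma smooth_manifold_prod:
  fixes M :: "('a, 'e::euclidean_space) manifold" and N :: "('b, 'f::euclidean_space) manifold"
  assumes M: "smooth_manifold M" and N: "smooth_manifold N"
  shows "smooth_manifold (prod_manifold M N)"
proof -
  note SM = smooth_manifold_model[OF M] and SN = smooth_manifold_model[OF N]
  have inv: "inv_into (U \<times> U') (map_prod \<phi> \<psi>) (a, b) = (inv_into U \<phi> a, inv_into U' \<psi> b)"
    if "(U, \<phi>) \<in> atlas M" "(U', \<psi>) \<in> atlas N" "a \<in> \<phi> ` U" "b \<in> \<psi> ` U'" for U \<phi> U' \<psi> a b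
  proof (rule inv_into_f_eq)
    show "inj_on (map_prod \<phi> \<psi>) (U \<times> U')"
      using that chart_inj[OF M] chart_inj[OF N] by (intro map_prod_inj_on)
  qed (use that in \<open>auto simp: inv_into_into f_inv_into_f\<close>)
  show ?thesis
    unfolding smooth_manifold_def
  proof (intro conjI)
    show "Hausdorff_space (mtop (prod_manifold M N))"
      using M N by (simp add: prod_manifold_def smooth_manifold_def Hausdorff_space_prod_topology)
    show "second_countable_space (mtop (prod_manifold M N))"
    proof -
      obtain A where A: "countable A" "\<forall>B\<in>A. openin (mtop M) B"
        "\<And>U x. openin (mtop M) U \<and> x \<in> U \<Longrightarrow> \<exists>B\<in>A. x \<in> B \<and> B \<subseteq> U"
        using M unfolding smooth_manifold_def second_countable_space_def by meson
      obtain B where B: "countable B" "\<forall>U\<in>B. openin (mtop N) U"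
        "\<And>U x. openin (mtop N) U \<and> x \<in> U \<Longrightarrow> \<exists>V\<in>B. x \<in> V \<and> V \<subseteq> U"
        using N unfolding smooth_manifold_def second_countable_space_def by meson
      show ?thesis
        unfolding second_countable_space_def
      proof (intro exI[of _ "(\<lambda>(U, V). U \<times> V) ` (A \<times> B)"] conjI allI impI ballI)
        show "countable ((\<lambda>(U, V). U \<times> V) ` (A \<times> B))"
          using A(1) B(1) by simp
        show "openin (mtop (prod_manifold M N)) W" if "W \<in> (\<lambda>(U, V). U \<times> V) ` (A \<times> B)" for W
          using that A(2) B(2) by (auto simp: prod_manifold_def openin_prod_Times_iff)
        fix W z assume W: "openin (mtop (prod_manifold M N)) W \<and> z \<in> W"
        then obtain U V where "openin (mtop M) U" "openin (mtop N) V" "fst z \<in> U" "snd z \<in> V" "U \<times> V \<subseteq> W"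
          unfolding prod_manifold_def by (simp add: openin_prod_topology_alt) (metis prod.collapse)
        moreover obtain U' where "U' \<in> A" "fst z \<in> U'" "U' \<subseteq> U" using A(3) calculation by blast
        moreover obtain V' where "V' \<in> B" "snd z \<in> V'" "V' \<subseteq> V" using B(3) calculation by blast
        ultimately show "\<exists>B\<in>(\<lambda>(U, V). U \<times> V) ` (A \<times> B). z \<in> B \<and> B \<subseteq> W"
          by (intro bexI[of _ "U' \<times> V'"]) (auto simp: mem_Times_iff)
      qed
    qed
    show "\<exists>B. finite B \<and> model (prod_manifold M N) = span B"
    proof -
      have sub: "subspace (model M \<times> model N)" using SM SN by (rule subspace_Times)
      obtain B where B: "B \<subseteq> model M \<times> model N" "independent B" "model M \<times> model N \<subseteq> span B"
        by (rule basis_exists)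
      have "finite B" using B(2) by (rule independent_imp_finite)
      moreover have "model M \<times> model N = span B"
        using B(3) span_minimal[OF B(1) sub] by (rule subset_antisym)
      ultimately show ?thesis by (auto simp: prod_manifold_def)
    qed
    show "(\<Union>(U, \<phi>)\<in>atlas (prod_manifold M N). U) = topspace (mtop (prod_manifold M N))"
    proof -
      have "(\<Union>(U, \<phi>)\<in>atlas (prod_manifold M N). U) = (\<Union>(U,\<phi>)\<in>atlas M. U) \<times> (\<Union>(U,\<phi>)\<in>atlas N. U)"
        by (auto simp: prod_manifold_def) blast+
      then show ?thesis using M N by (simp add: smooth_manifold_def prod_manifold_def)
    qed
    show "\<forall>(U,\<phi>)\<in>atlas (prod_manifold M N). openin (mtop (prod_manifold M N)) U \<and>
        openin (top_of_set (model (prod_manifold M N))) (\<phi> ` U) \<and>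
        homeomorphic_map (subtopology (mtop (prod_manifold M N)) U) (top_of_set (\<phi> ` U)) \<phi>"
    proof (intro ballI case_prodI2)
      fix c W \<theta> assume "c \<in> atlas (prod_manifold M N)" "c = (W, \<theta>)"
      then obtain U \<phi> U' \<psi> where c: "W = U \<times> U'" "\<theta> = map_prod \<phi> \<psi>" and
        U: "(U, \<phi>) \<in> atlas M" and U': "(U', \<psi>) \<in> atlas N"
        by (auto simp: prod_manifold_def)
      have im: "\<theta> ` W = (\<phi> ` U) \<times> (\<psi> ` U')" unfolding c by auto
      have "openin (mtop (prod_manifold M N)) W"
        using chart_openin[OF M U] chart_openin[OF N U'] by (simp add: c prod_manifold_def openin_prod_Times_iff)
      moreover have "openin (top_of_set (model (prod_manifold M N))) (\<theta> ` W)"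
        using chart_image[OF M U] chart_image[OF N U'] unfolding im by (simp add: prod_manifold_def openin_Times)
      moreover have "homeomorphic_map (subtopology (mtop (prod_manifold M N)) W) (top_of_set (\<theta> ` W)) \<theta>"
      proof -
        obtain f g where "homeomorphic_maps (subtopology (mtop M) U) (top_of_set (\<phi> ` U)) \<phi> f"
          "homeomorphic_maps (subtopology (mtop N) U') (top_of_set (\<psi> ` U')) \<psi> g"
          using chart_homeo[OF M U] chart_homeo[OF N U'] unfolding homeomorphic_map_maps by blast
        then have "homeomorphic_maps (prod_topology (subtopology (mtop M) U) (subtopology (mtop N) U'))
            (prod_topology (top_of_set (\<phi> ` U)) (top_of_set (\<psi> ` U'))) (\<lambda>(x,y). (\<phi> x, \<psi> y)) (\<lambda>(x,y). (f x, g y))"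
          by (simp only: homeomorphic_maps_prod) blast
        moreover have "(\<lambda>(x,y). (\<phi> x, \<psi> y)) = \<theta>" by (auto simp: c)
        ultimately show ?thesis
          unfolding homeomorphic_map_maps im by (auto simp: c(1) prod_manifold_def subtopology_Times)
      qed
      ultimately show "openin (mtop (prod_manifold M N)) W \<and>
        openin (top_of_set (model (prod_manifold M N))) (\<theta> ` W) \<and>
        homeomorphic_map (subtopology (mtop (prod_manifold M N)) W) (top_of_set (\<theta> ` W)) \<theta>" by blast
    qed
    show "\<forall>(U,\<phi>)\<in>atlas (prod_manifold M N). \<forall>(U',\<psi>)\<in>atlas (prod_manifold M N).
        smooth_on (model (prod_manifold M N)) (\<phi> ` (U \<inter> U')) (\<psi> \<circ> inv_into U \<phi>)"
    proof (intro ballI case_prodI2)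
      fix c W \<theta> d W' \<theta>' assume "c \<in> atlas (prod_manifold M N)" "c = (W, \<theta>)"
        "d \<in> atlas (prod_manifold M N)" "d = (W', \<theta>')"
      then obtain U \<phi> U' \<psi> V \<kappa> V' \<xi> where c: "W = U \<times> U'" "\<theta> = map_prod \<phi> \<psi>" and
        U: "(U, \<phi>) \<in> atlas M" and U': "(U', \<psi>) \<in> atlas N" and d: "W' = V \<times> V'" "\<theta>' = map_prod \<kappa> \<xi>" and
        V: "(V, \<kappa>) \<in> atlas M" and V': "(V', \<xi>) \<in> atlas N"
        by (auto simp: prod_manifold_def)
      have im: "\<theta> ` (W \<inter> W') = \<phi> ` (U \<inter> V) \<times> \<psi> ` (U' \<inter> V')" unfolding c d by auto
      have "smooth_on (model M \<times> model N) (\<phi> ` (U \<inter> V) \<times> \<psi> ` (U' \<inter> V')) (\<lambda>z. (\<kappa> \<circ> inv_into U \<phi>) (fst z))"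
        by (rule smooth_on_compose_linear[OF smooth_manifold_transition[OF M U V]])
          (auto intro: continuous_intros)
      moreover have "smooth_on (model M \<times> model N) (\<phi> ` (U \<inter> V) \<times> \<psi> ` (U' \<inter> V')) (\<lambda>z. (\<xi> \<circ> inv_into U' \<psi>) (snd z))"
        by (rule smooth_on_compose_linear[OF smooth_manifold_transition[OF N U' V']])
          (auto intro: continuous_intros)
      ultimately have "smooth_on (model M \<times> model N) (\<phi> ` (U \<inter> V) \<times> \<psi> ` (U' \<inter> V'))
          (\<lambda>z. ((\<kappa> \<circ> inv_into U \<phi>) (fst z), (\<xi> \<circ> inv_into U' \<psi>) (snd z)))"
        by (rule smooth_on_Pair)
      moreover have "dir_open (model M \<times> model N) (\<phi> ` (U \<inter> V) \<times> \<psi> ` (U' \<inter> V'))"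
        by (intro dir_open_openin subspace_Times SM SN openin_Times
            chart_image_openin[OF M U] chart_image_openin[OF N U'] openin_Int
            chart_openin[OF M U] chart_openin[OF M V] chart_openin[OF N U'] chart_openin[OF N V']) auto
      ultimately show "smooth_on (model (prod_manifold M N)) (\<theta> ` (W \<inter> W')) (\<theta>' \<circ> inv_into W \<theta>)"
        unfolding im by (simp add: prod_manifold_def) (erule (1) smooth_on_cong, auto simp: c d inv[OF U U'])
    qed
  qed
qed

lemma prod_manifold_sel [simp]:
  "mtop (prod_manifold M N) = prod_topology (mtop M) (mtop N)"
  "model (prod_manifold M N) = model M \<times> model N"
  by (simp_all add: prod_manifold_def)

lemma prod_manifold_atlas:
  "(U, \<phi>) \<in> atlas M \<Longrightarrow> (U', \<psi>) \<in> atlas N \<Longrightarrow> (U \<times> U', map_prod \<phi> \<psi>) \<in> atlas (prod_manifold M N)"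
  by (auto simp: prod_manifold_def)

lemma prod_chart_inv_into:
  fixes M :: "('a, 'e::euclidean_space) manifold" and N :: "('b, 'f::euclidean_space) manifold"
  assumes M: "smooth_manifold M" and N: "smooth_manifold N" and "(U, \<phi>) \<in> atlas M" "(U', \<psi>) \<in> atlas N"
    "x \<in> U" "y \<in> U'"
  shows "inv_into (U \<times> U') (map_prod \<phi> \<psi>) (\<phi> x, \<psi> y) = (x, y)"
  using chart_inv_into[OF smooth_manifold_prod[OF M N] prod_manifold_atlas[OF assms(3,4)], of "(x, y)"] assms(5,6)
  by simp

lemma smooth_at_fst:
  fixes M :: "('a, 'e::euclidean_space) manifold" and N :: "('b, 'f::euclidean_space) manifold"
  assumes M: "smooth_manifold M" and N: "smooth_manifold N"
    and x: "x \<in> topspace (mtop M)" and y: "y \<in> topspace (mtop N)"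
  shows "smooth_at (prod_manifold M N) M fst (x, y)"
proof -
  obtain U \<phi> where U: "(U, \<phi>) \<in> atlas M" "x \<in> U" using smooth_manifold_cover[OF M x] .
  obtain U' \<psi> where U': "(U', \<psi>) \<in> atlas N" "y \<in> U'" using smooth_manifold_cover[OF N y] .
  note c = prod_manifold_atlas[OF U(1) U'(1)] and P = smooth_manifold_prod[OF M N]
  have "smooth_on (model M \<times> model N) (map_prod \<phi> \<psi> ` (U \<times> U')) fst"
    by (rule smooth_on_bounded_linear[OF bounded_linear_fst])
  then have "smooth_on (model M \<times> model N) (map_prod \<phi> \<psi> ` (U \<times> U')) (\<phi> \<circ> fst \<circ> inv_into (U \<times> U') (map_prod \<phi> \<psi>))"
    by (rule smooth_on_cong) (use chart_dir_open[OF P c chart_openin[OF P c]] in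
        \<open>auto simp: prod_chart_inv_into[OF M N U(1) U'(1)]\<close>)
  then show ?thesis
    using U(2) U'(2) by (intro smooth_atI[OF c U(1) chart_openin[OF P c]]) auto
qed

lemma smooth_at_snd:
  fixes M :: "('a, 'e::euclidean_space) manifold" and N :: "('b, 'f::euclidean_space) manifold"
  assumes M: "smooth_manifold M" and N: "smooth_manifold N"
    and x: "x \<in> topspace (mtop M)" and y: "y \<in> topspace (mtop N)"
  shows "smooth_at (prod_manifold M N) N snd (x, y)"
proof -
  obtain U \<phi> where U: "(U, \<phi>) \<in> atlas M" "x \<in> U" using smooth_manifold_cover[OF M x] .
  obtain U' \<psi> where U': "(U', \<psi>) \<in> atlas N" "y \<in> U'" using smooth_manifold_cover[OF N y] .
  note c = prod_manifold_atlas[OF U(1) U'(1)] and P = smooth_manifold_prod[OF M N]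
  have "smooth_on (model M \<times> model N) (map_prod \<phi> \<psi> ` (U \<times> U')) snd"
    by (rule smooth_on_bounded_linear[OF bounded_linear_snd])
  then have "smooth_on (model M \<times> model N) (map_prod \<phi> \<psi> ` (U \<times> U')) (\<psi> \<circ> snd \<circ> inv_into (U \<times> U') (map_prod \<phi> \<psi>))"
    by (rule smooth_on_cong) (use chart_dir_open[OF P c chart_openin[OF P c]] in
        \<open>auto simp: prod_chart_inv_into[OF M N U(1) U'(1)]\<close>)
  then show ?thesis
    using U(2) U'(2) by (intro smooth_atI[OF c U'(1) chart_openin[OF P c]]) auto
qed

lemma smooth_at_Pair:
  fixes P :: "('c, 'h::euclidean_space) manifold"
    and M :: "('a, 'e::euclidean_space) manifold" and N :: "('b, 'f::euclidean_space) manifold"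
  assumes P: "smooth_manifold P" and M: "smooth_manifold M" and N: "smooth_manifold N"
    and f: "smooth_at P M f x" and g: "smooth_at P N g x"
  shows "smooth_at P (prod_manifold M N) (\<lambda>x. (f x, g x)) x"
proof -
  obtain V \<kappa> where V: "(V, \<kappa>) \<in> atlas P" "x \<in> V"
    using smooth_manifold_cover[OF P smooth_at_topspace[OF f]] .
  obtain U \<phi> where U: "(U, \<phi>) \<in> atlas M" "f x \<in> U"
    using smooth_manifold_cover[OF M smooth_at_codomain[OF M f]] .
  obtain U' \<psi> where U': "(U', \<psi>) \<in> atlas N" "g x \<in> U'"
    using smooth_manifold_cover[OF N smooth_at_codomain[OF N g]] .
  obtain W where W: "openin (mtop P) W" "x \<in> W" "W \<subseteq> V" "f ` W \<subseteq> U \<inter> U"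
    "smooth_on (model P) (\<kappa> ` W) (\<phi> \<circ> f \<circ> inv_into V \<kappa>)"
    by (rule smooth_at_chart[OF P M f V U chart_openin[OF M U(1)] U(2)])
  obtain W' where W': "openin (mtop P) W'" "x \<in> W'" "W' \<subseteq> V" "g ` W' \<subseteq> U' \<inter> U'"
    "smooth_on (model P) (\<kappa> ` W') (\<psi> \<circ> g \<circ> inv_into V \<kappa>)"
    by (rule smooth_at_chart[OF P N g V U' chart_openin[OF N U'(1)] U'(2)])
  have "smooth_on (model P) (\<kappa> ` (W \<inter> W')) (\<lambda>y. ((\<phi> \<circ> f \<circ> inv_into V \<kappa>) y, (\<psi> \<circ> g \<circ> inv_into V \<kappa>) y))"
    by (intro smooth_on_Pair smooth_on_subset[OF W(5)] smooth_on_subset[OF W'(5)]) auto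
  then show ?thesis
    using W W' by (intro smooth_atI[OF V(1) prod_manifold_atlas[OF U(1) U'(1)], of "W \<inter> W'"] openin_Int)
      (auto simp: o_def)
qed

section \<open>Maps of constant rank\<close>

text \<open>If a nonzero vector of \<open>S\<close> were killed, its orthogonal complement in
  \<open>S\<close> would have the same image as \<open>S\<close> but a smaller dimension.\<close>

lemma inj_on_dim_image:
  fixes f :: "'a::euclidean_space \<Rightarrow> 'b::euclidean_space"
  assumes f: "linear f" and S: "subspace S" and le: "dim S \<le> dim (f ` S)"
  shows "inj_on f S"
proof -
  have "k = 0" if k: "k \<in> S" "f k = 0" for k
  proof (rule ccontr)
    assume k0: "k \<noteq> 0"
    define C where "C = {y \<in> S. \<forall>x\<in>span {k}. orthogonal x y}"
    have "span {k} \<subseteq> S" using k S by (intro span_minimal) auto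
    then have "dim C + dim (span {k}) = dim S"
      unfolding C_def using S by (intro dim_subspace_orthogonal_to_vectors) (auto simp: subspace_span)
    moreover have "dim (span {k}) = 1" using k0 by (simp add: dim_singleton)
    ultimately have "dim C < dim S" by linarith
    moreover have "f ` S \<subseteq> f ` C"
    proof
      fix y assume "y \<in> f ` S"
      then obtain x where x: "x \<in> S" "y = f x" by auto
      define c where "c = x - ((x \<bullet> k) / (k \<bullet> k)) *\<^sub>R k"
      have "c \<in> S" unfolding c_def using x k S by (intro subspace_diff subspace_scale)
      moreover have "k \<bullet> c = 0" using k0 by (simp add: c_def inner_diff_right inner_commute)
      then have "\<forall>x\<in>span {k}. orthogonal x c"
        by (auto simp: span_singleton orthogonal_def)
      ultimately have "c \<in> C" by (simp add: C_def)
      moreover have "f c = y" using x k by (simp add: c_def linear_diff[OF f] linear_scale[OF f])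
      ultimately show "y \<in> f ` C" by blast
    qed
    then have "dim (f ` S) \<le> dim (f ` C)" by (rule dim_subset)
    ultimately show False using dim_image_le[OF f, of C] le by linarith
  qed
  then show ?thesis
    using linear_inj_on_iff_eq_0[OF f S] by blast
qed

text \<open>\<open>A\<close> is inverted on the orthogonal complement of its kernel, after
  projection to \<open>E\<close>. Then \<open>A'\<close> after \<open>A\<close> is an orthogonal
  projection and hence a contraction, which later keeps points inside a ball; and \<open>A'\<close>
  ignores components orthogonal to \<open>E\<close>, which can therefore be added freely.\<close>

lemma linear_pseudo_inverse:
  fixes A :: "'a::euclidean_space \<Rightarrow> 'b::euclidean_space"
  assumes A: "linear A" and E: "subspace E" "range A \<subseteq> E"
  obtains A' where "linear A'" "\<And>x. A (A' (A x)) = A x" "\<And>z. A' (A (A' z)) = A' z"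
    "\<And>x. norm (A' (A x)) \<le> norm x" "\<And>z. A' (proj_on E z) = A' z"
proof -
  define K where "K = {x. A x = 0}"
  define C where "C = {y. \<forall>x\<in>K. orthogonal x y}"
  have K: "subspace K" unfolding K_def by (rule linear_subspace_kernel[OF A])
  have C: "subspace C" unfolding C_def by (rule subspace_orthogonal_to_vectors)
  have "inj_on A C"
    unfolding linear_inj_on_iff_eq_0[OF A C]
  proof (intro ballI impI)
    fix x assume "x \<in> C" "A x = 0"
    then have "orthogonal x x" by (simp add: C_def K_def)
    then show "x = 0" by (simp add: orthogonal_self)
  qed
  then obtain g where g: "g ` UNIV \<subseteq> C" "linear g" "\<And>v. v \<in> C \<Longrightarrow> g (A v) = v"
    using linear_exists_left_inverse_on[OF A C] by metis
  define A' where "A' z = g (proj_on E z)" for z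
  note PE = proj_on[OF E(1)]
  have lin: "linear A'"
    unfolding A'_def using linear_compose[OF PE(1) g(2)] by (simp add: o_def)
  have A'A: "A' (A x) = x - proj_on K x" for x
  proof -
    have "x - proj_on K x \<in> C"
      using proj_on(4)[OF K] by (auto simp: C_def orthogonal_def inner_commute)
    moreover have "A (x - proj_on K x) = A x"
      using proj_on(2)[OF K, of x] by (simp add: K_def linear_diff[OF A])
    moreover have "proj_on E (A x) = A x" using E by (intro PE) auto
    ultimately show ?thesis using g(3)[of "x - proj_on K x"] by (simp add: A'_def)
  qed
  have projK: "proj_on K v = 0" if "v \<in> C" for v
  proof -
    have "proj_on K v \<bullet> proj_on K v = - ((v - proj_on K v) \<bullet> proj_on K v) + v \<bullet> proj_on K v"
      by (simp add: inner_diff_left)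
    also have "\<dots> = 0"
      using proj_on(2,4)[OF K] that by (auto simp: C_def orthogonal_def inner_commute)
    finally show ?thesis by simp
  qed
  show thesis
  proof (rule that[OF lin])
    show "A (A' (A x)) = A x" for x
      using proj_on(2)[OF K, of x] by (simp add: A'A K_def linear_diff[OF A])
    show "A' (A (A' z)) = A' z" for z
    proof -
      have "A' z \<in> C" using g(1) by (auto simp: A'_def)
      then show ?thesis by (simp only: A'A projK diff_zero)
    qed
    show "norm (A' (A x)) \<le> norm x" for x
    proof -
      have "(x - proj_on K x) \<bullet> proj_on K x = 0" by (rule proj_on(4)[OF K proj_on(2)[OF K]])
      then have "(norm x)\<^sup>2 = (norm (x - proj_on K x))\<^sup>2 + (norm (proj_on K x))\<^sup>2"
        using norm_add_Pythagorean[of "x - proj_on K x" "proj_on K x"] by (simp add: orthogonal_def)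
      then show ?thesis unfolding A'A
        by (intro power2_le_imp_le[of "norm (x - proj_on K x)" "norm x"]) auto
    qed
    show "A' (proj_on E z) = A' z" for z
      using PE(2,3) by (simp add: A'_def)
  qed
qed

text \<open>With \<open>A = dP(x\<^sub>0)\<close> and a pseudo-inverse \<open>A'\<close>, the map \<open>x \<mapsto> x - A'A x + A'P x\<close> is a local
  diffeomorphism at \<open>x\<^sub>0\<close>. In the coordinates given by its inverse \<open>\<Psi>\<close> the composition
  of \<open>P\<close> with \<open>A'\<close> is linear.\<close>

lemma straightening:
  fixes P :: "'a::euclidean_space \<Rightarrow> 'b::euclidean_space"
  assumes P: "smooth_on UNIV S P" and S: "open S" "x0 \<in> S"
    and A: "(P has_derivative A) (at x0)" and A': "linear A'" "\<And>x. A' (A (A' x)) = A' x"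
  obtains U V \<Phi> \<Psi> where "open U" "U \<subseteq> S" "x0 \<in> U" "open V" "\<Phi> x0 \<in> V" "homeomorphism U V \<Phi> \<Psi>"
    "smooth_on UNIV V \<Psi>" "\<And>y. y \<in> V \<Longrightarrow> A' (P (\<Psi> y)) = A' (A y)"
proof -
  have linA: "linear A" using A by (rule has_derivative_linear)
  have blA': "bounded_linear A'" using A'(1) by (simp add: linear_conv_bounded_linear)
  have blA: "bounded_linear A" using linA by (simp add: linear_conv_bounded_linear)
  have blN: "bounded_linear (\<lambda>x. x - A' (A x))"
    by (intro bounded_linear_sub bounded_linear_ident bounded_linear_compose[OF blA' blA])
  define \<Phi> where "\<Phi> x = (x - A' (A x)) + A' (P x)" for x
  have \<Phi>: "smooth_on UNIV S \<Phi>"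
    unfolding \<Phi>_def
    by (intro smooth_on_add smooth_on_bounded_linear[OF blN] smooth_on_linear_compose[OF P A'(1)] linear_continuous_on blA')
  have d: "(\<Phi> has_derivative (\<lambda>h. h)) (at x0)"
  proof -
    have "(\<Phi> has_derivative (\<lambda>h. (h - A' (A h)) + A' (A h))) (at x0)"
      unfolding \<Phi>_def
      by (intro has_derivative_add bounded_linear_imp_has_derivative[OF blN]
          bounded_linear.has_derivative[OF blA' A])
    then show ?thesis by simp
  qed
  obtain U V \<Psi> where inv: "open U" "U \<subseteq> S" "x0 \<in> U" "open V" "\<Phi> x0 \<in> V" "homeomorphism U V \<Phi> \<Psi>"
    "smooth_on UNIV V \<Psi>"
    by (rule smooth_inverse_function[OF \<Phi> S d])
  show thesis
  proof (rule that[OF inv])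
    fix y assume "y \<in> V"
    then have "\<Phi> (\<Psi> y) = y" using inv(6) by (simp add: homeomorphism_def)
    then have "A' (A y) = A' (A (\<Phi> (\<Psi> y)))" by simp
    also have "\<dots> = A' (P (\<Psi> y))"
      by (simp add: \<Phi>_def linear_add[OF A'(1)] linear_diff[OF A'(1)] linear_add[OF linA] linear_diff[OF linA] A'(2))
    finally show "A' (P (\<Psi> y)) = A' (A y)" by simp
  qed
qed

text \<open>If the derivative fills \<open>E\<close>, then \<open>A\<close> after \<open>A'\<close>
  is the identity on \<open>E\<close>, and in the straightened coordinates \<open>P\<close> is the
  linear map \<open>A\<close> itself. A right inverse of \<open>A\<close> then gives a right inverse
  of \<open>P\<close>.\<close>

lemma submersion_local_section:
  fixes P :: "'a::euclidean_space \<Rightarrow> 'b::euclidean_space"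
  assumes P: "smooth_on UNIV S P" and S: "open S" "x0 \<in> S" and E: "subspace E" "P ` S \<subseteq> E"
    and A: "(P has_derivative A) (at x0)" "range A = E"
  obtains t B where "open B" "P x0 \<in> B" "smooth_on UNIV B t" "t ` B \<subseteq> S" "t (P x0) = x0"
    "\<And>a. a \<in> B \<Longrightarrow> a \<in> E \<Longrightarrow> P (t a) = a"
proof -
  have linA: "linear A" using A(1) by (rule has_derivative_linear)
  obtain A' where A': "linear A'" "\<And>x. A (A' (A x)) = A x" "\<And>z. A' (A (A' z)) = A' z"
    using linear_pseudo_inverse[OF linA E(1)] A(2) by (metis subset_refl)
  obtain U V \<Phi> \<Psi> where inv: "open U" "U \<subseteq> S" "x0 \<in> U" "open V" "\<Phi> x0 \<in> V" "homeomorphism U V \<Phi> \<Psi>"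
    "smooth_on UNIV V \<Psi>" and eq: "\<And>y. y \<in> V \<Longrightarrow> A' (P (\<Psi> y)) = A' (A y)"
    by (rule straightening[OF P S A(1) A'(1,3)]) blast
  have AA': "A (A' e) = e" if "e \<in> E" for e
    using that A(2) A'(2) by (metis imageE)
  have \<Psi>: "\<Psi> y \<in> S" if "y \<in> V" for y
    using that inv by (auto simp: homeomorphism_def)
  have P\<Psi>: "P (\<Psi> y) = A y" if "y \<in> V" for y
  proof -
    have "P (\<Psi> y) = A (A' (P (\<Psi> y)))" using E(2) \<Psi>[OF that] by (simp add: AA' image_subset_iff)
    also have "\<dots> = A y" using eq[OF that] A'(2) by simp
    finally show ?thesis .
  qed
  have \<Psi>0: "\<Psi> (\<Phi> x0) = x0" using inv by (simp add: homeomorphism_def)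
  then have A0: "A (\<Phi> x0) = P x0" using P\<Psi>[OF inv(5)] by simp
  \<comment> \<open>This vector lies in the kernel of \<open>A\<close>, since
    \<open>A (\<Phi> x0)\<close> is \<open>P x0\<close>. Adding it makes the section pass through
    \<open>x0\<close> without changing the values of \<open>A\<close>.\<close>
  define c where "c = \<Phi> x0 - A' (P x0)"
  define B where "B = (\<lambda>a. c + A' a) -` V"
  have blA': "bounded_linear A'" using A'(1) by (simp add: linear_conv_bounded_linear)
  have cont: "continuous_on X (\<lambda>a. c + A' a)" for X
    by (intro continuous_intros linear_continuous_on blA')
  have sm: "smooth_on UNIV B (\<lambda>a. c + A' a)"
    by (intro smooth_on_add smooth_on_const smooth_on_bounded_linear blA')
  have B: "open B" unfolding B_def using inv(4) cont[of UNIV] by (intro open_vimage)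
  show thesis
  proof (rule that[of B "\<lambda>a. \<Psi> (c + A' a)"])
    show "smooth_on UNIV B (\<lambda>a. \<Psi> (c + A' a))"
      by (rule smooth_on_compose[OF inv(7) subspace_UNIV _ sm dir_open_open[OF B]]) (use inv(4) in \<open>auto simp: B_def\<close>)
    show "P x0 \<in> B" using inv(5) by (simp add: B_def c_def)
    show "\<Psi> (c + A' (P x0)) = x0" using \<Psi>0 by (simp add: c_def)
    show "(\<lambda>a. \<Psi> (c + A' a)) ` B \<subseteq> S" using \<Psi> by (auto simp: B_def)
    fix a assume a: "a \<in> B" "a \<in> E"
    have "P x0 \<in> E" using E S by auto
    then have "A (c + A' a) = a"
      using a by (simp add: c_def linear_add[OF linA] linear_diff[OF linA] AA' A0)
    then show "P (\<Psi> (c + A' a)) = a" using a P\<Psi> by (simp add: B_def)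
  qed (rule B)
qed

text \<open>At a point of maximal rank the straightened map depends on fewer than
  \<open>dim E\<close> parameters. As \<open>E\<close> may itself be negligible in the coordinate
  type, negligibility is asserted for the cylinder over the image, that is, for the image with all
  vectors orthogonal to \<open>E\<close> added.\<close>

lemma deficient_rank_negligible_image:
  fixes P :: "'a::euclidean_space \<Rightarrow> 'b::euclidean_space"
  assumes P: "smooth_on UNIV S P" and S: "open S" "x0 \<in> S" and E: "subspace E" "P ` S \<subseteq> E"
    and A: "(P has_derivative A) (at x0)" "range A \<subseteq> E" "dim (range A) < dim E"
    and rank: "\<And>x A2. x \<in> S \<Longrightarrow> (P has_derivative A2) (at x) \<Longrightarrow> dim (range A2) \<le> dim (range A)"
  obtains N where "open N" "x0 \<in> N" "N \<subseteq> S" "negligible (proj_on E -` (P ` N))"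
proof -
  have linA: "linear A" using A(1) by (rule has_derivative_linear)
  obtain A' where A': "linear A'" "\<And>x. A (A' (A x)) = A x" "\<And>z. A' (A (A' z)) = A' z"
    "\<And>x. norm (A' (A x)) \<le> norm x" "\<And>z. A' (proj_on E z) = A' z"
    by (rule linear_pseudo_inverse[OF linA E(1) A(2)]) blast
  obtain U V \<Phi> \<Psi> where inv: "open U" "U \<subseteq> S" "x0 \<in> U" "open V" "\<Phi> x0 \<in> V" "homeomorphism U V \<Phi> \<Psi>"
    "smooth_on UNIV V \<Psi>" and eq: "\<And>y. y \<in> V \<Longrightarrow> A' (P (\<Psi> y)) = A' (A y)"
    by (rule straightening[OF P S A(1) A'(1,3)]) blast
  have blA: "bounded_linear A" and blA': "bounded_linear A'"
    using linA A'(1) by (auto simp: linear_conv_bounded_linear)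
  define y0 where "y0 = \<Phi> x0"
  obtain r where r: "r > 0" "ball y0 r \<subseteq> V"
    using inv(4,5) open_contains_ball by (metis y0_def)
  define G where "G y = P (\<Psi> y)" for y
  have \<Psi>: "\<Psi> y \<in> S" if "y \<in> V" for y
    using that inv by (auto simp: homeomorphism_def)
  have smG: "smooth_on UNIV V G"
    unfolding G_def by (rule smooth_on_compose[OF P subspace_UNIV _ inv(7) dir_open_open[OF inv(4)]]) (use S \<Psi> in auto)
  \<comment> \<open>From the straightening, \<open>A'\<close> composed with the derivative
    \<open>D\<close> of \<open>G\<close> equals \<open>A'\<close> composed with \<open>A\<close>, so
    \<open>D\<close> has at least the rank of \<open>A\<close>. Maximality of the rank makes the two
    equal, so \<open>A'\<close> is injective on the range of \<open>D\<close>, and every vector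
    killed by \<open>A\<close> is killed by \<open>D\<close>.\<close>
  have der: "\<exists>D. (G has_derivative D) (at z) \<and> (\<forall>h. A h = 0 \<longrightarrow> D h = 0)" if z: "z \<in> V" for z
  proof -
    obtain D1 where D1: "(\<Psi> has_derivative D1) (at z)"
      using smooth_on_differentiable[OF inv(7,4) z] by (auto simp: differentiable_def)
    obtain D2 where D2: "(P has_derivative D2) (at (\<Psi> z))"
      using smooth_on_differentiable[OF P S(1) \<Psi>[OF z]] by (auto simp: differentiable_def)
    define D where "D h = D2 (D1 h)" for h
    have D: "(G has_derivative D) (at z)"
      using diff_chain_at[OF D1 D2] by (simp add: o_def G_def[abs_def] D_def[abs_def])
    have linD: "linear D" using D by (rule has_derivative_linear)
    have A'D: "A' (D h) = A' (A h)" for h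
    proof -
      have "((\<lambda>y. A' (G y)) has_derivative (\<lambda>h. A' (D h))) (at z)"
        by (rule bounded_linear.has_derivative[OF blA' D])
      moreover have "((\<lambda>y. A' (A y)) has_derivative (\<lambda>h. A' (A h))) (at z)"
        by (intro bounded_linear_imp_has_derivative bounded_linear_compose[OF blA' blA])
      then have "((\<lambda>y. A' (G y)) has_derivative (\<lambda>h. A' (A h))) (at z)"
        by (rule has_derivative_transform_within_open[OF _ inv(4) z]) (simp add: eq G_def)
      ultimately have "(\<lambda>h. A' (D h)) = (\<lambda>h. A' (A h))" by (rule has_derivative_unique)
      then show ?thesis by (rule fun_cong)
    qed
    have "range D \<subseteq> range D2" by (auto simp: D_def)
    then have "dim (range D) \<le> dim (range A)"
      using dim_subset rank[OF \<Psi>[OF z] D2] order_trans by blast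
    also have "range A \<subseteq> A ` A' ` range D"
    proof
      fix y assume "y \<in> range A"
      then obtain x where "y = A x" by auto
      then have "y = A (A' (D x))" using A'(2) A'D by simp
      then show "y \<in> A ` A' ` range D" by blast
    qed
    then have "dim (range A) \<le> dim (A ` A' ` range D)" by (rule dim_subset)
    also have "\<dots> \<le> dim (A' ` range D)" by (rule dim_image_le[OF linA])
    finally have "inj_on A' (range D)"
      by (intro inj_on_dim_image[OF A'(1)] linear_subspace_image linD subspace_UNIV) auto
    then have "D h = 0" if "A h = 0" for h
      using A'D[of h] that linear_0[OF A'(1)] linear_0[OF linD] by (metis inj_onD rangeI)
    then show ?thesis using D by blast
  qed
  \<comment> \<open>The two points differ by a vector killed by \<open>A\<close>, and the derivative
    of \<open>G\<close> vanishes along the segment joining them. The segment stays in the ball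
    because \<open>A'\<close> after \<open>A\<close> is a contraction.\<close>
  have const: "G y = G (y0 + A' (A (y - y0)))" if y: "y \<in> ball y0 r" for y
  proof -
    define y1 where "y1 = y0 + A' (A (y - y0))"
    define h where "h = y - y1"
    have y1: "y1 \<in> ball y0 r"
      using A'(4)[of "y - y0"] y by (simp add: y1_def dist_norm norm_minus_commute)
    have Ah: "A h = 0"
      using A'(2)[of "y - y0"] by (simp add: h_def y1_def linear_diff[OF linA] linear_add[OF linA])
    define g where "g t = G (y1 + t *\<^sub>R h)" for t :: real
    have "g 1 = g 0"
    proof (rule has_derivative_zero_unique[of "{0..1}"])
      fix t :: real assume t: "t \<in> {0..1}"
      have "y1 + t *\<^sub>R h \<in> closed_segment y1 y"
        using t by (auto simp: closed_segment_def h_def algebra_simps intro!: exI[of _ t])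
      then have "y1 + t *\<^sub>R h \<in> V"
        using closed_segment_subset[OF y1 y convex_ball] r by blast
      then obtain D where D: "(G has_derivative D) (at (y1 + t *\<^sub>R h))" "D h = 0"
        using der Ah by blast
      have "((\<lambda>t. y1 + t *\<^sub>R h) has_derivative (\<lambda>s. s *\<^sub>R h)) (at t)"
        by (auto intro!: derivative_eq_intros)
      from diff_chain_at[OF this D(1)] have "(g has_derivative (\<lambda>s. D (s *\<^sub>R h))) (at t)"
        by (simp add: o_def g_def[abs_def])
      moreover have "D (s *\<^sub>R h) = 0" for s
        using D linear_scale[OF has_derivative_linear[OF D(1)]] by simp
      ultimately show "(g has_derivative (\<lambda>s. 0)) (at t within {0..1})"
        by (simp add: has_derivative_at_withinI)
    qed auto
    then show ?thesis by (simp add: g_def h_def y1_def)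
  qed
  have "dim (A' ` E) \<le> dim (range A')" by (rule dim_subset) auto
  also have "range A' \<subseteq> A' ` range A" using A'(3) by (metis image_subsetI rangeI image_eqI)
  then have "dim (range A') \<le> dim (A' ` range A)" by (rule dim_subset)
  also have "\<dots> \<le> dim (range A)" by (rule dim_image_le[OF A'(1)])
  finally have "dim (A' ` E) < dim E" using A(3) by linarith
  then have "\<not> inj_on A' E"
    using dim_image_eq[OF A'(1), of E] E(1) by (metis less_irrefl span_eq_iff)
  \<comment> \<open>\<open>A'\<close> has rank at most that of \<open>A\<close>, hence less than
    \<open>dim E\<close>. Moving along such a \<open>w\<close> does not change \<open>A'\<close>, so
    it is enough to consider arguments orthogonal to \<open>w\<close>.\<close>
  then obtain w where w: "w \<in> E" "A' w = 0" "w \<noteq> 0"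
    using linear_inj_on_iff_eq_0[OF A'(1) E(1)] by blast
  note PE = proj_on[OF E(1)]
  \<comment> \<open>Restoring the component orthogonal to \<open>E\<close> makes \<open>F\<close> a
    differentiable map of the coordinate type into itself where it is used. It carries a subset of
    the hyperplane orthogonal to \<open>w\<close>, which is negligible, onto a set containing the
    cylinder in question.\<close>
  define F where "F z = G (y0 + A' z) + (z - proj_on E z)" for z
  define Z where "Z = {z. y0 + A' z \<in> ball y0 r} \<inter> {z. w \<bullet> z = 0}"
  define N where "N = {x \<in> U. \<Phi> x \<in> ball y0 r}"
  have cov: "proj_on E -` (P ` N) \<subseteq> F ` Z"
  proof
    fix q assume "q \<in> proj_on E -` (P ` N)"
    then obtain x where x: "x \<in> N" "proj_on E q = P x" by auto
    define y where "y = \<Phi> x"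
    have y: "y \<in> ball y0 r" "\<Psi> y = x" using x inv(6) by (auto simp: N_def y_def homeomorphism_def)
    define e where "e = q - proj_on E q"
    define z where "z = A (y - y0) + e"
    define z' where "z' = z - ((w \<bullet> z) / (w \<bullet> w)) *\<^sub>R w"
    have pe: "proj_on E e = 0"
      using PE(2,3) by (simp add: e_def linear_diff[OF PE(1)])
    have "A' e = 0" using A'(5)[of e] pe by (simp add: linear_0[OF A'(1)])
    then have Az': "A' z' = A' (A (y - y0))"
      by (simp add: z'_def z_def linear_diff[OF A'(1)] linear_add[OF A'(1)] linear_scale[OF A'(1)] w(2))
    have "norm (A' z') < r" using A'(4)[of "y - y0"] y(1) by (simp add: Az' dist_norm norm_minus_commute)
    moreover have "w \<bullet> z' = 0" using w(3) by (simp add: z'_def inner_diff_right)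
    ultimately have "z' \<in> Z" by (simp add: Z_def dist_norm)
    moreover have "proj_on E (A (y - y0)) = A (y - y0)" using A(2) by (intro PE) auto
    then have "z' - proj_on E z' = e"
      using PE(3)[OF w(1)] pe
      by (simp add: z'_def z_def linear_diff[OF PE(1)] linear_add[OF PE(1)] linear_scale[OF PE(1)])
    then have "F z' = G y + e" using const[OF y(1)] by (simp add: F_def Az')
    then have "F z' = q" using y(2) x(2) by (simp add: G_def e_def)
    ultimately show "q \<in> F ` Z" by blast
  qed
  have "negligible (F ` Z)"
  proof (rule negligible_differentiable_image_negligible[OF order_refl])
    show "negligible Z"
      by (rule negligible_subset[OF negligible_hyperplane[of w 0]]) (use w in \<open>auto simp: Z_def\<close>)
    show "F differentiable_on Z"
      unfolding differentiable_on_def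
    proof
      fix z assume "z \<in> Z"
      then have "y0 + A' z \<in> V" using r by (auto simp: Z_def)
      then have G: "G differentiable (at (y0 + A' z))" using smooth_on_differentiable[OF smG inv(4)] by blast
      have "(\<lambda>z. y0 + A' z) differentiable (at z)"
        by (intro differentiable_add differentiable_const linear_imp_differentiable A'(1))
      from differentiable_chain_at[OF this G] have "(\<lambda>z. G (y0 + A' z)) differentiable (at z)"
        by (simp add: o_def)
      then have "F differentiable (at z)"
        unfolding F_def
        by (rule differentiable_add[OF _ differentiable_diff[OF differentiable_ident linear_imp_differentiable[OF PE(1)]]])
      then show "F differentiable (at z within Z)" by (rule differentiable_at_withinI)
    qed
  qed
  then have "negligible (proj_on E -` (P ` N))" using cov by (rule negligible_subset)
  moreover have "open N"
  proof -
    have "continuous_on U \<Phi>" using inv(6) by (simp add: homeomorphism_def)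
    from continuous_open_preimage[OF this inv(1), of "ball y0 r"] show ?thesis
      by (simp add: N_def vimage_def Int_def)
  qed
  moreover have "x0 \<in> N" using inv(3) r by (simp add: N_def y0_def)
  ultimately show thesis using inv(2) by (intro that[of N]) (auto simp: N_def)
qed


section \<open>Vector-valued maps and charts\<close>

abbreviation vec_mfd :: "'v::euclidean_space set \<Rightarrow> ('v, 'v) manifold"
  where "vec_mfd V \<equiv> mfd (vec_group V)"

lemma vec_group_sel [simp]:
  "carrier (vec_group V) = V" "mult (vec_group V) = (+)" "one (vec_group V) = 0"
  "mtop (vec_mfd V) = top_of_set V" "model (vec_mfd V) = V" "atlas (vec_mfd V) = {(V, \<lambda>u. u)}"
  by (simp_all add: vec_group_def)

lemma inv_into_self: "x \<in> A \<Longrightarrow> inv_into A (\<lambda>u. u) x = x"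
  by (rule inv_into_f_f) auto

lemma smooth_manifold_vec:
  fixes V :: "'v::euclidean_space set"
  assumes V: "subspace V"
  shows "smooth_manifold (vec_mfd V)"
  unfolding smooth_manifold_def
proof (intro conjI)
  show "Hausdorff_space (mtop (vec_mfd V))"
    by (simp add: Hausdorff_space_subtopology)
  obtain B :: "'v set set" where B: "countable B" "topological_basis B"
    using ex_countable_basis by blast
  show "second_countable_space (mtop (vec_mfd V))"
    unfolding second_countable_space_def
  proof (intro exI[of _ "(\<lambda>b. V \<inter> b) ` B"] conjI ballI allI impI)
    fix U x assume "openin (mtop (vec_mfd V)) U \<and> x \<in> U"
    then obtain S where S: "open S" "U = V \<inter> S" "x \<in> U" by (auto simp: openin_open)
    then have "x \<in> S" by simp
    then obtain b where b: "b \<in> B" "x \<in> b" "b \<subseteq> S"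
      by (rule topological_basisE[OF B(2) S(1)])
    show "\<exists>C\<in>(\<lambda>b. V \<inter> b) ` B. x \<in> C \<and> C \<subseteq> U"
      by (rule bexI[of _ "V \<inter> b"]) (use b S in auto)
  next
    show "openin (mtop (vec_mfd V)) W" if "W \<in> (\<lambda>b. V \<inter> b) ` B" for W
      using that topological_basis_open[OF B(2)] by (auto simp: openin_open)
  qed (use B in simp)
  obtain C where C: "C \<subseteq> V" "independent C" "V \<subseteq> span C"
    by (rule basis_exists)
  have "finite C" using C(2) by (rule independent_imp_finite)
  moreover have "V = span C"
    using C(3) span_minimal[OF C(1) V] by (rule subset_antisym)
  ultimately show "\<exists>B. finite B \<and> model (vec_mfd V) = span B" by auto
  have "smooth_on V V (\<lambda>u. u)" by (rule smooth_on_bounded_linear[OF bounded_linear_ident])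
  then have "smooth_on V V (\<lambda>u. inv_into V (\<lambda>u. u) u)"
    by (rule smooth_on_cong) (auto intro: dir_open_openin V simp: inv_into_self)
  then show "\<forall>(U, \<phi>)\<in>atlas (vec_mfd V). \<forall>(U', \<psi>)\<in>atlas (vec_mfd V).
       smooth_on (model (vec_mfd V)) (\<phi> ` (U \<inter> U')) (\<psi> \<circ> inv_into U \<phi>)"
    by (simp add: o_def)
  have "homeomorphic_map (top_of_set V) (top_of_set V) (\<lambda>u. u)"
    using homeomorphic_map_id[of "top_of_set V" "top_of_set V"] by (simp add: id_def)
  then show "\<forall>(U, \<phi>)\<in>atlas (vec_mfd V). openin (mtop (vec_mfd V)) U \<and>
       openin (top_of_set (model (vec_mfd V))) (\<phi> ` U) \<and>
       homeomorphic_map (subtopology (mtop (vec_mfd V)) U) (top_of_set (\<phi> ` U)) \<phi>"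
    by (simp add: subtopology_subtopology)
qed simp

lemma smooth_at_vecI:
  assumes M: "smooth_manifold (M :: ('a, 'e::euclidean_space) manifold)"
    and "(U, \<phi>) \<in> atlas M" "openin (mtop M) W" "x \<in> W" "W \<subseteq> U" "f ` W \<subseteq> V"
    "smooth_on (model M) (\<phi> ` W) (f \<circ> inv_into U \<phi>)"
  shows "smooth_at M (vec_mfd V) f x"
proof (rule smooth_atI[OF assms(2) _ assms(3-6)])
  show "smooth_on (model M) (\<phi> ` W) ((\<lambda>u. u) \<circ> f \<circ> inv_into U \<phi>)"
    using assms(7) by (simp add: o_def)
qed simp

lemma smooth_at_vecE:
  fixes M :: "('a, 'e::euclidean_space) manifold"
  assumes M: "smooth_manifold M" and V: "subspace V" and f: "smooth_at M (vec_mfd V) f x"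
    and c: "(U, \<phi>) \<in> atlas M" "x \<in> U"
  obtains W where "openin (mtop M) W" "x \<in> W" "W \<subseteq> U" "f ` W \<subseteq> V"
    "smooth_on (model M) (\<phi> ` W) (f \<circ> inv_into U \<phi>)"
proof -
  have fx: "f x \<in> V" using smooth_at_codomain[OF smooth_manifold_vec[OF V] f] by simp
  obtain W where W: "openin (mtop M) W" "x \<in> W" "W \<subseteq> U" "f ` W \<subseteq> V \<inter> V"
    "smooth_on (model M) (\<phi> ` W) ((\<lambda>u. u) \<circ> f \<circ> inv_into U \<phi>)"
    by (rule smooth_at_chart[OF M smooth_manifold_vec[OF V] f c, where U' = V and B = V and \<psi> = "\<lambda>u. u"])
      (use fx in auto)
  then show thesis by (intro that[of W]) (auto simp: o_def)
qed

lemma smooth_at_vec_op: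
  fixes M :: "('a, 'e::euclidean_space) manifold"
  assumes M: "smooth_manifold M" and V: "subspace V1" "subspace V2"
    and f: "smooth_at M (vec_mfd V1) f x" and g: "smooth_at M (vec_mfd V2) g x"
    and h: "\<And>E U f g. smooth_on E (U :: 'e set) f \<Longrightarrow> smooth_on E U g \<Longrightarrow> smooth_on E U (\<lambda>x. h (f x) (g x))"
    and cl: "\<And>a b. a \<in> V1 \<Longrightarrow> b \<in> V2 \<Longrightarrow> h a b \<in> V3"
  shows "smooth_at M (vec_mfd V3) (\<lambda>x. h (f x) (g x)) x"
proof -
  obtain U \<phi> where U: "(U, \<phi>) \<in> atlas M" "x \<in> U"
    using smooth_manifold_cover[OF M smooth_at_topspace[OF f]] .
  obtain W where W: "openin (mtop M) W" "x \<in> W" "W \<subseteq> U" "f ` W \<subseteq> V1"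
    "smooth_on (model M) (\<phi> ` W) (f \<circ> inv_into U \<phi>)"
    by (rule smooth_at_vecE[OF M V(1) f U])
  obtain W' where W': "openin (mtop M) W'" "x \<in> W'" "W' \<subseteq> U" "g ` W' \<subseteq> V2"
    "smooth_on (model M) (\<phi> ` W') (g \<circ> inv_into U \<phi>)"
    by (rule smooth_at_vecE[OF M V(2) g U])
  have "smooth_on (model M) (\<phi> ` (W \<inter> W')) (\<lambda>y. h ((f \<circ> inv_into U \<phi>) y) ((g \<circ> inv_into U \<phi>) y))"
    by (intro h smooth_on_subset[OF W(5)] smooth_on_subset[OF W'(5)]) auto
  moreover have "h (f z) (g z) \<in> V3" if "z \<in> W \<inter> W'" for z
    using that W(4) W'(4) by (intro cl) auto
  ultimately show ?thesis
    using W W' by (intro smooth_at_vecI[OF M U(1), of "W \<inter> W'"] openin_Int) (auto simp: o_def)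
qed

lemma smooth_at_add:
  fixes M :: "('a, 'e::euclidean_space) manifold"
  assumes "smooth_manifold M" "subspace V" "smooth_at M (vec_mfd V) f x" "smooth_at M (vec_mfd V) g x"
  shows "smooth_at M (vec_mfd V) (\<lambda>x. f x + g x) x"
  by (rule smooth_at_vec_op[OF assms(1,2,2,3,4)]) (use assms(2) in \<open>auto intro: smooth_on_add subspace_add\<close>)

lemma smooth_at_scaleR:
  fixes M :: "('a, 'e::euclidean_space) manifold"
  assumes "smooth_manifold M" "subspace V" "smooth_at M (vec_mfd UNIV) f x" "smooth_at M (vec_mfd V) g x"
  shows "smooth_at M (vec_mfd V) (\<lambda>x. f x *\<^sub>R g x) x"
  by (rule smooth_at_vec_op[OF assms(1) subspace_UNIV assms(2,3,4)])
    (use assms(2) in \<open>auto intro: bounded_bilinear.smooth_on[OF bounded_bilinear_scaleR] subspace_scale\<close>)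

lemma smooth_at_vec_const:
  fixes M :: "('a, 'e::euclidean_space) manifold"
  assumes "smooth_manifold M" "subspace V" "x \<in> topspace (mtop M)" "c \<in> V"
  shows "smooth_at M (vec_mfd V) (\<lambda>x. c) x"
  using smooth_at_const[OF assms(1,3) smooth_manifold_vec[OF assms(2)]] assms(4) by simp

lemma smooth_at_sum:
  fixes M :: "('a, 'e::euclidean_space) manifold"
  assumes "smooth_manifold M" "subspace V" "x \<in> topspace (mtop M)"
    "\<And>i. i \<in> I \<Longrightarrow> smooth_at M (vec_mfd V) (f i) x"
  shows "smooth_at M (vec_mfd V) (\<lambda>x. \<Sum>i\<in>I. f i x) x"
  using assms(4)
proof (induction I rule: infinite_finite_induct)
  case (insert i I)
  then show ?case using smooth_at_add[OF assms(1,2)] by simp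
qed (use smooth_at_vec_const[OF assms(1-3)] assms(2) subspace_0 in auto)

lemma smooth_at_vec_vecI:
  fixes V :: "'v::euclidean_space set"
  assumes V: "subspace V" and h: "smooth_on V S h" "openin (top_of_set V) S" "y \<in> S" "h ` S \<subseteq> V'"
  shows "smooth_at (vec_mfd V) (vec_mfd V') h y"
proof (rule smooth_at_vecI[OF smooth_manifold_vec[OF V], where U = V and W = S and \<phi> = "\<lambda>u. u"])
  have S: "S \<subseteq> V" using h(2) by (rule openin_imp_subset)
  then show "S \<subseteq> V" .
  have "smooth_on V S (h \<circ> inv_into V (\<lambda>u. u))"
    by (rule smooth_on_cong[OF h(1) dir_open_openin[OF V h(2)]]) (use S in \<open>auto simp: inv_into_self\<close>)
  then show "smooth_on (model (vec_mfd V)) ((\<lambda>u. u) ` S) (h \<circ> inv_into V (\<lambda>u. u))" by simp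
qed (use h in auto)

lemma smooth_at_vec_vecE:
  fixes V :: "'v::euclidean_space set"
  assumes V: "subspace V" "subspace V'" and h: "smooth_at (vec_mfd V) (vec_mfd V') h y"
  obtains S where "smooth_on V S h" "openin (top_of_set V) S" "y \<in> S" "h ` S \<subseteq> V'"
proof -
  have y: "y \<in> V" using smooth_at_topspace[OF h] by simp
  obtain W where W: "openin (top_of_set V) W" "y \<in> W" "W \<subseteq> V" "h ` W \<subseteq> V'"
    "smooth_on V ((\<lambda>u. u) ` W) (h \<circ> inv_into V (\<lambda>u. u))"
    using smooth_at_vecE[OF smooth_manifold_vec[OF V(1)] V(2) h, of V "\<lambda>u. u"] y by auto
  have "smooth_on V W (h \<circ> inv_into V (\<lambda>u. u))" using W(5) by simp
  then have "smooth_on V W h"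
    by (rule smooth_on_cong[OF _ dir_open_openin[OF V(1) W(1)]]) (use W(3) in \<open>auto simp: inv_into_self\<close>)
  then show thesis using W by (intro that)
qed

lemma smooth_at_vec_linear:
  fixes M :: "('a, 'e::euclidean_space) manifold"
  assumes M: "smooth_manifold M" and V: "subspace V" and f: "smooth_at M (vec_mfd V) f x"
    and h: "linear h" "h ` V \<subseteq> V'"
  shows "smooth_at M (vec_mfd V') (\<lambda>x. h (f x)) x"
proof (rule smooth_at_compose[OF M smooth_manifold_vec[OF V] _ f])
  have "f x \<in> V" using smooth_at_codomain[OF smooth_manifold_vec[OF V] f] by simp
  then show "smooth_at (vec_mfd V) (vec_mfd V') h (f x)"
    using h by (intro smooth_at_vec_vecI[OF V, of V] smooth_on_bounded_linear) (auto simp: linear_conv_bounded_linear)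
qed

section \<open>Charts and their inverses as smooth maps\<close>

lemma smooth_at_chart_map:
  fixes M :: "('a, 'e::euclidean_space) manifold"
  assumes M: "smooth_manifold M" and c: "(U, \<phi>) \<in> atlas M" "x \<in> U"
  shows "smooth_at M (vec_mfd (model M)) \<phi> x"
proof (rule smooth_at_vecI[OF M c(1) chart_openin[OF M c(1)] c(2) order_refl])
  show "\<phi> ` U \<subseteq> model M" using chart_mem_model[OF M c(1)] by blast
  have "smooth_on (model M) (\<phi> ` U) (\<lambda>y. y)" by (rule smooth_on_bounded_linear[OF bounded_linear_ident])
  then show "smooth_on (model M) (\<phi> ` U) (\<phi> \<circ> inv_into U \<phi>)"
    by (rule smooth_on_cong[OF _ chart_dir_open[OF M c(1) chart_openin[OF M c(1)] order_refl]])
      (simp add: f_inv_into_f)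
qed

lemma smooth_at_chart_inverse:
  fixes M :: "('a, 'e::euclidean_space) manifold"
  assumes M: "smooth_manifold M" and c: "(U, \<phi>) \<in> atlas M" and y: "y \<in> \<phi> ` U"
  shows "smooth_at (vec_mfd (model M)) M (inv_into U \<phi>) y"
proof (rule smooth_atI[OF _ c _ y])
  have U: "\<phi> ` U \<subseteq> model M" using chart_mem_model[OF M c] by blast
  then show "\<phi> ` U \<subseteq> model M" .
  have "smooth_on (model M) (\<phi> ` U) (\<lambda>y. y)" by (rule smooth_on_bounded_linear[OF bounded_linear_ident])
  then have "smooth_on (model M) (\<phi> ` U) (\<phi> \<circ> inv_into U \<phi> \<circ> inv_into (model M) (\<lambda>u. u))"
    by (rule smooth_on_cong[OF _ chart_dir_open[OF M c chart_openin[OF M c] order_refl]])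
      (use U in \<open>auto simp: inv_into_self f_inv_into_f subset_iff\<close>)
  then show "smooth_on (model (vec_mfd (model M))) ((\<lambda>u. u) ` \<phi> ` U) (\<phi> \<circ> inv_into U \<phi> \<circ> inv_into (model M) (\<lambda>u. u))"
    by simp
qed (use chart_image[OF M c] in \<open>auto simp: inv_into_into\<close>)

text \<open>Composing a chart inverse with the orthogonal projection onto the model space turns it into a
  map that is defined on an open set of the whole coordinate type.\<close>

definition chart_param :: "('a, 'e::euclidean_space) manifold \<Rightarrow> 'a set \<Rightarrow> ('a \<Rightarrow> 'e) \<Rightarrow> 'e \<Rightarrow> 'a"
  where "chart_param M U \<phi> y = inv_into U \<phi> (proj_on (model M) y)"

context
  fixes M :: "('a, 'e::euclidean_space) manifold" and U \<phi>
  assumes M: "smooth_manifold M" and c: "(U, \<phi>) \<in> atlas M"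
begin

lemma chart_param_chart: "x \<in> U \<Longrightarrow> chart_param M U \<phi> (\<phi> x) = x"
  using chart_inv_into[OF M c] chart_mem_model[OF M c] proj_on(3)[OF smooth_manifold_model[OF M]]
  by (simp add: chart_param_def)

lemma open_chart_param_domain: "open (proj_on (model M) -` \<phi> ` U)"
  by (rule open_proj_on_vimage[OF smooth_manifold_model[OF M] chart_image[OF M c]])

lemma smooth_at_proj_on: "smooth_at (vec_mfd UNIV) (vec_mfd (model M)) (proj_on (model M)) y"
  using proj_on[OF smooth_manifold_model[OF M]]
  by (intro smooth_at_vec_vecI[of _ UNIV] smooth_on_bounded_linear) (auto simp: linear_conv_bounded_linear)

lemma smooth_at_chart_param:
  assumes "proj_on (model M) y \<in> \<phi> ` U"
  shows "smooth_at (vec_mfd UNIV) M (chart_param M U \<phi>) y"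
  unfolding chart_param_def
  by (rule smooth_at_compose[OF smooth_manifold_vec[OF subspace_UNIV]
        smooth_manifold_vec[OF smooth_manifold_model[OF M]] smooth_at_chart_inverse[OF M c assms] smooth_at_proj_on])

lemma chart_chart_param:
  assumes "proj_on (model M) y \<in> \<phi> ` U"
  shows "chart_param M U \<phi> y \<in> U" "\<phi> (chart_param M U \<phi> y) = proj_on (model M) y"
  using assms by (auto simp: chart_param_def inv_into_into f_inv_into_f)

end

lemma nhdsin_vec_UNIV: "eventually P (nhdsin (mtop (vec_mfd UNIV)) y) \<longleftrightarrow> eventually P (nhds y)"
  by (auto simp: eventually_nhdsin eventually_nhds)

lemma smooth_at_vec_differentiable:
  assumes "subspace V" "smooth_at (vec_mfd UNIV) (vec_mfd V) h y"
  shows "h differentiable (at y)"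
proof -
  obtain S where S: "smooth_on UNIV S h" "openin (top_of_set UNIV) S" "y \<in> S" "h ` S \<subseteq> V"
    by (rule smooth_at_vec_vecE[OF subspace_UNIV assms])
  then show ?thesis by (intro smooth_on_differentiable[OF S(1) _ S(3)]) simp
qed

lemma smooth_at_compose':
  fixes M :: "('a, 'e::euclidean_space) manifold" and N :: "('b, 'f::euclidean_space) manifold"
    and P :: "('c, 'h::euclidean_space) manifold"
  assumes "smooth_manifold M" "smooth_manifold N" "smooth_at M N f x" "f x = y" "smooth_at N P g y"
  shows "smooth_at M P (\<lambda>x. g (f x)) x"
  using smooth_at_compose[where f = f and g = g] assms by blast

text \<open>The Lindelof property: for every basic open set contained in some \<open>B x\<close> one
  such \<open>x\<close> is selected.\<close>

lemma countable_subcover: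
  assumes X: "second_countable_space X" and O: "\<And>x. x \<in> A \<Longrightarrow> openin X (B x)" "\<And>x. x \<in> A \<Longrightarrow> x \<in> B x"
  obtains C where "countable C" "C \<subseteq> A" "A \<subseteq> (\<Union>x\<in>C. B x)"
proof -
  obtain \<B> where \<B>: "countable \<B>"
    "\<And>U x. openin X U \<and> x \<in> U \<Longrightarrow> \<exists>b\<in>\<B>. x \<in> b \<and> b \<subseteq> U"
    using X unfolding second_countable_space_def by (elim exE conjE) simp
  define \<B>' where "\<B>' = {b \<in> \<B>. \<exists>x\<in>A. b \<subseteq> B x}"
  define p where "p b = (SOME x. x \<in> A \<and> b \<subseteq> B x)" for b
  have p: "p b \<in> A" "b \<subseteq> B (p b)" if "b \<in> \<B>'" for b
  proof -
    have "\<exists>x. x \<in> A \<and> b \<subseteq> B x" using that by (auto simp: \<B>'_def)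
    from someI_ex[OF this] show "p b \<in> A" "b \<subseteq> B (p b)" by (simp_all add: p_def)
  qed
  show thesis
  proof (rule that[of "p ` \<B>'"])
    have "countable \<B>'" using \<B>(1) by (rule countable_subset[rotated]) (auto simp: \<B>'_def)
    then show "countable (p ` \<B>')" by (rule countable_image)
    show "p ` \<B>' \<subseteq> A" using p by auto
    show "A \<subseteq> (\<Union>x\<in>p ` \<B>'. B x)"
    proof
      fix x assume x: "x \<in> A"
      then obtain b where "b \<in> \<B>" "x \<in> b" "b \<subseteq> B x" using \<B>(2) O by blast
      then have "b \<in> \<B>'" using x by (auto simp: \<B>'_def)
      then show "x \<in> (\<Union>x\<in>p ` \<B>'. B x)" using p(2) \<open>x \<in> b\<close> by blast
    qed
  qed
qed

context
  fixes M :: "('a, 'e::euclidean_space) manifold" and N :: "('b, 'f::euclidean_space) manifold" and f :: "'a \<Rightarrow> 'b"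
  assumes M: "smooth_manifold M" and N: "smooth_manifold N"
begin

lemma smooth_at_chart_rep:
  assumes U: "(U, \<phi>) \<in> atlas M" and U': "(U', \<psi>) \<in> atlas N" and y: "proj_on (model M) y \<in> \<phi> ` U"
    and f: "smooth_at M N f (chart_param M U \<phi> y)" "f (chart_param M U \<phi> y) \<in> U'"
  shows "smooth_at (vec_mfd UNIV) (vec_mfd (model N)) (\<lambda>y. \<psi> (f (chart_param M U \<phi> y))) y"
proof -
  note UM = smooth_manifold_vec[OF subspace_UNIV]
  have "smooth_at (vec_mfd UNIV) N (\<lambda>y. f (chart_param M U \<phi> y)) y"
    by (rule smooth_at_compose[OF UM M f(1) smooth_at_chart_param[OF M U y]])
  from smooth_at_compose'[OF UM N this refl smooth_at_chart_map[OF N U' f(2)]] show ?thesis .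
qed

text \<open>Near \<open>x'\<close> the map factors as \<open>L\<close> after \<open>f\<close> after
  \<open>R\<close>, so by the chain rule its derivative at \<open>z\<close> factors through that at
  \<open>y\<close>. Neither \<open>L\<close> nor \<open>R\<close> is assumed invertible, which is
  why only an inequality results; the reverse one comes from exchanging the two points.\<close>

lemma chart_rep_rank_le:
  assumes U: "(U, \<phi>) \<in> atlas M" and U': "(U', \<psi>) \<in> atlas N" and y: "proj_on (model M) y \<in> \<phi> ` U"
    and V: "(V, \<kappa>) \<in> atlas M" and V': "(V', \<xi>) \<in> atlas N" and z: "proj_on (model M) z \<in> \<kappa> ` V"
    and x: "x = chart_param M U \<phi> y" "f x \<in> U'" and x': "x' = chart_param M V \<kappa> z" "f x' \<in> V'"
    and f: "smooth_at M N f x"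
    and L: "smooth_at N N L (f x)" and R: "smooth_at M M R x'" "R x' = x"
    and eq: "\<forall>\<^sub>F w in nhdsin (mtop M) x'. f w = L (f (R w))"
    and A: "((\<lambda>y. \<psi> (f (chart_param M U \<phi> y))) has_derivative A) (at y)"
    and A': "((\<lambda>y. \<xi> (f (chart_param M V \<kappa> y))) has_derivative A') (at z)"
  shows "dim (range A') \<le> dim (range A)"
proof -
  note UM = smooth_manifold_vec[OF subspace_UNIV] and SM = smooth_manifold_model[OF M] and SN = smooth_manifold_model[OF N]
  note PM = proj_on[OF SM]
  have xU: "x \<in> U" and x'V: "x' \<in> V"
    using chart_chart_param(1)[OF M U y] chart_chart_param(1)[OF M V z] x x' by auto
  have x'M: "x' \<in> topspace (mtop M)" using x'V chart_topspace[OF M V] by blast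
  have Lfx: "L (f x) = f x'"
    using eventually_nhdsin_self[OF eq x'M] R(2) by simp
  \<comment> \<open>The extended inverse chart forgets the component of \<open>y\<close> orthogonal
    to the model space. Adding it back makes the coordinate form of \<open>R\<close> send
    \<open>z\<close> exactly to \<open>y\<close>, where the derivative \<open>A\<close> is
    taken.\<close>
  define k where "k = y - proj_on (model M) y"
  have k: "proj_on (model M) k = 0" using PM(2,3) by (simp add: k_def linear_diff[OF PM(1)])
  define P where "P y = \<psi> (f (chart_param M U \<phi> y))" for y
  define R' where "R' w = \<phi> (R (chart_param M V \<kappa> w)) + k" for w
  define L' where "L' e = \<xi> (L (chart_param N U' \<psi> e))" for e
  have par: "smooth_at (vec_mfd UNIV) M (chart_param M V \<kappa>) z"
    by (rule smooth_at_chart_param[OF M V z])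
  have Rc: "smooth_at (vec_mfd UNIV) M (\<lambda>w. R (chart_param M V \<kappa> w)) z"
    by (rule smooth_at_compose'[OF UM M par x'(1)[symmetric] R(1)])
  have Rz: "R (chart_param M V \<kappa> z) = x" using R(2) x' by simp
  have smR: "smooth_at (vec_mfd UNIV) (vec_mfd (model M)) (\<lambda>w. \<phi> (R (chart_param M V \<kappa> w))) z"
    by (rule smooth_at_compose'[OF UM M Rc Rz smooth_at_chart_map[OF M U xU]])
  have R'z: "R' z = y"
    using chart_chart_param(2)[OF M U y] x by (simp add: R'_def Rz k_def)
  have "(\<lambda>w. \<phi> (R (chart_param M V \<kappa> w))) differentiable (at z)"
    by (rule smooth_at_vec_differentiable[OF SM smR])
  then have "R' differentiable (at z)"
    unfolding R'_def by (intro differentiable_add differentiable_const)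
  then obtain DR where DR: "(R' has_derivative DR) (at z)" by (auto simp: differentiable_def)
  have Py: "P y = \<psi> (f x)" by (simp add: P_def x)
  have projPy: "proj_on (model N) (P y) = P y"
    using proj_on(3)[OF SN] chart_mem_model[OF N U' x(2)] by (simp add: Py)
  have parN: "chart_param N U' \<psi> (P y) = f x"
    using chart_param_chart[OF N U' x(2)] by (simp add: Py)
  have "smooth_at (vec_mfd UNIV) N (chart_param N U' \<psi>) (P y)"
    by (rule smooth_at_chart_param[OF N U']) (use x(2) projPy in \<open>simp add: Py\<close>)
  from smooth_at_compose'[OF UM N this parN L]
  have Lc: "smooth_at (vec_mfd UNIV) N (\<lambda>e. L (chart_param N U' \<psi> e)) (P y)" .
  have "L (chart_param N U' \<psi> (P y)) = f x'" by (simp add: parN Lfx)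
  from smooth_at_compose'[OF UM N Lc this smooth_at_chart_map[OF N V' x'(2)]]
  have "smooth_at (vec_mfd UNIV) (vec_mfd (model N)) L' (P y)"
    unfolding L'_def[abs_def] .
  from smooth_at_vec_differentiable[OF SN this] obtain DL where DL: "(L' has_derivative DL) (at (P y))"
    by (auto simp: differentiable_def)
  have A0: "(P has_derivative A) (at (R' z))" using A by (simp add: P_def[abs_def] R'z)
  have 1: "((\<lambda>w. L' (P (R' w))) has_derivative (\<lambda>h. DL (A (DR h)))) (at z)"
  proof -
    have "((\<lambda>w. P (R' w)) has_derivative (\<lambda>h. A (DR h))) (at z)"
      using diff_chain_at[OF DR A0] by (simp add: o_def)
    moreover have "(L' has_derivative DL) (at (P (R' z)))" using DL by (simp add: R'z)
    ultimately show ?thesis using diff_chain_at by (fastforce simp: o_def)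
  qed
  have "\<forall>\<^sub>F w in nhdsin (mtop M) x'. R w \<in> U \<and> f (R w) \<in> U' \<and> f w = L (f (R w))"
  proof (intro eventually_conj eq)
    show "\<forall>\<^sub>F w in nhdsin (mtop M) x'. R w \<in> U"
      by (rule smooth_at_eventually[OF M M R(1) eventually_nhdsin_openin[OF chart_openin[OF M U]]]) (simp add: R xU)
    have "\<forall>\<^sub>F w in nhdsin (mtop M) (R x'). f w \<in> U'"
      unfolding R(2) by (rule smooth_at_eventually[OF M N f eventually_nhdsin_openin[OF chart_openin[OF N U'] x(2)]])
    then show "\<forall>\<^sub>F w in nhdsin (mtop M) x'. f (R w) \<in> U'"
      by (rule smooth_at_eventually[OF M M R(1)])
  qed
  then have "\<forall>\<^sub>F w in nhdsin (mtop (vec_mfd UNIV)) z.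
      (\<lambda>w. R w \<in> U \<and> f (R w) \<in> U' \<and> f w = L (f (R w))) (chart_param M V \<kappa> w)"
    unfolding x'(1) by (rule smooth_at_eventually[OF UM M par])
  then have "\<forall>\<^sub>F w in nhds z. (\<lambda>w. R w \<in> U \<and> f (R w) \<in> U' \<and> f w = L (f (R w))) (chart_param M V \<kappa> w)"
    unfolding nhdsin_vec_UNIV .
  then have ev: "\<forall>\<^sub>F w in nhds z. L' (P (R' w)) = \<xi> (f (chart_param M V \<kappa> w))"
  proof eventually_elim
    case (elim w)
    define v where "v = chart_param M V \<kappa> w"
    have v: "R v \<in> U" "f (R v) \<in> U'" "f v = L (f (R v))" using elim by (auto simp: v_def)
    have "proj_on (model M) (\<phi> (R v) + k) = proj_on (model M) (\<phi> (R v))"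
      by (simp add: linear_add[OF PM(1)] k)
    then have "chart_param M U \<phi> (R' w) = chart_param M U \<phi> (\<phi> (R v))"
      by (simp add: R'_def chart_param_def v_def)
    then have "P (R' w) = \<psi> (f (R v))"
      using chart_param_chart[OF M U v(1)] by (simp add: P_def)
    then have "L' (P (R' w)) = \<xi> (L (f (R v)))"
      using chart_param_chart[OF N U' v(2)] by (simp add: L'_def)
    then show ?case using v by (simp add: v_def)
  qed
  have "((\<lambda>y. \<xi> (f (chart_param M V \<kappa> y))) has_derivative (\<lambda>h. DL (A (DR h)))) (at z)"
    by (rule has_derivative_transform_eventually[OF 1]) (use ev eventually_nhds_x_imp_x in \<open>auto simp: eventually_at_filter elim: eventually_mono\<close>)
  with A' have "A' = (\<lambda>h. DL (A (DR h)))" by (rule has_derivative_unique)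
  then have "range A' \<subseteq> DL ` range A" by auto
  then have "dim (range A') \<le> dim (DL ` range A)" by (rule dim_subset)
  also have "\<dots> \<le> dim (range A)" by (rule dim_image_le[OF has_derivative_linear[OF DL]])
  finally show ?thesis .
qed

text \<open>The homogeneity assumption makes the rank of \<open>f\<close> constant; a constant rank below the
  dimension of \<open>N\<close> would make the image negligible.\<close>

theorem homogeneous_local_section:
  assumes M0: "openin (mtop M) M0" and f: "\<And>x. x \<in> M0 \<Longrightarrow> smooth_at M N f x"
    and hom: "\<And>x x'. x \<in> M0 \<Longrightarrow> x' \<in> M0 \<Longrightarrow> \<exists>L R. smooth_at N N L (f x) \<and> smooth_at M M R x' \<and> R x' = x \<and>
        (\<forall>\<^sub>F w in nhdsin (mtop M) x'. f w = L (f (R w)))"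
    and W: "openin (mtop N) W" "W \<noteq> {}" "W \<subseteq> f ` M0" and x: "x \<in> M0"
  obtains t where "smooth_at N M t (f x)" "t (f x) = x" "\<forall>\<^sub>F y in nhdsin (mtop N) (f x). f (t y) = y"
proof -
  note UM = smooth_manifold_vec[OF subspace_UNIV] and SM = smooth_manifold_model[OF M] and SN = smooth_manifold_model[OF N]
  note PM = proj_on[OF SM] and PN = proj_on[OF SN]
  have rep: "\<exists>S A. open S \<and> \<phi> x \<in> S \<and> smooth_on UNIV S P \<and> P ` S \<subseteq> model N \<and>
      (P has_derivative A) (at (\<phi> x)) \<and> range A \<subseteq> model N \<and>
      (\<forall>y\<in>S. proj_on (model M) y \<in> \<phi> ` U \<and> chart_param M U \<phi> y \<in> M0 \<and> f (chart_param M U \<phi> y) \<in> U')"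
    if x: "x \<in> M0" and U: "(U, \<phi>) \<in> atlas M" "x \<in> U" and U': "(U', \<psi>) \<in> atlas N" "f x \<in> U'"
      and P: "P = (\<lambda>y. \<psi> (f (chart_param M U \<phi> y)))" for x U \<phi> U' \<psi> P
  proof -
    have y: "proj_on (model M) (\<phi> x) = \<phi> x"
      using chart_mem_model[OF M U] by (rule PM(3))
    then have y': "proj_on (model M) (\<phi> x) \<in> \<phi> ` U" using U(2) by simp
    have cp: "chart_param M U \<phi> (\<phi> x) = x" by (rule chart_param_chart[OF M U])
    have sm: "smooth_at (vec_mfd UNIV) (vec_mfd (model N)) P (\<phi> x)"
      unfolding P by (rule smooth_at_chart_rep[OF U(1) U'(1) y']) (use f[OF x] U'(2) in \<open>auto simp: cp\<close>)
    obtain S where S: "smooth_on UNIV S P" "openin (top_of_set UNIV) S" "\<phi> x \<in> S" "P ` S \<subseteq> model N"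
      by (rule smooth_at_vec_vecE[OF subspace_UNIV SN sm])
    have "\<forall>\<^sub>F w in nhdsin (mtop M) x. w \<in> M0 \<and> f w \<in> U'"
      by (intro eventually_conj eventually_nhdsin_openin[OF M0 x]
          smooth_at_eventually[OF M N f[OF x] eventually_nhdsin_openin[OF chart_openin[OF N U'(1)] U'(2)]])
    then have "\<forall>\<^sub>F w in nhdsin (mtop (vec_mfd UNIV)) (\<phi> x). (\<lambda>w. w \<in> M0 \<and> f w \<in> U') (chart_param M U \<phi> w)"
      by (intro smooth_at_eventually[OF UM M smooth_at_chart_param[OF M U(1) y']]) (simp add: cp)
    then obtain T where T: "open T" "\<phi> x \<in> T" "\<And>w. w \<in> T \<Longrightarrow> chart_param M U \<phi> w \<in> M0 \<and> f (chart_param M U \<phi> w) \<in> U'"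
      unfolding nhdsin_vec_UNIV eventually_nhds by auto
    define S' where "S' = S \<inter> T \<inter> proj_on (model M) -` \<phi> ` U"
    have S': "open S'" "\<phi> x \<in> S'" "S' \<subseteq> S"
      using S T y' open_chart_param_domain[OF M U(1)] by (auto simp: S'_def)
    have smS': "smooth_on UNIV S' P" by (rule smooth_on_subset[OF S(1) S'(3)])
    obtain A where A: "(P has_derivative A) (at (\<phi> x))"
      using smooth_on_differentiable[OF smS' S'(1,2)] by (auto simp: differentiable_def)
    \<comment> \<open>\<open>P\<close> has values in the model space, so it coincides with its own
      projection near the point, and the derivative is unique.\<close>
    have "A h \<in> model N" for h
    proof -
      have "bounded_linear (proj_on (model N))" using PN(1) by (simp add: linear_conv_bounded_linear)
      then have "((\<lambda>y. proj_on (model N) (P y)) has_derivative (\<lambda>h. proj_on (model N) (A h))) (at (\<phi> x))"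
        using A by (rule bounded_linear.has_derivative)
      then have "(P has_derivative (\<lambda>h. proj_on (model N) (A h))) (at (\<phi> x))"
        by (rule has_derivative_transform_within_open[OF _ S'(1,2)]) (use S(4) S'(3) in \<open>auto intro!: PN(3)\<close>)
      with A have "A = (\<lambda>h. proj_on (model N) (A h))" by (rule has_derivative_unique)
      then show ?thesis using PN(2) by metis
    qed
    then have "range A \<subseteq> model N" by auto
    moreover have "\<forall>y\<in>S'. proj_on (model M) y \<in> \<phi> ` U \<and> chart_param M U \<phi> y \<in> M0 \<and> f (chart_param M U \<phi> y) \<in> U'"
      using T(3) by (auto simp: S'_def)
    ultimately show ?thesis
      using S' smS' A S(4) by (intro exI[of _ S'] exI[of _ A]) blast
  qed
  obtain U \<phi> where U: "(U, \<phi>) \<in> atlas M" "x \<in> U"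
    using smooth_manifold_cover[OF M smooth_at_topspace[OF f[OF x]]] .
  obtain U' \<psi> where U': "(U', \<psi>) \<in> atlas N" "f x \<in> U'"
    using smooth_manifold_cover[OF N smooth_at_codomain[OF N f[OF x]]] .
  define P where "P = (\<lambda>y. \<psi> (f (chart_param M U \<phi> y)))"
  obtain S A where S: "open S" "\<phi> x \<in> S" "smooth_on UNIV S P" "P ` S \<subseteq> model N"
    and A: "(P has_derivative A) (at (\<phi> x))" "range A \<subseteq> model N"
    and S_dom: "\<And>y. y \<in> S \<Longrightarrow> proj_on (model M) y \<in> \<phi> ` U \<and> chart_param M U \<phi> y \<in> M0 \<and> f (chart_param M U \<phi> y) \<in> U'"
    using rep[OF x U U' P_def] by (elim exE conjE) blast
  have cp: "chart_param M U \<phi> (\<phi> x) = x" by (rule chart_param_chart[OF M U])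
  have subA: "subspace (range A)"
    by (intro linear_subspace_image has_derivative_linear[OF A(1)] subspace_UNIV)
  have "range A = model N"
  proof (rule ccontr)
    assume "range A \<noteq> model N"
    then have lt: "dim (range A) < dim (model N)"
      using subspace_dim_equal[OF subA SN A(2)] dim_subset[OF A(2)] by linarith
    obtain w where w: "w \<in> W" using W(2) by blast
    obtain V' \<xi> where V': "(V', \<xi>) \<in> atlas N" "w \<in> V'"
      using smooth_manifold_cover[OF N] w W(1) openin_subset by (metis subsetD)
    define X where "X = {z \<in> M0. f z \<in> V' \<inter> W}"
    \<comment> \<open>All points of \<open>X\<close> are mapped into the one fixed chart
      \<open>V'\<close>, so the local images can be measured in the same coordinates
      \<open>\<xi>\<close> and their union makes sense as a union of negligible sets.\<close>
    have step: "\<exists>B. openin (mtop M) B \<and> z \<in> B \<and> negligible (proj_on (model N) -` \<xi> ` f ` (B \<inter> X))" if z: "z \<in> X" for z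
    proof -
      have z0: "z \<in> M0" "f z \<in> V'" using z by (auto simp: X_def)
      obtain V \<kappa> where V: "(V, \<kappa>) \<in> atlas M" "z \<in> V"
        using smooth_manifold_cover[OF M smooth_at_topspace[OF f[OF z0(1)]]] .
      define Q where "Q = (\<lambda>y. \<xi> (f (chart_param M V \<kappa> y)))"
      obtain S' A' where S': "open S'" "\<kappa> z \<in> S'" "smooth_on UNIV S' Q" "Q ` S' \<subseteq> model N"
        and A': "(Q has_derivative A') (at (\<kappa> z))" "range A' \<subseteq> model N"
        and S'_dom: "\<And>y. y \<in> S' \<Longrightarrow> proj_on (model M) y \<in> \<kappa> ` V \<and> chart_param M V \<kappa> y \<in> M0 \<and> f (chart_param M V \<kappa> y) \<in> V'"
        using rep[OF z0(1) V V'(1) z0(2) Q_def] by (elim exE conjE) blast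
      have cpz: "chart_param M V \<kappa> (\<kappa> z) = z" by (rule chart_param_chart[OF M V])
      \<comment> \<open>Homogeneity carries the derivative at \<open>z\<close> to any other point of
        the coordinate domain, so the rank at \<open>z\<close> is maximal there. This is the rank
        hypothesis of the negligibility lemma.\<close>
      have rank: "dim (range A2) \<le> dim (range A')" if y: "y \<in> S'" and A2: "(Q has_derivative A2) (at y)" for y A2
      proof -
        obtain L R where LR: "smooth_at N N L (f z)" "smooth_at M M R (chart_param M V \<kappa> y)" "R (chart_param M V \<kappa> y) = z"
          "\<forall>\<^sub>F w in nhdsin (mtop M) (chart_param M V \<kappa> y). f w = L (f (R w))"
          using hom[OF z0(1), of "chart_param M V \<kappa> y"] S'_dom[OF y] by (elim exE conjE impE) blast
        show ?thesis
          by (rule chart_rep_rank_le[OF V(1) V'(1) _ V(1) V'(1) _ cpz[symmetric] z0(2) refl _ f[OF z0(1)] LR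
                A'(1)[unfolded Q_def] A2[unfolded Q_def]]) (use S'_dom[OF y] S'_dom[OF S'(2)] in auto)
      qed
      obtain L R where LR: "smooth_at N N L (f x)" "smooth_at M M R z" "R z = x"
        "\<forall>\<^sub>F w in nhdsin (mtop M) z. f w = L (f (R w))"
        using hom[OF x z0(1)] by (elim exE conjE)
      have "dim (range A') \<le> dim (range A)"
        by (rule chart_rep_rank_le[OF U(1) U'(1) _ V(1) V'(1) _ cp[symmetric] U'(2) cpz[symmetric] z0(2) f[OF x] LR
              A(1)[unfolded P_def] A'(1)[unfolded Q_def]]) (use S'_dom[OF S'(2)] S_dom[OF S(2)] in auto)
      then have lt': "dim (range A') < dim (model N)" using lt by linarith
      obtain T where T: "open T" "\<kappa> z \<in> T" "T \<subseteq> S'" "negligible (proj_on (model N) -` (Q ` T))"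
        by (rule deficient_rank_negligible_image[OF S'(3,1,2) SN S'(4) A' lt' rank])
      define B where "B = {v \<in> V. \<kappa> v \<in> T \<inter> model M}"
      have "openin (mtop M) B"
        unfolding B_def by (rule chart_vimage_openin[OF M V(1)]) (use T(1) in \<open>auto simp: openin_open\<close>)
      moreover have "z \<in> B" using V T(2) chart_mem_model[OF M V] by (simp add: B_def)
      moreover have "\<xi> ` f ` (B \<inter> X) \<subseteq> Q ` T"
      proof (clarsimp simp: B_def)
        fix v assume "v \<in> V" "\<kappa> v \<in> T"
        then show "\<xi> (f v) \<in> Q ` T"
          by (intro image_eqI[of _ _ "\<kappa> v"]) (simp_all add: Q_def chart_param_chart[OF M V(1)])
      qed
      then have "negligible (proj_on (model N) -` \<xi> ` f ` (B \<inter> X))"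
        by (intro negligible_subset[OF T(4)] vimage_mono)
      ultimately show ?thesis by blast
    qed
    then obtain B where B: "\<And>z. z \<in> X \<Longrightarrow> openin (mtop M) (B z)" "\<And>z. z \<in> X \<Longrightarrow> z \<in> B z"
      "\<And>z. z \<in> X \<Longrightarrow> negligible (proj_on (model N) -` \<xi> ` f ` (B z \<inter> X))"
      by metis
    have "second_countable_space (mtop M)" using M by (simp add: smooth_manifold_def)
    then obtain C where C: "countable C" "C \<subseteq> X" "X \<subseteq> (\<Union>z\<in>C. B z)"
      using B(1,2) by (rule countable_subcover)
    \<comment> \<open>Here second countability is used. The countable union covers the cylinder over
      \<open>V' \<inter> W\<close>, which is open and contains the coordinates of
      \<open>w\<close>.\<close>
    have "negligible (\<Union>z\<in>C. proj_on (model N) -` \<xi> ` f ` (B z \<inter> X))"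
      using C(1,2) B(3) by (intro negligible_countable_Union) auto
    moreover have "proj_on (model N) -` \<xi> ` (V' \<inter> W) \<subseteq> (\<Union>z\<in>C. proj_on (model N) -` \<xi> ` f ` (B z \<inter> X))"
    proof
      fix q assume "q \<in> proj_on (model N) -` \<xi> ` (V' \<inter> W)"
      then obtain v where v: "v \<in> V' \<inter> W" "proj_on (model N) q = \<xi> v" by auto
      then obtain z where z: "z \<in> M0" "v = f z" using W(3) by auto
      then have "z \<in> X" using v by (simp add: X_def)
      then obtain c where "c \<in> C" "z \<in> B c" using C(3) by blast
      then show "q \<in> (\<Union>z\<in>C. proj_on (model N) -` \<xi> ` f ` (B z \<inter> X))"
        using v z \<open>z \<in> X\<close> by (auto intro!: bexI[of _ c] imageI)
    qed
    ultimately have "negligible (proj_on (model N) -` \<xi> ` (V' \<inter> W))" by (rule negligible_subset)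
    moreover have "open (proj_on (model N) -` \<xi> ` (V' \<inter> W))"
      using chart_openin[OF N V'(1)] W(1)
      by (intro open_proj_on_vimage[OF SN] chart_image_openin[OF N V'(1)] openin_Int) auto
    moreover have "\<xi> w \<in> proj_on (model N) -` \<xi> ` (V' \<inter> W)"
      using PN(3)[OF chart_mem_model[OF N V']] w V'(2) by auto
    ultimately show False using open_not_negligible by blast
  qed
  then obtain s B where s: "open B" "P (\<phi> x) \<in> B" "smooth_on UNIV B s" "s ` B \<subseteq> S" "s (P (\<phi> x)) = \<phi> x"
    "\<And>a. a \<in> B \<Longrightarrow> a \<in> model N \<Longrightarrow> P (s a) = a"
    using submersion_local_section[OF S(3,1,2) SN S(4) A(1)] by metis
  have Px: "P (\<phi> x) = \<psi> (f x)" by (simp add: P_def cp)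
  define t where "t v = chart_param M U \<phi> (s (\<psi> v))" for v
  have sB: "smooth_at (vec_mfd (model N)) (vec_mfd UNIV) s (\<psi> (f x))"
    by (rule smooth_at_vec_vecI[OF SN smooth_on_from_UNIV[OF smooth_on_subset[OF s(3)]], of "model N \<inter> B"])
      (use s chart_mem_model[OF N U'] in \<open>auto simp: Px openin_open\<close>)
  have "smooth_at N (vec_mfd UNIV) (\<lambda>v. s (\<psi> v)) (f x)"
    by (rule smooth_at_compose[OF N smooth_manifold_vec[OF SN] sB smooth_at_chart_map[OF N U']])
  moreover have "smooth_at (vec_mfd UNIV) M (chart_param M U \<phi>) (s (\<psi> (f x)))"
    by (rule smooth_at_chart_param[OF M U(1)]) (use S_dom[OF S(2)] s(5) in \<open>simp add: Px\<close>)
  ultimately have "smooth_at N M t (f x)"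
    unfolding t_def[abs_def] by (rule smooth_at_compose'[OF N UM _ refl])
  moreover have "t (f x) = x" using s(5) by (simp add: t_def Px cp)
  moreover have "\<forall>\<^sub>F v in nhdsin (mtop N) (f x). f (t v) = v"
  proof (rule eventually_nhdsinI[of _ "{v \<in> U'. \<psi> v \<in> model N \<inter> B}"])
    show "openin (mtop N) {v \<in> U'. \<psi> v \<in> model N \<inter> B}"
      by (rule chart_vimage_openin[OF N U'(1)]) (use s(1) in \<open>auto simp: openin_open\<close>)
    show "f x \<in> {v \<in> U'. \<psi> v \<in> model N \<inter> B}"
      using U' s(2) chart_mem_model[OF N U'] by (simp add: Px)
    fix v assume v: "v \<in> {v \<in> U'. \<psi> v \<in> model N \<inter> B}"
    then have "\<psi> (f (t v)) = \<psi> v" using s(6)[of "\<psi> v"] by (simp add: P_def t_def)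
    moreover have "f (t v) \<in> U'" using S_dom[of "s (\<psi> v)"] s(4) v by (auto simp: t_def)
    ultimately show "f (t v) = v"
      using chart_inj[OF N U'(1)] v by (auto dest: inj_onD)
  qed
  ultimately show thesis by (rule that)
qed

end

section \<open>Lie groups and their extensions\<close>

context
  fixes G :: "('g, 'e::euclidean_space) smooth_group"
  assumes G: "lie_group G"
begin

lemma lie_group_manifold: "smooth_manifold (mfd G)"
  and lie_group_topspace: "topspace (mtop (mfd G)) = carrier G"
  using G by (auto simp: lie_group_def)

lemma smooth_at_carrier:
  fixes M :: "('a, 'h::euclidean_space) manifold"
  assumes "smooth_at M (mfd G) f x"
  shows "f x \<in> carrier G"
  using smooth_at_codomain[OF lie_group_manifold assms] by (simp add: lie_group_topspace)

lemma smooth_at_mult: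
  fixes M :: "('a, 'h::euclidean_space) manifold"
  assumes M: "smooth_manifold M" and f: "smooth_at M (mfd G) f x" and g: "smooth_at M (mfd G) g x"
  shows "smooth_at M (mfd G) (\<lambda>x. f x \<otimes>\<^bsub>G\<^esub> g x) x"
proof -
  note MG = lie_group_manifold
  have "smooth_at (prod_manifold (mfd G) (mfd G)) (mfd G) (\<lambda>(g, h). g \<otimes>\<^bsub>G\<^esub> h) (f x, g x)"
    using G smooth_at_carrier[OF f] smooth_at_carrier[OF g]
    by (intro smooth_map_smooth_at[OF smooth_manifold_prod[OF MG MG] MG]) (auto simp: lie_group_def)
  from smooth_at_compose'[OF M smooth_manifold_prod[OF MG MG] smooth_at_Pair[OF M MG MG f g] refl this]
  show ?thesis by simp
qed

lemma smooth_at_inv: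
  fixes M :: "('a, 'h::euclidean_space) manifold"
  assumes M: "smooth_manifold M" and f: "smooth_at M (mfd G) f x"
  shows "smooth_at M (mfd G) (\<lambda>x. inv\<^bsub>G\<^esub> f x) x"
proof -
  note MG = lie_group_manifold
  have "smooth_at (mfd G) (mfd G) (\<lambda>g. inv\<^bsub>G\<^esub> g) (f x)"
    using G smooth_at_carrier[OF f] by (intro smooth_map_smooth_at[OF MG MG]) (auto simp: lie_group_def)
  from smooth_at_compose'[OF M MG f refl this] show ?thesis .
qed

lemma smooth_at_group_const:
  fixes M :: "('a, 'h::euclidean_space) manifold"
  assumes M: "smooth_manifold M" and x: "x \<in> topspace (mtop M)" "c \<in> carrier G"
  shows "smooth_at M (mfd G) (\<lambda>x. c) x"
  using smooth_at_const[OF M x(1) lie_group_manifold] x(2) by (simp add: lie_group_topspace)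

lemma smooth_at_group_id: "x \<in> carrier G \<Longrightarrow> smooth_at (mfd G) (mfd G) (\<lambda>x. x) x"
  using smooth_at_id[OF lie_group_manifold] by (simp add: lie_group_topspace)

end

locale lie_extension = G: group G + H: group H
  for G :: "('g, 'e::euclidean_space) smooth_group" and H :: "('p, 'f::euclidean_space) smooth_group" +
  fixes V :: "'v::euclidean_space set" and i :: "'v \<Rightarrow> 'p" and p :: "'p \<Rightarrow> 'g"
  assumes lieG: "lie_group G" and lieH: "lie_group H" and V: "subspace V"
    and i_hom: "lie_hom (vec_group V) H i" and p_hom: "lie_hom H G p"
    and i_inj: "inj_on i V" and i_image: "i ` V = kernel H G p" and p_surj: "p ` carrier H = carrier G"
begin

lemmas MG = lie_group_manifold[OF lieG] and MH = lie_group_manifold[OF lieH] and MV = smooth_manifold_vec[OF V]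
lemmas tG [simp] = lie_group_topspace[OF lieG] and tH [simp] = lie_group_topspace[OF lieH]

lemma i_closed [simp]: "u \<in> V \<Longrightarrow> i u \<in> carrier H"
  using i_hom by (auto simp: lie_hom_def hom_def)

lemma i_add: "u \<in> V \<Longrightarrow> w \<in> V \<Longrightarrow> i (u + w) = i u \<otimes>\<^bsub>H\<^esub> i w"
  using i_hom by (auto simp: lie_hom_def hom_def)

lemma i_zero [simp]: "i 0 = \<one>\<^bsub>H\<^esub>"
proof -
  have "0 \<in> V" using V by (rule subspace_0)
  then show ?thesis using i_add[of 0 0] i_closed[of 0] by (simp add: H.l_cancel_one' H.r_cancel_one')
qed

lemma i_minus: "u \<in> V \<Longrightarrow> i (- u) = inv\<^bsub>H\<^esub> (i u)"
  using i_add[of "- u" u] subspace_neg[OF V, of u] by (intro H.inv_equality[symmetric]) auto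

lemma p_closed [simp]: "x \<in> carrier H \<Longrightarrow> p x \<in> carrier G"
  using p_hom by (auto simp: lie_hom_def hom_def)

lemma p_mult [simp]: "x \<in> carrier H \<Longrightarrow> y \<in> carrier H \<Longrightarrow> p (x \<otimes>\<^bsub>H\<^esub> y) = p x \<otimes>\<^bsub>G\<^esub> p y"
  using p_hom by (auto simp: lie_hom_def hom_def)

lemma p_group_hom: "group_hom H G p"
  using p_hom by unfold_locales (simp add: lie_hom_def)

lemma p_one [simp]: "p \<one>\<^bsub>H\<^esub> = \<one>\<^bsub>G\<^esub>"
  using p_group_hom by (rule group_hom.hom_one)

lemma p_inv [simp]: "x \<in> carrier H \<Longrightarrow> p (inv\<^bsub>H\<^esub> x) = inv\<^bsub>G\<^esub> (p x)"
  using p_group_hom by (rule group_hom.hom_inv)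

lemma p_i [simp]: "u \<in> V \<Longrightarrow> p (i u) = \<one>\<^bsub>G\<^esub>"
  using i_image by (auto simp: kernel_def)

text \<open>The inverse of \<open>i\<close> on the kernel of \<open>p\<close>. Algebraically it is
  immediate; its smoothness, in the form of \<open>smooth_at_c\<close>, is the analytic content of
  this locale.\<close>

definition c :: "'p \<Rightarrow> 'v" where "c = inv_into V i"

lemma c_i [simp]: "u \<in> V \<Longrightarrow> c (i u) = u"
  using i_inj by (simp add: c_def)

lemma kernelI: "x \<in> carrier H \<Longrightarrow> p x = \<one>\<^bsub>G\<^esub> \<Longrightarrow> x \<in> i ` V"
  using i_image by (simp add: kernel_def)

lemma c_closed: "x \<in> carrier H \<Longrightarrow> p x = \<one>\<^bsub>G\<^esub> \<Longrightarrow> c x \<in> V"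
  using kernelI by (simp add: c_def inv_into_into)

lemma i_c: "x \<in> carrier H \<Longrightarrow> p x = \<one>\<^bsub>G\<^esub> \<Longrightarrow> i (c x) = x"
  using kernelI by (simp add: c_def f_inv_into_f)

lemma smooth_i: "u \<in> V \<Longrightarrow> smooth_at (vec_mfd V) (mfd H) i u"
  using i_hom by (intro smooth_map_smooth_at[OF MV MH]) (auto simp: lie_hom_def)

lemma smooth_p: "x \<in> carrier H \<Longrightarrow> smooth_at (mfd H) (mfd G) p x"
  using p_hom by (intro smooth_map_smooth_at[OF MH MG]) (auto simp: lie_hom_def)

lemma smooth_at_i:
  fixes M :: "('a, 'h::euclidean_space) manifold"
  assumes "smooth_manifold M" "smooth_at M (vec_mfd V) f x"
  shows "smooth_at M (mfd H) (\<lambda>x. i (f x)) x"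
  by (rule smooth_at_compose'[OF assms(1) MV assms(2) refl smooth_i])
    (use smooth_at_codomain[OF MV assms(2)] in simp)

text \<open>Left translations of the total group and their images in \<open>G\<close> move any point
  to any other and commute with \<open>p\<close>. Surjectivity of \<open>p\<close> supplies the open
  set inside the image.\<close>

lemma p_local_section:
  assumes x: "x \<in> carrier H"
  obtains t where "smooth_at (mfd G) (mfd H) t (p x)" "t (p x) = x" "\<forall>\<^sub>F g in nhdsin (mtop (mfd G)) (p x). p (t g) = g"
proof (rule homogeneous_local_section[OF MH MG, of "carrier H" p "carrier G" x])
  show "openin (mtop (mfd H)) (carrier H)" "openin (mtop (mfd G)) (carrier G)"
    using openin_topspace[of "mtop (mfd H)"] openin_topspace[of "mtop (mfd G)"] by simp_all
  show "\<exists>L R. smooth_at (mfd G) (mfd G) L (p x) \<and> smooth_at (mfd H) (mfd H) R x' \<and> R x' = x \<and>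
      (\<forall>\<^sub>F w in nhdsin (mtop (mfd H)) x'. p w = L (p (R w)))" if x: "x \<in> carrier H" "x' \<in> carrier H" for x x'
  proof (intro exI conjI)
    let ?L = "\<lambda>g. p (x' \<otimes>\<^bsub>H\<^esub> inv\<^bsub>H\<^esub> x) \<otimes>\<^bsub>G\<^esub> g" and ?R = "\<lambda>w. x \<otimes>\<^bsub>H\<^esub> inv\<^bsub>H\<^esub> x' \<otimes>\<^bsub>H\<^esub> w"
    show "smooth_at (mfd G) (mfd G) ?L (p x)"
      using x by (intro smooth_at_mult[OF lieG MG] smooth_at_group_const[OF lieG MG] smooth_at_group_id[OF lieG]) auto
    show "smooth_at (mfd H) (mfd H) ?R x'"
      using x by (intro smooth_at_mult[OF lieH MH] smooth_at_group_const[OF lieH MH] smooth_at_group_id[OF lieH]) auto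
    show "?R x' = x" using x by (simp add: H.m_assoc)
    show "\<forall>\<^sub>F w in nhdsin (mtop (mfd H)) x'. p w = ?L (p (?R w))"
    proof (rule eventually_mono[OF eventually_nhdsin_topspace])
      fix w assume "w \<in> topspace (mtop (mfd H))"
      then show "p w = ?L (p (?R w))"
        using x by (simp add: G.m_assoc[symmetric]) (simp add: G.m_assoc)
    qed (use x in simp)
  qed
qed (use smooth_p x p_surj in auto)

text \<open>The map \<open>(u, g) \<mapsto> i(u) t(g)\<close> for a local section \<open>t\<close> is again homogeneous, and a local
  section of it provides the inverse of \<open>i\<close>.\<close>

lemma c_smooth_near_one:
  obtains k where "smooth_at (mfd H) (vec_mfd V) k \<one>\<^bsub>H\<^esub>"
    "\<forall>\<^sub>F x in nhdsin (mtop (mfd H)) \<one>\<^bsub>H\<^esub>. p x = \<one>\<^bsub>G\<^esub> \<longrightarrow> c x = k x"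
proof -
  let ?M = "prod_manifold (vec_mfd V) (mfd G)"
  note MM = smooth_manifold_prod[OF MV MG]
  obtain t where t0: "smooth_at (mfd G) (mfd H) t \<one>\<^bsub>G\<^esub>" "t \<one>\<^bsub>G\<^esub> = \<one>\<^bsub>H\<^esub>"
    "\<forall>\<^sub>F g in nhdsin (mtop (mfd G)) \<one>\<^bsub>G\<^esub>. p (t g) = g"
    using p_local_section[OF H.one_closed] by auto
  obtain B where B: "openin (mtop (mfd G)) B" "\<one>\<^bsub>G\<^esub> \<in> B"
    "\<And>g. g \<in> B \<Longrightarrow> smooth_at (mfd G) (mfd H) t g \<and> p (t g) = g"
    using eventually_nhdsinE[OF eventually_conj[OF smooth_at_near[OF t0(1)] t0(3)]] by auto
  have BG: "g \<in> carrier G" if "g \<in> B" for g using openin_subset[OF B(1)] that by auto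
  have tc: "t g \<in> carrier H" if "g \<in> B" for g
    by (rule smooth_at_carrier[OF lieH conjunct1[OF B(3)[OF that]]])
  have pt: "p (t g) = g" if "g \<in> B" for g using B(3)[OF that] by blast
  define \<mu> where "\<mu> = (\<lambda>(u, g). i u \<otimes>\<^bsub>H\<^esub> t g)"
  have fst: "smooth_at ?M (vec_mfd V) fst z" and snd: "smooth_at ?M (mfd G) snd z" if "z \<in> V \<times> carrier G" for z
    using that smooth_at_fst[OF MV MG] smooth_at_snd[OF MV MG] by (cases z; force)+
  have sm\<mu>: "smooth_at ?M (mfd H) \<mu> z" if z: "z \<in> V \<times> B" for z
  proof -
    have z': "z \<in> V \<times> carrier G" using z BG by auto
    have "smooth_at ?M (mfd H) (\<lambda>z. i (fst z) \<otimes>\<^bsub>H\<^esub> t (snd z)) z"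
      by (intro smooth_at_mult[OF lieH MM] smooth_at_i[OF MM] fst z'
          smooth_at_compose'[OF MM MG snd[OF z'] refl]) (use z B(3) in auto)
    then show ?thesis by (simp add: \<mu>_def case_prod_unfold)
  qed
  have op: "openin (mtop ?M) (V \<times> B)"
    using B(1) by (simp add: openin_prod_Times_iff)
  obtain r where r: "smooth_at (mfd H) ?M r (\<mu> (0, \<one>\<^bsub>G\<^esub>))" "r (\<mu> (0, \<one>\<^bsub>G\<^esub>)) = (0, \<one>\<^bsub>G\<^esub>)"
    "\<forall>\<^sub>F x in nhdsin (mtop (mfd H)) (\<mu> (0, \<one>\<^bsub>G\<^esub>)). \<mu> (r x) = x"
  proof (rule homogeneous_local_section[OF MM MH op sm\<mu>])
    show "openin (mtop (mfd H)) {x \<in> carrier H. p x \<in> B}"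
      using openin_continuous_map_preimage[OF _ B(1), of "mtop (mfd H)" p] p_hom
      by (simp add: lie_hom_def smooth_map_def)
    have "\<one>\<^bsub>H\<^esub> \<in> {x \<in> carrier H. p x \<in> B}" using B(2) by simp
    then show "{x \<in> carrier H. p x \<in> B} \<noteq> {}" by (rule ex_in_conv[THEN iffD1, OF exI])
    show "(0, \<one>\<^bsub>G\<^esub>) \<in> V \<times> B" using B(2) subspace_0[OF V] by simp
    show "{x \<in> carrier H. p x \<in> B} \<subseteq> \<mu> ` (V \<times> B)"
    proof
      fix x assume x: "x \<in> {x \<in> carrier H. p x \<in> B}"
      define y where "y = x \<otimes>\<^bsub>H\<^esub> inv\<^bsub>H\<^esub> t (p x)"
      have y: "y \<in> carrier H" "p y = \<one>\<^bsub>G\<^esub>" using x tc pt by (auto simp: y_def)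
      have "x = \<mu> (c y, p x)"
        using x tc by (simp add: \<mu>_def i_c[OF y]) (simp add: y_def H.m_assoc)
      then show "x \<in> \<mu> ` (V \<times> B)" by (rule image_eqI) (use x c_closed[OF y] in simp)
    qed
    fix z z' assume z: "z \<in> V \<times> B" and z': "z' \<in> V \<times> B"
    obtain u0 g0 where z0: "z = (u0, g0)" "u0 \<in> V" "g0 \<in> B" using z by auto
    obtain u1 g1 where z1: "z' = (u1, g1)" "u1 \<in> V" "g1 \<in> B" using z' by auto
    have g: "g0 \<in> carrier G" "g1 \<in> carrier G" using BG z0 z1 by auto
    define d where "d = u1 - u0"
    have d: "d \<in> V" "- d \<in> V" using V z0 z1 by (auto simp: d_def subspace_diff)
    define a where "a = g0 \<otimes>\<^bsub>G\<^esub> inv\<^bsub>G\<^esub> g1"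
    have a: "a \<in> carrier G" using g by (simp add: a_def)
    \<comment> \<open>The local section \<open>t\<close> is no homomorphism, so a translation of the
      total group would not correspond to the shift \<open>R\<close>. \<open>L\<close> exchanges the
      factor \<open>t (p x)\<close> for the value of \<open>t\<close> at the argument shifted back,
      and restores \<open>d\<close> in front.\<close>
    define L where "L x = i d \<otimes>\<^bsub>H\<^esub> x \<otimes>\<^bsub>H\<^esub> inv\<^bsub>H\<^esub> t (p x) \<otimes>\<^bsub>H\<^esub> t (inv\<^bsub>G\<^esub> a \<otimes>\<^bsub>G\<^esub> p x)" for x
    define R where "R z = (fst z + - d, a \<otimes>\<^bsub>G\<^esub> snd z)" for z
    have ag1: "a \<otimes>\<^bsub>G\<^esub> g1 = g0" and ag0: "inv\<^bsub>G\<^esub> a \<otimes>\<^bsub>G\<^esub> g0 = g1"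
      using g by (simp_all add: a_def G.m_assoc G.inv_mult_group)
    have x0: "\<mu> z \<in> carrier H" "p (\<mu> z) = g0"
      using z0 tc pt g by (auto simp: \<mu>_def)
    have Rz': "R z' = z" using z0 z1 by (simp add: R_def d_def ag1)
    have zV: "z' \<in> V \<times> carrier G" using z1 g by simp
    have zt: "z' \<in> topspace (mtop ?M)" using zV by simp
    have smR: "smooth_at ?M ?M R z'"
      unfolding R_def
      by (intro smooth_at_Pair[OF MM MV MG] smooth_at_add[OF MM V] smooth_at_vec_const[OF MM V]
          smooth_at_mult[OF lieG MM] smooth_at_group_const[OF lieG MM] fst snd zV zt d a)
    have smL: "smooth_at (mfd H) (mfd H) L (\<mu> z)"
    proof -
      have px: "smooth_at (mfd H) (mfd G) p (\<mu> z)" using x0 by (intro smooth_p)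
      have 1: "smooth_at (mfd H) (mfd H) (\<lambda>x. t (p x)) (\<mu> z)"
        by (rule smooth_at_compose'[OF MH MG px x0(2)]) (use B(3) z0 in blast)
      have "smooth_at (mfd H) (mfd G) (\<lambda>x. inv\<^bsub>G\<^esub> a \<otimes>\<^bsub>G\<^esub> p x) (\<mu> z)"
        by (intro smooth_at_mult[OF lieG MH] smooth_at_group_const[OF lieG MH] px) (use x0 a in auto)
      then have 2: "smooth_at (mfd H) (mfd H) (\<lambda>x. t (inv\<^bsub>G\<^esub> a \<otimes>\<^bsub>G\<^esub> p x)) (\<mu> z)"
        by (rule smooth_at_compose'[OF MH MG]) (use B(3) z1 x0 ag0 in auto)
      show ?thesis
        unfolding L_def
        by (intro smooth_at_mult[OF lieH MH] smooth_at_inv[OF lieH MH] smooth_at_group_const[OF lieH MH]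
            smooth_at_group_id[OF lieH] 1 2) (use x0 d in auto)
    qed
    have "\<forall>\<^sub>F w in nhdsin (mtop ?M) z'. w \<in> V \<times> B \<and> R w \<in> V \<times> B"
      by (intro eventually_conj eventually_nhdsin_openin[OF op z']
          smooth_at_eventually[OF MM MM smR] eventually_nhdsin_openin[OF op]) (use Rz' z in simp)
    then have "\<forall>\<^sub>F w in nhdsin (mtop ?M) z'. \<mu> w = L (\<mu> (R w))"
    proof eventually_elim
      case (elim w)
      obtain u g where w: "w = (u, g)" "u \<in> V" "g \<in> B" using elim by auto
      have ag: "a \<otimes>\<^bsub>G\<^esub> g \<in> B" and ud: "u + - d \<in> V" using elim w by (auto simp: R_def)
      have gc: "g \<in> carrier G" using BG w by simp
      have bk: "inv\<^bsub>G\<^esub> a \<otimes>\<^bsub>G\<^esub> (a \<otimes>\<^bsub>G\<^esub> g) = g" using a gc by (simp add: G.m_assoc[symmetric])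
      have "i d \<otimes>\<^bsub>H\<^esub> i (u + - d) = i u" using i_add[OF d(1) ud] by simp
      then show ?case
        using w d ud tc[OF ag] tc[OF w(3)] pt[OF ag] a gc bk
        by (simp add: L_def R_def \<mu>_def H.m_assoc)
    qed
    then show "\<exists>L R. smooth_at (mfd H) (mfd H) L (\<mu> z) \<and> smooth_at ?M ?M R z' \<and> R z' = z \<and>
        (\<forall>\<^sub>F w in nhdsin (mtop ?M) z'. \<mu> w = L (\<mu> (R w)))"
      using smL smR Rz' by blast
  qed
  have \<mu>0: "\<mu> (0, \<one>\<^bsub>G\<^esub>) = \<one>\<^bsub>H\<^esub>" by (simp add: \<mu>_def t0(2))
  note r = r[unfolded \<mu>0]
  have z0: "(0, \<one>\<^bsub>G\<^esub>) \<in> V \<times> B" using B(2) subspace_0[OF V] by simp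
  show thesis
  proof (rule that[of "\<lambda>x. fst (r x)"])
    show "smooth_at (mfd H) (vec_mfd V) (\<lambda>x. fst (r x)) \<one>\<^bsub>H\<^esub>"
      by (rule smooth_at_compose'[OF MH MM r(1,2) fst]) (use z0 BG in auto)
    \<comment> \<open>For \<open>x\<close> in the kernel the second component of \<open>r x\<close>
      is the unit, where \<open>t\<close> is normalised; so \<open>x\<close> is \<open>i\<close> of
      the first component.\<close>
    have "\<forall>\<^sub>F x in nhdsin (mtop (mfd H)) \<one>\<^bsub>H\<^esub>. r x \<in> V \<times> B"
      by (rule smooth_at_eventually[OF MH MM r(1) eventually_nhdsin_openin[OF op]]) (use r(2) z0 in simp)
    with r(3) show "\<forall>\<^sub>F x in nhdsin (mtop (mfd H)) \<one>\<^bsub>H\<^esub>. p x = \<one>\<^bsub>G\<^esub> \<longrightarrow> c x = fst (r x)"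
    proof eventually_elim
      case (elim x)
      obtain u g where ug: "r x = (u, g)" "u \<in> V" "g \<in> B" using elim by auto
      then have x: "x = i u \<otimes>\<^bsub>H\<^esub> t g" using elim by (simp add: \<mu>_def)
      then have "p x = g" using ug tc pt BG by simp
      then show ?case using x ug t0(2) by auto
    qed
  qed
qed

text \<open>Additivity of \<open>c\<close> moves the problem to the unit: \<open>c (f z)\<close> is
  \<open>c (f x)\<close> plus \<open>c\<close> of the quotient of \<open>f z\<close> by
  \<open>f x\<close>. It suffices that \<open>f\<close> takes values in the kernel near the
  point.\<close>

lemma smooth_at_c:
  fixes M :: "('a, 'h::euclidean_space) manifold"
  assumes M: "smooth_manifold M" and f: "smooth_at M (mfd H) f x"
    and ker: "\<forall>\<^sub>F z in nhdsin (mtop M) x. p (f z) = \<one>\<^bsub>G\<^esub>"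
  shows "smooth_at M (vec_mfd V) (\<lambda>z. c (f z)) x"
proof -
  obtain k where k: "smooth_at (mfd H) (vec_mfd V) k \<one>\<^bsub>H\<^esub>"
    "\<forall>\<^sub>F x in nhdsin (mtop (mfd H)) \<one>\<^bsub>H\<^esub>. p x = \<one>\<^bsub>G\<^esub> \<longrightarrow> c x = k x"
    by (rule c_smooth_near_one)
  have x: "x \<in> topspace (mtop M)" by (rule smooth_at_topspace[OF f])
  have fx: "f x \<in> carrier H" by (rule smooth_at_carrier[OF lieH f])
  have pfx: "p (f x) = \<one>\<^bsub>G\<^esub>" by (rule eventually_nhdsin_self[OF ker x])
  define h where "h z = inv\<^bsub>H\<^esub> f x \<otimes>\<^bsub>H\<^esub> f z" for z
  have h: "smooth_at M (mfd H) h x"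
    unfolding h_def by (intro smooth_at_mult[OF lieH M] smooth_at_group_const[OF lieH M] f x) (use fx in simp)
  have hx: "h x = \<one>\<^bsub>H\<^esub>" using fx by (simp add: h_def)
  have "smooth_at M (vec_mfd V) (\<lambda>z. c (f x) + k (h z)) x"
    by (intro smooth_at_add[OF M V] smooth_at_vec_const[OF M V x] c_closed fx pfx smooth_at_compose'[OF M MH h hx k(1)])
  moreover have "\<forall>\<^sub>F z in nhdsin (mtop M) x. p (h z) = \<one>\<^bsub>G\<^esub> \<longrightarrow> c (h z) = k (h z)"
    by (rule smooth_at_eventually[OF M MH h]) (use k(2) in \<open>simp add: hx\<close>)
  then have "\<forall>\<^sub>F z in nhdsin (mtop M) x. c (f x) + k (h z) = c (f z)"
    using ker smooth_at_near[OF f]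
  proof eventually_elim
    case (elim z)
    have fz: "f z \<in> carrier H" by (rule smooth_at_carrier[OF lieH elim(3)])
    have hz: "h z \<in> carrier H" "p (h z) = \<one>\<^bsub>G\<^esub>" using fx fz pfx elim(2) by (simp_all add: h_def)
    have "f z = f x \<otimes>\<^bsub>H\<^esub> h z" using fx fz by (simp add: h_def H.m_assoc[symmetric])
    also have "\<dots> = i (c (f x) + c (h z))"
      using i_add[OF c_closed[OF fx pfx] c_closed[OF hz]] i_c[OF fx pfx] i_c[OF hz] by simp
    finally have "c (f z) = c (f x) + c (h z)"
      using c_closed[OF fx pfx] c_closed[OF hz] V by (simp add: subspace_add)
    then show ?case using elim(1) hz by simp
  qed
  ultimately show ?thesis by (rule smooth_at_cong[OF M])
qed

end

text \<open>A cutoff function in a chart is extended by 0. The last property, vanishing near every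
  point off \<open>B\<close>, allows products with functions that are smooth on \<open>B\<close>
  only.\<close>

lemma manifold_bump:
  fixes M :: "('a, 'e::euclidean_space) manifold"
  assumes M: "smooth_manifold M" and B: "openin (mtop M) B" "x \<in> B"
  obtains f :: "'a \<Rightarrow> real" and A where "openin (mtop M) A" "x \<in> A" "A \<subseteq> B" "\<And>y. y \<in> A \<Longrightarrow> f y = 1"
    "\<And>y. y \<in> topspace (mtop M) \<Longrightarrow> smooth_at M (vec_mfd UNIV) f y"
    "\<And>y. y \<in> topspace (mtop M) \<Longrightarrow> y \<notin> B \<Longrightarrow> \<forall>\<^sub>F z in nhdsin (mtop M) y. f z = 0"
proof -
  note SM = smooth_manifold_model[OF M]
  have xM: "x \<in> topspace (mtop M)" using B openin_subset by blast
  obtain U \<phi> where U: "(U, \<phi>) \<in> atlas M" "x \<in> U" using smooth_manifold_cover[OF M xM] .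
  note Uop = chart_openin[OF M U(1)]
  define a where "a = \<phi> x"
  have "openin (top_of_set (model M)) (\<phi> ` (U \<inter> B))"
    by (intro chart_image_openin[OF M U(1)] openin_Int Uop B) auto
  then obtain S where S: "open S" "\<phi> ` (U \<inter> B) = model M \<inter> S" by (auto simp: openin_open)
  have aS: "a \<in> S" using S U B by (auto simp: a_def)
  then obtain e where e: "e > 0" "cball a e \<subseteq> S" using S(1) open_contains_cball by blast
  define r where "r = e / 2"
  have r: "r > 0" "cball a (2 * r) \<subseteq> S" using e by (auto simp: r_def)
  \<comment> \<open>The squared distance is used because it is smooth at the centre as well.
    \<open>Q\<close> is 1 up to distance \<open>r\<close> and already 0 once the squared distance
    exceeds \<open>2 * r\<^sup>2\<close>, hence beyond distance \<open>2 * r\<close>.\<close>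
  define Q where "Q v = smooth_step (((v - a) \<bullet> (v - a)) * (1 / r\<^sup>2))" for v
  have Q: "smooth_on UNIV UNIV Q"
  proof -
    have 1: "smooth_on UNIV UNIV (\<lambda>v. v + (- a))"
      by (intro smooth_on_add smooth_on_const smooth_on_bounded_linear bounded_linear_ident)
    have "smooth_on UNIV UNIV (\<lambda>v. ((v + (- a)) \<bullet> (v + (- a))) * (1 / r\<^sup>2))"
      by (intro bounded_bilinear.smooth_on[OF bounded_bilinear_mult]
          bounded_bilinear.smooth_on[OF bounded_bilinear_inner] 1 smooth_on_const)
    from smooth_on_compose[OF smooth_step(3) subspace_UNIV _ this] show ?thesis
      by (simp add: Q_def[abs_def] dir_open_open)
  qed
  have Q1: "Q v = 1" if "dist a v < r" for v
  proof -
    have "(v - a) \<bullet> (v - a) \<le> r\<^sup>2"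
      using that r(1) by (simp add: dist_norm norm_minus_commute power2_norm_eq_inner[symmetric] power_mono)
    then show ?thesis using r(1) unfolding Q_def by (intro smooth_step) (simp add: divide_simps)
  qed
  have Q0: "Q v = 0" if "dist a v > 2 * r" for v
  proof -
    have "(2 * r)\<^sup>2 \<le> (norm (v - a))\<^sup>2"
      using that r(1) by (intro power_mono) (auto simp: dist_norm norm_minus_commute)
    then have "4 * r\<^sup>2 \<le> (v - a) \<bullet> (v - a)"
      by (simp add: power2_norm_eq_inner power_mult_distrib)
    moreover have "0 \<le> r\<^sup>2" by simp
    ultimately have "2 * r\<^sup>2 \<le> (v - a) \<bullet> (v - a)" by linarith
    then show ?thesis using r(1) unfolding Q_def by (intro smooth_step) (simp add: field_simps)
  qed
  define C where "C = cball a (2 * r) \<inter> model M"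
  have C_sub: "C \<subseteq> \<phi> ` (U \<inter> B)" using r(2) S(2) by (auto simp: C_def)
  define K where "K = {y \<in> U. \<phi> y \<in> C}"
  have KB: "K \<subseteq> B" using C_sub chart_inj[OF M U(1)] by (auto simp: K_def inj_on_def subset_iff)
  \<comment> \<open>\<open>K\<close> is compact, and closed because the space is Hausdorff. Without
    this the extension by 0 could fail to be smooth at boundary points of the chart domain.\<close>
  have K_closed: "closedin (mtop M) K"
  proof -
    obtain g where g: "homeomorphic_maps (subtopology (mtop M) U) (top_of_set (\<phi> ` U)) \<phi> g"
      using chart_homeo[OF M U(1)] unfolding homeomorphic_map_maps by blast
    have gy: "g (\<phi> y) = y" if "y \<in> U" for y
      using g that chart_topspace[OF M U(1)] by (auto simp: homeomorphic_maps_def)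
    have "compactin (top_of_set (\<phi> ` U)) C"
      using C_sub closed_subspace[OF SM]
      by (auto simp: compactin_subtopology C_def intro: compact_Int_closed)
    then have "compactin (subtopology (mtop M) U) (g ` C)"
      using g by (intro image_compactin) (auto simp: homeomorphic_maps_def)
    moreover have "g ` C = K"
    proof
      show "g ` C \<subseteq> K" using C_sub gy by (auto simp: K_def subset_iff)
      show "K \<subseteq> g ` C" using gy by (auto simp: K_def intro!: image_eqI[of _ g "\<phi> _"])
    qed
    ultimately have "compactin (mtop M) K" by (simp add: compactin_subtopology)
    moreover have "Hausdorff_space (mtop M)" using M by (simp add: smooth_manifold_def)
    ultimately show ?thesis by (simp add: compactin_imp_closedin)
  qed
  define f where "f y = (if y \<in> U then Q (\<phi> y) else 0)" for y
  have f0: "f y = 0" if "y \<notin> K" for y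
    using that Q0 chart_mem_model[OF M U(1)] by (auto simp: f_def K_def C_def not_le)
  have near0: "\<forall>\<^sub>F z in nhdsin (mtop M) y. f z = 0" if "y \<in> topspace (mtop M)" "y \<notin> K" for y
    by (rule eventually_nhdsinI[of _ "topspace (mtop M) - K"]) (use K_closed that f0 in auto)
  show thesis
  proof (rule that[of "{y \<in> U. \<phi> y \<in> ball a r \<inter> model M}" f])
    show "openin (mtop M) {y \<in> U. \<phi> y \<in> ball a r \<inter> model M}"
      by (rule chart_vimage_openin[OF M U(1)]) (auto simp: openin_open)
    show "x \<in> {y \<in> U. \<phi> y \<in> ball a r \<inter> model M}"
      using U chart_mem_model[OF M U] r(1) by (simp add: a_def)
    show "{y \<in> U. \<phi> y \<in> ball a r \<inter> model M} \<subseteq> B"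
      using KB r(1) by (auto simp: K_def C_def)
    show "f y = 1" if "y \<in> {y \<in> U. \<phi> y \<in> ball a r \<inter> model M}" for y
      using that Q1 by (simp add: f_def)
    show "\<forall>\<^sub>F z in nhdsin (mtop M) y. f z = 0" if "y \<in> topspace (mtop M)" "y \<notin> B" for y
      using near0 that KB by blast
    show "smooth_at M (vec_mfd UNIV) f y" if y: "y \<in> topspace (mtop M)" for y
    proof (cases "y \<in> U")
      case True
      have "smooth_at (vec_mfd (model M)) (vec_mfd UNIV) Q (\<phi> y)"
        by (rule smooth_at_vec_vecI[OF SM smooth_on_from_UNIV[OF smooth_on_subset[OF Q]], of "model M"])
          (use chart_mem_model[OF M U(1) True] in auto)
      from smooth_at_compose'[OF M smooth_manifold_vec[OF SM] smooth_at_chart_map[OF M U(1) True] refl this]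
      have "smooth_at M (vec_mfd UNIV) (\<lambda>y. Q (\<phi> y)) y" .
      then show ?thesis
        by (rule smooth_at_cong[OF M _ eventually_nhdsinI[OF Uop True]]) (simp add: f_def)
    next
      case False
      then have "y \<notin> K" by (simp add: K_def)
      have "smooth_at M (vec_mfd UNIV) (\<lambda>y. 0 :: real) y"
        by (rule smooth_at_vec_const[OF M subspace_UNIV y]) simp
      then show ?thesis
        by (rule smooth_at_cong[OF M _ eventually_mono[OF near0[OF y \<open>y \<notin> K\<close>]]]) simp
    qed
  qed
qed

context lie_extension
begin

lemma c_mult:
  assumes "x \<in> carrier H" "y \<in> carrier H" "p x = \<one>\<^bsub>G\<^esub>" "p y = \<one>\<^bsub>G\<^esub>"
  shows "c (x \<otimes>\<^bsub>H\<^esub> y) = c x + c y"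
proof -
  have "x \<otimes>\<^bsub>H\<^esub> y = i (c x + c y)"
    using assms by (simp add: i_add c_closed i_c)
  then show ?thesis using assms V by (simp add: c_closed subspace_add)
qed

text \<open>Local sections differ by \<open>V\<close>-valued maps, so they can be averaged. The weights
  \<open>f\<^sub>j \<Prod>\<^sub>i\<^sub><\<^sub>j (1 - f\<^sub>i)\<close> built from bump functions \<open>f\<^sub>i\<close> that are \<open>1\<close> on the sets of an open cover
  vanish for large \<open>j\<close> on each set of the cover and add up to \<open>1\<close>.\<close>

theorem global_section:
  obtains s where "\<And>g. g \<in> carrier G \<Longrightarrow> smooth_at (mfd G) (mfd H) s g" "\<And>g. g \<in> carrier G \<Longrightarrow> p (s g) = g"
    "s \<one>\<^bsub>G\<^esub> = \<one>\<^bsub>H\<^esub>"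
proof -
  \<comment> \<open>The data chosen around one point are bundled: a local section on
    \<open>B\<close> and a bump function equal to 1 on \<open>A\<close>. The sets \<open>A\<close>
    are the ones required to cover \<open>G\<close>.\<close>
  define good where "good t B f A \<longleftrightarrow> (openin (mtop (mfd G)) B \<and> openin (mtop (mfd G)) A \<and> A \<subseteq> B \<and>
    (\<forall>g\<in>B. smooth_at (mfd G) (mfd H) t g \<and> p (t g) = g) \<and> (\<forall>g\<in>A. f g = (1::real)) \<and>
    (\<forall>g\<in>carrier G. smooth_at (mfd G) (vec_mfd UNIV) f g \<and>
      (g \<notin> B \<longrightarrow> (\<forall>\<^sub>F z in nhdsin (mtop (mfd G)) g. f z = 0))))" for t B f A
  have "\<exists>t B f A. g \<in> A \<and> good t B f A" if g: "g \<in> carrier G" for g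
  proof -
    have "g \<in> p ` carrier H" using g by (simp add: p_surj)
    then obtain x where x: "x \<in> carrier H" "p x = g" by (auto simp del: p_closed)
    obtain t where t: "smooth_at (mfd G) (mfd H) t g" "\<forall>\<^sub>F g in nhdsin (mtop (mfd G)) g. p (t g) = g"
      by (rule p_local_section[OF x(1), unfolded x(2)])
    obtain B where B: "openin (mtop (mfd G)) B" "g \<in> B" "\<And>g. g \<in> B \<Longrightarrow> smooth_at (mfd G) (mfd H) t g \<and> p (t g) = g"
      using eventually_nhdsinE[OF eventually_conj[OF smooth_at_near[OF t(1)] t(2)]] g by auto
    obtain f :: "'g \<Rightarrow> real" and A where "openin (mtop (mfd G)) A" "g \<in> A" "A \<subseteq> B" "\<And>y. y \<in> A \<Longrightarrow> f y = 1"
      "\<And>y. y \<in> topspace (mtop (mfd G)) \<Longrightarrow> smooth_at (mfd G) (vec_mfd UNIV) f y"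
      "\<And>y. y \<in> topspace (mtop (mfd G)) \<Longrightarrow> y \<notin> B \<Longrightarrow> \<forall>\<^sub>F z in nhdsin (mtop (mfd G)) y. f z = 0"
      by (rule manifold_bump[OF MG B(1,2)]) blast
    then show ?thesis using B unfolding good_def by (intro exI[of _ t] exI[of _ B] exI[of _ f] exI[of _ A]) auto
  qed
  then obtain t B f A where gd: "\<And>g. g \<in> carrier G \<Longrightarrow> g \<in> A g \<and> good (t g) (B g) (f g) (A g)"
    by metis
  have "second_countable_space (mtop (mfd G))" using MG by (simp add: smooth_manifold_def)
  then obtain C where C: "countable C" "C \<subseteq> carrier G" "carrier G \<subseteq> (\<Union>g\<in>C. A g)"
    by (rule countable_subcover[where A = "carrier G" and B = A]) (use gd in \<open>auto simp: good_def\<close>)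
  have "C \<noteq> {}" using C(3) G.one_closed by blast
  define idx where "idx = from_nat_into C"
  have idx: "range idx = C" unfolding idx_def using \<open>C \<noteq> {}\<close> C(1) by (rule range_from_nat_into)
  define t' B' f' A' where "t' n = t (idx n)" and "B' n = B (idx n)" and "f' n = f (idx n)" and "A' n = A (idx n)" for n
  have good: "good (t' n) (B' n) (f' n) (A' n)" for n
    unfolding t'_def B'_def f'_def A'_def using gd idx C(2) by blast
  have cover: "\<exists>n. g \<in> A' n" if "g \<in> carrier G" for g
    using that C(3) idx unfolding A'_def by blast
  have AB: "g \<in> B' n" if "g \<in> A' n" for g n using good[of n] that by (auto simp: good_def)
  have BG: "g \<in> carrier G" if "g \<in> B' n" for g n
    using good[of n] openin_subset[of "mtop (mfd G)" "B' n"] that by (auto simp: good_def)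
  have Aop: "openin (mtop (mfd G)) (A' n)" and Bop: "openin (mtop (mfd G)) (B' n)" for n
    using good[of n] by (auto simp: good_def)
  have t_sm: "smooth_at (mfd G) (mfd H) (t' n) g" and t_p: "p (t' n g) = g" if "g \<in> B' n" for g n
    using good[of n] that by (auto simp: good_def)
  have t_c: "t' n g \<in> carrier H" if "g \<in> B' n" for g n by (rule smooth_at_carrier[OF lieH t_sm[OF that]])
  have f1: "f' n g = 1" if "g \<in> A' n" for g n using good[of n] that by (auto simp: good_def)
  have f_sm: "smooth_at (mfd G) (vec_mfd UNIV) (f' n) g" if "g \<in> carrier G" for g n
    using good[of n] that by (auto simp: good_def)
  have f0: "\<forall>\<^sub>F z in nhdsin (mtop (mfd G)) g. f' n z = 0" if "g \<in> carrier G" "g \<notin> B' n" for g n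
    using good[of n] that by (auto simp: good_def)
  have f0': "f' n g = 0" if "g \<in> carrier G" "g \<notin> B' n" for g n
    using eventually_nhdsin_self[OF f0[OF that]] that by simp
  define \<rho> where "\<rho> j g = f' j g * (\<Prod>i<j. 1 - f' i g)" for j g
  have \<rho>_sum: "(\<Sum>j<n. \<rho> j g) = 1 - (\<Prod>i<n. 1 - f' i g)" for n g
    by (induction n) (auto simp: \<rho>_def algebra_simps)
  have \<rho>0: "\<rho> j g = 0" if "g \<in> A' k" "k < j" for j k g
    using that f1[OF that(1)] by (auto simp: \<rho>_def intro!: bexI[of _ k])
  have \<rho>1: "(\<Sum>j\<le>k. \<rho> j g) = 1" if "g \<in> A' k" for k g
  proof -
    have "(\<Prod>i<Suc k. 1 - f' i g) = 0" using f1[OF that] by simp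
    then show ?thesis using \<rho>_sum[of g "Suc k"] unfolding lessThan_Suc_atMost by simp
  qed
  have \<rho>_sm: "smooth_at (mfd G) (vec_mfd UNIV) (\<rho> j) g" if g: "g \<in> carrier G" for j g
  proof -
    have 1: "smooth_at (mfd G) (vec_mfd UNIV) (\<lambda>g. 1 - f' i g) g" for i
    proof -
      have gt: "g \<in> topspace (mtop (mfd G))" using g by simp
      have "smooth_at (mfd G) (vec_mfd UNIV) (\<lambda>g. 1 + (- 1) *\<^sub>R f' i g) g"
        by (intro smooth_at_add[OF MG subspace_UNIV] smooth_at_scaleR[OF MG subspace_UNIV]
            smooth_at_vec_const[OF MG subspace_UNIV gt] f_sm g UNIV_I)
      then show ?thesis by simp
    qed
    have "smooth_at (mfd G) (vec_mfd UNIV) (\<lambda>g. \<Prod>i<n. 1 - f' i g) g" for n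
    proof (induction n)
      case 0
      show ?case using smooth_at_vec_const[OF MG subspace_UNIV, of g "1::real"] g by simp
    next
      case (Suc n)
      show ?case using smooth_at_scaleR[OF MG subspace_UNIV Suc 1[of n]] by simp
    qed
    from smooth_at_scaleR[OF MG subspace_UNIV f_sm[OF g] this] show ?thesis by (simp add: \<rho>_def[abs_def])
  qed
  \<comment> \<open>A set-theoretic section, used only as a reference point in each fibre. The
    coordinates \<open>a\<close> relative to it need not be smooth; their differences
    \<open>b\<close> are, and only these survive below.\<close>
  define s0 where "s0 = inv_into (carrier H) p"
  have s0: "s0 g \<in> carrier H" "p (s0 g) = g" if "g \<in> carrier G" for g
    using that p_surj by (auto simp: s0_def inv_into_into f_inv_into_f)
  \<comment> \<open>The value 0 off \<open>B' j\<close> is harmless, because the weight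
    \<open>\<rho> j\<close> vanishes there.\<close>
  define a where "a j g = (if g \<in> B' j then c (t' j g \<otimes>\<^bsub>H\<^esub> inv\<^bsub>H\<^esub> s0 g) else 0)" for j g
  define b where "b j k g = (if g \<in> B' j then c (t' j g \<otimes>\<^bsub>H\<^esub> inv\<^bsub>H\<^esub> t' k g) else 0)" for j k g
  have aV: "a j g \<in> V" for j g
    using t_c t_p s0 BG subspace_0[OF V] by (auto simp: a_def intro!: c_closed)
  have bV: "b j k g \<in> V" if "g \<in> B' k" for j k g
    using that t_c t_p BG subspace_0[OF V] by (auto simp: b_def intro!: c_closed)
  have ab: "a j g = b j k g + a k g" if g: "g \<in> B' j" "g \<in> B' k" for j k g
  proof -
    have gG: "g \<in> carrier G" using BG g by blast
    have "t' j g \<otimes>\<^bsub>H\<^esub> inv\<^bsub>H\<^esub> s0 g = (t' j g \<otimes>\<^bsub>H\<^esub> inv\<^bsub>H\<^esub> t' k g) \<otimes>\<^bsub>H\<^esub> (t' k g \<otimes>\<^bsub>H\<^esub> inv\<^bsub>H\<^esub> s0 g)"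
      using t_c g s0[OF gG] by (simp add: H.m_assoc[symmetric]) (simp add: H.m_assoc)
    then show ?thesis
      using g gG t_c t_p s0[OF gG] by (simp add: a_def b_def c_mult)
  qed
  \<comment> \<open>All weights with an index above \<open>N g\<close> vanish at \<open>g\<close>,
    so this truncation keeps the full sum while making it finite.\<close>
  define N where "N g = (LEAST n. g \<in> A' n)" for g
  define s' where "s' g = i (\<Sum>j\<le>N g. \<rho> j g *\<^sub>R a j g) \<otimes>\<^bsub>H\<^esub> s0 g" for g
  \<comment> \<open>On \<open>A' k\<close> the sum may be cut at the fixed index \<open>k\<close>,
    and since the weights add up to 1 the reference point can be changed from \<open>s0\<close> to
    \<open>t' k\<close>. The pointwise choices \<open>N\<close> and \<open>s0\<close> disappear, and
    what is left is smooth.\<close>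
  have loc: "s' g = i (\<Sum>j\<le>k. \<rho> j g *\<^sub>R b j k g) \<otimes>\<^bsub>H\<^esub> t' k g" if g: "g \<in> A' k" for g k
  proof -
    have gB: "g \<in> B' k" and gG: "g \<in> carrier G" using g AB BG by blast+
    have N: "g \<in> A' (N g)" "N g \<le> k" unfolding N_def using g by (auto intro: LeastI Least_le)
    have "(\<Sum>j\<le>N g. \<rho> j g *\<^sub>R a j g) = (\<Sum>j\<le>k. \<rho> j g *\<^sub>R a j g)"
      using N \<rho>0[OF N(1)] by (intro sum.mono_neutral_left) auto
    also have "\<dots> = (\<Sum>j\<le>k. \<rho> j g *\<^sub>R b j k g + \<rho> j g *\<^sub>R a k g)"
    proof (rule sum.cong[OF refl])
      fix j show "\<rho> j g *\<^sub>R a j g = \<rho> j g *\<^sub>R b j k g + \<rho> j g *\<^sub>R a k g"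
        using ab[OF _ gB] f0'[OF gG] by (cases "g \<in> B' j") (auto simp: scaleR_add_right \<rho>_def)
    qed
    also have "\<dots> = (\<Sum>j\<le>k. \<rho> j g *\<^sub>R b j k g) + a k g"
      using \<rho>1[OF g] by (simp add: sum.distrib scaleR_sum_left[symmetric])
    finally have "s' g = i (\<Sum>j\<le>k. \<rho> j g *\<^sub>R b j k g) \<otimes>\<^bsub>H\<^esub> i (a k g) \<otimes>\<^bsub>H\<^esub> s0 g"
      using bV[OF gB] aV V by (simp add: s'_def i_add subspace_sum subspace_scale)
    also have "i (a k g) = t' k g \<otimes>\<^bsub>H\<^esub> inv\<^bsub>H\<^esub> s0 g"
      using gB gG t_c t_p s0[OF gG] by (simp add: a_def i_c)
    finally show ?thesis
      using bV[OF gB] V t_c[OF gB] s0[OF gG] by (simp add: H.m_assoc subspace_sum subspace_scale)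
  qed
  have sm: "smooth_at (mfd G) (mfd H) s' g" and ps: "p (s' g) = g" if g: "g \<in> carrier G" for g
  proof -
    obtain k where k: "g \<in> A' k" using cover[OF g] by blast
    have gB: "g \<in> B' k" using AB k by blast
    have gt: "g \<in> topspace (mtop (mfd G))" using g by simp
    have summand: "smooth_at (mfd G) (vec_mfd V) (\<lambda>g. \<rho> j g *\<^sub>R b j k g) g" for j
    proof (cases "g \<in> B' j")
      case True
      have ev: "\<forall>\<^sub>F z in nhdsin (mtop (mfd G)) g. z \<in> B' j \<and> z \<in> B' k"
        by (intro eventually_conj eventually_nhdsin_openin[OF Bop] True gB)
      have "smooth_at (mfd G) (vec_mfd V) (\<lambda>g. c (t' j g \<otimes>\<^bsub>H\<^esub> inv\<^bsub>H\<^esub> t' k g)) g"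
        by (intro smooth_at_c[OF MG] smooth_at_mult[OF lieH MG] smooth_at_inv[OF lieH MG] t_sm True gB
            eventually_mono[OF ev]) (use t_c t_p BG in auto)
      then have "smooth_at (mfd G) (vec_mfd V) (b j k) g"
        by (rule smooth_at_cong[OF MG _ eventually_mono[OF ev]]) (simp add: b_def)
      then show ?thesis by (rule smooth_at_scaleR[OF MG V \<rho>_sm[OF g]])
    next
      case False
      have "smooth_at (mfd G) (vec_mfd V) (\<lambda>g. 0) g"
        by (rule smooth_at_vec_const[OF MG V gt subspace_0[OF V]])
      then show ?thesis
        by (rule smooth_at_cong[OF MG _ eventually_mono[OF f0[OF g False]]]) (simp add: \<rho>_def)
    qed
    have "smooth_at (mfd G) (mfd H) (\<lambda>g. i (\<Sum>j\<le>k. \<rho> j g *\<^sub>R b j k g) \<otimes>\<^bsub>H\<^esub> t' k g) g"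
      by (intro smooth_at_mult[OF lieH MG] smooth_at_i[OF MG] smooth_at_sum[OF MG V gt] summand t_sm gB)
    then show "smooth_at (mfd G) (mfd H) s' g"
      by (rule smooth_at_cong[OF MG _ eventually_nhdsinI[OF Aop k]]) (simp add: loc)
    show "p (s' g) = g"
      using loc[OF k] bV[OF gB] V t_c[OF gB] t_p[OF gB] g by (simp add: subspace_sum subspace_scale)
  qed
  \<comment> \<open>The averaged section takes some value of the kernel at the unit; a constant left
    factor corrects this to the unit of the total group.\<close>
  define u where "u = - c (s' \<one>\<^bsub>G\<^esub>)"
  have s1: "s' \<one>\<^bsub>G\<^esub> \<in> carrier H" "p (s' \<one>\<^bsub>G\<^esub>) = \<one>\<^bsub>G\<^esub>"
    using smooth_at_carrier[OF lieH sm] ps by auto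
  have u: "u \<in> V" using c_closed[OF s1] V by (simp add: u_def subspace_neg)
  show thesis
  proof (rule that[of "\<lambda>g. i u \<otimes>\<^bsub>H\<^esub> s' g"])
    show "smooth_at (mfd G) (mfd H) (\<lambda>g. i u \<otimes>\<^bsub>H\<^esub> s' g) g" if "g \<in> carrier G" for g
      by (intro smooth_at_mult[OF lieH MG] smooth_at_group_const[OF lieH MG] sm) (use that u in auto)
    show "p (i u \<otimes>\<^bsub>H\<^esub> s' g) = g" if "g \<in> carrier G" for g
      using that u ps smooth_at_carrier[OF lieH sm[OF that]] by simp
    have "i u = inv\<^bsub>H\<^esub> s' \<one>\<^bsub>G\<^esub>" using i_minus[OF c_closed[OF s1]] i_c[OF s1] by (simp add: u_def)
    then show "i u \<otimes>\<^bsub>H\<^esub> s' \<one>\<^bsub>G\<^esub> = \<one>\<^bsub>H\<^esub>" using s1 by simp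
  qed
qed

end


section \<open>Smooth representations\<close>

lemma linear_endoD:
  assumes "linear_endo V A" and "subspace V"
  shows "u \<in> V \<Longrightarrow> A u \<in> V" "u \<in> V \<Longrightarrow> w \<in> V \<Longrightarrow> A (u + w) = A u + A w" "u \<in> V \<Longrightarrow> A (r *\<^sub>R u) = r *\<^sub>R A u"
    "A 0 = 0" "u \<in> V \<Longrightarrow> A (- u) = - A u" "u \<in> V \<Longrightarrow> w \<in> V \<Longrightarrow> A (u - w) = A u - A w"
proof -
  show 1: "u \<in> V \<Longrightarrow> A u \<in> V" "u \<in> V \<Longrightarrow> w \<in> V \<Longrightarrow> A (u + w) = A u + A w" "u \<in> V \<Longrightarrow> A (r *\<^sub>R u) = r *\<^sub>R A u" for u w r
    using assms(1) by (auto simp: linear_endo_def)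
  show "A 0 = 0" using 1(3)[of 0 0] subspace_0[OF assms(2)] by simp
  show 2: "u \<in> V \<Longrightarrow> A (- u) = - A u" for u using 1(3)[of u "-1"] by simp
  show "u \<in> V \<Longrightarrow> w \<in> V \<Longrightarrow> A (u - w) = A u - A w"
    using 1(2)[of u "- w"] 2[of w] subspace_neg[OF assms(2)] by simp
qed

lemma linear_endo_sum:
  assumes "linear_endo V A" "subspace V" "\<And>b. b \<in> B \<Longrightarrow> x b \<in> V"
  shows "A (\<Sum>b\<in>B. x b) = (\<Sum>b\<in>B. A (x b))"
  using assms(3)
proof (induction B rule: infinite_finite_induct)
  case (insert b B)
  then show ?case using linear_endoD[OF assms(1,2)] assms(2) by (simp add: subspace_sum)
qed (use linear_endoD(4)[OF assms(1,2)] in auto)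

text \<open>Expansion of \<open>u z\<close> in an orthonormal basis of \<open>V\<close> leaves
  finitely many evaluations \<open>A z b\<close> with smooth coefficients. Derivatives in the space
  of endomorphisms are thereby avoided.\<close>

lemma smooth_at_linear_endo:
  fixes M :: "('a, 'e::euclidean_space) manifold" and V :: "'v::euclidean_space set"
  assumes M: "smooth_manifold M" and V: "subspace V" and A: "\<And>z. z \<in> topspace (mtop M) \<Longrightarrow> linear_endo V (A z)"
    and sm: "\<And>b. b \<in> V \<Longrightarrow> smooth_at M (vec_mfd V) (\<lambda>z. A z b) x" and u: "smooth_at M (vec_mfd V) u x"
  shows "smooth_at M (vec_mfd V) (\<lambda>z. A z (u z)) x"
proof -
  have x: "x \<in> topspace (mtop M)" by (rule smooth_at_topspace[OF u])
  obtain B where B: "B \<subseteq> V" "pairwise orthogonal B" "\<And>x. x \<in> B \<Longrightarrow> norm x = 1" "independent B" "card B = dim V" "span B = V"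
    using orthonormal_basis_subspace[OF V] by metis
  have fin: "finite B" using B(4) by (rule independent_imp_finite)
  have exp: "(\<Sum>b\<in>B. (v \<bullet> b) *\<^sub>R b) = v" if "v \<in> V" for v
    using orthonormal_basis_expand[of B v] B fin that by (simp add: inner_commute)
  have "smooth_at M (vec_mfd V) (\<lambda>z. \<Sum>b\<in>B. (u z \<bullet> b) *\<^sub>R A z b) x"
  proof (intro smooth_at_sum[OF M V x] smooth_at_scaleR[OF M V] sm)
    fix b assume b: "b \<in> B"
    show "smooth_at M (vec_mfd UNIV) (\<lambda>z. u z \<bullet> b) x"
      by (rule smooth_at_vec_linear[OF M V u]) (auto intro: bounded_linear.linear bounded_linear_inner_left)
    show "b \<in> V" using b B by blast
  qed
  moreover have "\<forall>\<^sub>F z in nhdsin (mtop M) x. z \<in> topspace (mtop M) \<and> smooth_at M (vec_mfd V) u z"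
    by (intro eventually_conj eventually_nhdsin_topspace x smooth_at_near u)
  then have "\<forall>\<^sub>F z in nhdsin (mtop M) x. (\<Sum>b\<in>B. (u z \<bullet> b) *\<^sub>R A z b) = A z (u z)"
  proof eventually_elim
    case (elim z)
    have uz: "u z \<in> V" using smooth_at_codomain[OF smooth_manifold_vec[OF V]] elim by fastforce
    have lz: "linear_endo V (A z)" using A elim by blast
    have "A z (\<Sum>b\<in>B. (u z \<bullet> b) *\<^sub>R b) = (\<Sum>b\<in>B. A z ((u z \<bullet> b) *\<^sub>R b))"
      using B(1) V by (intro linear_endo_sum[OF lz V]) (auto intro: subspace_scale)
    also have "\<dots> = (\<Sum>b\<in>B. (u z \<bullet> b) *\<^sub>R A z b)"
      using B(1) linear_endoD(3)[OF lz V] by (intro sum.cong) auto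
    finally show ?case using exp[OF uz] by simp
  qed
  ultimately show ?thesis by (rule smooth_at_cong[OF M])
qed

locale lie_rep = G: group G for G :: "('g, 'e::euclidean_space) smooth_group" +
  fixes V :: "'v::euclidean_space set" and \<Theta> :: "'g \<Rightarrow> 'v \<Rightarrow> 'v"
  assumes lieG: "lie_group G" and V: "subspace V" and \<Theta>: "lie_hom G (GL_group V) \<Theta>"
begin

lemma \<Theta>_GL: "g \<in> carrier G \<Longrightarrow> \<Theta> g \<in> carrier (GL_group V)"
  using \<Theta> by (auto simp: lie_hom_def hom_def)

lemma \<Theta>_endo: "g \<in> carrier G \<Longrightarrow> linear_endo V (\<Theta> g)"
  using \<Theta>_GL by (auto simp: GL_group_def End_space_def Let_def)

lemma \<Theta>_bij: "g \<in> carrier G \<Longrightarrow> bij_betw (\<Theta> g) V V"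
  using \<Theta>_GL by (auto simp: GL_group_def Let_def)

lemma \<Theta>_closed: "g \<in> carrier G \<Longrightarrow> u \<in> V \<Longrightarrow> \<Theta> g u \<in> V"
  using linear_endoD(1)[OF \<Theta>_endo V] .

lemma \<Theta>_mult: "g \<in> carrier G \<Longrightarrow> h \<in> carrier G \<Longrightarrow> \<Theta> (g \<otimes>\<^bsub>G\<^esub> h) u = \<Theta> g (\<Theta> h u)"
  using \<Theta> by (auto simp: lie_hom_def hom_def GL_group_def Let_def)

text \<open>Membership in \<open>hom\<close> says nothing about units; the image of the unit is
  idempotent and injective on \<open>V\<close>, hence the identity there.\<close>

lemma \<Theta>_one: "u \<in> V \<Longrightarrow> \<Theta> \<one>\<^bsub>G\<^esub> u = u"
  using \<Theta>_mult[of "\<one>\<^bsub>G\<^esub>" "\<one>\<^bsub>G\<^esub>" u] \<Theta>_bij[of "\<one>\<^bsub>G\<^esub>"] \<Theta>_closed[of "\<one>\<^bsub>G\<^esub>" u]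
  by (auto simp: bij_betw_def dest: inj_onD)

lemma smooth_at_\<Theta>_const:
  assumes b: "b \<in> V" and g: "g \<in> carrier G"
  shows "smooth_at (mfd G) (vec_mfd V) (\<lambda>g. \<Theta> g b) g"
proof -
  note MG = lie_group_manifold[OF lieG] and tG = lie_group_topspace[OF lieG]
  obtain U \<phi> where U: "(U, \<phi>) \<in> atlas (mfd G)" "g \<in> U"
    using smooth_manifold_cover[OF MG] g tG by metis
  define C where "C = carrier (GL_group V)"
  have UC: "U \<inter> \<Theta> -` C = U" using chart_topspace[OF MG U(1)] \<Theta>_GL tG by (auto simp: C_def)
  have "(C, \<lambda>A. A) \<in> atlas (mfd (GL_group V))" by (simp add: GL_group_def Let_def C_def)
  then have "smooth_on (model (mfd G)) (\<phi> ` (U \<inter> \<Theta> -` C)) ((\<lambda>A. A) \<circ> \<Theta> \<circ> inv_into U \<phi>)"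
    using \<Theta> U(1) unfolding lie_hom_def smooth_map_def by fast
  then have "smooth_on (model (mfd G)) (\<phi> ` U) (\<Theta> \<circ> inv_into U \<phi>)" unfolding UC by (simp add: o_def)
  then have "smooth_on (model (mfd G)) (\<phi> ` U) (\<lambda>y. (\<Theta> \<circ> inv_into U \<phi>) y b)"
    by (rule smooth_on_linear_compose[OF _ _ continuous_on_product_coordinates]) (auto intro!: linearI simp: scaleR_fun_def)
  then show ?thesis
    using \<Theta>_closed[OF _ b] chart_topspace[OF MG U(1)] tG U(2)
    by (intro smooth_at_vecI[OF MG U(1) chart_openin[OF MG U(1)]]) (auto simp: o_def)
qed

lemma smooth_at_\<Theta>:
  fixes M :: "('a, 'h::euclidean_space) manifold"
  assumes M: "smooth_manifold M" and f: "\<And>z. z \<in> topspace (mtop M) \<Longrightarrow> f z \<in> carrier G"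
    and sm: "smooth_at M (mfd G) f x" "smooth_at M (vec_mfd V) u x"
  shows "smooth_at M (vec_mfd V) (\<lambda>z. \<Theta> (f z) (u z)) x"
proof (rule smooth_at_linear_endo[OF M V _ _ sm(2)])
  show "linear_endo V (\<Theta> (f z))" if "z \<in> topspace (mtop M)" for z using f[OF that] by (rule \<Theta>_endo)
  show "smooth_at M (vec_mfd V) (\<lambda>z. \<Theta> (f z) b) x" if b: "b \<in> V" for b
    by (rule smooth_at_compose'[OF M lie_group_manifold[OF lieG] sm(1) refl smooth_at_\<Theta>_const[OF b smooth_at_carrier[OF lieG sm(1)]]])
qed

end

section \<open>Cochains as functions on powers of the group\<close>

text \<open>Along a homeomorphism \<open>j\<close> whose coordinate form is a linear isomorphism
  \<open>L\<close> of model spaces, the charts of \<open>M\<close> and \<open>N\<close> correspond,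
  and so do the coordinate expressions of vector-valued maps. The coordinates of \<open>N\<close>
  need not be normed: this is how cochains, defined on powers with coordinates in a function space,
  become maps on \<open>G\<close> and on its square.\<close>

lemma smooth_map_vec_chart_transfer:
  fixes M :: "('a, 'e::euclidean_space) manifold" and N :: "('b, 'h::{real_vector,topological_space}) manifold"
    and V :: "'v::euclidean_space set"
  assumes M: "smooth_manifold M"
    and j: "continuous_map (mtop M) (mtop N) j" and k: "continuous_map (mtop N) (mtop M) k"
    and kj: "\<And>x. x \<in> topspace (mtop M) \<Longrightarrow> k (j x) = x" and jk: "\<And>y. y \<in> topspace (mtop N) \<Longrightarrow> j (k y) = y"
    and L: "continuous_on UNIV L" "\<And>x v t. L (x + t *\<^sub>R v) = L x + t *\<^sub>R L v" "\<And>v. v \<in> model M \<Longrightarrow> L v \<in> model N"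
    and L': "continuous_on UNIV L'" "\<And>x v t. L' (x + t *\<^sub>R v) = L' x + t *\<^sub>R L' v" "\<And>v. v \<in> model N \<Longrightarrow> L' v \<in> model M"
    and LL': "\<And>x. x \<in> model M \<Longrightarrow> L' (L x) = x" and L'L: "\<And>y. y \<in> model N \<Longrightarrow> L (L' y) = y"
    and N_add: "\<And>x v t. x \<in> model N \<Longrightarrow> v \<in> model N \<Longrightarrow> x + t *\<^sub>R v \<in> model N"
    and MN: "\<And>U \<phi>. (U, \<phi>) \<in> atlas M \<Longrightarrow> \<exists>\<psi>. (j ` U, \<psi>) \<in> atlas N \<and> (\<forall>x\<in>U. \<psi> (j x) = L (\<phi> x))"
    and NM: "\<And>U' \<psi>. (U', \<psi>) \<in> atlas N \<Longrightarrow> \<exists>U \<phi>. (U, \<phi>) \<in> atlas M \<and> U' = j ` U \<and> (\<forall>x\<in>U. \<psi> (j x) = L (\<phi> x))"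
  shows "smooth_map N (vec_mfd V) \<alpha> \<longleftrightarrow> smooth_map M (vec_mfd V) (\<alpha> \<circ> j)"
proof -
  have inv: "inv_into (j ` U) \<psi> (L (\<phi> x)) = j x"
    if c: "(U, \<phi>) \<in> atlas M" "\<forall>x\<in>U. \<psi> (j x) = L (\<phi> x)" "x \<in> U" for U \<phi> \<psi> x
  proof (rule inv_into_f_eq)
    show "inj_on \<psi> (j ` U)"
    proof (rule inj_onI)
      fix y z assume "y \<in> j ` U" "z \<in> j ` U" and eq: "\<psi> y = \<psi> z"
      then obtain a b where ab: "a \<in> U" "b \<in> U" "y = j a" "z = j b" by auto
      then have "L (\<phi> a) = L (\<phi> b)" using eq c(2) by simp
      then have "L' (L (\<phi> a)) = L' (L (\<phi> b))" by simp
      then have "\<phi> a = \<phi> b" using chart_mem_model[OF M c(1)] ab by (simp add: LL')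
      then show "y = z" using inj_onD[OF chart_inj[OF M c(1)], of a b] ab by simp
    qed
  qed (use c in auto)
  show ?thesis
  proof
    assume \<alpha>: "smooth_map N (vec_mfd V) \<alpha>"
    have cont: "continuous_map (mtop N) (top_of_set V) \<alpha>" using \<alpha> by (simp add: smooth_map_def)
    have "smooth_on (model M) (\<phi> ` U) (\<alpha> \<circ> j \<circ> inv_into U \<phi>)" if c: "(U, \<phi>) \<in> atlas M" for U \<phi>
    proof -
      obtain \<psi> where \<psi>: "(j ` U, \<psi>) \<in> atlas N" "\<forall>x\<in>U. \<psi> (j x) = L (\<phi> x)" using MN[OF c] by blast
      have UM: "x \<in> topspace (mtop M)" if "x \<in> U" for x using chart_topspace[OF M c] that by blast
      have "j ` U \<inter> \<alpha> -` V = j ` U"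
        using cont j UM by (force simp: continuous_map_def Pi_iff)
      then have "smooth_on (model N) (\<psi> ` j ` U) (\<alpha> \<circ> inv_into (j ` U) \<psi>)"
        using \<alpha> \<psi>(1) unfolding smooth_map_def by (fastforce simp: o_def)
      then have "smooth_on (model M) (\<phi> ` U) (\<lambda>y. (\<alpha> \<circ> inv_into (j ` U) \<psi>) (L y))"
        by (rule smooth_on_compose_linear)
          (use L \<psi>(2) in \<open>auto intro: continuous_on_subset simp: image_subset_iff image_image\<close>)
      then show ?thesis
        by (rule smooth_on_cong[OF _ chart_dir_open[OF M c chart_openin[OF M c] order_refl]])
          (use inv[OF c \<psi>(2)] chart_inv_into[OF M c] in auto)
    qed
    moreover have contj: "continuous_map (mtop M) (top_of_set V) (\<alpha> \<circ> j)"
      using j cont by (rule continuous_map_compose)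
    moreover have "U \<inter> (\<alpha> \<circ> j) -` V = U" if c: "(U, \<phi>) \<in> atlas M" for U \<phi>
      using contj chart_topspace[OF M c] by (force simp: continuous_map_def Pi_iff)
    ultimately show "smooth_map M (vec_mfd V) (\<alpha> \<circ> j)"
      unfolding smooth_map_def by (fastforce simp: o_def)
  next
    assume \<alpha>: "smooth_map M (vec_mfd V) (\<alpha> \<circ> j)"
    have cont: "continuous_map (mtop M) (top_of_set V) (\<alpha> \<circ> j)" using \<alpha> by (simp add: smooth_map_def)
    have contN: "continuous_map (mtop N) (top_of_set V) \<alpha>"
      by (rule continuous_map_eq[OF continuous_map_compose[OF k cont]]) (simp add: jk)
    have "smooth_on (model N) (\<psi> ` U') (\<alpha> \<circ> inv_into U' \<psi>)" and "U' \<inter> \<alpha> -` V = U'"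
      if c': "(U', \<psi>) \<in> atlas N" for U' \<psi>
    proof -
      obtain U \<phi> where c: "(U, \<phi>) \<in> atlas M" and U': "U' = j ` U" and \<psi>: "\<forall>x\<in>U. \<psi> (j x) = L (\<phi> x)"
        using NM[OF c'] by blast
      have UM: "x \<in> topspace (mtop M)" if "x \<in> U" for x using chart_topspace[OF M c] that by blast
      have 1: "U \<inter> (\<alpha> \<circ> j) -` V = U" using cont UM by (force simp: continuous_map_def Pi_iff)
      then show "U' \<inter> \<alpha> -` V = U'" by (auto simp: U')
      have im: "\<psi> ` U' = L ` \<phi> ` U" using \<psi> by (auto simp: U' image_image)
      have \<phi>M: "\<phi> x \<in> model M" if "x \<in> U" for x using chart_mem_model[OF M c that] .
      have d: "dir_open (model M) (\<phi> ` U)" by (rule chart_dir_open[OF M c chart_openin[OF M c] order_refl])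
      have "smooth_on (model M) (\<phi> ` (U \<inter> (\<alpha> \<circ> j) -` V)) (\<alpha> \<circ> j \<circ> inv_into U \<phi>)"
        using \<alpha> c unfolding smooth_map_def by (fastforce simp: o_def)
      then have "smooth_on (model M) (\<phi> ` U) (\<alpha> \<circ> j \<circ> inv_into U \<phi>)" unfolding 1 .
      then have "smooth_on (model N) (\<psi> ` U') (\<lambda>y. (\<alpha> \<circ> j \<circ> inv_into U \<phi>) (L' y))"
      proof (rule smooth_on_compose_linear)
        show "L' ` \<psi> ` U' \<subseteq> \<phi> ` U" using LL' \<phi>M by (auto simp: im)
      qed (use L' in \<open>auto intro: continuous_on_subset\<close>)
      then show "smooth_on (model N) (\<psi> ` U') (\<alpha> \<circ> inv_into U' \<psi>)"
      proof (rule smooth_on_cong)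
        \<comment> \<open>Openness of the chart image cannot be invoked in a type that is not
          normed; short segments are carried over from \<open>M\<close> by the linear maps.\<close>
        show "dir_open (model N) (\<psi> ` U')"
          unfolding dir_open_def
        proof (intro ballI)
          fix y v assume y: "y \<in> \<psi> ` U'" and v: "v \<in> model N"
          obtain x where x: "x \<in> U" "y = L (\<phi> x)" using y by (auto simp: im)
          have yN: "y \<in> model N" using x \<phi>M L(3) by simp
          have "\<forall>\<^sub>F t in at 0. \<phi> x + t *\<^sub>R L' v \<in> \<phi> ` U"
            using d x(1) L'(3)[OF v] by (simp add: dir_open_def)
          then show "\<forall>\<^sub>F t in at 0. y + t *\<^sub>R v \<in> \<psi> ` U'"
          proof eventually_elim
            case (elim t)
            have "L' (y + t *\<^sub>R v) = \<phi> x + t *\<^sub>R L' v" using x \<phi>M LL' by (simp add: L'(2))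
            then have "y + t *\<^sub>R v = L (\<phi> x + t *\<^sub>R L' v)"
              using L'L[OF N_add[OF yN v, of t]] by simp
            then show ?case using elim by (auto simp: im)
          qed
        qed
        fix y assume "y \<in> \<psi> ` U'"
        then obtain x where x: "x \<in> U" "y = L (\<phi> x)" by (auto simp: im)
        then show "(\<alpha> \<circ> j \<circ> inv_into U \<phi>) (L' y) = (\<alpha> \<circ> inv_into U' \<psi>) y"
          using inv[OF c \<psi> x(1)] chart_inv_into[OF M c x(1)] \<phi>M LL' by (simp add: U')
      qed
    qed
    then show "smooth_map N (vec_mfd V) \<alpha>"
      using contN unfolding smooth_map_def by (fastforce simp: o_def)
  qed
qed

section \<open>Powers with one and with two factors\<close>

lemma power_manifold_topspace:
  "topspace (mtop (power_manifold n M)) = {xs. length xs = n \<and> set xs \<subseteq> topspace (mtop M)}"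
  by (auto simp: power_manifold_def topspace_pullback_topology PiE_def Pi_def set_conv_nth)

lemma continuous_map_power_nth:
  assumes "i < n"
  shows "continuous_map (mtop (power_manifold n M)) (mtop M) (\<lambda>xs. xs ! i)"
proof -
  have "continuous_map (product_topology (\<lambda>i. mtop M) {..<n}) (mtop M) (\<lambda>x. x i)"
    using assms by (intro continuous_map_product_projection) auto
  from continuous_map_pullback[OF this, of "{xs. length xs = n}" "\<lambda>xs. \<lambda>i\<in>{..<n}. xs ! i"]
  show ?thesis using assms by (simp add: power_manifold_def o_def)
qed

lemma continuous_map_into_power:
  assumes "\<And>x. x \<in> topspace X \<Longrightarrow> length (f x) = n" "\<And>i. i < n \<Longrightarrow> continuous_map X (mtop M) (\<lambda>x. f x ! i)"
  shows "continuous_map X (mtop (power_manifold n M)) f"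
proof -
  have "continuous_map X (product_topology (\<lambda>i. mtop M) {..<n}) ((\<lambda>xs. \<lambda>i\<in>{..<n}. xs ! i) \<circ> f)"
    using assms(2) by (auto simp: continuous_map_componentwise)
  then show ?thesis
    unfolding power_manifold_def using assms(1) by (auto intro: continuous_map_pullback')
qed

lemma smooth_map_power_1:
  fixes M :: "('a, 'e::euclidean_space) manifold" and V :: "'v::euclidean_space set"
  assumes M: "smooth_manifold M"
  shows "smooth_map (power_manifold 1 M) (vec_mfd V) \<alpha> \<longleftrightarrow> smooth_map M (vec_mfd V) (\<lambda>g. \<alpha> [g])"
proof -
  note SM = smooth_manifold_model[OF M]
  let ?L = "\<lambda>a i. if i < (1::nat) then a else (0::'e)" and ?L' = "\<lambda>x::nat \<Rightarrow> 'e. x 0"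
  have "smooth_map (power_manifold 1 M) (vec_mfd V) \<alpha> \<longleftrightarrow> smooth_map M (vec_mfd V) (\<alpha> \<circ> (\<lambda>g. [g]))"
  proof (rule smooth_map_vec_chart_transfer[OF M, where k = "\<lambda>xs. xs ! 0" and L = ?L and L' = ?L'])
    show "continuous_map (mtop M) (mtop (power_manifold 1 M)) (\<lambda>g. [g])"
      by (rule continuous_map_into_power) (auto simp: continuous_map_id[unfolded id_def])
    show "continuous_map (mtop (power_manifold 1 M)) (mtop M) (\<lambda>xs. xs ! 0)"
      by (rule continuous_map_power_nth) simp
    show "[y ! 0] = y" if "y \<in> topspace (mtop (power_manifold 1 M))" for y
      using that by (cases y) (auto simp: power_manifold_topspace)
    show "continuous_on UNIV ?L"
    proof (rule continuous_on_coordinatewise_then_product)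
      show "continuous_on UNIV (\<lambda>a. ?L a i)" for i
        by (cases i) (auto intro: continuous_intros)
    qed
    show "continuous_on UNIV ?L'" by (rule continuous_on_product_coordinates)
    show "\<exists>\<psi>. ((\<lambda>g. [g]) ` U, \<psi>) \<in> atlas (power_manifold 1 M) \<and> (\<forall>x\<in>U. \<psi> [x] = ?L (\<phi> x))"
      if "(U, \<phi>) \<in> atlas M" for U \<phi>
    proof (intro exI conjI ballI)
      show "((\<lambda>g. [g]) ` U, \<lambda>xs i. if i < 1 then \<phi> (xs ! i) else 0) \<in> atlas (power_manifold 1 M)"
        using that by (auto simp: power_manifold_def length_Suc_conv fun_eq_iff intro!: exI[of _ "\<lambda>i. (U, \<phi>)"])
    qed auto
    show "\<exists>U \<phi>. (U, \<phi>) \<in> atlas M \<and> U' = (\<lambda>g. [g]) ` U \<and> (\<forall>x\<in>U. \<psi> [x] = ?L (\<phi> x))"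
      if c: "(U', \<psi>) \<in> atlas (power_manifold 1 M)" for U' \<psi>
    proof -
      obtain c where "U' = {xs. length xs = 1 \<and> (\<forall>i<1. xs ! i \<in> fst (c i))}"
        "\<psi> = (\<lambda>xs i. if i < 1 then snd (c i) (xs ! i) else 0)" "\<forall>i<1. c i \<in> atlas M"
        using c by (auto simp: power_manifold_def)
      then show ?thesis
        by (intro exI[of _ "fst (c 0)"] exI[of _ "snd (c 0)"]) (auto simp: length_Suc_conv)
    qed
  qed (auto simp: power_manifold_def fun_eq_iff scaleR_fun_def intro: subspace_add[OF SM] subspace_scale[OF SM])
  then show ?thesis by (simp add: o_def)
qed

lemma smooth_map_power_2:
  fixes M :: "('a, 'e::euclidean_space) manifold" and V :: "'v::euclidean_space set"
  assumes M: "smooth_manifold M"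
  shows "smooth_map (power_manifold 2 M) (vec_mfd V) \<alpha> \<longleftrightarrow>
    smooth_map (prod_manifold M M) (vec_mfd V) (\<lambda>z. \<alpha> [fst z, snd z])"
proof -
  note SM = smooth_manifold_model[OF M]
  let ?j = "\<lambda>z::'a \<times> 'a. [fst z, snd z]"
  let ?L = "\<lambda>a i. if i < (2::nat) then (if i = 0 then fst a else snd a) else (0::'e)" and ?L' = "\<lambda>x::nat \<Rightarrow> 'e. (x 0, x 1)"
  have i2: "(\<forall>i<2. P i) \<longleftrightarrow> P 0 \<and> P (1::nat)" for P by (auto simp: less_2_cases_iff)
  have im2: "?j ` (A \<times> B) = {xs. length xs = 2 \<and> xs ! 0 \<in> A \<and> xs ! 1 \<in> B}" for A B
  proof
    show "{xs. length xs = 2 \<and> xs ! 0 \<in> A \<and> xs ! 1 \<in> B} \<subseteq> ?j ` (A \<times> B)"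
    proof
      fix xs assume xs: "xs \<in> {xs. length xs = 2 \<and> xs ! 0 \<in> A \<and> xs ! 1 \<in> B}"
      then obtain a b where "xs = [a, b]" by (auto simp: numeral_2_eq_2 length_Suc_conv)
      with xs show "xs \<in> ?j ` (A \<times> B)" by (intro image_eqI[of _ _ "(a, b)"]) auto
    qed
  qed auto
  have "smooth_map (power_manifold 2 M) (vec_mfd V) \<alpha> \<longleftrightarrow> smooth_map (prod_manifold M M) (vec_mfd V) (\<alpha> \<circ> ?j)"
  proof (rule smooth_map_vec_chart_transfer[OF smooth_manifold_prod[OF M M],
        where k = "\<lambda>xs. (xs ! 0, xs ! 1)" and L = ?L and L' = ?L'])
    show "continuous_map (mtop (prod_manifold M M)) (mtop (power_manifold 2 M)) ?j"
      by (rule continuous_map_into_power) (auto simp: less_2_cases_iff continuous_map_fst continuous_map_snd)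
    show "continuous_map (mtop (power_manifold 2 M)) (mtop (prod_manifold M M)) (\<lambda>xs. (xs ! 0, xs ! 1))"
      by (simp add: continuous_map_pairwise o_def continuous_map_power_nth)
    show "?j (y ! 0, y ! 1) = y" if "y \<in> topspace (mtop (power_manifold 2 M))" for y
      using that by (auto simp: power_manifold_topspace numeral_2_eq_2 length_Suc_conv)
    show "continuous_on UNIV ?L"
    proof (rule continuous_on_coordinatewise_then_product)
      show "continuous_on UNIV (\<lambda>a. ?L a i)" for i
        by (cases "i < 2"; cases "i = 0") (auto intro: continuous_intros)
    qed
    show "continuous_on UNIV ?L'" by (intro continuous_on_Pair continuous_on_product_coordinates)
    show "\<exists>\<psi>. (?j ` U, \<psi>) \<in> atlas (power_manifold 2 M) \<and> (\<forall>x\<in>U. \<psi> (?j x) = ?L (\<phi> x))"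
      if "(U, \<phi>) \<in> atlas (prod_manifold M M)" for U \<phi>
    proof -
      obtain A \<kappa> B \<xi> where c: "U = A \<times> B" "\<phi> = map_prod \<kappa> \<xi>" "(A, \<kappa>) \<in> atlas M" "(B, \<xi>) \<in> atlas M"
        using \<open>(U, \<phi>) \<in> _\<close> by (auto simp: prod_manifold_def)
      define cc where "cc i = (if i = 0 then (A, \<kappa>) else (B, \<xi>))" for i :: nat
      have jU: "?j ` U = {xs. length xs = 2 \<and> (\<forall>i<2. xs ! i \<in> fst (cc i))}"
        unfolding i2 c(1) im2 by (simp add: cc_def)
      show ?thesis
      proof (intro exI conjI ballI)
        have "\<forall>i<2. cc i \<in> atlas M" using c(3,4) by (simp add: cc_def)
        then show "(?j ` U, \<lambda>xs i. if i < 2 then snd (cc i) (xs ! i) else 0) \<in> atlas (power_manifold 2 M)"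
          unfolding power_manifold_def manifold.select_convs jU by blast
      qed (auto simp: c cc_def fun_eq_iff)
    qed
    show "\<exists>U \<phi>. (U, \<phi>) \<in> atlas (prod_manifold M M) \<and> U' = ?j ` U \<and> (\<forall>x\<in>U. \<psi> (?j x) = ?L (\<phi> x))"
      if c: "(U', \<psi>) \<in> atlas (power_manifold 2 M)" for U' \<psi>
    proof -
      obtain c where c: "U' = {xs. length xs = 2 \<and> (\<forall>i<2. xs ! i \<in> fst (c i))}"
        "\<psi> = (\<lambda>xs i. if i < 2 then snd (c i) (xs ! i) else 0)" "\<forall>i<2. c i \<in> atlas M"
        using c by (auto simp: power_manifold_def)
      show ?thesis
      proof (intro exI conjI ballI)
        show "(fst (c 0) \<times> fst (c 1), map_prod (snd (c 0)) (snd (c 1))) \<in> atlas (prod_manifold M M)"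
          using c(3) by (intro prod_manifold_atlas) auto
        show "U' = ?j ` (fst (c 0) \<times> fst (c 1))"
          unfolding c(1) i2 im2 ..
      qed (auto simp: c(2) fun_eq_iff less_2_cases_iff)
    qed
    show "x + t *\<^sub>R v \<in> model (power_manifold 2 M)"
      if "x \<in> model (power_manifold 2 M)" "v \<in> model (power_manifold 2 M)" for x v t
      using that by (simp add: power_manifold_def i2 scaleR_fun_def subspace_add[OF SM] subspace_scale[OF SM])
  qed (auto simp: power_manifold_def fun_eq_iff scaleR_fun_def less_2_cases_iff prod_eq_iff intro: subspace_add[OF SM] subspace_scale[OF SM])
  then show ?thesis by (simp add: o_def)
qed

section \<open>Cocycles of degree two\<close>

lemma tuples_1: "gs \<in> tuples G 1 \<longleftrightarrow> (\<exists>g\<in>carrier G. gs = [g])"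
  by (cases gs) (auto simp: tuples_def)

lemmas tuples_Suc_0 = tuples_1[unfolded One_nat_def]

lemma tuples_2: "gs \<in> tuples G 2 \<longleftrightarrow> (\<exists>g\<in>carrier G. \<exists>h\<in>carrier G. gs = [g, h])"
  by (auto simp: tuples_def numeral_2_eq_2 length_Suc_conv)

lemma tuples_3: "gs \<in> tuples G 3 \<longleftrightarrow> (\<exists>g\<in>carrier G. \<exists>h\<in>carrier G. \<exists>k\<in>carrier G. gs = [g, h, k])"
  by (auto simp: tuples_def numeral_3_eq_3 length_Suc_conv)

lemma (in group) inv_mult_cancel: "x \<in> carrier G \<Longrightarrow> y \<in> carrier G \<Longrightarrow> inv x \<otimes> (x \<otimes> y) = y"
  by (simp add: m_assoc[symmetric])

locale difference_module = lie_rep G V \<Theta>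
  for G :: "('g, 'e::euclidean_space) smooth_group" and V :: "'v::euclidean_space set" and \<Theta> :: "'g \<Rightarrow> 'v \<Rightarrow> 'v" +
  fixes D :: "'g \<Rightarrow> 'g" and T :: "'v \<Rightarrow> 'v"
  assumes diff_G: "difference_lie_group G D" and rep: "difference_rep G D V T \<Theta>"
begin

lemmas MG = lie_group_manifold[OF lieG] and MV = smooth_manifold_vec[OF V]
lemmas tG [simp] = lie_group_topspace[OF lieG]

lemma T_endo: "linear_endo V T"
  using rep by (simp add: difference_rep_def)

lemmas T_lin = linear_endoD[OF T_endo V] and \<Theta>_lin = linear_endoD[OF \<Theta>_endo V]
lemmas V_closed = subspace_add[OF V] subspace_diff[OF V] subspace_neg[OF V] subspace_0[OF V]

lemma smooth_D: "g \<in> carrier G \<Longrightarrow> smooth_at (mfd G) (mfd G) D g"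
  using diff_G by (intro smooth_map_smooth_at[OF MG MG]) (auto simp: difference_lie_group_def)

lemma D_closed [simp]: "g \<in> carrier G \<Longrightarrow> D g \<in> carrier G"
  by (rule smooth_at_carrier[OF lieG smooth_D])

definition E :: "'g \<Rightarrow> 'g" where "E g = D g \<otimes>\<^bsub>G\<^esub> g"

lemma E_closed [simp]: "g \<in> carrier G \<Longrightarrow> E g \<in> carrier G"
  by (simp add: E_def)

lemma E_mult: "g \<in> carrier G \<Longrightarrow> h \<in> carrier G \<Longrightarrow> E (g \<otimes>\<^bsub>G\<^esub> h) = E g \<otimes>\<^bsub>G\<^esub> E h"
  using diff_G by (simp add: E_def difference_lie_group_def G.m_assoc G.inv_mult_cancel)

lemma E_one [simp]: "E \<one>\<^bsub>G\<^esub> = \<one>\<^bsub>G\<^esub>"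
  using E_mult[of "\<one>\<^bsub>G\<^esub>" "\<one>\<^bsub>G\<^esub>"] by (simp add: G.l_cancel_one')

lemma D_one [simp]: "D \<one>\<^bsub>G\<^esub> = \<one>\<^bsub>G\<^esub>"
  using E_one by (simp add: E_def)

text \<open>Read with \<open>E\<close>, the compatibility condition of a representation says that
  \<open>T\<close> plus the identity intertwines \<open>\<Theta> g\<close> with
  \<open>\<Theta> (E g)\<close>.\<close>

lemma rep_E: "g \<in> carrier G \<Longrightarrow> u \<in> V \<Longrightarrow> T (\<Theta> g u) + \<Theta> g u = \<Theta> (E g) (T u + u)"
  using rep by (simp add: difference_rep_def E_def \<Theta>_lin T_lin)

lemma cochain_1_iff:
  "\<beta> \<in> group_cochains G V 1 \<longleftrightarrow> (\<forall>g\<in>carrier G. smooth_at (mfd G) (vec_mfd V) (\<lambda>g. \<beta> [g]) g) \<and>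
     \<beta> [\<one>\<^bsub>G\<^esub>] = 0 \<and> (\<forall>gs. gs \<notin> tuples G 1 \<longrightarrow> \<beta> gs = 0)"
proof -
  have "smooth_map (power_manifold 1 (mfd G)) (vec_mfd V) \<beta> \<longleftrightarrow>
      (\<forall>g\<in>carrier G. smooth_at (mfd G) (vec_mfd V) (\<lambda>g. \<beta> [g]) g)"
    unfolding smooth_map_power_1[OF MG]
    using smooth_map_smooth_at[OF MG MV] smooth_mapI[OF MG MV] by fastforce
  then show ?thesis unfolding group_cochains_def by (auto simp: tuples_Suc_0)
qed

lemma cochain_2_iff:
  "\<alpha> \<in> group_cochains G V 2 \<longleftrightarrow>
     (\<forall>z\<in>carrier G \<times> carrier G. smooth_at (prod_manifold (mfd G) (mfd G)) (vec_mfd V) (\<lambda>z. \<alpha> [fst z, snd z]) z) \<and>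
     (\<forall>g\<in>carrier G. \<alpha> [g, \<one>\<^bsub>G\<^esub>] = 0 \<and> \<alpha> [\<one>\<^bsub>G\<^esub>, g] = 0) \<and> (\<forall>gs. gs \<notin> tuples G 2 \<longrightarrow> \<alpha> gs = 0)"
proof -
  note MGG = smooth_manifold_prod[OF MG MG]
  have "smooth_map (power_manifold 2 (mfd G)) (vec_mfd V) \<alpha> \<longleftrightarrow>
      (\<forall>z\<in>carrier G \<times> carrier G. smooth_at (prod_manifold (mfd G) (mfd G)) (vec_mfd V) (\<lambda>z. \<alpha> [fst z, snd z]) z)"
    unfolding smooth_map_power_2[OF MG]
    using smooth_map_smooth_at[OF MGG MV] smooth_mapI[OF MGG MV] by fastforce
  then show ?thesis unfolding group_cochains_def by (auto simp: tuples_2)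
qed

lemma cochain_1_closed: "\<beta> \<in> group_cochains G V 1 \<Longrightarrow> g \<in> carrier G \<Longrightarrow> \<beta> [g] \<in> V"
  using smooth_at_codomain[OF MV] unfolding cochain_1_iff by fastforce

lemma cochain_2_closed: "\<alpha> \<in> group_cochains G V 2 \<Longrightarrow> g \<in> carrier G \<Longrightarrow> h \<in> carrier G \<Longrightarrow> \<alpha> [g, h] \<in> V"
  using smooth_at_codomain[OF MV] unfolding cochain_2_iff by fastforce

definition gam :: "('g list \<Rightarrow> 'v) \<Rightarrow> ('g list \<Rightarrow> 'v) \<Rightarrow> 'g \<Rightarrow> 'v"
  where "gam \<alpha> \<beta> g = \<beta> [g] + \<alpha> [D g, g]"

text \<open>The operator \<open>E g = D g \<cdot> g\<close> is a homomorphism, and in terms of \<open>\<gamma> g = \<beta> g + \<alpha> (D g, g)\<close> the second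
  cocycle condition says that it lifts to a homomorphism of the extension.\<close>

lemma cocycle_iff:
  "(\<alpha>, \<beta>) \<in> carrier (cocycle_group G D V T \<Theta> 2) \<longleftrightarrow> \<alpha> \<in> group_cochains G V 2 \<and> \<beta> \<in> group_cochains G V 1 \<and>
    (\<forall>g\<in>carrier G. \<forall>h\<in>carrier G. \<forall>k\<in>carrier G. \<Theta> g (\<alpha> [h, k]) + \<alpha> [g, h \<otimes>\<^bsub>G\<^esub> k] = \<alpha> [g \<otimes>\<^bsub>G\<^esub> h, k] + \<alpha> [g, h]) \<and>
    (\<forall>g\<in>carrier G. \<forall>h\<in>carrier G. gam \<alpha> \<beta> g + \<Theta> (E g) (gam \<alpha> \<beta> h) + \<alpha> [E g, E h] =
       T (\<alpha> [g, h]) + \<alpha> [g, h] + gam \<alpha> \<beta> (g \<otimes>\<^bsub>G\<^esub> h))"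
proof -
  have 1: "group_coboundary G \<Theta> 2 \<alpha> = 0 \<longleftrightarrow>
    (\<forall>g\<in>carrier G. \<forall>h\<in>carrier G. \<forall>k\<in>carrier G. \<Theta> g (\<alpha> [h, k]) + \<alpha> [g, h \<otimes>\<^bsub>G\<^esub> k] = \<alpha> [g \<otimes>\<^bsub>G\<^esub> h, k] + \<alpha> [g, h])"
  proof -
    have "group_coboundary G \<Theta> 2 \<alpha> = 0 \<longleftrightarrow> (\<forall>gs\<in>tuples G 3. group_coboundary G \<Theta> 2 \<alpha> gs = 0)"
      by (auto simp: fun_eq_iff group_coboundary_def)
    also have "\<dots> \<longleftrightarrow> (\<forall>g\<in>carrier G. \<forall>h\<in>carrier G. \<forall>k\<in>carrier G. group_coboundary G \<Theta> 2 \<alpha> [g, h, k] = 0)"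
      by (auto simp: tuples_3)
    also have "\<dots> \<longleftrightarrow> (\<forall>g\<in>carrier G. \<forall>h\<in>carrier G. \<forall>k\<in>carrier G. \<Theta> g (\<alpha> [h, k]) + \<alpha> [g, h \<otimes>\<^bsub>G\<^esub> k] = \<alpha> [g \<otimes>\<^bsub>G\<^esub> h, k] + \<alpha> [g, h])"
    proof (intro ball_cong refl)
      fix g h k assume "g \<in> carrier G" "h \<in> carrier G" "k \<in> carrier G"
      then have "group_coboundary G \<Theta> 2 \<alpha> [g, h, k] =
          (\<Theta> g (\<alpha> [h, k]) + \<alpha> [g, h \<otimes>\<^bsub>G\<^esub> k]) - (\<alpha> [g \<otimes>\<^bsub>G\<^esub> h, k] + \<alpha> [g, h])"
        by (simp add: group_coboundary_def tuples_def numeral_2_eq_2 sum.atLeast_Suc_atMost algebra_simps)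
      then show "group_coboundary G \<Theta> 2 \<alpha> [g, h, k] = 0 \<longleftrightarrow>
          \<Theta> g (\<alpha> [h, k]) + \<alpha> [g, h \<otimes>\<^bsub>G\<^esub> k] = \<alpha> [g \<otimes>\<^bsub>G\<^esub> h, k] + \<alpha> [g, h]"
        by (simp only: right_minus_eq)
    qed
    finally show ?thesis .
  qed
  define F where "F = group_coboundary G (rep_D G D \<Theta>) 1 \<beta> + K_map G D T \<Theta> 2 \<alpha>"
  have 2: "F = 0 \<longleftrightarrow>
    (\<forall>g\<in>carrier G. \<forall>h\<in>carrier G. gam \<alpha> \<beta> g + \<Theta> (E g) (gam \<alpha> \<beta> h) + \<alpha> [E g, E h] =
       T (\<alpha> [g, h]) + \<alpha> [g, h] + gam \<alpha> \<beta> (g \<otimes>\<^bsub>G\<^esub> h))"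
    if ab: "\<alpha> \<in> group_cochains G V 2" "\<beta> \<in> group_cochains G V 1"
  proof -
    have "F = 0 \<longleftrightarrow> (\<forall>gs\<in>tuples G 2. F gs = 0)"
      unfolding F_def fun_eq_iff by (auto simp: group_coboundary_def K_map_def numeral_2_eq_2)
    also have "\<dots> \<longleftrightarrow> (\<forall>g\<in>carrier G. \<forall>h\<in>carrier G. F [g, h] = 0)"
      by (auto simp: tuples_2)
    also have "\<dots> \<longleftrightarrow> (\<forall>g\<in>carrier G. \<forall>h\<in>carrier G. gam \<alpha> \<beta> g + \<Theta> (E g) (gam \<alpha> \<beta> h) + \<alpha> [E g, E h] =
       T (\<alpha> [g, h]) + \<alpha> [g, h] + gam \<alpha> \<beta> (g \<otimes>\<^bsub>G\<^esub> h))"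
    proof (intro ball_cong refl)
      fix g h assume gh: "g \<in> carrier G" "h \<in> carrier G"
      \<comment> \<open>\<open>\<Theta> (E g)\<close> is additive on \<open>V\<close> only, so the
        values of \<open>\<alpha>\<close> and \<open>\<beta>\<close> must be known to lie in
        \<open>V\<close>; this is why the equivalence is stated for cochains.\<close>
      have lin: "\<Theta> (E g) (gam \<alpha> \<beta> h) = \<Theta> (E g) (\<beta> [h]) + \<Theta> (E g) (\<alpha> [D h, h])"
        unfolding gam_def using gh ab by (intro \<Theta>_lin(2)) (auto intro: cochain_1_closed cochain_2_closed)
      have c1: "group_coboundary G (rep_D G D \<Theta>) 1 \<beta> [g, h] = \<Theta> (E g) (\<beta> [h]) - \<beta> [g \<otimes>\<^bsub>G\<^esub> h] + \<beta> [g]"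
        using gh by (simp add: group_coboundary_def tuples_def rep_D_def E_def flip: numeral_2_eq_2)
      have c2: "K_map G D T \<Theta> 2 \<alpha> [g, h] =
         \<alpha> [D g, g] - \<alpha> [D (g \<otimes>\<^bsub>G\<^esub> h), g \<otimes>\<^bsub>G\<^esub> h] + \<Theta> (E g) (\<alpha> [D h, h]) +
         (\<alpha> [E g, E h] - T (\<alpha> [g, h]) - \<alpha> [g, h])"
        using gh by (simp add: K_map_def K_prime_def K_hat_def tuples_def E_def)
      have "F [g, h] = gam \<alpha> \<beta> g + \<Theta> (E g) (gam \<alpha> \<beta> h) + \<alpha> [E g, E h] -
          (T (\<alpha> [g, h]) + \<alpha> [g, h] + gam \<alpha> \<beta> (g \<otimes>\<^bsub>G\<^esub> h))"
        unfolding lin unfolding F_def plus_fun_apply c1 c2 gam_def by (simp add: algebra_simps)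
      then show "F [g, h] = 0 \<longleftrightarrow> gam \<alpha> \<beta> g + \<Theta> (E g) (gam \<alpha> \<beta> h) + \<alpha> [E g, E h] =
         T (\<alpha> [g, h]) + \<alpha> [g, h] + gam \<alpha> \<beta> (g \<otimes>\<^bsub>G\<^esub> h)"
        by simp
    qed
    finally show ?thesis .
  qed
  have "(\<alpha>, \<beta>) \<in> carrier (cocycle_group G D V T \<Theta> 2) \<longleftrightarrow>
      (\<alpha> \<in> group_cochains G V 2 \<and> \<beta> \<in> group_cochains G V 1) \<and> group_coboundary G \<Theta> 2 \<alpha> = 0 \<and> F = 0"
    by (simp add: cocycle_group_def cochains_def coboundary_def F_def zero_prod_def)
  then show ?thesis using 1 2 by blast
qed

definition cob :: "('g list \<Rightarrow> 'v) \<Rightarrow> ('g list \<Rightarrow> 'v) \<times> ('g list \<Rightarrow> 'v)"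
  where "cob \<theta> = coboundary G D T \<Theta> 1 (\<theta>, 0)"

lemma coboundaries_2: "coboundaries G D V T \<Theta> 2 = cob ` group_cochains G V 1"
  by (auto simp: coboundaries_def cochains_def cob_def image_def)

lemma cob_eval:
  assumes "g \<in> carrier G" "h \<in> carrier G"
  shows "fst (cob \<theta>) [g, h] = \<Theta> g (\<theta> [h]) - \<theta> [g \<otimes>\<^bsub>G\<^esub> h] + \<theta> [g]"
    "snd (cob \<theta>) [g] = T (\<theta> [g]) + \<theta> [g] - \<Theta> (D g) (\<theta> [g]) - \<theta> [D g]"
  using assms
  by (simp_all add: cob_def coboundary_def group_coboundary_def K_map_def K_prime_def K_hat_def tuples_def E_def)

lemma cob_outside: "gs \<notin> tuples G 2 \<Longrightarrow> fst (cob \<theta>) gs = 0" "gs \<notin> tuples G 1 \<Longrightarrow> snd (cob \<theta>) gs = 0"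
  by (simp_all add: cob_def coboundary_def group_coboundary_def K_map_def numeral_2_eq_2)

lemma pair_fun_eqI:
  assumes "\<And>g h. g \<in> carrier G \<Longrightarrow> h \<in> carrier G \<Longrightarrow> fst x [g, h] = fst y [g, h]"
    "\<And>g. g \<in> carrier G \<Longrightarrow> snd x [g] = snd y [g]"
    "\<And>gs. gs \<notin> tuples G 2 \<Longrightarrow> fst x gs = fst y gs" "\<And>gs. gs \<notin> tuples G 1 \<Longrightarrow> snd x gs = snd y gs"
  shows "x = (y :: ('g list \<Rightarrow> 'v) \<times> ('g list \<Rightarrow> 'v))"
proof (rule prod_eqI; rule ext)
  show "fst x gs = fst y gs" for gs
    by (cases "gs \<in> tuples G 2") (use assms(1,3) in \<open>auto simp: tuples_2\<close>)
  show "snd x gs = snd y gs" for gs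
    by (cases "gs \<in> tuples G 1") (use assms(2,4) in \<open>auto simp: tuples_Suc_0\<close>)
qed

lemma cochain_1_add: "\<theta> \<in> group_cochains G V 1 \<Longrightarrow> \<eta> \<in> group_cochains G V 1 \<Longrightarrow> \<theta> + \<eta> \<in> group_cochains G V 1"
  unfolding cochain_1_iff by (auto intro!: smooth_at_add[OF MG V])

lemma cochain_1_minus: "\<theta> \<in> group_cochains G V 1 \<Longrightarrow> - \<theta> \<in> group_cochains G V 1"
  unfolding cochain_1_iff
  by (auto intro!: smooth_at_vec_linear[OF MG V, where h = uminus] simp: V_closed bounded_linear.linear[OF bounded_linear_minus[OF bounded_linear_ident]])

lemma cob_add:
  assumes "\<theta> \<in> group_cochains G V 1" "\<eta> \<in> group_cochains G V 1"
  shows "cob (\<theta> + \<eta>) = cob \<theta> + cob \<eta>"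
  by (rule pair_fun_eqI)
    (use assms in \<open>auto simp: cob_eval cob_outside \<Theta>_lin(2) T_lin(2) cochain_1_closed\<close>)

lemma cob_minus:
  assumes "\<theta> \<in> group_cochains G V 1"
  shows "cob (- \<theta>) = - cob \<theta>"
  by (rule pair_fun_eqI)
    (use assms in \<open>auto simp: cob_eval cob_outside \<Theta>_lin(5) T_lin(5) cochain_1_closed\<close>)

lemma cohomology_class_eq:
  "cohomology_class G D V T \<Theta> 2 c = (\<lambda>\<theta>. cob \<theta> + c) ` group_cochains G V 1"
  by (auto simp: cohomology_class_def r_coset_def coboundaries_2 cocycle_group_def)

lemma cohomology_class_eq_iff:
  "cohomology_class G D V T \<Theta> 2 c = cohomology_class G D V T \<Theta> 2 d \<longleftrightarrow> (\<exists>\<theta>\<in>group_cochains G V 1. c = cob \<theta> + d)"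
proof
  have zero: "0 \<in> group_cochains G V 1"
    unfolding cochain_1_iff using smooth_at_vec_const[OF MG V _ subspace_0[OF V]] by simp
  have "cob 0 = 0" by (rule pair_fun_eqI) (auto simp: cob_eval cob_outside \<Theta>_lin(4) T_lin(4))
  then have self: "c \<in> cohomology_class G D V T \<Theta> 2 c"
    unfolding cohomology_class_eq using zero by (intro image_eqI[of _ _ 0]) auto
  assume "cohomology_class G D V T \<Theta> 2 c = cohomology_class G D V T \<Theta> 2 d"
  then show "\<exists>\<theta>\<in>group_cochains G V 1. c = cob \<theta> + d"
    using self unfolding cohomology_class_eq by auto
next
  assume "\<exists>\<theta>\<in>group_cochains G V 1. c = cob \<theta> + d"
  then obtain \<theta> where \<theta>: "\<theta> \<in> group_cochains G V 1" "c = cob \<theta> + d" by blast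
  show "cohomology_class G D V T \<Theta> 2 c = cohomology_class G D V T \<Theta> 2 d"
    unfolding cohomology_class_eq
  proof (intro equalityI subsetI)
    fix x assume "x \<in> (\<lambda>\<theta>. cob \<theta> + c) ` group_cochains G V 1"
    then obtain \<eta> where \<eta>: "\<eta> \<in> group_cochains G V 1" "x = cob \<eta> + c" by blast
    have "\<eta> + \<theta> \<in> group_cochains G V 1" by (rule cochain_1_add[OF \<eta>(1) \<theta>(1)])
    moreover have "x = cob (\<eta> + \<theta>) + d"
      unfolding cob_add[OF \<eta>(1) \<theta>(1)] using \<theta> \<eta> by (simp add: add.assoc)
    ultimately show "x \<in> (\<lambda>\<theta>. cob \<theta> + d) ` group_cochains G V 1" by blast
  next
    fix x assume "x \<in> (\<lambda>\<theta>. cob \<theta> + d) ` group_cochains G V 1"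
    then obtain \<eta> where \<eta>: "\<eta> \<in> group_cochains G V 1" "x = cob \<eta> + d" by blast
    then have "\<eta> + - \<theta> \<in> group_cochains G V 1" using \<theta> by (intro cochain_1_add cochain_1_minus)
    moreover have "x = cob (\<eta> + - \<theta>) + c"
      using \<theta> \<eta> cob_add[OF \<eta>(1) cochain_1_minus[OF \<theta>(1)]] cob_minus[OF \<theta>(1)] by simp
    ultimately show "x \<in> (\<lambda>\<theta>. cob \<theta> + c) ` group_cochains G V 1" by blast
  qed
qed

lemma carrier_cohomology_group:
  "carrier (cohomology_group G D V T \<Theta> 2) = cohomology_class G D V T \<Theta> 2 ` carrier (cocycle_group G D V T \<Theta> 2)"
  by (auto simp: cohomology_group_def FactGroup_def RCOSETS_def cohomology_class_def)

end

section \<open>The cocycle of a section\<close>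

locale difference_extension = difference_module G V \<Theta> D T
  for G :: "('g, 'e::euclidean_space) smooth_group" and V :: "'v::euclidean_space set" and \<Theta> :: "'g \<Rightarrow> 'v \<Rightarrow> 'v"
    and D :: "'g \<Rightarrow> 'g" and T :: "'v \<Rightarrow> 'v" +
  fixes X :: "('p, 'f::euclidean_space, 'v, 'g) extension"
  assumes X: "X \<in> abelian_extensions_rel G D V T \<Theta>"
begin

lemma extension: "abelian_extension G D V T X"
  using X by (simp add: abelian_extensions_rel_def)

lemma lie_H: "lie_group (total X)"
  using extension by (simp add: abelian_extension_def difference_lie_group_def)

sublocale ext: lie_extension G "total X" V "incl X" "proj X"
proof -
  interpret H: group "total X" using lie_H by (simp add: lie_group_def)
  show "lie_extension G (total X) V (incl X) (proj X)"
    by unfold_locales (use extension lie_H lieG V in \<open>auto simp: abelian_extension_def difference_hom_def\<close>)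
qed

abbreviation "H \<equiv> total X"
abbreviation "i \<equiv> incl X"
abbreviation "p \<equiv> proj X"

lemmas MH = lie_group_manifold[OF lie_H]

lemma dop_i: "u \<in> V \<Longrightarrow> dop X (i u) = i (T u)"
  using extension by (simp add: abelian_extension_def difference_hom_def)

lemma p_dop: "x \<in> carrier H \<Longrightarrow> p (dop X x) = D (p x)"
  using extension by (simp add: abelian_extension_def difference_hom_def)

lemma smooth_dop: "x \<in> carrier H \<Longrightarrow> smooth_at (mfd H) (mfd H) (dop X) x"
  using extension lie_group_topspace[OF lie_H]
  by (intro smooth_map_smooth_at[OF MH MH]) (auto simp: abelian_extension_def difference_lie_group_def)

lemma dop_closed [simp]: "x \<in> carrier H \<Longrightarrow> dop X x \<in> carrier H"
  by (rule smooth_at_carrier[OF lie_H smooth_dop])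

definition EH :: "'p \<Rightarrow> 'p" where "EH x = dop X x \<otimes>\<^bsub>total X\<^esub> x"

lemma EH_closed [simp]: "x \<in> carrier H \<Longrightarrow> EH x \<in> carrier H"
  by (simp add: EH_def)

lemma EH_mult: "x \<in> carrier H \<Longrightarrow> y \<in> carrier H \<Longrightarrow> EH (x \<otimes>\<^bsub>total X\<^esub> y) = EH x \<otimes>\<^bsub>total X\<^esub> EH y"
  using extension by (simp add: EH_def abelian_extension_def difference_lie_group_def ext.H.m_assoc ext.H.inv_mult_cancel)

text \<open>The difference operator is recovered from the homomorphism \<open>EH\<close>. A group
  homomorphism that commutes with the operators \<open>EH\<close> therefore commutes with the
  difference operators.\<close>

lemma dop_EH: "x \<in> carrier H \<Longrightarrow> dop X x = EH x \<otimes>\<^bsub>total X\<^esub> inv\<^bsub>total X\<^esub> x"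
  by (simp add: EH_def ext.H.m_assoc)

lemma EH_i: "u \<in> V \<Longrightarrow> EH (i u) = i (T u + u)"
  by (simp add: EH_def dop_i ext.i_add T_lin)

lemma p_EH: "x \<in> carrier H \<Longrightarrow> p (EH x) = E (p x)"
  by (simp add: EH_def E_def p_dop)

end

locale section_of_extension = difference_extension G V \<Theta> D T X
  for G :: "('g, 'e::euclidean_space) smooth_group" and V :: "'v::euclidean_space set" and \<Theta> :: "'g \<Rightarrow> 'v \<Rightarrow> 'v"
    and D :: "'g \<Rightarrow> 'g" and T :: "'v \<Rightarrow> 'v" and X :: "('p, 'f::euclidean_space, 'v, 'g) extension" +
  fixes s :: "'g \<Rightarrow> 'p"
  assumes s: "is_section G X s"
begin

lemma smooth_s: "g \<in> carrier G \<Longrightarrow> smooth_at (mfd G) (mfd H) s g"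
  using s by (intro smooth_map_smooth_at[OF MG MH]) (auto simp: is_section_def)

lemma s_closed [simp]: "g \<in> carrier G \<Longrightarrow> s g \<in> carrier H"
  by (rule smooth_at_carrier[OF lie_H smooth_s])

lemma p_s [simp]: "g \<in> carrier G \<Longrightarrow> p (s g) = g"
  using s by (simp add: is_section_def)

lemma s_one [simp]: "s \<one>\<^bsub>G\<^esub> = \<one>\<^bsub>total X\<^esub>"
  using s by (simp add: is_section_def)

lemma s_i:
  assumes "g \<in> carrier G" "u \<in> V"
  shows "s g \<otimes>\<^bsub>total X\<^esub> i u = i (\<Theta> g u) \<otimes>\<^bsub>total X\<^esub> s g"
proof -
  have "i (\<Theta> g u) = s g \<otimes>\<^bsub>total X\<^esub> i u \<otimes>\<^bsub>total X\<^esub> inv\<^bsub>total X\<^esub> s g"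
    using X s assms by (simp add: abelian_extensions_rel_def)
  then show ?thesis using assms by (simp add: ext.H.m_assoc)
qed

text \<open>The \<open>V\<close>-coordinate of a point: together with \<open>p x\<close> it
  determines \<open>x\<close>. All identities in the total group are proved below by comparing these
  two coordinates.\<close>

definition fib :: "'p \<Rightarrow> 'v" where "fib x = ext.c (x \<otimes>\<^bsub>total X\<^esub> inv\<^bsub>total X\<^esub> s (p x))"

lemma fib_closed: "x \<in> carrier H \<Longrightarrow> fib x \<in> V"
  by (simp add: fib_def ext.c_closed)

lemma fib_decomp: "x \<in> carrier H \<Longrightarrow> x = i (fib x) \<otimes>\<^bsub>total X\<^esub> s (p x)"
  by (simp add: fib_def ext.i_c ext.H.m_assoc)

lemma fib_i_s: "u \<in> V \<Longrightarrow> g \<in> carrier G \<Longrightarrow> fib (i u \<otimes>\<^bsub>total X\<^esub> s g) = u"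
  by (simp add: fib_def ext.H.m_assoc)

lemma fib_s [simp]: "g \<in> carrier G \<Longrightarrow> fib (s g) = 0"
  using fib_i_s[of 0 g] by (simp add: V_closed)

lemma fib_i [simp]: "u \<in> V \<Longrightarrow> fib (i u) = u"
  using fib_i_s[of u "\<one>\<^bsub>G\<^esub>"] by simp

lemma fib_eqI: "x \<in> carrier H \<Longrightarrow> y \<in> carrier H \<Longrightarrow> p x = p y \<Longrightarrow> fib x = fib y \<Longrightarrow> x = y"
  using fib_decomp by metis

text \<open>The quotient of \<open>x\<close> by \<open>s (p x)\<close> depends smoothly on
  \<open>x\<close> and stays in the kernel, where the inverse of \<open>i\<close> is smooth.\<close>

lemma smooth_fib:
  assumes "x \<in> carrier H"
  shows "smooth_at (mfd H) (vec_mfd V) fib x"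
  unfolding fib_def
proof (rule ext.smooth_at_c[OF MH])
  have "smooth_at (mfd H) (mfd H) (\<lambda>x. s (p x)) x"
    by (rule smooth_at_compose'[OF MH MG ext.smooth_p[OF assms] refl smooth_s]) (use assms in simp)
  then show "smooth_at (mfd H) (mfd H) (\<lambda>x. x \<otimes>\<^bsub>total X\<^esub> inv\<^bsub>total X\<^esub> s (p x)) x"
    by (intro smooth_at_mult[OF lie_H MH] smooth_at_inv[OF lie_H MH] smooth_at_group_id[OF lie_H] assms)
  show "\<forall>\<^sub>F z in nhdsin (mtop (mfd H)) x. p (z \<otimes>\<^bsub>total X\<^esub> inv\<^bsub>total X\<^esub> s (p z)) = \<one>\<^bsub>G\<^esub>"
    by (rule eventually_mono[OF eventually_nhdsin_topspace]) (use assms in auto)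
qed

definition a :: "'g \<Rightarrow> 'g \<Rightarrow> 'v" where "a g h = ext.c (s g \<otimes>\<^bsub>total X\<^esub> s h \<otimes>\<^bsub>total X\<^esub> inv\<^bsub>total X\<^esub> s (g \<otimes>\<^bsub>G\<^esub> h))"

definition b :: "'g \<Rightarrow> 'v" where "b g = ext.c (dop X (s g) \<otimes>\<^bsub>total X\<^esub> inv\<^bsub>total X\<^esub> s (D g))"

lemma section_cocycle_eq:
  "section_cocycle G D V X s = ((\<lambda>gs. if gs \<in> tuples G 2 then a (gs ! 0) (gs ! 1) else 0),
     (\<lambda>gs. if gs \<in> tuples G 1 then b (gs ! 0) else 0))"
  by (simp add: section_cocycle_def a_def b_def ext.c_def Let_def cong: if_cong)

lemma section_cocycle_eval:
  "g \<in> carrier G \<Longrightarrow> h \<in> carrier G \<Longrightarrow> fst (section_cocycle G D V X s) [g, h] = a g h"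
  "g \<in> carrier G \<Longrightarrow> snd (section_cocycle G D V X s) [g] = b g"
  "gs \<notin> tuples G 2 \<Longrightarrow> fst (section_cocycle G D V X s) gs = 0"
  "gs \<notin> tuples G 1 \<Longrightarrow> snd (section_cocycle G D V X s) gs = 0"
  by (auto simp: section_cocycle_eq tuples_def)

lemma a_fib: "g \<in> carrier G \<Longrightarrow> h \<in> carrier G \<Longrightarrow> a g h = fib (s g \<otimes>\<^bsub>total X\<^esub> s h)"
  by (simp add: a_def fib_def)

lemma b_fib: "g \<in> carrier G \<Longrightarrow> b g = fib (dop X (s g))"
  by (simp add: b_def fib_def p_dop)

lemma a_closed: "g \<in> carrier G \<Longrightarrow> h \<in> carrier G \<Longrightarrow> a g h \<in> V"
  by (simp add: a_fib fib_closed)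

lemma b_closed: "g \<in> carrier G \<Longrightarrow> b g \<in> V"
  by (simp add: b_fib fib_closed)

lemma s_mult: "g \<in> carrier G \<Longrightarrow> h \<in> carrier G \<Longrightarrow> s g \<otimes>\<^bsub>total X\<^esub> s h = i (a g h) \<otimes>\<^bsub>total X\<^esub> s (g \<otimes>\<^bsub>G\<^esub> h)"
  using fib_decomp[of "s g \<otimes>\<^bsub>total X\<^esub> s h"] by (simp add: a_fib)

text \<open>Moving \<open>s (p x)\<close> past the \<open>V\<close>-part of \<open>y\<close>
  produces the action \<open>\<Theta>\<close>; contracting the product of the two section values
  produces the cocycle \<open>a\<close>.\<close>

lemma fib_mult:
  assumes "x \<in> carrier H" "y \<in> carrier H"
  shows "fib (x \<otimes>\<^bsub>total X\<^esub> y) = fib x + \<Theta> (p x) (fib y) + a (p x) (p y)"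
proof -
  define u v g h where "u = fib x" and "v = fib y" and "g = p x" and "h = p y"
  have uv: "u \<in> V" "v \<in> V" "g \<in> carrier G" "h \<in> carrier G"
    using assms by (simp_all add: u_def v_def g_def h_def fib_closed)
  note cl = uv \<Theta>_closed[OF uv(3,2)] a_closed[OF uv(3,4)]
  have "x \<otimes>\<^bsub>total X\<^esub> y = (i u \<otimes>\<^bsub>total X\<^esub> s g) \<otimes>\<^bsub>total X\<^esub> (i v \<otimes>\<^bsub>total X\<^esub> s h)"
    using fib_decomp assms by (simp add: u_def v_def g_def h_def)
  also have "\<dots> = i u \<otimes>\<^bsub>total X\<^esub> (s g \<otimes>\<^bsub>total X\<^esub> i v) \<otimes>\<^bsub>total X\<^esub> s h"
    using cl by (simp add: ext.H.m_assoc)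
  also have "\<dots> = i u \<otimes>\<^bsub>total X\<^esub> i (\<Theta> g v) \<otimes>\<^bsub>total X\<^esub> (s g \<otimes>\<^bsub>total X\<^esub> s h)"
    unfolding s_i[OF uv(3,2)] using cl by (simp add: ext.H.m_assoc)
  also have "\<dots> = i (u + \<Theta> g v + a g h) \<otimes>\<^bsub>total X\<^esub> s (g \<otimes>\<^bsub>G\<^esub> h)"
    unfolding s_mult[OF uv(3,4)] using cl by (simp add: ext.H.m_assoc ext.i_add V_closed)
  finally have "fib (x \<otimes>\<^bsub>total X\<^esub> y) = u + \<Theta> g v + a g h"
    using cl by (simp add: fib_i_s V_closed)
  then show ?thesis by (simp add: u_def v_def g_def h_def)
qed

lemma EH_s: "g \<in> carrier G \<Longrightarrow> fib (EH (s g)) = b g + a (D g) g"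
  by (simp add: EH_def fib_mult p_dop b_fib \<Theta>_lin)

text \<open>\<open>EH\<close> is multiplicative, so it can be applied to \<open>i (fib x)\<close>
  and \<open>s (p x)\<close> separately. The first image lies over the unit, where
  \<open>\<Theta>\<close> acts trivially and \<open>a\<close> vanishes.\<close>

lemma fib_EH:
  assumes "x \<in> carrier H"
  shows "fib (EH x) = T (fib x) + fib x + (b (p x) + a (D (p x)) (p x))"
proof -
  have x: "fib x \<in> V" "p x \<in> carrier G" using assms by (simp_all add: fib_closed)
  then have Tx: "T (fib x) + fib x \<in> V" by (simp add: T_lin V_closed)
  have cl: "b (p x) + a (D (p x)) (p x) \<in> V" using x by (simp add: a_closed b_closed V_closed)
  have "EH x = EH (i (fib x)) \<otimes>\<^bsub>total X\<^esub> EH (s (p x))"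
    using fib_decomp[OF assms] x by (subst EH_mult[symmetric]) auto
  also have "fib \<dots> = (T (fib x) + fib x) + \<Theta> \<one>\<^bsub>G\<^esub> (b (p x) + a (D (p x)) (p x)) + a \<one>\<^bsub>G\<^esub> (E (p x))"
    using x Tx by (simp add: fib_mult EH_i EH_s p_EH)
  also have "a \<one>\<^bsub>G\<^esub> (E (p x)) = 0" using x by (simp add: a_fib)
  finally show ?thesis using cl by (simp add: \<Theta>_one)
qed

lemma a_one: "g \<in> carrier G \<Longrightarrow> a g \<one>\<^bsub>G\<^esub> = 0" "g \<in> carrier G \<Longrightarrow> a \<one>\<^bsub>G\<^esub> g = 0"
  by (simp_all add: a_fib)

lemma b_one: "b \<one>\<^bsub>G\<^esub> = 0"
proof -
  have "EH \<one>\<^bsub>total X\<^esub> = \<one>\<^bsub>total X\<^esub>" using EH_mult[of "\<one>\<^bsub>total X\<^esub>" "\<one>\<^bsub>total X\<^esub>"] by (simp add: ext.H.l_cancel_one')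
  then have "dop X \<one>\<^bsub>total X\<^esub> = \<one>\<^bsub>total X\<^esub>" by (simp add: dop_EH)
  then show ?thesis using fib_i[of 0] by (simp add: b_fib V_closed)
qed

lemma smooth_a:
  assumes z: "z \<in> carrier G \<times> carrier G"
  shows "smooth_at (prod_manifold (mfd G) (mfd G)) (vec_mfd V) (\<lambda>z. a (fst z) (snd z)) z"
proof -
  let ?M = "prod_manifold (mfd G) (mfd G)"
  note MM = smooth_manifold_prod[OF MG MG]
  have fst: "smooth_at ?M (mfd G) fst z" and snd: "smooth_at ?M (mfd G) snd z"
    using z smooth_at_fst[OF MG MG] smooth_at_snd[OF MG MG] by (cases z; force)+
  have zc: "fst z \<in> carrier G" "snd z \<in> carrier G" using z by auto
  have 1: "smooth_at ?M (mfd H) (\<lambda>z. s (fst z)) z" and 2: "smooth_at ?M (mfd H) (\<lambda>z. s (snd z)) z"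
    by (rule smooth_at_compose'[OF MM MG fst refl smooth_s[OF zc(1)]],
        rule smooth_at_compose'[OF MM MG snd refl smooth_s[OF zc(2)]])
  have 3: "smooth_at ?M (mfd H) (\<lambda>z. s (fst z \<otimes>\<^bsub>G\<^esub> snd z)) z"
    by (rule smooth_at_compose'[OF MM MG smooth_at_mult[OF lieG MM fst snd] refl smooth_s]) (use zc in simp)
  show ?thesis
    unfolding a_def
  proof (rule ext.smooth_at_c[OF MM])
    show "smooth_at ?M (mfd H) (\<lambda>z. s (fst z) \<otimes>\<^bsub>total X\<^esub> s (snd z) \<otimes>\<^bsub>total X\<^esub> inv\<^bsub>total X\<^esub> s (fst z \<otimes>\<^bsub>G\<^esub> snd z)) z"
      by (intro smooth_at_mult[OF lie_H MM] smooth_at_inv[OF lie_H MM] 1 2 3)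
    show "\<forall>\<^sub>F z in nhdsin (mtop ?M) z. p (s (fst z) \<otimes>\<^bsub>total X\<^esub> s (snd z) \<otimes>\<^bsub>total X\<^esub> inv\<^bsub>total X\<^esub> s (fst z \<otimes>\<^bsub>G\<^esub> snd z)) = \<one>\<^bsub>G\<^esub>"
      by (rule eventually_mono[OF eventually_nhdsin_topspace]) (use z in auto)
  qed
qed

lemma smooth_b:
  assumes g: "g \<in> carrier G"
  shows "smooth_at (mfd G) (vec_mfd V) b g"
  unfolding b_def
proof (rule ext.smooth_at_c[OF MG])
  have 1: "smooth_at (mfd G) (mfd H) (\<lambda>g. dop X (s g)) g"
    by (rule smooth_at_compose'[OF MG MH smooth_s[OF g] refl smooth_dop]) (use g in simp)
  have 2: "smooth_at (mfd G) (mfd H) (\<lambda>g. s (D g)) g"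
    by (rule smooth_at_compose'[OF MG MG smooth_D[OF g] refl smooth_s]) (use g in simp)
  show "smooth_at (mfd G) (mfd H) (\<lambda>g. dop X (s g) \<otimes>\<^bsub>total X\<^esub> inv\<^bsub>total X\<^esub> s (D g)) g"
    by (intro smooth_at_mult[OF lie_H MG] smooth_at_inv[OF lie_H MG] 1 2)
  show "\<forall>\<^sub>F g in nhdsin (mtop (mfd G)) g. p (dop X (s g) \<otimes>\<^bsub>total X\<^esub> inv\<^bsub>total X\<^esub> s (D g)) = \<one>\<^bsub>G\<^esub>"
    by (rule eventually_mono[OF eventually_nhdsin_topspace]) (use g in \<open>auto simp: p_dop\<close>)
qed

lemma section_cocycle_cocycle: "section_cocycle G D V X s \<in> carrier (cocycle_group G D V T \<Theta> 2)"
proof -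
  define \<alpha> \<beta> where "\<alpha> = fst (section_cocycle G D V X s)" and "\<beta> = snd (section_cocycle G D V X s)"
  have \<alpha>: "\<alpha> [g, h] = a g h" if "g \<in> carrier G" "h \<in> carrier G" for g h
    using that by (simp add: \<alpha>_def section_cocycle_eval)
  have \<beta>: "\<beta> [g] = b g" if "g \<in> carrier G" for g
    using that section_cocycle_eval(2) by (simp add: \<beta>_def)
  have gam: "gam \<alpha> \<beta> g = fib (EH (s g))" if "g \<in> carrier G" for g
    using that by (simp add: gam_def \<alpha> \<beta> EH_s)
  have "(\<alpha>, \<beta>) \<in> carrier (cocycle_group G D V T \<Theta> 2)"
    unfolding cocycle_iff cochain_1_iff cochain_2_iff
  proof (intro conjI ballI allI impI)
    show "smooth_at (prod_manifold (mfd G) (mfd G)) (vec_mfd V) (\<lambda>z. \<alpha> [fst z, snd z]) z"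
      if z: "z \<in> carrier G \<times> carrier G" for z
      by (rule smooth_at_cong[OF smooth_manifold_prod[OF MG MG] smooth_a[OF z] eventually_mono[OF eventually_nhdsin_topspace]])
        (use z \<alpha> in auto)
    show "smooth_at (mfd G) (vec_mfd V) (\<lambda>g. \<beta> [g]) g" if g: "g \<in> carrier G" for g
      by (rule smooth_at_cong[OF MG smooth_b[OF g] eventually_mono[OF eventually_nhdsin_topspace]])
        (use g \<beta> in auto)
    show "\<alpha> gs = 0" if "gs \<notin> tuples G 2" for gs using that by (simp add: \<alpha>_def section_cocycle_eval)
    show "\<beta> gs = 0" if "gs \<notin> tuples G 1" for gs using section_cocycle_eval(4)[OF that] by (simp add: \<beta>_def)
    fix g h assume gh: "g \<in> carrier G" "h \<in> carrier G"
    have "fib (EH (s g \<otimes>\<^bsub>total X\<^esub> s h)) = fib (EH (s g) \<otimes>\<^bsub>total X\<^esub> EH (s h))"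
      using gh by (simp add: EH_mult)
    then show "gam \<alpha> \<beta> g + \<Theta> (E g) (gam \<alpha> \<beta> h) + \<alpha> [E g, E h] = T (\<alpha> [g, h]) + \<alpha> [g, h] + gam \<alpha> \<beta> (g \<otimes>\<^bsub>G\<^esub> h)"
      using gh fib_EH[of "s g \<otimes>\<^bsub>total X\<^esub> s h"] fib_mult[of "EH (s g)" "EH (s h)"]
      by (simp add: gam \<alpha> p_EH a_fib EH_s)
    fix k assume k: "k \<in> carrier G"
    have "fib ((s g \<otimes>\<^bsub>total X\<^esub> s h) \<otimes>\<^bsub>total X\<^esub> s k) = fib (s g \<otimes>\<^bsub>total X\<^esub> (s h \<otimes>\<^bsub>total X\<^esub> s k))"
      using gh k by (simp add: ext.H.m_assoc)
    then show "\<Theta> g (\<alpha> [h, k]) + \<alpha> [g, h \<otimes>\<^bsub>G\<^esub> k] = \<alpha> [g \<otimes>\<^bsub>G\<^esub> h, k] + \<alpha> [g, h]"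
      using gh k fib_mult[of "s g \<otimes>\<^bsub>total X\<^esub> s h" "s k"] fib_mult[of "s g" "s h \<otimes>\<^bsub>total X\<^esub> s k"]
      by (simp add: \<alpha> a_fib[symmetric] \<Theta>_lin add.commute)
  qed (simp_all add: \<alpha> \<beta> a_one b_one)
  then show ?thesis by (simp add: \<alpha>_def \<beta>_def)
qed

text \<open>The new \<open>V\<close>-coordinate is the old one minus \<open>\<theta>\<close> of the
  base point. Both components of the new cocycle are read off from this single relation, and the
  correction terms are those of the coboundary.\<close>

lemma change_section:
  assumes \<theta>: "\<theta> \<in> group_cochains G V 1"
  defines "s' \<equiv> \<lambda>g. i (\<theta> [g]) \<otimes>\<^bsub>total X\<^esub> s g"
  shows "is_section G X s'" "section_cocycle G D V X s' = cob \<theta> + section_cocycle G D V X s"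
proof -
  have \<theta>V: "\<theta> [g] \<in> V" if "g \<in> carrier G" for g using cochain_1_closed[OF \<theta> that] .
  have "smooth_map (mfd G) (mfd H) s'"
    unfolding s'_def
    by (intro smooth_mapI[OF MG MH] smooth_at_mult[OF lie_H MG] ext.smooth_at_i[OF MG] smooth_s)
      (use \<theta>[unfolded cochain_1_iff] in auto)
  then show sec: "is_section G X s'"
    using \<theta> \<theta>V unfolding is_section_def cochain_1_iff by (simp add: s'_def)
  interpret S': section_of_extension G V \<Theta> D T X s' by unfold_locales (rule sec)
  have fib': "S'.fib x = fib x - \<theta> [p x]" if x: "x \<in> carrier H" for x
  proof -
    have "x = i (S'.fib x + \<theta> [p x]) \<otimes>\<^bsub>total X\<^esub> s (p x)"
      using S'.fib_decomp[OF x] S'.fib_closed[OF x] \<theta>V[of "p x"] x by (simp add: s'_def ext.i_add ext.H.m_assoc)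
    then have "fib x = S'.fib x + \<theta> [p x]"
      using fib_i_s[of "S'.fib x + \<theta> [p x]" "p x"] S'.fib_closed[OF x] \<theta>V[of "p x"] x by (simp add: V_closed)
    then show ?thesis by simp
  qed
  have fib_s': "fib (s' g) = \<theta> [g]" if "g \<in> carrier G" for g
    using fib_i_s[OF \<theta>V[OF that] that] by (simp add: s'_def)
  have a': "S'.a g h = \<Theta> g (\<theta> [h]) - \<theta> [g \<otimes>\<^bsub>G\<^esub> h] + \<theta> [g] + a g h" if gh: "g \<in> carrier G" "h \<in> carrier G" for g h
    using gh by (simp add: S'.a_fib fib' fib_mult fib_s')
  have "S'.b g = T (\<theta> [g]) + \<theta> [g] - \<Theta> (D g) (\<theta> [g]) - \<theta> [D g] + b g" if g: "g \<in> carrier G" for g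
  proof -
    \<comment> \<open>The second component is computed through \<open>EH\<close>, whose coordinate
      formula is known for arbitrary points. The term \<open>\<theta> [E g]\<close> then cancels
      against the one contained in \<open>S'.a (D g) g\<close>.\<close>
    have "S'.b g + S'.a (D g) g = S'.fib (EH (s' g))" using g by (simp add: S'.EH_s)
    also have "\<dots> = T (\<theta> [g]) + \<theta> [g] + (b g + a (D g) g) - \<theta> [E g]"
      using g by (simp add: fib' fib_EH fib_s' p_EH)
    finally show ?thesis using a'[of "D g" g] g by (simp add: E_def algebra_simps)
  qed
  with a' show "section_cocycle G D V X s' = cob \<theta> + section_cocycle G D V X s"
    by (intro pair_fun_eqI) (simp_all add: cob_eval cob_outside section_cocycle_eval S'.section_cocycle_eval
        section_cocycle_eval(2,4)[unfolded One_nat_def] S'.section_cocycle_eval(2,4)[unfolded One_nat_def])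
qed

text \<open>The cochain is the \<open>V\<close>-coordinate of the second section with respect to the
  first; it is normalised because both sections send the unit to the unit.\<close>

lemma section_difference:
  assumes s': "is_section G X s'"
  obtains \<theta> where "\<theta> \<in> group_cochains G V 1" "section_cocycle G D V X s' = cob \<theta> + section_cocycle G D V X s"
proof -
  interpret S': section_of_extension G V \<Theta> D T X s' by unfold_locales (rule s')
  define \<theta> where "\<theta> gs = (if gs \<in> tuples G 1 then fib (s' (gs ! 0)) else 0)" for gs
  have \<theta>: "\<theta> [g] = fib (s' g)" if "g \<in> carrier G" for g using that by (simp add: \<theta>_def tuples_def)
  have sm: "smooth_at (mfd G) (vec_mfd V) (\<lambda>g. \<theta> [g]) g" if g: "g \<in> carrier G" for g
  proof -
    have "smooth_at (mfd G) (vec_mfd V) (\<lambda>g. fib (s' g)) g"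
      by (rule smooth_at_compose'[OF MG MH S'.smooth_s[OF g] refl smooth_fib]) (use g in simp)
    then show ?thesis
      by (rule smooth_at_cong[OF MG _ eventually_mono[OF eventually_nhdsin_topspace]]) (use g \<theta> in auto)
  qed
  have th: "\<theta> \<in> group_cochains G V 1"
    unfolding cochain_1_iff using sm fib_i[of 0] by (auto simp: \<theta> V_closed) (simp add: \<theta>_def)
  have eq: "i (\<theta> [g]) \<otimes>\<^bsub>total X\<^esub> s g = s' g" if "g \<in> carrier G" for g
    using fib_decomp[of "s' g"] that by (simp add: \<theta>)
  \<comment> \<open>The two sections are only known to agree on \<open>carrier G\<close>, and the
    cocycle of a section consults no other arguments.\<close>
  have "section_cocycle G D V X s' = section_cocycle G D V X (\<lambda>g. i (\<theta> [g]) \<otimes>\<^bsub>total X\<^esub> s g)"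
    unfolding section_cocycle_def by (auto simp: fun_eq_iff tuples_2 tuples_Suc_0 eq)
  then show thesis using change_section(2)[OF th] th that by simp
qed

end

lemma (in difference_extension) section_exists: "\<exists>s. is_section G X s"
proof -
  obtain s where s: "\<And>g. g \<in> carrier G \<Longrightarrow> smooth_at (mfd G) (mfd H) s g" "\<And>g. g \<in> carrier G \<Longrightarrow> p (s g) = g"
    "s \<one>\<^bsub>G\<^esub> = \<one>\<^bsub>total X\<^esub>"
    by (rule ext.global_section) blast
  then have "is_section G X s" unfolding is_section_def by (auto intro!: smooth_mapI[OF MG MH])
  then show ?thesis by blast
qed

section \<open>Isomorphic extensions\<close>

locale equal_cocycles = X: section_of_extension G V \<Theta> D T X s + Y: section_of_extension G V \<Theta> D T Y t
  for G :: "('g, 'e::euclidean_space) smooth_group" and V :: "'v::euclidean_space set" and \<Theta> :: "'g \<Rightarrow> 'v \<Rightarrow> 'v"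
    and D :: "'g \<Rightarrow> 'g" and T :: "'v \<Rightarrow> 'v" and X :: "('p, 'f::euclidean_space, 'v, 'g) extension"
    and s :: "'g \<Rightarrow> 'p" and Y :: "('p, 'f, 'v, 'g) extension" and t :: "'g \<Rightarrow> 'p" +
  assumes eq: "section_cocycle G D V X s = section_cocycle G D V Y t"
begin

lemma a_eq: "g \<in> carrier G \<Longrightarrow> h \<in> carrier G \<Longrightarrow> X.a g h = Y.a g h"
  using X.section_cocycle_eval(1) Y.section_cocycle_eval(1) eq by metis

lemma b_eq: "g \<in> carrier G \<Longrightarrow> X.b g = Y.b g"
  using X.section_cocycle_eval(2) Y.section_cocycle_eval(2) eq by metis

definition \<sigma> :: "'p \<Rightarrow> 'p" where "\<sigma> x = incl Y (X.fib x) \<otimes>\<^bsub>total Y\<^esub> t (proj X x)"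

lemma \<sigma>_closed [simp]: "x \<in> carrier (total X) \<Longrightarrow> \<sigma> x \<in> carrier (total Y)"
  by (simp add: \<sigma>_def X.fib_closed)

lemma p_\<sigma> [simp]: "x \<in> carrier (total X) \<Longrightarrow> proj Y (\<sigma> x) = proj X x"
  by (simp add: \<sigma>_def X.fib_closed)

lemma fib_\<sigma> [simp]: "x \<in> carrier (total X) \<Longrightarrow> Y.fib (\<sigma> x) = X.fib x"
  by (simp add: \<sigma>_def X.fib_closed Y.fib_i_s)

lemma \<sigma>_mult: "x \<in> carrier (total X) \<Longrightarrow> y \<in> carrier (total X) \<Longrightarrow> \<sigma> (x \<otimes>\<^bsub>total X\<^esub> y) = \<sigma> x \<otimes>\<^bsub>total Y\<^esub> \<sigma> y"
  by (rule Y.fib_eqI) (simp_all add: X.fib_mult Y.fib_mult a_eq)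

lemma \<sigma>_EH: "x \<in> carrier (total X) \<Longrightarrow> \<sigma> (X.EH x) = Y.EH (\<sigma> x)"
  by (rule Y.fib_eqI) (simp_all add: X.fib_EH Y.fib_EH X.p_EH Y.p_EH a_eq b_eq)

lemma \<sigma>_hom: "group_hom (total X) (total Y) \<sigma>"
  by unfold_locales (simp add: hom_def \<sigma>_mult)

text \<open>Commutation with \<open>EH\<close> is visible in coordinates, where only
  \<open>T\<close> and the two cocycle components occur; together with multiplicativity it gives
  commutation with the difference operators.\<close>

lemma \<sigma>_dop: "x \<in> carrier (total X) \<Longrightarrow> dop Y (\<sigma> x) = \<sigma> (dop X x)"
  using group_hom.hom_inv[OF \<sigma>_hom] by (simp add: X.dop_EH Y.dop_EH \<sigma>_mult \<sigma>_EH)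

lemma smooth_\<sigma>: "smooth_map (mfd (total X)) (mfd (total Y)) \<sigma>"
proof (rule smooth_mapI[OF X.MH Y.MH])
  fix x assume "x \<in> topspace (mtop (mfd (total X)))"
  then have x: "x \<in> carrier (total X)" by simp
  have "smooth_at (mfd (total X)) (mfd (total Y)) (\<lambda>x. t (proj X x)) x"
    by (rule smooth_at_compose'[OF X.MH X.MG X.ext.smooth_p[OF x] refl Y.smooth_s]) (use x in simp)
  then show "smooth_at (mfd (total X)) (mfd (total Y)) \<sigma> x"
    unfolding \<sigma>_def[abs_def]
    by (intro smooth_at_mult[OF Y.lie_H X.MH] Y.ext.smooth_at_i[OF X.MH] X.smooth_fib x)
qed

end

text \<open>The hypothesis is symmetric, so the same formula with \<open>X\<close> and
  \<open>Y\<close> exchanged is defined and smooth. Comparison of coordinates shows that it is the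
  inverse.\<close>

lemma (in equal_cocycles) isomorphic: "isomorphic_extensions V X Y"
proof -
  interpret inv: equal_cocycles G V \<Theta> D T Y t X s by unfold_locales (rule eq[symmetric])
  have 1: "inv.\<sigma> (\<sigma> x) = x" if "x \<in> carrier (total X)" for x
    by (rule X.fib_eqI) (use that in simp_all)
  have 2: "\<sigma> (inv.\<sigma> y) = y" if "y \<in> carrier (total Y)" for y
    by (rule Y.fib_eqI) (use that in simp_all)
  have bij: "bij_betw \<sigma> (carrier (total X)) (carrier (total Y))"
    by (rule bij_betw_byWitness[where f' = inv.\<sigma>]) (auto simp: 1 2)
  have inv_eq: "inv_into (carrier (total X)) \<sigma> y = inv.\<sigma> y" if "y \<in> carrier (total Y)" for y
    using bij that by (intro inv_into_f_eq) (auto simp: bij_betw_def 2)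
  have "smooth_map (mfd (total Y)) (mfd (total X)) (inv_into (carrier (total X)) \<sigma>)"
  proof (rule smooth_mapI[OF Y.MH X.MH])
    fix y assume y: "y \<in> topspace (mtop (mfd (total Y)))"
    have "smooth_at (mfd (total Y)) (mfd (total X)) inv.\<sigma> y"
      by (rule smooth_map_smooth_at[OF Y.MH X.MH inv.smooth_\<sigma> y])
    then show "smooth_at (mfd (total Y)) (mfd (total X)) (inv_into (carrier (total X)) \<sigma>) y"
      by (rule smooth_at_cong[OF Y.MH _ eventually_mono[OF eventually_nhdsin_topspace[OF y]]]) (simp add: inv_eq)
  qed
  moreover have "\<sigma> (incl X u) = incl Y u" if "u \<in> V" for u
    by (rule Y.fib_eqI) (use that in simp_all)
  moreover have "difference_hom (total X) (dop X) (total Y) (dop Y) \<sigma>"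
    using \<sigma>_hom smooth_\<sigma> \<sigma>_dop by (simp add: difference_hom_def lie_hom_def group_hom_def group_hom_axioms_def)
  ultimately show ?thesis
    unfolding isomorphic_extensions_def using bij by (intro exI[of _ \<sigma>]) simp
qed

section \<open>Isomorphism classes and cohomology classes\<close>

context difference_module
begin

text \<open>An isomorphism compatible with inclusions and projections carries sections to sections
  and respects the identification of the kernels with \<open>V\<close>, so the image section has
  literally the same cocycle.\<close>

lemma transported_section:
  fixes X Y :: "('p, 'f::euclidean_space, 'v, 'g) extension"
  assumes X: "X \<in> abelian_extensions_rel G D V T \<Theta>" and Y: "Y \<in> abelian_extensions_rel G D V T \<Theta>"
    and iso: "isomorphic_extensions V X Y" and s: "is_section G X s"
  obtains t where "is_section G Y t" "section_cocycle G D V Y t = section_cocycle G D V X s"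
proof -
  interpret X: section_of_extension G V \<Theta> D T X s by unfold_locales (rule X s)+
  interpret Y: difference_extension G V \<Theta> D T Y by unfold_locales (rule Y)
  obtain \<sigma> where \<sigma>: "difference_hom (total X) (dop X) (total Y) (dop Y) \<sigma>"
    "\<And>u. u \<in> V \<Longrightarrow> \<sigma> (incl X u) = incl Y u" "\<And>x. x \<in> carrier (total X) \<Longrightarrow> proj Y (\<sigma> x) = proj X x"
    using iso unfolding isomorphic_extensions_def by blast
  have hom: "group_hom (total X) (total Y) \<sigma>"
    using \<sigma>(1) by unfold_locales (simp add: difference_hom_def lie_hom_def)
  note [simp] = group_hom.hom_closed[OF hom] group_hom.hom_mult[OF hom] group_hom.hom_inv[OF hom] group_hom.hom_one[OF hom]
  have dop: "dop Y (\<sigma> x) = \<sigma> (dop X x)" if "x \<in> carrier (total X)" for x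
    using \<sigma>(1) that by (simp add: difference_hom_def)
  have sm: "smooth_at (mfd (total X)) (mfd (total Y)) \<sigma> x" if "x \<in> carrier (total X)" for x
    using \<sigma>(1) that by (intro smooth_map_smooth_at[OF X.MH Y.MH]) (auto simp: difference_hom_def lie_hom_def)
  define t where "t g = \<sigma> (s g)" for g
  have "smooth_map (mfd G) (mfd (total Y)) t"
    unfolding t_def
    by (intro smooth_mapI[OF MG Y.MH] smooth_at_compose'[OF MG X.MH X.smooth_s refl sm]) auto
  then have t: "is_section G Y t"
    by (simp add: is_section_def t_def \<sigma>(3))
  interpret Y: section_of_extension G V \<Theta> D T Y t by unfold_locales (rule t)
  have c: "Y.ext.c (\<sigma> x) = X.ext.c x" if "x \<in> carrier (total X)" "proj X x = \<one>\<^bsub>G\<^esub>" for x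
  proof -
    have "\<sigma> x = incl Y (X.ext.c x)" using \<sigma>(2)[OF X.ext.c_closed[OF that]] X.ext.i_c[OF that] by simp
    then show ?thesis using X.ext.c_closed[OF that] by simp
  qed
  have "Y.a g h = X.a g h" if "g \<in> carrier G" "h \<in> carrier G" for g h
    using that c[of "s g \<otimes>\<^bsub>total X\<^esub> s h \<otimes>\<^bsub>total X\<^esub> inv\<^bsub>total X\<^esub> s (g \<otimes>\<^bsub>G\<^esub> h)"] by (simp add: Y.a_def X.a_def t_def)
  moreover have "Y.b g = X.b g" if "g \<in> carrier G" for g
    using that c[of "dop X (s g) \<otimes>\<^bsub>total X\<^esub> inv\<^bsub>total X\<^esub> s (D g)"] by (simp add: Y.b_def X.b_def t_def dop X.p_dop)
  ultimately have "section_cocycle G D V Y t = section_cocycle G D V X s"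
    by (intro pair_fun_eqI) (simp_all add: X.section_cocycle_eval Y.section_cocycle_eval
        X.section_cocycle_eval(2,4)[unfolded One_nat_def] Y.section_cocycle_eval(2,4)[unfolded One_nat_def])
  then show thesis using t that by blast
qed

lemma isomorphic_iff_class:
  fixes X Y :: "('p, 'f::euclidean_space, 'v, 'g) extension"
  assumes X: "X \<in> abelian_extensions_rel G D V T \<Theta>" and Y: "Y \<in> abelian_extensions_rel G D V T \<Theta>"
    and s: "is_section G X s" and t: "is_section G Y t"
  shows "isomorphic_extensions V X Y \<longleftrightarrow>
    cohomology_class G D V T \<Theta> 2 (section_cocycle G D V X s) = cohomology_class G D V T \<Theta> 2 (section_cocycle G D V Y t)"
proof -
  interpret Y: section_of_extension G V \<Theta> D T Y t by unfold_locales (rule Y t)+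
  show ?thesis
    unfolding cohomology_class_eq_iff
  proof
    assume "isomorphic_extensions V X Y"
    then obtain t' where t': "is_section G Y t'" "section_cocycle G D V Y t' = section_cocycle G D V X s"
      using transported_section[OF X Y _ s] by metis
    obtain \<theta> where "\<theta> \<in> group_cochains G V 1" "section_cocycle G D V Y t' = cob \<theta> + section_cocycle G D V Y t"
      by (rule Y.section_difference[OF t'(1)])
    then show "\<exists>\<theta>\<in>group_cochains G V 1. section_cocycle G D V X s = cob \<theta> + section_cocycle G D V Y t"
      using t'(2) by auto
  next
    assume "\<exists>\<theta>\<in>group_cochains G V 1. section_cocycle G D V X s = cob \<theta> + section_cocycle G D V Y t"
    then obtain \<theta> where \<theta>: "\<theta> \<in> group_cochains G V 1" "section_cocycle G D V X s = cob \<theta> + section_cocycle G D V Y t"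
      by blast
    \<comment> \<open>The section of \<open>Y\<close> is altered by \<open>\<theta>\<close> so that
      the two cocycles become equal and not merely cohomologous.\<close>
    interpret eq: equal_cocycles G V \<Theta> D T X s Y "\<lambda>g. incl Y (\<theta> [g]) \<otimes>\<^bsub>total Y\<^esub> t g"
      by unfold_locales (use X Y s Y.change_section[OF \<theta>(1)] \<theta>(2) in auto)
    show "isomorphic_extensions V X Y" by (rule eq.isomorphic)
  qed
qed

end

section \<open>The extension of a cocycle\<close>

text \<open>The extension built on pairs from \<open>V\<close> and \<open>G\<close> has to live in
  the prescribed types of points and of coordinates. An injection \<open>j\<close> of the points and
  a linear injection \<open>L\<close> of the model space carry the whole structure over.\<close>

definition transported_manifold :: "('a, 'e::euclidean_space) manifold \<Rightarrow> ('a \<Rightarrow> 'b) \<Rightarrow> ('e \<Rightarrow> 'f::euclidean_space)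
    \<Rightarrow> ('b, 'f) manifold"
  where "transported_manifold M j L =
    \<lparr>mtop = pullback_topology (j ` topspace (mtop M)) (inv_into (topspace (mtop M)) j) (mtop M),
     model = L ` model M,
     atlas = {(j ` U, \<lambda>y. L (\<phi> (inv_into (topspace (mtop M)) j y))) | U \<phi>. (U, \<phi>) \<in> atlas M}\<rparr>"

context
  fixes M :: "('a, 'e::euclidean_space) manifold" and j :: "'a \<Rightarrow> 'b" and L :: "'e \<Rightarrow> 'f::euclidean_space"
  assumes M: "smooth_manifold M" and j: "inj_on j (topspace (mtop M))"
    and L: "linear L" "inj_on L (model M)"
begin

private definition k where "k = inv_into (topspace (mtop M)) j"
private abbreviation "N \<equiv> transported_manifold M j L"

private lemma kj: "x \<in> topspace (mtop M) \<Longrightarrow> k (j x) = x"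
  using j by (simp add: k_def)

lemma transported_topspace: "topspace (mtop (transported_manifold M j L)) = j ` topspace (mtop M)"
  using kj by (auto simp: transported_manifold_def topspace_pullback_topology k_def)

private lemma homeo: "homeomorphic_maps (mtop M) (mtop N) j k"
  unfolding homeomorphic_maps_def
proof (intro conjI ballI)
  have "continuous_map (mtop M) (mtop M) (k \<circ> j)"
    by (rule continuous_map_eq[OF continuous_map_id]) (simp add: kj)
  then show "continuous_map (mtop M) (mtop N) j"
    unfolding transported_manifold_def by (auto intro!: continuous_map_pullback' simp: k_def)
  show "continuous_map (mtop N) (mtop M) k"
    using continuous_map_pullback[OF continuous_map_id[of "mtop M"], of "j ` topspace (mtop M)" k]
    by (simp add: transported_manifold_def k_def)
qed (auto simp: kj transported_topspace)

private lemma model_left_inverse: "\<exists>L'. linear L' \<and> (\<forall>x\<in>model M. L' (L x) = x)"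
proof -
  obtain g where "g ` UNIV \<subseteq> model M" "linear g" "\<forall>v\<in>model M. g (L v) = v"
    using linear_exists_left_inverse_on[OF L(1) smooth_manifold_model[OF M] L(2)] by metis
  then show ?thesis by blast
qed

private lemma L_openin:
  assumes "openin (top_of_set (model M)) A"
  shows "openin (top_of_set (L ` model M)) (L ` A)"
proof -
  obtain L' where L': "linear L'" "\<forall>x\<in>model M. L' (L x) = x" using model_left_inverse by blast
  have AM: "A \<subseteq> model M" using assms by (rule openin_imp_subset)
  have "L ` A = L ` model M \<inter> L' -` A" using L'(2) AM by auto
  moreover have "openin (top_of_set (L ` model M)) (L ` model M \<inter> L' -` A)"
    by (rule continuous_openin_preimage[OF _ _ assms])
      (use L' in \<open>auto intro: linear_continuous_on simp: linear_conv_bounded_linear\<close>)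
  ultimately show ?thesis by simp
qed

private lemma chart_inv:
  assumes "(U, \<phi>) \<in> atlas M" "x \<in> U"
  shows "inv_into (j ` U) (\<lambda>y. L (\<phi> (k y))) (L (\<phi> x)) = j x"
proof (rule inv_into_f_eq)
  have UM: "x \<in> topspace (mtop M)" if "x \<in> U" for x using chart_topspace[OF M assms(1)] that by blast
  show "inj_on (\<lambda>y. L (\<phi> (k y))) (j ` U)"
  proof (rule inj_onI)
    fix y z assume "y \<in> j ` U" "z \<in> j ` U" and eq: "L (\<phi> (k y)) = L (\<phi> (k z))"
    then obtain u v where uv: "u \<in> U" "v \<in> U" "y = j u" "z = j v" by auto
    have "\<phi> u = \<phi> v"
      using eq uv inj_onD[OF L(2), of "\<phi> u" "\<phi> v"] chart_mem_model[OF M assms(1)] by (simp add: kj UM)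
    then show "y = z" using inj_onD[OF chart_inj[OF M assms(1)], of u v] uv by simp
  qed
  show "L (\<phi> (k (j x))) = L (\<phi> x)" using assms(2) by (simp add: kj UM)
qed (use assms in simp)

private lemma N_chart: "(U, \<phi>) \<in> atlas M \<Longrightarrow> (j ` U, \<lambda>y. L (\<phi> (k y))) \<in> atlas N"
  by (auto simp: transported_manifold_def k_def)

private lemma N_chartE:
  assumes "(U', \<psi>) \<in> atlas N"
  obtains U \<phi> where "(U, \<phi>) \<in> atlas M" "U' = j ` U" "\<psi> = (\<lambda>y. L (\<phi> (k y)))"
  using assms by (auto simp: transported_manifold_def k_def)

private lemma chart_image_eq:
  assumes "(U, \<phi>) \<in> atlas M" "W \<subseteq> U"
  shows "(\<lambda>y. L (\<phi> (k y))) ` j ` W = L ` \<phi> ` W"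
proof -
  have "k (j x) = x" if "x \<in> W" for x using kj that assms(2) chart_topspace[OF M assms(1)] by blast
  then show ?thesis by (simp add: image_image cong: image_cong)
qed

private lemma N_openin: "openin (mtop M) W \<Longrightarrow> openin (mtop N) (j ` W)"
  using homeomorphic_imp_open_map[of "mtop M" "mtop N" j] homeo
  unfolding homeomorphic_maps_map open_map_def by (elim conjE) simp

lemma transported_smooth_manifold: "smooth_manifold (transported_manifold M j L)"
  unfolding smooth_manifold_def
proof (intro conjI)
  note SM = smooth_manifold_model[OF M]
  obtain L' where L': "linear L'" "\<forall>x\<in>model M. L' (L x) = x" using model_left_inverse by blast
  have "mtop M homeomorphic_space mtop N" using homeo by (auto simp: homeomorphic_space_def)
  then show "Hausdorff_space (mtop N)"
    using M homeomorphic_Hausdorff_space by (auto simp: smooth_manifold_def)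
  obtain A where A: "countable A" "\<forall>B\<in>A. openin (mtop M) B"
    "\<And>U x. openin (mtop M) U \<and> x \<in> U \<Longrightarrow> \<exists>B\<in>A. x \<in> B \<and> B \<subseteq> U"
    using M unfolding smooth_manifold_def second_countable_space_def by (elim conjE exE) simp
  show "second_countable_space (mtop N)"
    unfolding second_countable_space_def
  proof (intro exI[of _ "(`) j ` A"] conjI ballI allI impI)
    show "countable ((`) j ` A)" using A(1) by simp
    show "openin (mtop N) B" if "B \<in> (`) j ` A" for B using that A(2) N_openin by auto
    fix U y assume U: "openin (mtop N) U \<and> y \<in> U"
    have cont: "continuous_map (mtop M) (mtop N) j" using homeo by (simp add: homeomorphic_maps_def)
    have "y \<in> j ` topspace (mtop M)" using U openin_subset transported_topspace by blast
    then obtain x where x: "x \<in> topspace (mtop M)" "y = j x" by auto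
    have "openin (mtop M) {x \<in> topspace (mtop M). j x \<in> U} \<and> x \<in> {x \<in> topspace (mtop M). j x \<in> U}"
      using openin_continuous_map_preimage[OF cont] U x by simp
    from A(3)[OF this] obtain B where B: "B \<in> A" "x \<in> B" "B \<subseteq> {x \<in> topspace (mtop M). j x \<in> U}" by blast
    show "\<exists>B\<in>(`) j ` A. y \<in> B \<and> B \<subseteq> U"
      by (rule bexI[of _ "j ` B"]) (use B x in auto)
  qed
  obtain B where "finite B" "model M = span B" using M by (auto simp: smooth_manifold_def)
  then show "\<exists>B. finite B \<and> model N = span B"
    by (intro exI[of _ "L ` B"]) (simp add: transported_manifold_def linear_span_image[OF L(1)])
  have "(\<Union>(U, \<phi>)\<in>atlas N. U) = j ` (\<Union>(U, \<phi>)\<in>atlas M. U)"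
    by (auto simp: transported_manifold_def)
  then show "(\<Union>(U, \<phi>)\<in>atlas N. U) = topspace (mtop N)"
    using M by (simp add: transported_topspace smooth_manifold_def)
  show "\<forall>(U, \<phi>)\<in>atlas N. openin (mtop N) U \<and> openin (top_of_set (model N)) (\<phi> ` U) \<and>
      homeomorphic_map (subtopology (mtop N) U) (top_of_set (\<phi> ` U)) \<phi>"
  proof (intro ballI case_prodI2)
    fix c U' \<psi> assume "c \<in> atlas N" "c = (U', \<psi>)"
    then obtain U \<phi> where c: "(U, \<phi>) \<in> atlas M" and U': "U' = j ` U" and \<psi>: "\<psi> = (\<lambda>y. L (\<phi> (k y)))"
      using N_chartE by blast
    have im: "\<psi> ` U' = L ` \<phi> ` U" unfolding U' \<psi> by (rule chart_image_eq[OF c order_refl])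
    have "openin (mtop N) U'" unfolding U' by (rule N_openin[OF chart_openin[OF M c]])
    moreover have "openin (top_of_set (model N)) (\<psi> ` U')"
      unfolding im using L_openin[OF chart_image[OF M c]] by (simp add: transported_manifold_def)
    moreover have "homeomorphic_map (subtopology (mtop N) U') (top_of_set (\<psi> ` U')) \<psi>"
    proof -
      have h1: "homeomorphic_map (subtopology (mtop N) U') (subtopology (mtop M) U) k"
      proof (rule homeomorphic_map_subtopologies)
        show "homeomorphic_map (mtop N) (mtop M) k" using homeo by (simp add: homeomorphic_maps_map)
        show "k ` (topspace (mtop N) \<inter> U') = topspace (mtop M) \<inter> U"
        proof -
          have "k (j x) = x" if "x \<in> U" for x using kj that chart_topspace[OF M c] by blast
          then have "k ` j ` U = U" by (simp add: image_image cong: image_cong)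
          moreover have "j ` topspace (mtop M) \<inter> j ` U = j ` U" "topspace (mtop M) \<inter> U = U"
            using chart_topspace[OF M c] by auto
          ultimately show ?thesis unfolding U' transported_topspace by simp
        qed
      qed
      have "homeomorphic_maps (top_of_set (\<phi> ` U)) (top_of_set (L ` \<phi> ` U)) L L'"
        using L(1) L' chart_mem_model[OF M c]
        by (auto simp: homeomorphic_maps_def linear_continuous_on linear_conv_bounded_linear)
      then have h3: "homeomorphic_map (top_of_set (\<phi> ` U)) (top_of_set (L ` \<phi> ` U)) L"
        by (simp add: homeomorphic_maps_map)
      have "L \<circ> \<phi> \<circ> k = \<psi>" by (auto simp: \<psi>)
      then show ?thesis
        using homeomorphic_map_compose[OF h1 homeomorphic_map_compose[OF chart_homeo[OF M c] h3]]
        by (simp add: im o_assoc)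
    qed
    ultimately show "openin (mtop N) U' \<and> openin (top_of_set (model N)) (\<psi> ` U') \<and>
      homeomorphic_map (subtopology (mtop N) U') (top_of_set (\<psi> ` U')) \<psi>" by blast
  qed
  show "\<forall>(U, \<phi>)\<in>atlas N. \<forall>(U', \<psi>)\<in>atlas N. smooth_on (model N) (\<phi> ` (U \<inter> U')) (\<psi> \<circ> inv_into U \<phi>)"
  proof (intro ballI case_prodI2)
    fix c U1 \<psi>1 d U2 \<psi>2 assume "c \<in> atlas N" "c = (U1, \<psi>1)" "d \<in> atlas N" "d = (U2, \<psi>2)"
    then obtain U \<phi> W \<theta> where c: "(U, \<phi>) \<in> atlas M" and U: "U1 = j ` U" "\<psi>1 = (\<lambda>y. L (\<phi> (k y)))"
      and d: "(W, \<theta>) \<in> atlas M" and W: "U2 = j ` W" "\<psi>2 = (\<lambda>y. L (\<theta> (k y)))"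
      using N_chartE by metis
    have UM: "U \<subseteq> topspace (mtop M)" "W \<subseteq> topspace (mtop M)" using chart_topspace[OF M] c d by blast+
    have "U1 \<inter> U2 = j ` (U \<inter> W)"
      unfolding U W using inj_on_image_Int[OF j UM] by simp
    then have im: "\<psi>1 ` (U1 \<inter> U2) = L ` \<phi> ` (U \<inter> W)"
      using chart_image_eq[OF c, of "U \<inter> W"] by (simp add: U)
    have op: "openin (mtop M) (U \<inter> W)" using chart_openin[OF M c] chart_openin[OF M d] by (rule openin_Int)
    have opN: "openin (top_of_set (L ` model M)) (L ` \<phi> ` (U \<inter> W))"
      by (intro L_openin chart_image_openin[OF M c op]) auto
    have "smooth_on (model M) (\<phi> ` (U \<inter> W)) (\<lambda>y. L ((\<theta> \<circ> inv_into U \<phi>) y))"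
      using L(1) by (intro smooth_on_linear_compose[OF smooth_manifold_transition[OF M c d]] linear_continuous_on)
        (auto simp: linear_conv_bounded_linear)
    then have "smooth_on (L ` model M) (L ` \<phi> ` (U \<inter> W)) (\<lambda>y. L ((\<theta> \<circ> inv_into U \<phi>) (L' y)))"
    proof (rule smooth_on_compose_linear)
      show "continuous_on (L ` \<phi> ` (U \<inter> W)) L'"
        using L'(1) by (simp add: linear_continuous_on linear_conv_bounded_linear)
      show "L' ` L ` \<phi> ` (U \<inter> W) \<subseteq> \<phi> ` (U \<inter> W)" using L'(2) chart_mem_model[OF M c] by auto
    qed (use L' in \<open>auto simp: linear_add linear_scale\<close>)
    then have "smooth_on (L ` model M) (L ` \<phi> ` (U \<inter> W)) (\<psi>2 \<circ> inv_into U1 \<psi>1)"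
    proof (rule smooth_on_cong[OF _ dir_open_openin[OF linear_subspace_image[OF L(1) SM] opN]])
      fix y assume "y \<in> L ` \<phi> ` (U \<inter> W)"
      then obtain x where x: "x \<in> U" "x \<in> W" "y = L (\<phi> x)" by auto
      then show "L ((\<theta> \<circ> inv_into U \<phi>) (L' y)) = (\<psi>2 \<circ> inv_into U1 \<psi>1) y"
        using chart_inv[OF c x(1)] L'(2) chart_mem_model[OF M c x(1)] chart_inv_into[OF M c x(1)] kj[of x] UM
        by (simp add: U W subset_iff)
    qed
    then show "smooth_on (model N) (\<psi>1 ` (U1 \<inter> U2)) (\<psi>2 \<circ> inv_into U1 \<psi>1)"
      unfolding im by (simp add: transported_manifold_def)
  qed
qed

text \<open>In corresponding charts the coordinate expression of \<open>j\<close> is the linear map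
  \<open>L\<close>.\<close>

lemma smooth_at_transport:
  assumes x: "x \<in> topspace (mtop M)"
  shows "smooth_at M (transported_manifold M j L) j x"
proof -
  obtain U \<phi> where c: "(U, \<phi>) \<in> atlas M" "x \<in> U" using smooth_manifold_cover[OF M x] .
  have "smooth_on (model M) (\<phi> ` U) L" using L(1) by (simp add: smooth_on_bounded_linear linear_conv_bounded_linear)
  then have "smooth_on (model M) (\<phi> ` U) ((\<lambda>y. L (\<phi> (k y))) \<circ> j \<circ> inv_into U \<phi>)"
    by (rule smooth_on_cong[OF _ chart_dir_open[OF M c(1) chart_openin[OF M c(1)] order_refl]])
      (use chart_inv_into[OF M c(1)] kj chart_topspace[OF M c(1)] in \<open>auto simp: subset_iff\<close>)
  then show ?thesis
    by (intro smooth_atI[OF c(1) N_chart[OF c(1)] chart_openin[OF M c(1)] c(2)]) auto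
qed

lemma smooth_at_transport_inverse:
  assumes x: "x \<in> topspace (mtop M)"
  shows "smooth_at (transported_manifold M j L) M (inv_into (topspace (mtop M)) j) (j x)"
proof -
  obtain L' where L': "linear L'" "\<forall>x\<in>model M. L' (L x) = x" using model_left_inverse by blast
  obtain U \<phi> where c: "(U, \<phi>) \<in> atlas M" "x \<in> U" using smooth_manifold_cover[OF M x] .
  note cN = N_chart[OF c(1)] and opN = N_openin[OF chart_openin[OF M c(1)]]
  have im: "(\<lambda>y. L (\<phi> (k y))) ` j ` U = L ` \<phi> ` U" by (rule chart_image_eq[OF c(1) order_refl])
  have UM: "x \<in> topspace (mtop M)" if "x \<in> U" for x using chart_topspace[OF M c(1)] that by blast
  have "smooth_on (model N) ((\<lambda>y. L (\<phi> (k y))) ` j ` U) L'"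
    using L'(1) by (simp add: smooth_on_bounded_linear linear_conv_bounded_linear)
  then have "smooth_on (model N) ((\<lambda>y. L (\<phi> (k y))) ` j ` U) (\<phi> \<circ> k \<circ> inv_into (j ` U) (\<lambda>y. L (\<phi> (k y))))"
  proof (rule smooth_on_cong[OF _ chart_dir_open[OF transported_smooth_manifold cN opN order_refl]])
    fix y assume "y \<in> (\<lambda>y. L (\<phi> (k y))) ` j ` U"
    then obtain u where u: "u \<in> U" "y = L (\<phi> u)" unfolding im by auto
    then show "L' y = (\<phi> \<circ> k \<circ> inv_into (j ` U) (\<lambda>y. L (\<phi> (k y)))) y"
      using chart_inv[OF c(1) u(1)] L'(2) chart_mem_model[OF M c(1) u(1)] by (simp add: kj UM)
  qed
  then have "smooth_at N M k (j x)"
    using c by (intro smooth_atI[OF cN c(1) opN]) (auto simp: kj UM)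
  then show ?thesis by (simp add: k_def)
qed

end

locale cocycle_extension = difference_module G V \<Theta> D T
  for G :: "('g, 'e::euclidean_space) smooth_group" and V :: "'v::euclidean_space set" and \<Theta> :: "'g \<Rightarrow> 'v \<Rightarrow> 'v"
    and D :: "'g \<Rightarrow> 'g" and T :: "'v \<Rightarrow> 'v" +
  fixes \<alpha> \<beta> :: "'g list \<Rightarrow> 'v" and j :: "'v \<times> 'g \<Rightarrow> 'p" and L :: "'v \<times> 'e \<Rightarrow> 'f::euclidean_space"
  assumes cocycle: "(\<alpha>, \<beta>) \<in> carrier (cocycle_group G D V T \<Theta> 2)"
    and j: "inj_on j (V \<times> carrier G)" and L: "linear L" "inj_on L (V \<times> model (mfd G))"
begin

abbreviation "M \<equiv> prod_manifold (vec_mfd V) (mfd G)"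

lemmas MM = smooth_manifold_prod[OF MV MG]

lemma tM: "topspace (mtop M) = V \<times> carrier G" by simp

definition k :: "'p \<Rightarrow> 'v \<times> 'g" where "k = inv_into (V \<times> carrier G) j"

lemma k_j [simp]: "u \<in> V \<Longrightarrow> g \<in> carrier G \<Longrightarrow> k (j (u, g)) = (u, g)"
  using j by (simp add: k_def)

lemma \<alpha>_closed [simp]: "g \<in> carrier G \<Longrightarrow> h \<in> carrier G \<Longrightarrow> \<alpha> [g, h] \<in> V"
  and \<beta>_closed [simp]: "g \<in> carrier G \<Longrightarrow> \<beta> [g] \<in> V"
  using cocycle cochain_1_closed cochain_2_closed by (auto simp: cocycle_iff)

lemma \<alpha>_one [simp]: "g \<in> carrier G \<Longrightarrow> \<alpha> [g, \<one>\<^bsub>G\<^esub>] = 0" "g \<in> carrier G \<Longrightarrow> \<alpha> [\<one>\<^bsub>G\<^esub>, g] = 0"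
  and \<beta>_one [simp]: "\<beta> [\<one>\<^bsub>G\<^esub>] = 0"
  using cocycle unfolding cocycle_iff cochain_1_iff cochain_2_iff by simp_all

lemma cocycle_\<alpha>: "g \<in> carrier G \<Longrightarrow> h \<in> carrier G \<Longrightarrow> l \<in> carrier G \<Longrightarrow>
    \<Theta> g (\<alpha> [h, l]) + \<alpha> [g, h \<otimes>\<^bsub>G\<^esub> l] = \<alpha> [g \<otimes>\<^bsub>G\<^esub> h, l] + \<alpha> [g, h]"
  using cocycle by (simp add: cocycle_iff)

abbreviation "\<gamma> \<equiv> gam \<alpha> \<beta>"

lemma \<gamma>_closed [simp]: "g \<in> carrier G \<Longrightarrow> \<gamma> g \<in> V"
  by (simp add: gam_def V_closed)

lemma cocycle_\<gamma>: "g \<in> carrier G \<Longrightarrow> h \<in> carrier G \<Longrightarrow>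
    \<gamma> g + \<Theta> (E g) (\<gamma> h) + \<alpha> [E g, E h] = T (\<alpha> [g, h]) + \<alpha> [g, h] + \<gamma> (g \<otimes>\<^bsub>G\<^esub> h)"
  using cocycle by (simp add: cocycle_iff)

lemmas V_simps = V_closed \<Theta>_closed T_lin(1)

text \<open>The crossed product of \<open>V\<close> and \<open>G\<close> twisted by the factor set
  \<open>\<alpha>\<close>, carried over to the type of points by \<open>j\<close>.\<close>

definition H :: "('p, 'f) smooth_group"
  where "H = \<lparr>carrier = j ` (V \<times> carrier G),
    mult = (\<lambda>x y. j (fst (k x) + \<Theta> (snd (k x)) (fst (k y)) + \<alpha> [snd (k x), snd (k y)], snd (k x) \<otimes>\<^bsub>G\<^esub> snd (k y))),
    one = j (0, \<one>\<^bsub>G\<^esub>),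
    mfd = transported_manifold M j L\<rparr>"

lemma H_carrierE:
  assumes "x \<in> carrier H"
  obtains u g where "u \<in> V" "g \<in> carrier G" "x = j (u, g)"
  using assms by (auto simp: H_def)

lemma H_carrierI [simp]: "u \<in> V \<Longrightarrow> g \<in> carrier G \<Longrightarrow> j (u, g) \<in> carrier H"
  by (simp add: H_def)

lemma H_mult: "u \<in> V \<Longrightarrow> g \<in> carrier G \<Longrightarrow> v \<in> V \<Longrightarrow> h \<in> carrier G \<Longrightarrow>
    j (u, g) \<otimes>\<^bsub>H\<^esub> j (v, h) = j (u + \<Theta> g v + \<alpha> [g, h], g \<otimes>\<^bsub>G\<^esub> h)"
  by (simp add: H_def)

lemma H_one: "\<one>\<^bsub>H\<^esub> = j (0, \<one>\<^bsub>G\<^esub>)"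
  by (simp add: H_def)

lemma H_group: "group H"
proof (rule groupI)
  fix x assume "x \<in> carrier H"
  then obtain u g where x: "u \<in> V" "g \<in> carrier G" "x = j (u, g)" by (rule H_carrierE)
  show "\<one>\<^bsub>H\<^esub> \<otimes>\<^bsub>H\<^esub> x = x"
    using x by (simp add: H_one H_mult V_simps \<Theta>_one)
  \<comment> \<open>The \<open>V\<close>-component of a left inverse is minus the sum of the two
    remaining summands of the product, \<open>\<Theta>\<close> of the inverse of \<open>g\<close>
    applied to \<open>u\<close> and \<open>\<alpha>\<close> at that inverse and
    \<open>g\<close>.\<close>
  have "j (- \<Theta> (inv\<^bsub>G\<^esub> g) u - \<alpha> [inv\<^bsub>G\<^esub> g, g], inv\<^bsub>G\<^esub> g) \<otimes>\<^bsub>H\<^esub> x = \<one>\<^bsub>H\<^esub>"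
    using x by (simp add: H_one H_mult V_simps)
  then show "\<exists>y\<in>carrier H. y \<otimes>\<^bsub>H\<^esub> x = \<one>\<^bsub>H\<^esub>"
    using x by (intro bexI) (auto simp: V_simps)
  fix y assume "y \<in> carrier H"
  then obtain v h where y: "v \<in> V" "h \<in> carrier G" "y = j (v, h)" by (rule H_carrierE)
  show "x \<otimes>\<^bsub>H\<^esub> y \<in> carrier H" using x y by (simp add: H_mult V_simps)
  fix z assume "z \<in> carrier H"
  then obtain w l where z: "w \<in> V" "l \<in> carrier G" "z = j (w, l)" by (rule H_carrierE)
  \<comment> \<open>After expanding by linearity, the \<open>V\<close>-components of the two
    bracketings differ exactly by the first cocycle condition at \<open>g\<close>, \<open>h\<close>,
    \<open>l\<close>.\<close>
  have "u + \<Theta> g v + \<alpha> [g, h] + \<Theta> (g \<otimes>\<^bsub>G\<^esub> h) w + \<alpha> [g \<otimes>\<^bsub>G\<^esub> h, l] = u + \<Theta> g (v + \<Theta> h w + \<alpha> [h, l]) + \<alpha> [g, h \<otimes>\<^bsub>G\<^esub> l]"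
    using x y z cocycle_\<alpha>[of g h l] by (simp add: \<Theta>_lin(2) V_simps \<Theta>_mult algebra_simps)
  moreover have "x \<otimes>\<^bsub>H\<^esub> y \<otimes>\<^bsub>H\<^esub> z = j (u + \<Theta> g v + \<alpha> [g, h] + \<Theta> (g \<otimes>\<^bsub>G\<^esub> h) w + \<alpha> [g \<otimes>\<^bsub>G\<^esub> h, l], g \<otimes>\<^bsub>G\<^esub> h \<otimes>\<^bsub>G\<^esub> l)"
    using x y z by (simp add: H_mult V_simps)
  moreover have "x \<otimes>\<^bsub>H\<^esub> (y \<otimes>\<^bsub>H\<^esub> z) = j (u + \<Theta> g (v + \<Theta> h w + \<alpha> [h, l]) + \<alpha> [g, h \<otimes>\<^bsub>G\<^esub> l], g \<otimes>\<^bsub>G\<^esub> h \<otimes>\<^bsub>G\<^esub> l)"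
    using x y z by (simp add: H_mult V_simps G.m_assoc)
  ultimately show "x \<otimes>\<^bsub>H\<^esub> y \<otimes>\<^bsub>H\<^esub> z = x \<otimes>\<^bsub>H\<^esub> (y \<otimes>\<^bsub>H\<^esub> z)" by (simp only:)
qed (simp_all add: H_one V_closed)

sublocale H: group H by (rule H_group)

lemma H_inv:
  assumes "u \<in> V" "g \<in> carrier G"
  shows "inv\<^bsub>H\<^esub> j (u, g) = j (- \<Theta> (inv\<^bsub>G\<^esub> g) u - \<alpha> [inv\<^bsub>G\<^esub> g, g], inv\<^bsub>G\<^esub> g)"
  using assms by (intro H.inv_equality) (simp_all add: H_one H_mult V_simps)

lemma mfd_H: "mfd H = transported_manifold M j L"
  by (simp add: H_def)

lemma MH: "smooth_manifold (mfd H)"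
  unfolding mfd_H using MM j L by (intro transported_smooth_manifold) (simp_all add: tM)

lemma tH: "topspace (mtop (mfd H)) = carrier H"
  unfolding mfd_H using transported_topspace[OF MM, of j L] j L by (simp add: H_def)

lemma smooth_j:
  fixes R :: "('a, 'h::euclidean_space) manifold"
  assumes R: "smooth_manifold R" and f: "smooth_at R (vec_mfd V) f x" and g: "smooth_at R (mfd G) g x"
  shows "smooth_at R (mfd H) (\<lambda>x. j (f x, g x)) x"
proof -
  have "smooth_at M (mfd H) j (f x, g x)"
    unfolding mfd_H using smooth_at_codomain[OF MV f] smooth_at_carrier[OF lieG g] MM j L
    by (intro smooth_at_transport) (simp_all add: tM)
  then show ?thesis
    by (rule smooth_at_compose'[OF R MM smooth_at_Pair[OF R MV MG f g] refl])
qed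

lemma smooth_k:
  fixes R :: "('a, 'h::euclidean_space) manifold"
  assumes R: "smooth_manifold R" and f: "smooth_at R (mfd H) f x"
  shows "smooth_at R (vec_mfd V) (\<lambda>x. fst (k (f x))) x" "smooth_at R (mfd G) (\<lambda>x. snd (k (f x))) x"
proof -
  have "f x \<in> carrier H" using smooth_at_codomain[OF MH f] by (simp add: tH)
  then obtain u g where x: "u \<in> V" "g \<in> carrier G" "f x = j (u, g)" by (rule H_carrierE)
  have "smooth_at (mfd H) M k (j (u, g))"
    unfolding mfd_H using smooth_at_transport_inverse[OF MM, of j L "(u, g)"] x j L by (simp add: k_def)
  from smooth_at_compose'[OF R MH f x(3) this]
  have k: "smooth_at R M (\<lambda>x. k (f x)) x" .
  have kx: "k (f x) = (u, g)" using x by simp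
  show "smooth_at R (vec_mfd V) (\<lambda>x. fst (k (f x))) x"
    by (rule smooth_at_compose'[OF R MM k kx smooth_at_fst[OF MV MG]]) (use x in simp_all)
  show "smooth_at R (mfd G) (\<lambda>x. snd (k (f x))) x"
    by (rule smooth_at_compose'[OF R MM k kx smooth_at_snd[OF MV MG]]) (use x in simp_all)
qed

lemma smooth_\<alpha>:
  fixes R :: "('a, 'h::euclidean_space) manifold"
  assumes R: "smooth_manifold R" and f: "smooth_at R (mfd G) f x" and g: "smooth_at R (mfd G) g x"
  shows "smooth_at R (vec_mfd V) (\<lambda>x. \<alpha> [f x, g x]) x"
proof -
  have "smooth_at (prod_manifold (mfd G) (mfd G)) (vec_mfd V) (\<lambda>z. \<alpha> [fst z, snd z]) (f x, g x)"
    using cocycle smooth_at_carrier[OF lieG f] smooth_at_carrier[OF lieG g] by (auto simp: cocycle_iff cochain_2_iff)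
  from smooth_at_compose'[OF R smooth_manifold_prod[OF MG MG] smooth_at_Pair[OF R MG MG f g] refl this]
  show ?thesis by simp
qed

lemma smooth_\<gamma>:
  assumes g: "g \<in> carrier G"
  shows "smooth_at (mfd G) (vec_mfd V) \<gamma> g"
proof -
  have "smooth_at (mfd G) (vec_mfd V) (\<lambda>g. \<beta> [g]) g"
    using cocycle g unfolding cocycle_iff cochain_1_iff by blast
  then show ?thesis
    unfolding gam_def[abs_def]
    by (intro smooth_at_add[OF MG V] smooth_\<alpha>[OF MG] smooth_D smooth_at_group_id[OF lieG] g)
qed

lemma smooth_minus:
  fixes R :: "('a, 'h::euclidean_space) manifold"
  assumes R: "smooth_manifold R" and f: "smooth_at R (vec_mfd V) f x"
  shows "smooth_at R (vec_mfd V) (\<lambda>x. - f x) x"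
  by (rule smooth_at_vec_linear[OF R V f])
    (auto simp: V_closed bounded_linear.linear[OF bounded_linear_minus[OF bounded_linear_ident]])

lemma k_closed: "x \<in> carrier H \<Longrightarrow> fst (k x) \<in> V" "x \<in> carrier H \<Longrightarrow> snd (k x) \<in> carrier G"
  by (auto elim!: H_carrierE)

lemma H_lie_group: "lie_group H"
  unfolding lie_group_def
proof (intro conjI)
  let ?Q = "prod_manifold (mfd H) (mfd H)"
  note MQ = smooth_manifold_prod[OF MH MH]
  show "smooth_map ?Q (mfd H) (\<lambda>(x, y). x \<otimes>\<^bsub>H\<^esub> y)"
  proof (rule smooth_mapI[OF MQ MH])
    fix q assume q: "q \<in> topspace (mtop ?Q)"
    then have q': "fst q \<in> carrier H" "snd q \<in> carrier H" by (auto simp: tH)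
    have 1: "smooth_at ?Q (mfd H) fst q" and 2: "smooth_at ?Q (mfd H) snd q"
      using smooth_at_fst[OF MH MH, of "fst q" "snd q"] smooth_at_snd[OF MH MH, of "fst q" "snd q"] q'
      by (simp_all add: tH)
    note k1 = smooth_k[OF MQ 1] and k2 = smooth_k[OF MQ 2]
    have "smooth_at ?Q (mfd H) (\<lambda>q. j (fst (k (fst q)) + \<Theta> (snd (k (fst q))) (fst (k (snd q))) + \<alpha> [snd (k (fst q)), snd (k (snd q))],
        snd (k (fst q)) \<otimes>\<^bsub>G\<^esub> snd (k (snd q)))) q"
      by (intro smooth_j[OF MQ] smooth_at_add[OF MQ V] smooth_at_\<Theta>[OF MQ] smooth_\<alpha>[OF MQ] smooth_at_mult[OF lieG MQ] k1 k2)
        (auto simp: tH k_closed)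
    then show "smooth_at ?Q (mfd H) (\<lambda>(x, y). x \<otimes>\<^bsub>H\<^esub> y) q"
      by (simp add: H_def case_prod_unfold)
  qed
  show "smooth_map (mfd H) (mfd H) (\<lambda>x. inv\<^bsub>H\<^esub> x)"
  proof (rule smooth_mapI[OF MH MH])
    fix x assume x: "x \<in> topspace (mtop (mfd H))"
    note k = smooth_k[OF MH smooth_at_id[OF MH x]]
    have "smooth_at (mfd H) (mfd H) (\<lambda>x. j (- \<Theta> (inv\<^bsub>G\<^esub> snd (k x)) (fst (k x)) + - \<alpha> [inv\<^bsub>G\<^esub> snd (k x), snd (k x)], inv\<^bsub>G\<^esub> snd (k x))) x"
      by (intro smooth_j[OF MH] smooth_at_add[OF MH V] smooth_minus[OF MH] smooth_at_\<Theta>[OF MH] smooth_\<alpha>[OF MH]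
          smooth_at_inv[OF lieG MH] k) (auto simp: tH k_closed)
    then show "smooth_at (mfd H) (mfd H) (\<lambda>x. inv\<^bsub>H\<^esub> x) x"
      by (rule smooth_at_cong[OF MH _ eventually_mono[OF eventually_nhdsin_topspace[OF x]]])
        (auto simp: tH H_inv elim!: H_carrierE)
  qed
qed (simp_all add: MH tH H_group)

definition EH :: "'p \<Rightarrow> 'p" where "EH x = j (T (fst (k x)) + fst (k x) + \<gamma> (snd (k x)), E (snd (k x)))"

lemma EH_j: "u \<in> V \<Longrightarrow> g \<in> carrier G \<Longrightarrow> EH (j (u, g)) = j (T u + u + \<gamma> g, E g)"
  by (simp add: EH_def)

lemma EH_closed [simp]: "x \<in> carrier H \<Longrightarrow> EH x \<in> carrier H"
  by (auto simp: EH_j V_simps elim!: H_carrierE)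

text \<open>The summand containing \<open>v\<close> is matched by the intertwining property
  \<open>rep_E\<close>; what remains is the second cocycle condition in terms of
  \<open>\<gamma>\<close>.\<close>

lemma EH_mult:
  assumes "x \<in> carrier H" "y \<in> carrier H"
  shows "EH (x \<otimes>\<^bsub>H\<^esub> y) = EH x \<otimes>\<^bsub>H\<^esub> EH y"
proof -
  obtain u g where x: "u \<in> V" "g \<in> carrier G" "x = j (u, g)" using assms(1) by (rule H_carrierE)
  obtain v h where y: "v \<in> V" "h \<in> carrier G" "y = j (v, h)" using assms(2) by (rule H_carrierE)
  have "\<Theta> (E g) (T v + v + \<gamma> h) = \<Theta> (E g) (T v + v) + \<Theta> (E g) (\<gamma> h)"
    using x y by (simp add: \<Theta>_lin(2) V_simps)
  also have "\<dots> = T (\<Theta> g v) + \<Theta> g v + \<Theta> (E g) (\<gamma> h)"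
    using rep_E[OF x(2) y(1)] by simp
  finally have 1: "\<Theta> (E g) (T v + v + \<gamma> h) = T (\<Theta> g v) + \<Theta> g v + \<Theta> (E g) (\<gamma> h)" .
  have "T (u + \<Theta> g v + \<alpha> [g, h]) + (u + \<Theta> g v + \<alpha> [g, h]) + \<gamma> (g \<otimes>\<^bsub>G\<^esub> h) =
      T u + u + \<gamma> g + \<Theta> (E g) (T v + v + \<gamma> h) + \<alpha> [E g, E h]"
    unfolding 1 using x y cocycle_\<gamma>[of g h] by (simp add: T_lin(2) V_simps algebra_simps)
  moreover have "EH (x \<otimes>\<^bsub>H\<^esub> y) = j (T (u + \<Theta> g v + \<alpha> [g, h]) + (u + \<Theta> g v + \<alpha> [g, h]) + \<gamma> (g \<otimes>\<^bsub>G\<^esub> h), E g \<otimes>\<^bsub>G\<^esub> E h)"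
    using x y by (simp add: H_mult EH_j V_simps E_mult)
  moreover have "EH x \<otimes>\<^bsub>H\<^esub> EH y = j (T u + u + \<gamma> g + \<Theta> (E g) (T v + v + \<gamma> h) + \<alpha> [E g, E h], E g \<otimes>\<^bsub>G\<^esub> E h)"
    using x y by (simp add: H_mult EH_j V_simps)
  ultimately show ?thesis by (simp only:)
qed

text \<open>The difference operator is defined from the homomorphism \<open>EH\<close> by removing
  the factor \<open>x\<close>; its defining identity is then equivalent to multiplicativity of
  \<open>EH\<close>.\<close>

definition X :: "('p, 'f, 'v, 'g) extension"
  where "X = \<lparr>total = H, dop = (\<lambda>x. EH x \<otimes>\<^bsub>H\<^esub> inv\<^bsub>H\<^esub> x), incl = (\<lambda>u. j (u, \<one>\<^bsub>G\<^esub>)), proj = (\<lambda>x. snd (k x))\<rparr>"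

lemma smooth_EH:
  assumes x: "x \<in> carrier H"
  shows "smooth_at (mfd H) (mfd H) EH x"
proof -
  have xt: "x \<in> topspace (mtop (mfd H))" using x by (simp add: tH)
  note k = smooth_k[OF MH smooth_at_id[OF MH xt]]
  have g: "snd (k x) \<in> carrier G" using x by (rule k_closed)
  have 1: "smooth_at (mfd H) (vec_mfd V) (\<lambda>x. T (fst (k x))) x"
  \<comment> \<open>\<open>T\<close> is linear on \<open>V\<close> only and arbitrary elsewhere, so
    it is treated as a constant family of endomorphisms of \<open>V\<close> and not as a linear map
    of the ambient type.\<close>
  proof (rule smooth_at_linear_endo[OF MH V _ _ k(1)])
    show "smooth_at (mfd H) (vec_mfd V) (\<lambda>x. T b) x" if "b \<in> V" for b
      by (rule smooth_at_vec_const[OF MH V xt T_lin(1)[OF that]])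
  qed (rule T_endo)
  have 2: "smooth_at (mfd H) (vec_mfd V) (\<lambda>x. \<gamma> (snd (k x))) x"
    by (rule smooth_at_compose'[OF MH MG k(2) refl smooth_\<gamma>[OF g]])
  have 3: "smooth_at (mfd H) (mfd G) (\<lambda>x. D (snd (k x))) x"
    by (rule smooth_at_compose'[OF MH MG k(2) refl smooth_D[OF g]])
  show ?thesis
    unfolding EH_def[abs_def] E_def
    by (intro smooth_j[OF MH] smooth_at_add[OF MH V] smooth_at_mult[OF lieG MH] k 1 2 3)
qed

lemma X_extension: "abelian_extension G D V T X"
  unfolding abelian_extension_def X_def extension.select_convs
proof (intro conjI)
  show "difference_lie_group H (\<lambda>x. EH x \<otimes>\<^bsub>H\<^esub> inv\<^bsub>H\<^esub> x)"
    unfolding difference_lie_group_def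
  proof (intro conjI ballI H_lie_group)
    show "smooth_map (mfd H) (mfd H) (\<lambda>x. EH x \<otimes>\<^bsub>H\<^esub> inv\<^bsub>H\<^esub> x)"
      by (intro smooth_mapI[OF MH MH] smooth_at_mult[OF H_lie_group MH] smooth_at_inv[OF H_lie_group MH]
          smooth_EH smooth_at_group_id[OF H_lie_group]) (simp_all add: tH)
    fix x y assume xy: "x \<in> carrier H" "y \<in> carrier H"
    have "EH x \<otimes>\<^bsub>H\<^esub> inv\<^bsub>H\<^esub> x \<otimes>\<^bsub>H\<^esub> x \<otimes>\<^bsub>H\<^esub> (EH y \<otimes>\<^bsub>H\<^esub> inv\<^bsub>H\<^esub> y) \<otimes>\<^bsub>H\<^esub> inv\<^bsub>H\<^esub> x = EH x \<otimes>\<^bsub>H\<^esub> EH y \<otimes>\<^bsub>H\<^esub> inv\<^bsub>H\<^esub> y \<otimes>\<^bsub>H\<^esub> inv\<^bsub>H\<^esub> x"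
      using xy by (simp add: H.m_assoc H.inv_mult_cancel)
    then show "EH (x \<otimes>\<^bsub>H\<^esub> y) \<otimes>\<^bsub>H\<^esub> inv\<^bsub>H\<^esub> (x \<otimes>\<^bsub>H\<^esub> y) = EH x \<otimes>\<^bsub>H\<^esub> inv\<^bsub>H\<^esub> x \<otimes>\<^bsub>H\<^esub> x \<otimes>\<^bsub>H\<^esub> (EH y \<otimes>\<^bsub>H\<^esub> inv\<^bsub>H\<^esub> y) \<otimes>\<^bsub>H\<^esub> inv\<^bsub>H\<^esub> x"
      using xy by (simp add: EH_mult H.inv_mult_group H.m_assoc)
  qed
  have incl_add: "j (u, \<one>\<^bsub>G\<^esub>) \<otimes>\<^bsub>H\<^esub> j (v, \<one>\<^bsub>G\<^esub>) = j (u + v, \<one>\<^bsub>G\<^esub>)" if "u \<in> V" "v \<in> V" for u v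
    using that by (simp add: H_mult \<Theta>_one V_closed)
  have incl_inv: "inv\<^bsub>H\<^esub> j (u, \<one>\<^bsub>G\<^esub>) = j (- u, \<one>\<^bsub>G\<^esub>)" if "u \<in> V" for u
    using that by (simp add: H_inv \<Theta>_one)
  have \<gamma>1: "\<gamma> \<one>\<^bsub>G\<^esub> = 0" by (simp add: gam_def)
  show "difference_hom (vec_group V) T H (\<lambda>x. EH x \<otimes>\<^bsub>H\<^esub> inv\<^bsub>H\<^esub> x) (\<lambda>u. j (u, \<one>\<^bsub>G\<^esub>))"
    unfolding difference_hom_def lie_hom_def
  proof (intro conjI ballI)
    show "(\<lambda>u. j (u, \<one>\<^bsub>G\<^esub>)) \<in> hom (vec_group V) H"
      by (auto simp: hom_def incl_add)
    show "smooth_map (vec_mfd V) (mfd H) (\<lambda>u. j (u, \<one>\<^bsub>G\<^esub>))"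
      by (intro smooth_mapI[OF MV MH] smooth_j[OF MV] smooth_at_id[OF MV] smooth_at_group_const[OF lieG MV]) auto
    fix u assume "u \<in> carrier (vec_group V)"
    then have u: "u \<in> V" by simp
    then show "EH (j (u, \<one>\<^bsub>G\<^esub>)) \<otimes>\<^bsub>H\<^esub> inv\<^bsub>H\<^esub> j (u, \<one>\<^bsub>G\<^esub>) = j (T u, \<one>\<^bsub>G\<^esub>)"
      by (simp add: EH_j \<gamma>1 incl_inv incl_add V_simps)
  qed
  have proj_mult: "snd (k (x \<otimes>\<^bsub>H\<^esub> y)) = snd (k x) \<otimes>\<^bsub>G\<^esub> snd (k y)" if "x \<in> carrier H" "y \<in> carrier H" for x y
    using that by (auto simp: H_mult V_simps elim!: H_carrierE)
  have proj_inv: "snd (k (inv\<^bsub>H\<^esub> x)) = inv\<^bsub>G\<^esub> snd (k x)" if "x \<in> carrier H" for x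
    using that by (auto simp: H_inv V_simps elim!: H_carrierE)
  have proj_EH: "snd (k (EH x)) = E (snd (k x))" if "x \<in> carrier H" for x
    using that by (auto simp: EH_j V_simps elim!: H_carrierE)
  show "difference_hom H (\<lambda>x. EH x \<otimes>\<^bsub>H\<^esub> inv\<^bsub>H\<^esub> x) G D (\<lambda>x. snd (k x))"
    unfolding difference_hom_def lie_hom_def
  proof (intro conjI ballI)
    show "(\<lambda>x. snd (k x)) \<in> hom H G" by (auto simp: hom_def proj_mult k_closed)
    show "smooth_map (mfd H) (mfd G) (\<lambda>x. snd (k x))"
      by (intro smooth_mapI[OF MH MG] smooth_k[OF MH] smooth_at_id[OF MH])
    fix x assume x: "x \<in> carrier H"
    then show "D (snd (k x)) = snd (k (EH x \<otimes>\<^bsub>H\<^esub> inv\<^bsub>H\<^esub> x))"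
      using k_closed(2)[OF x] by (simp add: proj_mult proj_inv proj_EH E_def G.m_assoc)
  qed
  show "inj_on (\<lambda>u. j (u, \<one>\<^bsub>G\<^esub>)) V"
    by (rule inj_onI) (use inj_onD[OF j] in auto)
  show "(\<lambda>u. j (u, \<one>\<^bsub>G\<^esub>)) ` V = kernel H G (\<lambda>x. snd (k x))"
    by (auto simp: kernel_def elim!: H_carrierE)
  show "(\<lambda>x. snd (k x)) ` carrier H = carrier G"
  proof
    show "carrier G \<subseteq> (\<lambda>x. snd (k x)) ` carrier H"
    proof
      fix g assume "g \<in> carrier G"
      then show "g \<in> (\<lambda>x. snd (k x)) ` carrier H"
        by (intro image_eqI[of _ _ "j (0, g)"]) (simp_all add: V_closed)
    qed
  qed (auto simp: k_closed)
qed

text \<open>A value of a section over \<open>g\<close> differs from the standard one by an element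
  of \<open>V\<close>, which commutes with \<open>incl X u\<close>. Hence every section induces the
  same action.\<close>

lemma X_relative: "X \<in> abelian_extensions_rel G D V T \<Theta>"
  unfolding abelian_extensions_rel_def
proof (intro CollectI conjI X_extension allI impI ballI)
  fix s g u assume s: "is_section G X s" and g: "g \<in> carrier G" and u: "u \<in> V"
  have "smooth_at (mfd G) (mfd H) s g"
    using s g by (intro smooth_map_smooth_at[OF MG MH]) (auto simp: is_section_def X_def)
  then have sg: "s g \<in> carrier H" by (rule smooth_at_carrier[OF H_lie_group])
  then obtain w h where w: "w \<in> V" "h \<in> carrier G" "s g = j (w, h)" by (rule H_carrierE)
  have "snd (k (s g)) = g" using s g by (simp add: is_section_def X_def)
  then have "h = g" using w by simp
  then have "s g \<otimes>\<^bsub>H\<^esub> j (u, \<one>\<^bsub>G\<^esub>) = j (\<Theta> g u, \<one>\<^bsub>G\<^esub>) \<otimes>\<^bsub>H\<^esub> s g"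
    using w u g by (simp add: H_mult V_simps \<Theta>_one add.commute)
  then have "s g \<otimes>\<^bsub>H\<^esub> j (u, \<one>\<^bsub>G\<^esub>) \<otimes>\<^bsub>H\<^esub> inv\<^bsub>H\<^esub> s g = j (\<Theta> g u, \<one>\<^bsub>G\<^esub>)"
    using sg g u by (simp add: H.m_assoc V_simps)
  then show "incl X (\<Theta> g u) = s g \<otimes>\<^bsub>total X\<^esub> incl X u \<otimes>\<^bsub>total X\<^esub> inv\<^bsub>total X\<^esub> s g"
    by (simp add: X_def)
qed

definition s :: "'g \<Rightarrow> 'p" where "s g = j (0, g)"

lemma s_section: "is_section G X s"
proof -
  have "smooth_map (mfd G) (mfd H) s"
    unfolding s_def
    by (intro smooth_mapI[OF MG MH] smooth_j[OF MG] smooth_at_vec_const[OF MG V] smooth_at_group_id[OF lieG])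
      (auto simp: V_closed)
  then show ?thesis by (simp add: is_section_def X_def s_def V_closed H_one)
qed

text \<open>Relative to the zero section the \<open>V\<close>-coordinate of \<open>j (u, g)\<close>
  is \<open>u\<close>. Products of section values then show \<open>\<alpha>\<close>, and
  \<open>EH (s g)\<close> shows \<open>\<gamma> g\<close>, from which \<open>\<beta>\<close> results
  by removing \<open>\<alpha> [D g, g]\<close>.\<close>

lemma s_cocycle: "section_cocycle G D V X s = (\<alpha>, \<beta>)"
proof -
  interpret S: section_of_extension G V \<Theta> D T X s
    by unfold_locales (rule X_relative s_section)+
  have iX: "incl X u = j (u, \<one>\<^bsub>G\<^esub>)" for u by (simp add: X_def)
  have H: "total X = H" and dop: "dop X x = EH x \<otimes>\<^bsub>H\<^esub> inv\<^bsub>H\<^esub> x" for x by (simp_all add: X_def)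
  have split: "j (u, g) = incl X u \<otimes>\<^bsub>total X\<^esub> s g" if "u \<in> V" "g \<in> carrier G" for u g
    using that by (simp add: H iX s_def H_mult V_closed \<Theta>_lin)
  have a: "S.a g h = \<alpha> [g, h]" if "g \<in> carrier G" "h \<in> carrier G" for g h
  proof -
    have "s g \<otimes>\<^bsub>total X\<^esub> s h = j (\<alpha> [g, h], g \<otimes>\<^bsub>G\<^esub> h)"
      using that by (simp add: H s_def H_mult V_closed \<Theta>_lin)
    then show ?thesis using that split S.fib_i_s by (simp add: S.a_fib)
  qed
  have "S.b g = \<beta> [g]" if g: "g \<in> carrier G" for g
  proof -
    have EHs: "S.EH (s g) = EH (s g)"
      using g by (simp add: S.EH_def H dop s_def H.m_assoc V_closed)
    have "S.b g + S.a (D g) g = S.fib (EH (s g))" by (simp only: EHs[symmetric] S.EH_s[OF g])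
    also have "EH (s g) = j (\<gamma> g, E g)" using g by (simp add: s_def EH_j V_closed T_lin)
    also have "S.fib \<dots> = \<gamma> g" using g split S.fib_i_s by simp
    finally show ?thesis using g by (simp add: a gam_def)
  qed
  then have "section_cocycle G D V X s = (\<lambda>gs. if gs \<in> tuples G 2 then \<alpha> [gs ! 0, gs ! 1] else 0, \<lambda>gs. if gs \<in> tuples G 1 then \<beta> [gs ! 0] else 0)"
    unfolding S.section_cocycle_eq using a by (auto simp: fun_eq_iff tuples_2 tuples_Suc_0)
  also have "\<dots> = (\<alpha>, \<beta>)"
  proof -
    have "\<alpha> gs = 0" if "gs \<notin> tuples G 2" for gs using cocycle that by (simp add: cocycle_iff cochain_2_iff)
    moreover have "\<beta> gs = 0" if "gs \<notin> tuples G 1" for gs using cocycle that unfolding cocycle_iff cochain_1_iff by blast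
    ultimately show ?thesis by (auto simp: fun_eq_iff tuples_2 tuples_Suc_0)
  qed
  finally show ?thesis .
qed

end

theorem theorem5p6:
  fixes G :: "('g, 'e::euclidean_space) smooth_group" and D :: "'g \<Rightarrow> 'g"
    and V :: "'v::euclidean_space set" and T :: "'v \<Rightarrow> 'v" and \<Theta> :: "'g \<Rightarrow> 'v \<Rightarrow> 'v"
  defines "Exts \<equiv> abelian_extensions_rel G D V T \<Theta> :: ('p, 'f::euclidean_space, 'v, 'g) extension set"
  assumes "difference_lie_group G D"
    and "difference_rep G D V T \<Theta>"
    \<comment> \<open>The extensions considered have points in the type \<open>'p\<close> and coordinates in the type \<open>'f\<close>,
       both arbitrary. The next two assumptions say that these types are large enough; they
       hold automatically as soon as some extension with these types exists, and they hold for
       \<open>'p = 'v \<times> 'g\<close> and \<open>'f = 'e \<times> 'v\<close>.\<close>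
    and "\<exists>j :: 'v \<times> 'g \<Rightarrow> 'p. inj_on j (V \<times> carrier G)"
    and "dim (model (mfd G)) + dim V \<le> DIM('f)"
  shows "(\<forall>X\<in>Exts. \<exists>s. is_section G X s) \<and>
    (\<forall>X\<in>Exts. \<forall>s. is_section G X s \<longrightarrow>
       section_cocycle G D V X s \<in> carrier (cocycle_group G D V T \<Theta> 2)) \<and>
    (\<exists>\<Phi>. (\<forall>X\<in>Exts. \<forall>s. is_section G X s \<longrightarrow>
             \<Phi> (extension_iso_rel G D V T \<Theta> `` {X})
               = cohomology_class G D V T \<Theta> 2 (section_cocycle G D V X s)) \<and>
         bij_betw \<Phi> (Exts // extension_iso_rel G D V T \<Theta>)
           (carrier (cohomology_group G D V T \<Theta> 2)))"
proof -
  interpret group G using assms(2) by (simp add: difference_lie_group_def lie_group_def)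
  interpret difference_module G V \<Theta> D T
    by unfold_locales (use assms(2,3) in \<open>auto simp: difference_lie_group_def difference_rep_def\<close>)
  have ex_section: "\<exists>s. is_section G X s" if "X \<in> Exts" for X
  proof -
    interpret difference_extension G V \<Theta> D T X by unfold_locales (use that in \<open>simp add: Exts_def\<close>)
    show ?thesis by (rule section_exists)
  qed
  have cocycle: "section_cocycle G D V X s \<in> carrier (cocycle_group G D V T \<Theta> 2)"
    if "X \<in> Exts" "is_section G X s" for X s
  proof -
    interpret section_of_extension G V \<Theta> D T X s by unfold_locales (use that in \<open>simp_all add: Exts_def\<close>)
    show ?thesis by (rule section_cocycle_cocycle)
  qed
  define cls where "cls X = cohomology_class G D V T \<Theta> 2 (section_cocycle G D V X (SOME s. is_section G X s))"
    for X :: "('p, 'f, 'v, 'g) extension"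
  have some: "is_section G X (SOME s. is_section G X s)" if "X \<in> Exts" for X
    using ex_section[OF that] by (rule someI_ex)
  \<comment> \<open>Isomorphism of extensions is thus equality of a function, so its classes are the
    fibres of \<open>cls\<close>; this gives at once that the induced map is well defined and
    injective.\<close>
  have iso_cls: "isomorphic_extensions V X Y \<longleftrightarrow> cls X = cls Y" if "X \<in> Exts" "Y \<in> Exts" for X Y
    unfolding cls_def using that by (intro isomorphic_iff_class some) (simp_all add: Exts_def)
  have cls: "cls X = cohomology_class G D V T \<Theta> 2 (section_cocycle G D V X s)"
    if X: "X \<in> Exts" and s: "is_section G X s" for X s
  proof -
    have "isomorphic_extensions V X X" using iso_cls[OF X X] by simp
    then show ?thesis
      unfolding cls_def using isomorphic_iff_class[OF _ _ some[OF X] s] X by (simp add: Exts_def)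
  qed
  define R where "R = (extension_iso_rel G D V T \<Theta> :: ('p, 'f, 'v, 'g) extension rel)"
  have R: "R `` {X} = {Y \<in> Exts. cls Y = cls X}" if "X \<in> Exts" for X
    using that iso_cls by (auto simp: R_def extension_iso_rel_def Exts_def[symmetric])
  \<comment> \<open>Any representative may be selected, because \<open>cls\<close> is constant on
    the classes.\<close>
  define \<Phi> where "\<Phi> C = cls (SOME X. X \<in> C)" for C
  have \<Phi>: "\<Phi> (R `` {X}) = cls X" if X: "X \<in> Exts" for X
  proof -
    have "(SOME Y. Y \<in> R `` {X}) \<in> R `` {X}" by (rule someI[of _ X]) (use R X in simp)
    then show ?thesis using R[OF X] by (simp add: \<Phi>_def)
  qed
  have "bij_betw \<Phi> (Exts // R) (carrier (cohomology_group G D V T \<Theta> 2))"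
    unfolding bij_betw_def
  proof
    show "inj_on \<Phi> (Exts // R)"
    proof (rule inj_onI)
      fix A B assume "A \<in> Exts // R" "B \<in> Exts // R" and eq: "\<Phi> A = \<Phi> B"
      then obtain X Y where "X \<in> Exts" "A = R `` {X}" "Y \<in> Exts" "B = R `` {Y}"
        by (auto elim!: quotientE)
      then show "A = B" using eq \<Phi> R by simp
    qed
    show "\<Phi> ` (Exts // R) = carrier (cohomology_group G D V T \<Theta> 2)"
    proof
      show "\<Phi> ` (Exts // R) \<subseteq> carrier (cohomology_group G D V T \<Theta> 2)"
      proof
        fix c assume "c \<in> \<Phi> ` (Exts // R)"
        then obtain X where X: "X \<in> Exts" "c = cls X" using \<Phi> by (auto elim!: quotientE)
        then show "c \<in> carrier (cohomology_group G D V T \<Theta> 2)"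
          unfolding carrier_cohomology_group cls_def using cocycle[OF X(1) some[OF X(1)]] by blast
      qed
      show "carrier (cohomology_group G D V T \<Theta> 2) \<subseteq> \<Phi> ` (Exts // R)"
      proof
        fix c assume "c \<in> carrier (cohomology_group G D V T \<Theta> 2)"
        then obtain \<alpha> \<beta> where ab: "(\<alpha>, \<beta>) \<in> carrier (cocycle_group G D V T \<Theta> 2)"
          and c: "c = cohomology_class G D V T \<Theta> 2 (\<alpha>, \<beta>)"
          unfolding carrier_cohomology_group by auto
        obtain j :: "'v \<times> 'g \<Rightarrow> 'p" where j: "inj_on j (V \<times> carrier G)" using assms(4) by blast
        have sub: "subspace (V \<times> model (mfd G))"
          by (intro subspace_Times V smooth_manifold_model MG)
        \<comment> \<open>The dimension assumption leaves room in the coordinate type for an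
          isomorphic copy of the model space of the product, as \<open>j\<close> does for its
          points.\<close>
        have "dim (V \<times> model (mfd G)) \<le> dim (UNIV :: 'f set)"
          using assms(5) by (simp add: dim_Times V smooth_manifold_model[OF MG])
        then obtain S :: "'f set" where S: "subspace S" "dim S = dim (V \<times> model (mfd G))"
          by (rule choose_subspace_of_subspace) blast
        obtain L :: "'v \<times> 'e \<Rightarrow> 'f" where L: "linear L" "inj_on L (V \<times> model (mfd G))"
          using subspace_isomorphism[OF sub S(1) S(2)[symmetric]] by blast
        interpret C: cocycle_extension G V \<Theta> D T \<alpha> \<beta> j L
          by (rule cocycle_extension.intro[OF difference_module_axioms cocycle_extension_axioms.intro[OF ab j L]])
        have X: "C.X \<in> Exts" using C.X_relative by (simp add: Exts_def)
        have "cls C.X = c" using cls[OF X C.s_section] by (simp add: C.s_cocycle c)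
        then have "\<Phi> (R `` {C.X}) = c" using \<Phi>[OF X] by simp
        then show "c \<in> \<Phi> ` (Exts // R)" using quotientI[OF X] by blast
      qed
    qed
  qed
  then show ?thesis
    using ex_section cocycle \<Phi> cls unfolding R_def by (intro conjI exI[of _ \<Phi>]) auto
qed

end
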